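(* Let $\mathbb{K}$ be a convex cone with an involution, let $\mathbb{K}'=\mathbb{K}\setminus\{\mathbf{e}\}$, and let $\hat{\mathbb{K}}$ be a countable separating family of characters on $\mathbb{K}$ that contains the constant function $\mathbf{1}$, is closed under finite products, and generates the $\sigma$-algebra of $\mathbb{K}$. Let $\alpha>0$ and let $\xi$ be a strictly $\alpha$-stable random element of $\mathbb{K}$ that admits a $\sigma$-finite Lévy measure $\nu$ (on $\mathbb{K}'$). Assume that: (1) the function $t\mapsto\operatorname{Re}\chi(tx)$, $t\in(0,\infty)$, is right-continuous for all $x\in\mathbb{K}'$ and $\chi\in\hat{\mathbb{K}}$ (or it is left-continuous for all such $x$ and $\chi$); (2) there is a measurable set $\mathbb{S}\subseteq\mathbb{K}'$ such that $\mathbb{K}'=\{tx: t>0,\ x\in\mathbb{S}\}$ and such that $\{x,tx\}\subset\mathbb{S}$ for some $x\in\mathbb{K}'$ and $t>0$ implies $t=1$; (3) $\liminf_{t\downarrow 0}\operatorname{Re}\chi(tx)>0$ for all $x\in\mathbb{K}$ and $\chi\in\hat{\mathbb{K}}$. Then $\nu$ admits the polar representation $\pi\otimes\theta_\alpha$, that is, there is a probability measure $\pi$ on $\mathbb{K}'$ such that $\nu$ is the push-forward of $\pi\otimes\theta_\alpha$ under the map $(x,t)\mapsto tx$ from $\mathbb{K}'\times(0,\infty)$ to $\mathbb{K}'$, where $\theta_\alpha(dt)=\alpha t^{-(\alpha+1)}\,dt$ on $(0,\infty)$, and, if $\varepsilon$ denotes a random element of $\mathbb{K}'$ with distribution $\pi$,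 $$\int_0^\infty \mathbf{E}\bigl[1-\operatorname{Re}\chi(t\varepsilon)\bigr]\,t^{-(\alpha+1)}\,dt<\infty\quad\text{for all }\chi\in\hat{\mathbb{K}}.$$ The Poisson process on $\mathbb{K}'$ with intensity measure $\nu$ can be represented as $\{\Gamma_i^{-1/\alpha}\varepsilon_i\}_{i\in\mathbb{N}}$, where $\{\varepsilon_i\}_{i\in\mathbb{N}}$ is a sequence of i.i.d. copies of $\varepsilon$ and $\{\Gamma_i\}_{i\in\mathbb{N}}$ are the successive points of a unit intensity Poisson process on $\mathbb{R}_+$ (independent of $\{\varepsilon_i\}$). If $\xi$ is symmetric (i.e. $\xi$ and $\xi^*$ have the same distribution), then $\varepsilon$ can also be chosen to have a symmetric distribution.
   Context: A convex cone $\mathbb{K}$ is an abelian measurable semigroup (operation $+$, measurable) with neutral element $\mathbf{e}$, together with a scaling $(x,a)\mapsto ax$, $a>0$: a jointly measurable action of the multiplicative group $(0,\infty)$ on $\mathbb{K}$ ($a(bx)=(ab)x$, $1x=x$) with $a(x+y)=ax+ay$ and $a\mathbf{e}=\mathbf{e}$. (The law $ax+bx=(a+b)x$ is not assumed.) An involution is a measurable map $x\mapsto x^*$ on $\mathbb{K}$ with $(x+y)^*=x^*+y^*$, $(ax)^*=ax^*$, $(x^* )^*=x$. A character (bounded semicharacter) is a measurable function $\chi:\mathbb{K}\to\{z\in\mathbb{C}:|z|\le1\}$ with $\chi(\mathbf{e})=1$, $\chi(x+y)=\chi(x)\chi(y)$, $\chi(x^* )=\overline{\chi(x)}$. A family of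 characters is separating if for all $x\ne y$ in $\mathbb{K}$ some $\chi$ in the family has $\chi(x)\ne\chi(y)$. The family $\hat{\mathbb{K}}$ is regarded as a semigroup under pointwise multiplication, with neutral element $\mathbf{1}$ and with complex conjugation as involution; it is not assumed to be closed under the scaling $(a\chi)(x)=\chi(ax)$. A random element $\xi$ of $\mathbb{K}$ is strictly $\alpha$-stable if $a^{1/\alpha}\xi'+b^{1/\alpha}\xi''$ has the same distribution as $(a+b)^{1/\alpha}\xi$ for all $a,b>0$, where $\xi',\xi''$ are i.i.d. copies of $\xi$. Such a $\xi$ is infinitely divisible, and $\mathbf{E}\chi(\xi)=\exp\{-\varphi(\chi)\}$, $\chi\in\hat{\mathbb{K}}$, for a negative definite complex-valued function $\varphi$ on $\hat{\mathbb{K}}$ with $\operatorname{Re}\varphi\in[0,\infty]$, $\varphi(\mathbf{1})=0$, called the Laplace exponent of $\xi$. Lévy measure: the Laplace exponent is associated, through the Lévy–Khinchin theorem on semigroups with involution (Berg–Christensen–Ressel), with a unique Lévy measure $\nu$, a Radon measure on the semigroup of all bounded characters $\rho$ of the semigroup $\hat{\mathbb{K}}$ (with the constant character $1$ removed): $\nu$ is the measure in the integral part of the representation of $\varphi$ as the sum of an additive part, a quadratic-form part, and $\int(1-\rho(\chi)+\mathrm{i}L(\chi,\rho))\,\nu(d\rho)$, where $L$ is a fixed Lévy function (compensating term). The cone $\mathbb{K}$ is embedded canonically into the semigroup of bounded characters of $\hat{\mathbb{K}}$ via $x\mapsto(\chi\mapsto\chi(x))$. One says that $\xi$ admits a Lévy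 measure if $\nu$ is supported by (the image of) $\mathbb{K}'$ and is $\sigma$-finite there, and then $\nu$ is regarded as a measure on $\mathbb{K}'$; it satisfies $\int_{\mathbb{K}'}(1-\operatorname{Re}\chi(x))\,\nu(dx)<\infty$ for all $\chi\in\hat{\mathbb{K}}$.
   Formalization: The Lévy measure ν is assumed to be nonzero; for ν = 0 (for instance ξ = e) the claim fails, because the push-forward of π⊗θ_α has infinite mass for every probability measure π. *)

theory Defs
  imports "HOL-Probability.Probability"
begin

section \<open>Convex cones with involution and characters\<close>

text \<open>
  The carrier of the cone is the whole type \<open>'a\<close>; \<open>M\<close> only supplies its \<open>\<sigma>\<close>-algebra.
  The scaling \<open>scl a x\<close> is meaningful for \<open>a > 0\<close> only; its values for \<open>a \<le> 0\<close> are arbitrary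
  and never used.
\<close>

locale convex_cone =
  fixes M :: "'a measure"
    and add :: "'a \<Rightarrow> 'a \<Rightarrow> 'a"
    and e :: 'a
    and scl :: "real \<Rightarrow> 'a \<Rightarrow> 'a"
  assumes space_M: "space M = UNIV"
    and add_assoc: "add (add x y) z = add x (add y z)"
    and add_commute: "add x y = add y x"
    and add_neutral: "add e x = x"
    and add_measurable: "(\<lambda>(x, y). add x y) \<in> measurable (M \<Otimes>\<^sub>M M) M"
    and scale_scale: "a > 0 \<Longrightarrow> b > 0 \<Longrightarrow> scl a (scl b x) = scl (a * b) x"
    and scale_one: "scl 1 x = x"
    and scale_add: "a > 0 \<Longrightarrow> scl a (add x y) = add (scl a x) (scl a y)"
    and scale_neutral: "a > 0 \<Longrightarrow> scl a e = e"
    and scale_measurable: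
      "(\<lambda>(x, a). scl a x) \<in> measurable (M \<Otimes>\<^sub>M restrict_space borel {0<..}) M"

locale convex_cone_involution = convex_cone M add e scl
  for M :: "'a measure" and add e scl +
  fixes star :: "'a \<Rightarrow> 'a"
  assumes star_measurable: "star \<in> measurable M M"
    and star_add: "star (add x y) = add (star x) (star y)"
    and star_scale: "a > 0 \<Longrightarrow> star (scl a x) = scl a (star x)"
    and star_star: "star (star x) = x"

definition is_character ::
  "'a measure \<Rightarrow> ('a \<Rightarrow> 'a \<Rightarrow> 'a) \<Rightarrow> 'a \<Rightarrow> ('a \<Rightarrow> 'a) \<Rightarrow> ('a \<Rightarrow> complex) \<Rightarrow> bool" where
  "is_character M add e star f \<longleftrightarrow>
     f \<in> borel_measurable M \<and> (\<forall>x. norm (f x) \<le> 1) \<and> f e = 1 \<and>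
     (\<forall>x y. f (add x y) = f x * f y) \<and> (\<forall>x. f (star x) = cnj (f x))"

definition separating :: "('a \<Rightarrow> complex) set \<Rightarrow> bool" where
  "separating H \<longleftrightarrow> (\<forall>x y. x \<noteq> y \<longrightarrow> (\<exists>f\<in>H. f x \<noteq> f y))"

definition generates :: "('a \<Rightarrow> complex) set \<Rightarrow> 'a measure \<Rightarrow> bool" where
  "generates H M \<longleftrightarrow>
     sets M = sigma_sets (space M) {f -` B \<inter> space M | f B. f \<in> H \<and> B \<in> sets borel}"

text \<open>
  A family of functions that is a semigroup under pointwise multiplication, with neutral
  element \<open>1\<close> and with complex conjugation as involution.
\<close>

definition character_semigroup :: "('a \<Rightarrow> complex) set \<Rightarrow> bool" where
  "character_semigroup H \<longleftrightarrow>
     (\<lambda>x. 1) \<in> H \<and> (\<forall>f\<in>H. \<forall>g\<in>H. (\<lambda>x. f x * g x) \<in> H) \<and> (\<forall>f\<in>H. (\<lambda>x. cnj (f x)) \<in> H)"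

definition punctured :: "'a measure \<Rightarrow> 'a \<Rightarrow> 'a measure" where
  "punctured M e = restrict_space M (- {e})"


section \<open>Strict stability and the Laplace exponent\<close>

text \<open>Both notions depend on the random element only through its distribution \<open>\<mu>\<close>.\<close>

definition strictly_stable ::
  "'a measure \<Rightarrow> ('a \<Rightarrow> 'a \<Rightarrow> 'a) \<Rightarrow> (real \<Rightarrow> 'a \<Rightarrow> 'a) \<Rightarrow> real \<Rightarrow> 'a measure \<Rightarrow> bool" where
  "strictly_stable M add scl \<alpha> \<mu> \<longleftrightarrow>
     (\<forall>a>0. \<forall>b>0.
        distr (\<mu> \<Otimes>\<^sub>M \<mu>) M (\<lambda>(x, y). add (scl (a powr (1 / \<alpha>)) x) (scl (b powr (1 / \<alpha>)) y))
        = distr \<mu> M (scl ((a + b) powr (1 / \<alpha>))))"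

definition negative_definite ::
  "('a \<Rightarrow> complex) set \<Rightarrow> (('a \<Rightarrow> complex) \<Rightarrow> complex) \<Rightarrow> bool" where
  "negative_definite H \<phi> \<longleftrightarrow>
     (\<forall>f\<in>H. \<phi> (\<lambda>x. cnj (f x)) = cnj (\<phi> f)) \<and>
     (\<forall>(n::nat) s (c :: nat \<Rightarrow> complex).
        (\<forall>j<n. s j \<in> H) \<longrightarrow> (\<Sum>j<n. c j) = 0 \<longrightarrow>
        Re (\<Sum>j<n. \<Sum>k<n. c j * cnj (c k) * \<phi> (\<lambda>x. s j x * cnj (s k x))) \<le> 0)"

text \<open>
  The value \<open>Re \<phi> = \<infinity>\<close>, i.e. a character \<open>f\<close> with vanishing expectation, is not represented. For
  strictly stable \<open>\<xi>\<close> it would force \<open>E f (n powr (-1/\<alpha>) \<xi>) = 0\<close> for all \<open>n\<close>, which Fatou's lemma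
  excludes when \<open>Re (f (t x))\<close> has a positive lower limit as \<open>t\<close> decreases to \<open>0\<close>.
\<close>

definition laplace_exponent ::
  "('a \<Rightarrow> complex) set \<Rightarrow> 'a measure \<Rightarrow> (('a \<Rightarrow> complex) \<Rightarrow> complex) \<Rightarrow> bool" where
  "laplace_exponent H \<mu> \<phi> \<longleftrightarrow>
     negative_definite H \<phi> \<and> (\<forall>f\<in>H. Re (\<phi> f) \<ge> 0) \<and> \<phi> (\<lambda>x. 1) = 0 \<and>
     (\<forall>f\<in>H. (\<integral>x. f x \<partial>\<mu>) = exp (- \<phi> f))"


section \<open>Levy measures\<close>

text \<open>
  The bounded characters \<open>\<rho>\<close> of the semigroup \<open>H\<close>, the constant character \<open>1\<close> being removed,
  with the \<open>\<sigma>\<close>-algebra generated by the evaluations. Characters are \<open>undefined\<close> outside \<open>H\<close>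
  (as elements of \<open>space (PiM H _)\<close>). For countable \<open>H\<close> this is the Borel \<open>\<sigma>\<close>-algebra of the
  topology of pointwise convergence, which is compact and metrizable before removing \<open>1\<close>.
\<close>

definition dual_chars :: "('a \<Rightarrow> complex) set \<Rightarrow> (('a \<Rightarrow> complex) \<Rightarrow> complex) set" where
  "dual_chars H =
     {\<rho> \<in> extensional H.
        (\<forall>f\<in>H. norm (\<rho> f) \<le> 1) \<and> \<rho> (\<lambda>x. 1) = 1 \<and>
        (\<forall>f\<in>H. \<forall>g\<in>H. \<rho> (\<lambda>x. f x * g x) = \<rho> f * \<rho> g) \<and>
        (\<forall>f\<in>H. \<rho> (\<lambda>x. cnj (f x)) = cnj (\<rho> f))}"

definition punctured_dual :: "('a \<Rightarrow> complex) set \<Rightarrow> (('a \<Rightarrow> complex) \<Rightarrow> complex) measure" where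
  "punctured_dual H =
     restrict_space (PiM H (\<lambda>_. borel)) (dual_chars H - {\<lambda>f\<in>H. 1})"

text \<open>
  The admissible integrators of the Levy-Khinchin formula. For countable \<open>H\<close> the integrability
  condition makes them finite on compact sets, hence they are Radon measures: every \<open>\<rho> \<noteq> 1\<close> has
  some \<open>f\<close> with \<open>Re (\<rho> f) < 1\<close>, and finitely many \<open>f\<close> serve a whole compact set.
\<close>

definition levy_integrator ::
  "('a \<Rightarrow> complex) set \<Rightarrow> (('a \<Rightarrow> complex) \<Rightarrow> complex) measure \<Rightarrow> bool" where
  "levy_integrator H \<kappa> \<longleftrightarrow>
     sets \<kappa> = sets (punctured_dual H) \<and>
     (\<forall>f\<in>H. (\<integral>\<^sup>+\<rho>. ennreal (1 - Re (\<rho> f)) \<partial>\<kappa>) < \<infinity>)"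

definition star_additive :: "('a \<Rightarrow> complex) set \<Rightarrow> (('a \<Rightarrow> complex) \<Rightarrow> real) \<Rightarrow> bool" where
  "star_additive H l \<longleftrightarrow>
     (\<forall>f\<in>H. \<forall>g\<in>H. l (\<lambda>x. f x * g x) = l f + l g) \<and> (\<forall>f\<in>H. l (\<lambda>x. cnj (f x)) = - l f)"

definition nonneg_quadratic_form :: "('a \<Rightarrow> complex) set \<Rightarrow> (('a \<Rightarrow> complex) \<Rightarrow> real) \<Rightarrow> bool" where
  "nonneg_quadratic_form H q \<longleftrightarrow>
     (\<forall>f\<in>H. q f \<ge> 0) \<and>
     (\<forall>f\<in>H. \<forall>g\<in>H. 2 * q f + 2 * q g = q (\<lambda>x. f x * g x) + q (\<lambda>x. f x * cnj (g x)))"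

definition levy_function ::
  "('a \<Rightarrow> complex) set \<Rightarrow> (('a \<Rightarrow> complex) \<Rightarrow> (('a \<Rightarrow> complex) \<Rightarrow> complex) \<Rightarrow> real) \<Rightarrow> bool" where
  "levy_function H L \<longleftrightarrow>
     (\<forall>\<rho>\<in>space (punctured_dual H). star_additive H (\<lambda>f. L f \<rho>)) \<and>
     (\<forall>f\<in>H. L f \<in> borel_measurable (punctured_dual H)) \<and>
     (\<forall>\<kappa>. levy_integrator H \<kappa> \<longrightarrow>
        (\<forall>f\<in>H. integrable \<kappa> (\<lambda>\<rho>. 1 - \<rho> f + \<i> * of_real (L f \<rho>))))"

text \<open>
  \<open>\<kappa>\<close> is the measure in the Levy-Khinchin representation (Berg, Christensen and Ressel) of the
  negative definite function \<open>\<phi>\<close>, for the Levy function \<open>L\<close>.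
\<close>

definition levy_khinchin ::
  "('a \<Rightarrow> complex) set \<Rightarrow> (('a \<Rightarrow> complex) \<Rightarrow> (('a \<Rightarrow> complex) \<Rightarrow> complex) \<Rightarrow> real) \<Rightarrow>
   (('a \<Rightarrow> complex) \<Rightarrow> complex) \<Rightarrow> (('a \<Rightarrow> complex) \<Rightarrow> complex) measure \<Rightarrow> bool" where
  "levy_khinchin H L \<phi> \<kappa> \<longleftrightarrow>
     levy_integrator H \<kappa> \<and>
     (\<exists>l q. star_additive H l \<and> nonneg_quadratic_form H q \<and>
        (\<forall>f\<in>H. \<phi> f = \<phi> (\<lambda>x. 1) + \<i> * of_real (l f) + of_real (q f)
                   + (\<integral>\<rho>. (1 - \<rho> f + \<i> * of_real (L f \<rho>)) \<partial>\<kappa>)))"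

definition char_embedding :: "('a \<Rightarrow> complex) set \<Rightarrow> 'a \<Rightarrow> (('a \<Rightarrow> complex) \<Rightarrow> complex)" where
  "char_embedding H x = (\<lambda>f\<in>H. f x)"

text \<open>
  \<open>\<nu>\<close> is a \<open>\<sigma>\<close>-finite measure on the cone without its neutral element whose image under the
  canonical embedding is the Levy measure of \<open>\<phi>\<close>. In other words, the Levy measure is supported
  by the embedded cone and \<open>\<nu>\<close> is its trace there.
\<close>

definition admits_levy_measure ::
  "'a measure \<Rightarrow> 'a \<Rightarrow> ('a \<Rightarrow> complex) set \<Rightarrow>
   (('a \<Rightarrow> complex) \<Rightarrow> (('a \<Rightarrow> complex) \<Rightarrow> complex) \<Rightarrow> real) \<Rightarrow>
   (('a \<Rightarrow> complex) \<Rightarrow> complex) \<Rightarrow> 'a measure \<Rightarrow> bool" where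
  "admits_levy_measure M e H L \<phi> \<nu> \<longleftrightarrow>
     sets \<nu> = sets (punctured M e) \<and> sigma_finite_measure \<nu> \<and>
     levy_khinchin H L \<phi> (distr \<nu> (punctured_dual H) (char_embedding H))"

definition theta :: "real \<Rightarrow> real measure" where
  "theta \<alpha> = density (restrict_space lborel {0<..}) (\<lambda>t. ennreal (\<alpha> * t powr (- (\<alpha> + 1))))"

definition polar_representation ::
  "'a measure \<Rightarrow> 'a \<Rightarrow> (real \<Rightarrow> 'a \<Rightarrow> 'a) \<Rightarrow> real \<Rightarrow> 'a measure \<Rightarrow> 'a measure \<Rightarrow> bool" where
  "polar_representation M e scl \<alpha> \<pi> \<nu> \<longleftrightarrow>
     prob_space \<pi> \<and> sets \<pi> = sets (punctured M e) \<and>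
     \<nu> = distr (\<pi> \<Otimes>\<^sub>M theta \<alpha>) (punctured M e) (\<lambda>(x, t). scl t x)"


section \<open>Poisson processes\<close>

text \<open>A point process is a random counting measure \<open>\<eta>\<close> on the measurable space of \<open>\<nu>\<close>.\<close>

definition poisson_process :: "'w measure \<Rightarrow> 'b measure \<Rightarrow> ('w \<Rightarrow> 'b measure) \<Rightarrow> bool" where
  "poisson_process P \<nu> \<eta> \<longleftrightarrow>
     prob_space P \<and>
     (\<forall>\<omega>\<in>space P. sets (\<eta> \<omega>) = sets \<nu>) \<and>
     (\<forall>A\<in>sets \<nu>. (\<lambda>\<omega>. emeasure (\<eta> \<omega>) A) \<in> borel_measurable P) \<and>
     (\<forall>A\<in>sets \<nu>. emeasure \<nu> A < \<infinity> \<longrightarrow>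
        (\<forall>k::nat. measure P {\<omega> \<in> space P. emeasure (\<eta> \<omega>) A = of_nat k}
                  = measure \<nu> A ^ k / fact k * exp (- measure \<nu> A))) \<and>
     (\<forall>A\<in>sets \<nu>. emeasure \<nu> A = \<infinity> \<longrightarrow> (AE \<omega> in P. emeasure (\<eta> \<omega>) A = \<infinity>)) \<and>
     (\<forall>(n::nat) A. (\<forall>i<n. A i \<in> sets \<nu>) \<longrightarrow> disjoint_family_on A {..<n} \<longrightarrow>
        prob_space.indep_vars P (\<lambda>_. borel) (\<lambda>i \<omega>. emeasure (\<eta> \<omega>) (A i)) {..<n})"

text \<open>The point process \<open>{X i | i \<in> \<nat>}\<close>, points being counted with multiplicities.\<close>

definition point_process_of :: "'b measure \<Rightarrow> (nat \<Rightarrow> 'w \<Rightarrow> 'b) \<Rightarrow> 'w \<Rightarrow> 'b measure" where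
  "point_process_of N X \<omega> = distr (count_space UNIV) N (\<lambda>i. X i \<omega>)"

definition successive_unit_poisson_points :: "'w measure \<Rightarrow> (nat \<Rightarrow> 'w \<Rightarrow> real) \<Rightarrow> bool" where
  "successive_unit_poisson_points P \<Gamma> \<longleftrightarrow>
     (\<forall>i. \<Gamma> i \<in> measurable P (restrict_space lborel {0<..})) \<and>
     (AE \<omega> in P. \<forall>i. \<Gamma> i \<omega> < \<Gamma> (Suc i) \<omega>) \<and>
     poisson_process P (restrict_space lborel {0<..})
       (point_process_of (restrict_space lborel {0<..}) \<Gamma>)"

text \<open>
  On the probability space \<open>P\<close>: i.i.d. random elements \<open>\<epsilon> i\<close> with distribution \<open>\<pi>\<close>, and an
  independent sequence \<open>\<Gamma> i\<close> of the successive points of a unit Poisson process.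
\<close>

definition lepage_input ::
  "'w measure \<Rightarrow> 'a measure \<Rightarrow> (nat \<Rightarrow> 'w \<Rightarrow> 'a) \<Rightarrow> (nat \<Rightarrow> 'w \<Rightarrow> real) \<Rightarrow> bool" where
  "lepage_input P \<pi> \<epsilon> \<Gamma> \<longleftrightarrow>
     prob_space P \<and>
     prob_space.indep_vars P (\<lambda>_. \<pi>) \<epsilon> UNIV \<and> (\<forall>i. distr P \<pi> (\<epsilon> i) = \<pi>) \<and>
     successive_unit_poisson_points P \<Gamma> \<and>
     prob_space.indep_set P
       {(\<lambda>\<omega> i. \<epsilon> i \<omega>) -` A \<inter> space P | A. A \<in> sets (PiM UNIV (\<lambda>_. \<pi>))}
       {(\<lambda>\<omega> i. \<Gamma> i \<omega>) -` B \<inter> space P | B. B \<in> sets (PiM UNIV (\<lambda>_. restrict_space lborel {0<..}))}"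

end

theory Submission
  imports Defs
begin

text \<open>
  The difficulty is that \<open>H\<close> need not be closed under scaling, so that homogeneity of \<open>\<nu>\<close> does not follow from
  the uniqueness of the Levy measure. Strict stability gives \<open>E \<psi>(s \<xi>) = exp (- s\<^sup>\<alpha> c(\<psi>))\<close> for all
  sufficiently regular characters \<open>\<psi>\<close>, scaled ones included. For \<open>f\<close> and \<open>\<eta>\<close> in \<open>H\<close> the second difference
  \<open>\<phi>(f \<eta>) + \<phi>(f \<eta>\<^sup>*) - 2 \<phi>(f)\<close> is a constant plus twice the transform at \<open>f\<close> of the finite measure
  \<open>(1 - Re \<eta>) d\<nu>\<close>. Its exponential is the transform of a compound Poisson law; since \<open>H\<close> determines measures,
  the exponentiated identity extends to all regular characters, and the
  logarithm can be taken along the paths \<open>t \<mapsto> \<psi>(t x)\<close>, which are continuous in mean and tend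
  to \<open>1\<close>. Comparing the identity for \<open>\<psi>\<close> and for its scaled versions yields \<open>\<nu>(s\<^sup>-\<^sup>1 A) = s\<^sup>\<alpha> \<nu>(A)\<close>.

  A \<open>\<sigma>\<close>-finite measure with this property is decomposed along the orbits of the scaling: if \<open>f \<ge> 0\<close> has
  integral \<open>1\<close> and \<open>F(x) = \<integral> f(t x) \<theta>\<^sub>\<alpha>(dt)\<close> is positive and finite, then \<open>F\<close> is
  homogeneous of degree \<open>\<alpha>\<close>, and \<open>\<pi>\<close> is the image of \<open>f d\<nu>\<close> under
  \<open>x \<mapsto> F(x)\<^sup>-\<^sup>1\<^sup>/\<^sup>\<alpha> x\<close>. The Poisson processes are identified by their Laplace functionals, and averaging \<open>\<pi>\<close>
  with its image under the involution makes it symmetric.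
\<close>

section \<open>Determination of measures by a semigroup of characters\<close>

text \<open>Two obstacles shape the argument. First, a transform determines its exponent only modulo
  multiples of \<open>2 pi i\<close>, so \<open>\<phi>\<close> cannot be compared directly with the
  exponent \<open>expo\<close> that stability provides: identities are exponentiated, carried from
  \<open>H\<close> to all regular characters as equalities of finite complex measures, and only then
  is the logarithm taken, along a path that starts at the constant character. Second, the paths
  \<open>t\<close> |-> \<open>\<psi>(t x)\<close> are only one-sided continuous, and the hypotheses
  speak of real parts. Imaginary parts are recovered from
  \<open>Im z Im w = Re z Re w - Re (z w)\<close>, and two-sided continuity holds in mean because
  the second moments of increments are themselves combinations of transforms, which obey a
  reflection formula at scale \<open>1\<close>. Second differences are the right object since
  \<open>1 - Re \<eta>\<close> is integrable against \<open>\<nu>\<close>, whereas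
  \<open>1 - f\<close> need not be. Homogeneity is tested with weights
  \<open>(1 - Re \<eta>(x)) (1 - Re \<zeta>(x / s))\<close>, whose scaled version has the same
  shape, so that both sides are integrable.\<close>

lemma integrable_bounded_comp:
  fixes g w :: "_ \<Rightarrow> complex"
  assumes "X \<in> measurable P M" and w: "integrable P w" and "g \<in> borel_measurable M" and C: "\<And>x. norm (g x) \<le> C"
  shows "integrable P (\<lambda>x. g (X x) * w x)"
proof (rule Bochner_Integration.integrable_bound)
  note [measurable] = assms(1,3) borel_measurable_integrable[OF w]
  show "integrable P (\<lambda>x. C * norm (w x))" using w by simp
  show "AE x in P. norm (g (X x) * w x) \<le> norm (C * norm (w x))"
    using C order_trans[OF C abs_ge_self] by (intro AE_I2) (simp add: norm_mult abs_mult mult_right_mono)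
  show "(\<lambda>x. g (X x) * w x) \<in> borel_measurable P" by measurable
qed

lemma weighted_integral_LIMSEQ:
  fixes h :: "'a \<Rightarrow> complex" and F :: "nat \<Rightarrow> 'a \<Rightarrow> complex"
  assumes X: "X \<in> measurable P M" and w: "integrable P w" and h: "h \<in> borel_measurable M" "\<And>x. norm (h x) \<le> 1"
    and F: "\<And>n. F n \<in> borel_measurable M" "\<And>n x. norm (F n x) \<le> C" and lim: "\<And>x. (\<lambda>n. F n x) \<longlonglongrightarrow> g x"
  shows "(\<lambda>n. \<integral>x. h (X x) * F n (X x) * w x \<partial>P) \<longlonglongrightarrow> (\<integral>x. h (X x) * g (X x) * w x \<partial>P)"
proof (rule integral_dominated_convergence[where w="\<lambda>x. C * norm (w x)"])
  note [measurable] = X F(1) h(1) borel_measurable_integrable[OF w]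
  have [measurable]: "g \<in> borel_measurable M" by (rule borel_measurable_LIMSEQ_metric[of F]) (auto simp: lim)
  show "AE x in P. norm (h (X x) * F i (X x) * w x) \<le> C * norm (w x)" for i
    using mult_mono[OF h(2) F(2)[of i]] by (intro AE_I2) (simp add: norm_mult mult_right_mono)
  show "AE x in P. (\<lambda>i. h (X x) * F i (X x) * w x) \<longlonglongrightarrow> h (X x) * g (X x) * w x"
    by (intro AE_I2 tendsto_intros lim)
  show "(\<lambda>x. h (X x) * F i (X x) * w x) \<in> borel_measurable P" "(\<lambda>x. h (X x) * g (X x) * w x) \<in> borel_measurable P" for i
    by measurable
qed (use w in simp)

lemma weighted_integral_lincomb:
  fixes a b :: complex
  assumes "integrable P (\<lambda>x. h (X x) * f (X x) * w x)" "integrable P (\<lambda>x. h (X x) * g (X x) * w x)"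
  shows "(\<integral>x. h (X x) * (a * f (X x) + b * g (X x)) * w x \<partial>P)
    = a * (\<integral>x. h (X x) * f (X x) * w x \<partial>P) + b * (\<integral>x. h (X x) * g (X x) * w x \<partial>P)"
proof -
  have "(\<integral>x. h (X x) * (a * f (X x) + b * g (X x)) * w x \<partial>P)
    = (\<integral>x. a * (h (X x) * f (X x) * w x) + b * (h (X x) * g (X x) * w x) \<partial>P)"
    by (rule Bochner_Integration.integral_cong) (simp_all only: algebra_simps)
  then show ?thesis using assms by simp
qed

text \<open>The sets whose indicators may be multiplied into the weights form a \<open>\<sigma>\<close>-algebra, so no
  \<open>\<pi>\<close>-system argument is needed.\<close>

lemma character_semigroup_determines_sets:
  fixes X1 :: "'b \<Rightarrow> 'a" and X2 :: "'c \<Rightarrow> 'a" and w1 :: "'b \<Rightarrow> complex" and w2 :: "'c \<Rightarrow> complex"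
  assumes sp: "space M = UNIV"
    and H: "character_semigroup H" and gen: "generates H M"
    and Hm: "\<And>f. f \<in> H \<Longrightarrow> f \<in> borel_measurable M"
    and Hb: "\<And>f x. f \<in> H \<Longrightarrow> norm (f x) \<le> 1"
    and X1: "X1 \<in> measurable P1 M" and X2: "X2 \<in> measurable P2 M"
    and w1: "integrable P1 w1" and w2: "integrable P2 w2"
    and eq: "\<And>f. f \<in> H \<Longrightarrow> (\<integral>x. f (X1 x) * w1 x \<partial>P1) = (\<integral>x. f (X2 x) * w2 x \<partial>P2)"
    and E: "E \<in> sets M"
  shows "(\<integral>x. indicator E (X1 x) * w1 x \<partial>P1) = (\<integral>x. indicator E (X2 x) * w2 x \<partial>P2)"
proof -
  note [measurable] = X1 X2 Hm
  have [measurable]: "w1 \<in> borel_measurable P1" "w2 \<in> borel_measurable P2"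
    using w1 w2 by auto
  define G where "G = {g::'a \<Rightarrow> complex. g \<in> borel_measurable M \<and> (\<exists>C. \<forall>x. norm (g x) \<le> C)}"
  \<comment> \<open>Testing against every \<open>f\<close> in \<open>H\<close>, and not only against
    the constant \<open>1\<close>, makes \<open>P\<close> stable under multiplication by elements of
    \<open>H\<close>.\<close>
  define P where "P g \<longleftrightarrow> g \<in> G \<and> (\<forall>f\<in>H. (\<integral>x. f (X1 x) * g (X1 x) * w1 x \<partial>P1)
      = (\<integral>x. f (X2 x) * g (X2 x) * w2 x \<partial>P2))" for g
  have G_mult: "(\<lambda>x. f x * g x) \<in> G" if f: "f \<in> G" and g: "g \<in> G" for f g
  proof -
    obtain C where C: "\<And>x. norm (f x) \<le> C" using f by (auto simp: G_def)
    obtain D where D: "\<And>x. norm (g x) \<le> D" using g by (auto simp: G_def)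
    have "norm (f x * g x) \<le> C * D" for x
      unfolding norm_mult using C D by (meson mult_mono norm_ge_zero order_trans)
    with f g show ?thesis by (auto simp: G_def)
  qed
  have HG: "f \<in> G" if "f \<in> H" for f using Hm Hb that by (auto simp: G_def)
  have int1: "integrable P1 (\<lambda>x. g (X1 x) * w1 x)" and int2: "integrable P2 (\<lambda>x. g (X2 x) * w2 x)" if g: "g \<in> G" for g
  proof -
    obtain C where "g \<in> borel_measurable M" "\<And>x. norm (g x) \<le> C" using g by (auto simp: G_def)
    then show "integrable P1 (\<lambda>x. g (X1 x) * w1 x)" "integrable P2 (\<lambda>x. g (X2 x) * w2 x)"
      using integrable_bounded_comp[OF X1 w1] integrable_bounded_comp[OF X2 w2] by blast+
  qed
  have one: "(\<lambda>x. 1) \<in> H" and mulH: "\<And>f g. f \<in> H \<Longrightarrow> g \<in> H \<Longrightarrow> (\<lambda>x. f x * g x) \<in> H"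
    and cnjH: "\<And>f. f \<in> H \<Longrightarrow> (\<lambda>x. cnj (f x)) \<in> H"
    using H by (auto simp: character_semigroup_def)
  have P1: "P (\<lambda>x. 1)" unfolding P_def using eq by (auto simp: G_def)
  have PG: "P g \<Longrightarrow> g \<in> G" for g by (simp add: P_def)
  have P_lin: "P (\<lambda>x. a * f x + b * g x)" if Pf: "P f" and Pg: "P g" for a b f g
  proof -
    obtain C where C: "\<And>x. norm (f x) \<le> C" using PG[OF Pf] by (auto simp: G_def)
    obtain D where D: "\<And>x. norm (g x) \<le> D" using PG[OF Pg] by (auto simp: G_def)
    have "norm (a * f x + b * g x) \<le> norm a * C + norm b * D" for x
      using C[of x] D[of x] by (intro order_trans[OF norm_triangle_ineq])
        (simp add: norm_mult add_mono mult_left_mono)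
    then have "(\<lambda>x. a * f x + b * g x) \<in> G"
      using PG[OF Pf] PG[OF Pg] by (auto simp: G_def)
    moreover have "(\<integral>x. h (X1 x) * (a * f (X1 x) + b * g (X1 x)) * w1 x \<partial>P1)
      = (\<integral>x. h (X2 x) * (a * f (X2 x) + b * g (X2 x)) * w2 x \<partial>P2)" if "h \<in> H" for h
    proof -
      note hG = G_mult[OF HG[OF \<open>h \<in> H\<close>] PG[OF \<open>P f\<close>]] G_mult[OF HG[OF \<open>h \<in> H\<close>] PG[OF \<open>P g\<close>]]
      show ?thesis
        unfolding weighted_integral_lincomb[where X=X1, OF hG[THEN int1]] weighted_integral_lincomb[where X=X2, OF hG[THEN int2]]
        using that \<open>P f\<close> \<open>P g\<close> by (auto simp: P_def)
    qed
    ultimately show ?thesis by (simp add: P_def)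
  qed
  have P_lim: "P g" if P: "\<And>n. P (F n)" and lim: "\<And>x. (\<lambda>n. F n x) \<longlonglongrightarrow> g x"
    and bd: "\<And>n x. norm (F n x) \<le> C" for F :: "nat \<Rightarrow> 'a \<Rightarrow> complex" and g C
  proof -
    have [measurable]: "F n \<in> borel_measurable M" for n using PG[OF P] by (auto simp: G_def)
    have gm[measurable]: "g \<in> borel_measurable M"
      by (rule borel_measurable_LIMSEQ_metric[of F]) (auto simp: lim)
    have gb: "norm (g x) \<le> C" for x
      using tendsto_norm[OF lim[of x]] by (rule LIMSEQ_le_const2) (use bd in auto)
    have gG: "g \<in> G" using gm gb by (auto simp: G_def)
    have "(\<integral>x. h (X1 x) * g (X1 x) * w1 x \<partial>P1) = (\<integral>x. h (X2 x) * g (X2 x) * w2 x \<partial>P2)"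
      if h: "h \<in> H" for h
    proof -
      have Fm: "F n \<in> borel_measurable M" for n by measurable
      note l1 = weighted_integral_LIMSEQ[OF X1 w1 Hm[OF h] Hb[OF h] Fm bd lim]
        and l2 = weighted_integral_LIMSEQ[OF X2 w2 Hm[OF h] Hb[OF h] Fm bd lim]
      have "(\<integral>x. h (X1 x) * F n (X1 x) * w1 x \<partial>P1) = (\<integral>x. h (X2 x) * F n (X2 x) * w2 x \<partial>P2)" for n
        using P h by (auto simp: P_def)
      then show ?thesis using l1 l2 LIMSEQ_unique by simp
    qed
    with gG show ?thesis by (simp add: P_def)
  qed
  have P_H: "P (\<lambda>x. f x * g x)" if "P g" "f \<in> H" for f g
  proof -
    have "(\<integral>x. h (X1 x) * (f (X1 x) * g (X1 x)) * w1 x \<partial>P1) = (\<integral>x. h (X2 x) * (f (X2 x) * g (X2 x)) * w2 x \<partial>P2)"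
      if "h \<in> H" for h
      using \<open>P g\<close> mulH[OF \<open>h \<in> H\<close> \<open>f \<in> H\<close>] unfolding P_def by (auto simp: mult.assoc)
    then show ?thesis using G_mult[OF HG[OF \<open>f \<in> H\<close>] PG[OF \<open>P g\<close>]] by (simp add: P_def)
  qed
  have P_Re: "P (\<lambda>x. of_real (Re (f x)) * g x)" and P_Im: "P (\<lambda>x. of_real (Im (f x)) * g x)"
    if "P g" "f \<in> H" for f g
  proof -
    have 1: "P (\<lambda>x. f x * g x)" "P (\<lambda>x. cnj (f x) * g x)"
      using P_H that cnjH by auto
    have "(1/2) * (f x * g x) + (1/2) * (cnj (f x) * g x) = of_real (Re (f x)) * g x" for x
    proof -
      have "of_real (Re (f x)) = (f x + cnj (f x)) / 2" by (simp add: complex_add_cnj)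
      then show ?thesis by (simp only:) (simp add: field_simps)
    qed
    then show "P (\<lambda>x. of_real (Re (f x)) * g x)" using P_lin[OF 1, of "1/2" "1/2"] by (simp only:)
    have "(-\<i>/2) * (f x * g x) + (\<i>/2) * (cnj (f x) * g x) = of_real (Im (f x)) * g x" for x
    proof -
      have "of_real (Im (f x)) = - \<i> * (f x - cnj (f x)) / 2" by (simp add: complex_diff_cnj complex_eq_iff)
      then show ?thesis by (simp only:) (simp add: field_simps)
    qed
    then show "P (\<lambda>x. of_real (Im (f x)) * g x)" using P_lin[OF 1, of "-\<i>/2" "\<i>/2"] by (simp only:)
  qed
  \<comment> \<open>Members of \<open>R\<close> may be multiplied into any \<open>g\<close> with
    \<open>P g\<close>, hence so may all polynomials in them; the bound by \<open>1\<close> places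
    their values in the interval on which polynomials will approximate.\<close>
  define R where "R = {r :: 'a \<Rightarrow> real. (\<forall>x. \<bar>r x\<bar> \<le> 1) \<and> (\<forall>g. P g \<longrightarrow> P (\<lambda>x. of_real (r x) * g x))}"
  have R_pow: "P (\<lambda>x. of_real (r x) ^ n * g x)" if "r \<in> R" "P g" for r n g
  proof (induction n)
    case 0 then show ?case using that by simp
  next
    case (Suc n)
    have "P (\<lambda>x. of_real (r x) * (of_real (r x) ^ n * g x))" using that(1) Suc unfolding R_def by blast
    then show ?case by (simp add: mult.assoc)
  qed
  have P_sum: "P (\<lambda>x. \<Sum>i\<in>I. f i x)" if "finite I" "\<And>i. i \<in> I \<Longrightarrow> P (f i)" for I :: "nat set" and f
    using that
  proof (induction I rule: finite_induct)
    case empty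
    have "P (\<lambda>x. 0 * 1 + 0 * 1)" by (rule P_lin[OF P1 P1])
    then show ?case by simp
  next
    case (insert i I)
    have "P (\<lambda>x. 1 * f i x + 1 * (\<Sum>i\<in>I. f i x))"
      by (rule P_lin) (use insert in auto)
    then show ?case using insert(1,2) by simp
  qed
  have R_poly: "P (\<lambda>x. of_real (p (r x)) * g x)" if rR: "r \<in> R" and Pg: "P g" and pp: "real_polynomial_function p" for r g p
  proof -
    obtain a n where p: "p = (\<lambda>x. \<Sum>i\<le>n. a i * x ^ i)"
      using pp unfolding real_polynomial_function_iff_sum by auto
    have "P (\<lambda>x. \<Sum>i\<in>{..n}. of_real (a i) * (of_real (r x) ^ i * g x) + 0 * g x)"
      by (intro P_sum P_lin R_pow[OF rR] Pg) simp
    then show ?thesis by (simp add: p sum_distrib_right mult.assoc[symmetric])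
  qed
  define good where "good = {A \<in> sets M. \<forall>g. P g \<longrightarrow> P (\<lambda>x. indicator A x * g x)}"
  have R_set: "{x. r x > c} \<in> good" if r: "r \<in> R" and rm: "{x. r x > c} \<in> sets M" for r c
  proof -
    \<comment> \<open>The ramps tend to the indicator of \<open>{c<..}\<close> and are continuous,
      so each is approximated uniformly on \<open>{-1..1}\<close> by polynomials. With error
      \<open>inverse (Suc n)\<close> for the \<open>n\<close>-th ramp, a single sequence of
      polynomials converges pointwise to the indicator.\<close>
    define ramp where "ramp n t = min 1 (max 0 (real n * (t - c)))" for n t
    have "\<exists>p. real_polynomial_function p \<and> (\<forall>t\<in>{-1..1}. \<bar>ramp n t - p t\<bar> < inverse (Suc n))" for n
    proof -
      have "continuous_on {-1..1::real} (ramp n)"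
        unfolding ramp_def by (intro continuous_intros)
      then obtain g where "real_polynomial_function g" "\<And>x. x \<in> {-1..1} \<Longrightarrow> \<bar>ramp n x - g x\<bar> < inverse (Suc n)"
        by (rule Stone_Weierstrass_real_polynomial_function[OF compact_Icc, of _ _ _ "inverse (Suc n)"]) (simp | blast)+
      then show ?thesis by blast
    qed
    from choice[OF allI[OF this]] obtain p where
      "\<forall>n. real_polynomial_function (p n) \<and> (\<forall>t\<in>{-1..1}. \<bar>ramp n t - p n t\<bar> < inverse (Suc n))" ..
    then have p: "\<And>n. real_polynomial_function (p n)"
      and pb: "\<And>n t. t \<in> {-1..1} \<Longrightarrow> \<bar>ramp n t - p n t\<bar> < inverse (Suc n)" by blast+
    have lim: "(\<lambda>n. p n t) \<longlonglongrightarrow> indicator {c<..} t" if t: "t \<in> {-1..1}" for t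
    proof -
      have l1: "(\<lambda>n. ramp n t) \<longlonglongrightarrow> indicator {c<..} t"
      proof (cases "t > c")
        case True
        obtain N where N: "real N * (t - c) > 1" using True reals_Archimedean3[of "t - c"] by auto
        have "eventually (\<lambda>n. ramp n t = 1) sequentially"
        proof (rule eventually_sequentiallyI)
          fix n assume "N \<le> n"
          then have "real N * (t - c) \<le> real n * (t - c)" using True by (intro mult_right_mono) auto
          then show "ramp n t = 1" using N by (auto simp: ramp_def)
        qed
        then show ?thesis using True by (simp add: tendsto_eventually)
      next
        case False
        then have "ramp n t = 0" for n by (auto simp: ramp_def mult_nonneg_nonpos)
        then show ?thesis using False by simp
      qed
      have "(\<lambda>n. ramp n t - p n t) \<longlonglongrightarrow> 0"
      proof (rule Lim_null_comparison[OF _ LIMSEQ_inverse_real_of_nat])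
        show "\<forall>\<^sub>F n in sequentially. norm (ramp n t - p n t) \<le> inverse (real (Suc n))"
          using pb[OF t] by (intro always_eventually allI) (simp add: less_imp_le)
      qed
      from tendsto_diff[OF l1 this] show ?thesis by simp
    qed
    have "P (\<lambda>x. indicator {x. r x > c} x * g x)" if g: "P g" for g
    proof -
      obtain C where C: "\<And>x. norm (g x) \<le> C" using PG[OF g] by (auto simp: G_def)
      have rb: "r x \<in> {-1..1}" for x using r by (auto simp: R_def abs_le_iff minus_le_iff)
      show ?thesis
      proof (rule P_lim[of "\<lambda>n x. of_real (p n (r x)) * g x" _ "2 * C"])
        show "P (\<lambda>x. of_real (p n (r x)) * g x)" for n using R_poly[OF r g p] .
        have "(\<lambda>n. of_real (p n (r x)) * g x) \<longlonglongrightarrow> of_real (indicator {c<..} (r x)) * g x" for x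
          by (intro tendsto_intros lim rb)
        moreover have "of_real (indicator {c<..} (r x)) = (indicator {x. r x > c} x :: complex)" for x
          by (simp add: indicator_def)
        ultimately show "(\<lambda>n. of_real (p n (r x)) * g x) \<longlonglongrightarrow> indicator {x. r x > c} x * g x" for x
          by (simp only:)
        \<comment> \<open>The ramp is at most \<open>1\<close> and the approximation error is at
          most \<open>inverse (Suc n) \<le> 1\<close>, whence the factor \<open>2\<close>.\<close>
        show "norm (of_real (p n (r x)) * g x) \<le> 2 * C" for n x
        proof -
          have "inverse (real (Suc n)) \<le> 1" by (simp add: field_simps)
          then have "\<bar>p n (r x)\<bar> \<le> 2" using pb[OF rb, of n x] by (auto simp: ramp_def)
          then show ?thesis using C[of x] by (simp add: norm_mult mult_mono)
        qed
      qed
    qed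
    then show ?thesis using rm by (auto simp: good_def)
  qed
  have good_space: "space M \<in> good"
    using sets.top[of M] by (simp add: good_def sp)
  have good_Int: "A \<inter> B \<in> good" if "A \<in> good" "B \<in> good" for A B
  proof -
    have "P (\<lambda>x. indicator A x * (indicator B x * g x))" if "P g" for g
      using that \<open>A \<in> good\<close> \<open>B \<in> good\<close> unfolding good_def by blast
    moreover have "A \<inter> B \<in> sets M" using that unfolding good_def by blast
    ultimately show ?thesis by (simp add: good_def indicator_inter_arith mult.assoc)
  qed
  have good_Diff: "space M - A \<in> good" if "A \<in> good" for A
  proof -
    have "P (\<lambda>x. indicator (space M - A) x * g x)" if g: "P g" for g
    proof -
      have "P (\<lambda>x. indicator A x * g x)" using \<open>A \<in> good\<close> g unfolding good_def by blast
      from P_lin[OF g this, of 1 "-1"]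
      have "P (\<lambda>x. 1 * g x + (-1) * (indicator A x * g x))" .
      moreover have "1 * g x + (-1) * (indicator A x * g x) = indicator (space M - A) x * g x" for x
        by (simp add: sp indicator_def)
      ultimately show ?thesis by (simp only:)
    qed
    then show ?thesis using \<open>A \<in> good\<close> unfolding good_def by blast
  qed
  have good_Un: "(\<Union>i. A i) \<in> good" if A: "\<And>i::nat. A i \<in> good" for A
  proof -
    \<comment> \<open>Intersections correspond to products of indicators, so finite unions go
      through complements; the countable union is then a bounded pointwise limit.\<close>
    have fin: "space M - (\<Union>i<n. A i) \<in> good" for n :: nat
    proof (induction n)
      case 0 then show ?case using good_space by simp
    next
      case (Suc n)
      have "space M - (\<Union>i<Suc n. A i) = (space M - (\<Union>i<n. A i)) \<inter> (space M - A n)"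
        by (auto simp: less_Suc_eq)
      then show ?case using good_Int[OF Suc good_Diff[OF A]] by simp
    qed
    have fin': "(\<Union>i<n. A i) \<in> good" for n :: nat
    proof -
      have "(\<Union>i<n. A i) \<subseteq> space M" by (simp add: sp)
      then have "space M - (space M - (\<Union>i<n. A i)) = (\<Union>i<n. A i)" by auto
      then show ?thesis using good_Diff[OF fin[of n]] by simp
    qed
    have "P (\<lambda>x. indicator (\<Union>i. A i) x * g x)" if g: "P g" for g
    proof -
      obtain C where C: "\<And>x. norm (g x) \<le> C" using PG[OF g] by (auto simp: G_def)
      show ?thesis
      proof (rule P_lim[of "\<lambda>n x. indicator (\<Union>i<n. A i) x * g x" _ C])
        show "P (\<lambda>x. indicator (\<Union>i<n. A i) x * g x)" for n
          using fin'[of n] g unfolding good_def by blast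
        show "(\<lambda>n. indicator (\<Union>i<n. A i) x * g x) \<longlonglongrightarrow> indicator (\<Union>i. A i) x * g x" for x
          by (rule tendsto_mult[OF LIMSEQ_indicator_UN tendsto_const])
        show "norm (indicator (\<Union>i<n. A i) x * g x) \<le> C" for n x
          using C[of x] order_trans[OF norm_ge_zero C[of x]] by (auto split: split_indicator)
      qed
    qed
    moreover have "(\<Union>i. A i) \<in> sets M" using A unfolding good_def by blast
    ultimately show ?thesis unfolding good_def by blast
  qed
  have Rf: "(\<lambda>x. Re (f x)) \<in> R" "(\<lambda>x. Im (f x)) \<in> R" if "f \<in> H" for f
  proof -
    have "\<bar>Re (f x)\<bar> \<le> 1" "\<bar>Im (f x)\<bar> \<le> 1" for x
      using Hb[OF that, of x] abs_Re_le_cmod[of "f x"] abs_Im_le_cmod[of "f x"] by linarith+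
    then show "(\<lambda>x. Re (f x)) \<in> R" "(\<lambda>x. Im (f x)) \<in> R"
      using P_Re P_Im that unfolding R_def by blast+
  qed
  have sig: "sigma_algebra (space M) good"
  proof -
    have "{} \<in> good" using good_Diff[OF good_space] by simp
    then show ?thesis
      unfolding sigma_algebra_iff2 using good_Diff good_Un by (simp add: sp image_subset_iff)
  qed
  interpret s: sigma_algebra UNIV good using sig by (simp add: sp)
  have "{f -` B \<inter> space M | f B. f \<in> H \<and> B \<in> sets borel} \<subseteq> good"
  proof safe
    fix f and B :: "complex set" assume f: "f \<in> H" and B: "B \<in> sets borel"
    note [measurable] = Hm[OF f]
    have "{x \<in> space M. Re (f x) > c} \<in> sets M" "{x \<in> space M. Im (f x) > c} \<in> sets M" for c
      by measurable
    then have "{x. Re (f x) > c} \<in> good" "{x. Im (f x) > c} \<in> good" for c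
      using R_set[OF Rf(1)[OF f]] R_set[OF Rf(2)[OF f]] by (simp_all add: sp)
    \<comment> \<open>Measurability with respect to the sigma-algebra \<open>good\<close> need only
      be checked on the half-planes \<open>Re > c\<close> and \<open>Im > c\<close>.\<close>
    then have "f \<in> measurable (sigma UNIV good) borel"
      by (simp add: borel_measurable_complex_iff borel_measurable_iff_greater)
    from measurable_sets[OF this B] show "f -` B \<inter> space M \<in> good" by (simp add: sp)
  qed
  then have "sigma_sets (space M) {f -` B \<inter> space M | f B. f \<in> H \<and> B \<in> sets borel} \<subseteq> good"
    by (rule sigma_algebra.sigma_sets_subset[OF sig])
  then have "E \<in> good" using E gen unfolding generates_def by blast
  then have "P (\<lambda>x. indicator E x * 1)" using P1 unfolding good_def by blast
  from conjunct2[OF this[unfolded P_def], THEN bspec, OF one] show ?thesis by simp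
qed

text \<open>A complex measure is encoded by a map and an integrable weight: \<open>X1\<close> and
  \<open>w1\<close> stand for the image under \<open>X1\<close> of \<open>w1\<close> times
  \<open>P1\<close>. The two sides may live on different spaces, so that weighted laws of different
  random sums can be compared. Simple functions lead from indicators to bounded
  \<open>g\<close>.\<close>

theorem character_semigroup_determines:
  fixes X1 :: "'b \<Rightarrow> 'a" and X2 :: "'c \<Rightarrow> 'a" and w1 :: "'b \<Rightarrow> complex" and w2 :: "'c \<Rightarrow> complex"
    and g :: "'a \<Rightarrow> complex"
  assumes sp: "space M = UNIV"
    and H: "character_semigroup H" and gen: "generates H M"
    and Hm: "\<And>f. f \<in> H \<Longrightarrow> f \<in> borel_measurable M"
    and Hb: "\<And>f x. f \<in> H \<Longrightarrow> norm (f x) \<le> 1"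
    and X1: "X1 \<in> measurable P1 M" and X2: "X2 \<in> measurable P2 M"
    and w1: "integrable P1 w1" and w2: "integrable P2 w2"
    and eq: "\<And>f. f \<in> H \<Longrightarrow> (\<integral>x. f (X1 x) * w1 x \<partial>P1) = (\<integral>x. f (X2 x) * w2 x \<partial>P2)"
    and g: "g \<in> borel_measurable M" and gb: "\<And>x. norm (g x) \<le> 1"
  shows "(\<integral>x. g (X1 x) * w1 x \<partial>P1) = (\<integral>x. g (X2 x) * w2 x \<partial>P2)"
proof -
  note [measurable] = X1 X2 g
  have [measurable]: "w1 \<in> borel_measurable P1" "w2 \<in> borel_measurable P2"
    using w1 w2 by auto
  obtain F where F: "\<And>i. simple_function M (F i)" "\<And>x. x \<in> space M \<Longrightarrow> (\<lambda>i. F i x) \<longlonglongrightarrow> g x"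
    "\<And>i x. x \<in> space M \<Longrightarrow> dist (F i x) 0 \<le> 2 * dist (g x) 0"
    using borel_measurable_implies_sequence_metric[OF g, of 0] by blast
  have lim: "(\<lambda>i. F i x) \<longlonglongrightarrow> g x" and bd: "norm (F i x) \<le> 2" for i x
    using F(2)[of x] F(3)[of x i] gb[of x] by (simp_all add: sp)
  have Fm[measurable]: "F i \<in> borel_measurable M" for i
    using F(1) by (rule borel_measurable_simple_function)
  have Feq: "(\<integral>x. F i (X1 x) * w1 x \<partial>P1) = (\<integral>x. F i (X2 x) * w2 x \<partial>P2)" for i
  proof -
    have fin: "finite (range (F i))" using simple_functionD(1)[OF F(1), of i] by (simp add: sp)
    have sets: "F i -` {y} \<in> sets M" for y using simple_functionD(2)[OF F(1), of i "{y}"] by (simp add: sp)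
    have e: "F i x = (\<Sum>y\<in>range (F i). y * indicator (F i -` {y}) x)" for x
    proof -
      have "(\<Sum>y\<in>range (F i). y * indicator (F i -` {y}) x) = (\<Sum>y\<in>range (F i). if y = F i x then y else 0)"
        by (rule sum.cong) (auto simp: indicator_def)
      also have "\<dots> = F i x" using fin by (subst sum.delta) auto
      finally show ?thesis by simp
    qed
    have ew: "F i x * c = (\<Sum>y\<in>range (F i). y * (indicator (F i -` {y}) x * c))" for x c
      by (subst e) (simp only: sum_distrib_right mult.assoc)
    have i1: "integrable P1 (\<lambda>x. indicator A (X1 x) * w1 x)" if [measurable]: "A \<in> sets M" for A
      by (rule Bochner_Integration.integrable_bound[OF w1]) (auto simp: indicator_def)
    have i2: "integrable P2 (\<lambda>x. indicator A (X2 x) * w2 x)" if [measurable]: "A \<in> sets M" for A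
      by (rule Bochner_Integration.integrable_bound[OF w2]) (auto simp: indicator_def)
    have "(\<integral>x. F i (X1 x) * w1 x \<partial>P1) = (\<integral>x. (\<Sum>y\<in>range (F i). y * (indicator (F i -` {y}) (X1 x) * w1 x)) \<partial>P1)"
      unfolding ew ..
    also have "\<dots> = (\<Sum>y\<in>range (F i). y * (\<integral>x. indicator (F i -` {y}) (X1 x) * w1 x \<partial>P1))"
      by (subst Bochner_Integration.integral_sum) (use i1[OF sets] in auto)
    also have "\<dots> = (\<Sum>y\<in>range (F i). y * (\<integral>x. indicator (F i -` {y}) (X2 x) * w2 x \<partial>P2))"
    proof (rule sum.cong[OF refl])
      fix y
      have "(\<integral>x. indicator (F i -` {y}) (X1 x) * w1 x \<partial>P1) = (\<integral>x. indicator (F i -` {y}) (X2 x) * w2 x \<partial>P2)"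
        by (rule character_semigroup_determines_sets[where H=H and M=M])
          (rule sp H gen Hm Hb X1 X2 w1 w2 eq sets; assumption)+
      then show "y * (\<integral>x. indicator (F i -` {y}) (X1 x) * w1 x \<partial>P1)
          = y * (\<integral>x. indicator (F i -` {y}) (X2 x) * w2 x \<partial>P2)" by simp
    qed
    also have "\<dots> = (\<integral>x. (\<Sum>y\<in>range (F i). y * (indicator (F i -` {y}) (X2 x) * w2 x)) \<partial>P2)"
      by (subst Bochner_Integration.integral_sum) (use i2[OF sets] in auto)
    also have "\<dots> = (\<integral>x. F i (X2 x) * w2 x \<partial>P2)"
      unfolding ew ..
    finally show ?thesis .
  qed
  have l1: "(\<lambda>i. \<integral>x. F i (X1 x) * w1 x \<partial>P1) \<longlonglongrightarrow> (\<integral>x. g (X1 x) * w1 x \<partial>P1)"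
  proof (rule integral_dominated_convergence[where w="\<lambda>x. 2 * norm (w1 x)"])
    show "AE x in P1. norm (F i (X1 x) * w1 x) \<le> 2 * norm (w1 x)" for i
      using bd by (intro AE_I2) (simp add: norm_mult mult_right_mono)
    show "AE x in P1. (\<lambda>i. F i (X1 x) * w1 x) \<longlonglongrightarrow> g (X1 x) * w1 x"
      by (intro AE_I2 tendsto_mult lim tendsto_const)
  qed (use w1 in auto)
  have l2: "(\<lambda>i. \<integral>x. F i (X2 x) * w2 x \<partial>P2) \<longlonglongrightarrow> (\<integral>x. g (X2 x) * w2 x \<partial>P2)"
  proof (rule integral_dominated_convergence[where w="\<lambda>x. 2 * norm (w2 x)"])
    show "AE x in P2. norm (F i (X2 x) * w2 x) \<le> 2 * norm (w2 x)" for i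
      using bd by (intro AE_I2) (simp add: norm_mult mult_right_mono)
    show "AE x in P2. (\<lambda>i. F i (X2 x) * w2 x) \<longlonglongrightarrow> g (X2 x) * w2 x"
      by (intro AE_I2 tendsto_mult lim tendsto_const)
  qed (use w2 in auto)
  show ?thesis using LIMSEQ_unique[OF l1] l2 by (simp only: Feq)
qed

section \<open>Multiplicative functions and one-sided continuity\<close>

lemma integral_prod_PiM_nat:
  fixes f :: "nat \<Rightarrow> 'a \<Rightarrow> 'b::{real_normed_field, banach, second_countable_topology}"
  assumes \<pi>: "prob_space \<pi>" and f: "\<And>i. f i \<in> borel_measurable \<pi>" and b: "\<And>i x. norm (f i x) \<le> 1"
  shows "(\<integral>z. (\<Prod>i<n. f i (z i)) \<partial>PiM UNIV (\<lambda>_. \<pi>)) = (\<Prod>i<n. \<integral>x. f i x \<partial>\<pi>)"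
proof -
  interpret R: prob_space \<pi> by fact
  interpret PR: product_prob_space "\<lambda>_. \<pi>" "UNIV :: nat set" ..
  have d: "distr (PiM UNIV (\<lambda>_. \<pi>)) \<pi> (\<lambda>z. z i) = \<pi>" for i :: nat
    using PR.PiM_component[of i] by simp
  have comp: "(\<lambda>z. z i) \<in> measurable (PiM UNIV (\<lambda>_. \<pi>)) \<pi>" for i :: nat
    by (rule measurable_component_singleton) simp
  have int: "integrable (PiM UNIV (\<lambda>_. \<pi>)) (\<lambda>z. f i (z i))" for i :: nat
    by (rule PR.P.integrable_const_bound[where B=1])
      (use b measurable_compose[OF comp f] in auto)
  have "PR.P.indep_vars (\<lambda>_. \<pi>) (\<lambda>i z. z i) (UNIV :: nat set)"
    by (subst PR.P.indep_vars_iff_distr_eq_PiM) (use comp d in \<open>auto simp: restrict_UNIV\<close>)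
  then have "PR.P.indep_vars (\<lambda>_. borel) (\<lambda>i z. f i (z i)) (UNIV :: nat set)"
    by (rule PR.P.indep_vars_compose2) (rule f)
  then have "PR.P.indep_vars (\<lambda>_. borel) (\<lambda>i z. f i (z i)) {..<n}"
    by (rule PR.P.indep_vars_subset) simp
  from PR.P.indep_vars_lebesgue_integral[OF _ this int]
  have a: "(\<integral>z. (\<Prod>i<n. f i (z i)) \<partial>PiM UNIV (\<lambda>_. \<pi>)) = (\<Prod>i<n. \<integral>z. f i (z i) \<partial>PiM UNIV (\<lambda>_. \<pi>))" by simp
  have "(\<integral>z. f i (z i) \<partial>PiM UNIV (\<lambda>_. \<pi>)) = (\<integral>x. f i x \<partial>\<pi>)" for i :: nat
    using integral_distr[OF comp f, of i i] by (simp add: d)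
  then show ?thesis using a by simp
qed

text \<open>Dominated convergence concerns sequences; limits at a point of the real line can be
  tested on sequences in \<open>S - {u}\<close>, which covers one-sided limits as well.\<close>

lemma tendsto_integral_bounded_within:
  fixes F :: "real \<Rightarrow> 'b \<Rightarrow> 'c::{banach, second_countable_topology}"
  assumes "finite_measure P"
    and F: "\<And>t. t \<in> S \<Longrightarrow> F t \<in> borel_measurable P" and f: "f \<in> borel_measurable P"
    and bd: "\<And>t x. t \<in> S \<Longrightarrow> x \<in> space P \<Longrightarrow> norm (F t x) \<le> C"
    and lim: "\<And>x. x \<in> space P \<Longrightarrow> ((\<lambda>t. F t x) \<longlongrightarrow> f x) (at u within S)"
  shows "((\<lambda>t. \<integral>x. F t x \<partial>P) \<longlongrightarrow> (\<integral>x. f x \<partial>P)) (at u within S)"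
  unfolding tendsto_at_iff_sequentially
proof (intro allI impI)
  interpret finite_measure P by fact
  fix X :: "nat \<Rightarrow> real" assume X: "\<forall>i. X i \<in> S - {u}" "X \<longlonglongrightarrow> u"
  show "((\<lambda>t. \<integral>x. F t x \<partial>P) \<circ> X) \<longlonglongrightarrow> (\<integral>x. f x \<partial>P)"
    unfolding comp_def
  proof (rule integral_dominated_convergence[where w="\<lambda>_. C"])
    show "AE x in P. (\<lambda>i. F (X i) x) \<longlonglongrightarrow> f x"
    proof (intro AE_I2)
      fix x assume "x \<in> space P"
      from lim[OF this] X show "(\<lambda>i. F (X i) x) \<longlonglongrightarrow> f x"
        unfolding tendsto_at_iff_sequentially comp_def by blast
    qed
    show "F (X i) \<in> borel_measurable P" for i using X F by blast
    show "AE x in P. norm (F (X i) x) \<le> C" for i using X bd by (intro AE_I2) blast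
  qed (use f in simp_all)
qed

text \<open>The principal argument of \<open>w\<close> lies strictly between \<open>- pi / 2\<close>
  and \<open>pi / 2\<close>, and the factor \<open>r\<close> only shrinks it.\<close>

lemma Re_exp_Ln_pos:
  assumes "Re w > 0" "0 \<le> r" "r \<le> 1"
  shows "Re (exp (of_real r * Ln w)) > 0"
proof -
  have w: "w \<noteq> 0" using assms(1) by auto
  have "\<bar>Im (Ln w)\<bar> < pi / 2" using Re_Ln_pos_lt[OF w] assms(1) by simp
  then have "\<bar>r * Im (Ln w)\<bar> < pi / 2"
    using mult_left_le_one_le[of "\<bar>Im (Ln w)\<bar>" r] assms by (simp add: abs_mult)
  then have "cos (r * Im (Ln w)) > 0" by (intro cos_gt_zero_pi) (auto simp: abs_less_iff)
  then show ?thesis by (simp add: Re_exp)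
qed

text \<open>Near \<open>0\<close> the values have positive real part, so the principal logarithm at
  one small \<open>\<delta>\<close> defines \<open>c\<close>. The quotient \<open>k\<close> of
  \<open>h\<close> by the exponential is \<open>1\<close> at \<open>\<delta>\<close>; at successive
  halvings its square is \<open>1\<close>, and \<open>-1\<close> is excluded by the sign of the real
  part. Thus \<open>k\<close> is \<open>1\<close> at the dyadic multiples of
  \<open>\<delta>\<close>, and the limit at \<open>0\<close> reaches all other points.\<close>

lemma multiplicative_imp_exp:
  fixes h :: "real \<Rightarrow> complex"
  assumes mult: "\<And>s t. s > 0 \<Longrightarrow> t > 0 \<Longrightarrow> h (s + t) = h s * h t"
    and lim: "(h \<longlongrightarrow> 1) (at_right 0)"
  obtains c where "\<And>s. s > 0 \<Longrightarrow> h s = exp (- (of_real s * c))"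
proof -
  have "eventually (\<lambda>s. dist (h s) 1 < 1) (at_right 0)" using tendstoD[OF lim, of 1] by simp
  then obtain \<delta>0 where \<delta>0: "\<delta>0 > 0" "\<And>s. 0 < s \<Longrightarrow> s < \<delta>0 \<Longrightarrow> dist (h s) 1 < 1"
    unfolding eventually_at_right_field by auto
  \<comment> \<open>Halving makes the estimate available at the end point \<open>\<delta>\<close>
    too.\<close>
  define \<delta> where "\<delta> = \<delta>0 / 2"
  have \<delta>: "\<delta> > 0" using \<delta>0 by (simp add: \<delta>_def)
  have Reh: "Re (h s) > 0" if "0 < s" "s \<le> \<delta>" for s
  proof -
    have "dist (h s) 1 < 1" using \<delta>0 that by (simp add: \<delta>_def)
    then have "cmod (1 - h s) < 1" by (simp add: dist_norm norm_minus_commute)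
    then have "\<bar>Re (1 - h s)\<bar> < 1" using abs_Re_le_cmod[of "1 - h s"] by linarith
    then show ?thesis by simp
  qed
  define c where "c = - Ln (h \<delta>) / of_real \<delta>"
  define k where "k s = h s * exp (of_real s * c)" for s
  have h\<delta>: "h \<delta> \<noteq> 0" using Reh[OF \<delta> order_refl] by auto
  have kmult: "k (s + t) = k s * k t" if "s > 0" "t > 0" for s t
    using mult[OF that] by (simp add: k_def distrib_right exp_add)
  have k\<delta>: "k \<delta> = 1" using \<delta> h\<delta> by (simp add: k_def c_def exp_minus)
  \<comment> \<open>If \<open>k s\<close> were \<open>-1\<close>, then \<open>h s\<close> would be
    the negative of the principal power of \<open>h \<delta>\<close> with exponent
    \<open>s / \<delta> \<le> 1\<close>, and that power has positive real part.\<close>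
  have kne: "k s \<noteq> -1" if s: "0 < s" "s \<le> \<delta>" for s
  proof
    assume "k s = -1"
    then have "h s * exp (of_real s * c) * exp (- (of_real s * c)) = - exp (- (of_real s * c))"
      by (simp add: k_def)
    then have "h s = - exp (of_real (s / \<delta>) * Ln (h \<delta>))"
      by (simp add: mult.assoc c_def flip: exp_add)
    moreover have "Re (exp (of_real (s / \<delta>) * Ln (h \<delta>))) > 0"
      by (rule Re_exp_Ln_pos) (use s \<delta> Reh[OF \<delta> order_refl] in auto)
    ultimately have "Re (h s) < 0" by simp
    with Reh[OF s] show False by simp
  qed
  have ku: "k (\<delta> / 2 ^ n) = 1" for n
  proof (induction n)
    case 0 then show ?case using k\<delta> by simp
  next
    case (Suc n)
    have "k (\<delta> / 2 ^ Suc n + \<delta> / 2 ^ Suc n) = k (\<delta> / 2 ^ Suc n) * k (\<delta> / 2 ^ Suc n)"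
      by (rule kmult) (use \<delta> in auto)
    moreover have "\<delta> / 2 ^ Suc n + \<delta> / 2 ^ Suc n = \<delta> / 2 ^ n" by (simp add: field_simps)
    ultimately have "(k (\<delta> / 2 ^ Suc n))\<^sup>2 = 1" using Suc by (simp add: power2_eq_square)
    then have "k (\<delta> / 2 ^ Suc n) = 1 \<or> k (\<delta> / 2 ^ Suc n) = -1" by (simp only: power2_eq_1_iff)
    moreover have "\<delta> / 2 ^ Suc n \<le> \<delta> / 1" using \<delta> one_le_power[of "2::real" "Suc n"]
      by (intro divide_left_mono) auto
    ultimately show ?case using kne[of "\<delta> / 2 ^ Suc n"] \<delta> by auto
  qed
  have kmu: "k (real (Suc m) * (\<delta> / 2 ^ n)) = 1" for m n
  proof (induction m)
    case 0 then show ?case using ku by simp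
  next
    case (Suc m)
    define u where "u = \<delta> / 2 ^ n"
    have u: "u > 0" "k u = 1" "k (real (Suc m) * u) = 1" using \<delta> ku Suc by (simp_all add: u_def)
    have "real (Suc (Suc m)) * u = real (Suc m) * u + u" by (simp add: algebra_simps)
    then have "k (real (Suc (Suc m)) * u) = k (real (Suc m) * u) * k u"
      using kmult[of "real (Suc m) * u" u] u(1) by simp
    then show ?case unfolding u_def[symmetric] using u by simp
  qed
  have klim: "(k \<longlongrightarrow> 1) (at_right 0)"
  proof -
    have "((\<lambda>s. h s * exp (of_real s * c)) \<longlongrightarrow> 1 * exp (of_real 0 * c)) (at_right 0)"
      by (intro tendsto_intros lim)
    moreover have "k = (\<lambda>s. h s * exp (of_real s * c))" by (rule ext) (simp add: k_def)
    ultimately show ?thesis by simp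
  qed
  have k1: "k s = 1" if s: "s > 0" for s
  proof -
    \<comment> \<open>The ceiling minus one, instead of the floor, keeps the remainder
      \<open>d n\<close> strictly positive; \<open>h\<close> is controlled for positive arguments
      only.\<close>
    define m where "m n = nat (\<lceil>s * 2 ^ n / \<delta>\<rceil> - 1)" for n
    define d where "d n = s - real (m n) * (\<delta> / 2 ^ n)" for n
    have pos: "\<lceil>s * 2 ^ n / \<delta>\<rceil> \<ge> 1" for n using s \<delta> by (simp add: one_le_ceiling)
    have m: "real (m n) = of_int \<lceil>s * 2 ^ n / \<delta>\<rceil> - 1" for n
      using pos[of n] by (simp add: m_def)
    have d0: "d n > 0" and d1: "d n \<le> \<delta> / 2 ^ n" for n
    proof -
      have "real (m n) < s * 2 ^ n / \<delta>" "s * 2 ^ n / \<delta> \<le> real (m n) + 1"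
        unfolding m by linarith+
      then have "real (m n) * \<delta> < s * 2 ^ n" "s * 2 ^ n \<le> real (m n) * \<delta> + \<delta>"
        using \<delta> by (simp_all add: field_simps)
      moreover have "d n = (s * 2 ^ n - real (m n) * \<delta>) / 2 ^ n" by (simp add: d_def diff_divide_distrib)
      ultimately show "d n > 0" "d n \<le> \<delta> / 2 ^ n" by (simp_all add: divide_right_mono)
    qed
    have "(\<lambda>n. \<delta> / 2 ^ n) \<longlonglongrightarrow> 0"
      using tendsto_mult[OF tendsto_const[of \<delta>] LIMSEQ_inverse_realpow_zero[of 2]] by (simp add: divide_inverse)
    then have "d \<longlonglongrightarrow> 0"
      by (rule tendsto_sandwich[OF _ _ tendsto_const, rotated 2]) (auto intro!: always_eventually less_imp_le d0 d1)
    then have "filterlim d (at_right 0) sequentially"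
      unfolding filterlim_at by (auto intro!: always_eventually simp: d0 less_imp_neq[OF d0, symmetric])
    then have "(\<lambda>n. k (d n)) \<longlonglongrightarrow> 1" by (rule filterlim_compose[OF klim])
    moreover have "k (d n) = k s" for n
    proof (cases "m n")
      case 0 then show ?thesis by (simp add: d_def)
    next
      case (Suc j)
      have "k s = k (real (Suc j) * (\<delta> / 2 ^ n) + d n)" by (simp add: d_def Suc)
      also have "\<dots> = k (real (Suc j) * (\<delta> / 2 ^ n)) * k (d n)" by (rule kmult) (use \<delta> d0 in auto)
      finally show ?thesis using kmu[of j n] by simp
    qed
    ultimately show "k s = 1" by (simp add: LIMSEQ_const_iff)
  qed
  show thesis
  proof (rule that[of c])
    fix s :: real assume "s > 0"
    from k1[OF this] have "h s * exp (of_real s * c) * exp (- (of_real s * c)) = exp (- (of_real s * c))"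
      by (simp add: k_def)
    then show "h s = exp (- (of_real s * c))" by (simp add: mult.assoc flip: exp_add)
  qed
qed

text \<open>Convergence for a single \<open>s\<close> would determine the limit only modulo
  \<open>2 pi i / s\<close>. Averaging over \<open>s\<close> in \<open>{0..1}\<close> avoids any
  choice of logarithm: with \<open>y = z - w\<close> the averages \<open>I\<close> of
  \<open>exp (- s y)\<close> tend to \<open>1\<close>, while \<open>y I = 1 - exp (- y)\<close>
  tends to \<open>0\<close>.\<close>

lemma tendsto_of_exp_scaled:
  fixes z :: "nat \<Rightarrow> complex"
  assumes lim: "\<And>s. s > 0 \<Longrightarrow> (\<lambda>n. exp (- (of_real s * z n))) \<longlonglongrightarrow> exp (- (of_real s * w))"
  shows "z \<longlonglongrightarrow> w"
proof -
  define y where "y n = z n - w" for n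
  have y: "(\<lambda>n. exp (- (of_real s * y n))) \<longlonglongrightarrow> 1" if "s > 0" for s :: real
  proof -
    have "(\<lambda>n. exp (- (of_real s * z n)) * exp (of_real s * w)) \<longlonglongrightarrow> exp (- (of_real s * w)) * exp (of_real s * w)"
      by (intro tendsto_intros lim that)
    then show ?thesis by (simp add: y_def algebra_simps flip: exp_add)
  qed
  have y1: "(\<lambda>n. exp (- y n)) \<longlonglongrightarrow> 1" using y[of 1] by simp
  obtain K where K: "\<And>n. norm (exp (- y n)) \<le> K"
    using Bseq_conv_Bfun[of "\<lambda>n. exp (- y n)"] convergent_imp_Bseq[OF convergentI[OF y1]]
    by (auto simp: Bseq_def)
  define I where "I n = (\<integral>s. indicator {0..1} s *\<^sub>R exp (- (of_real s * y n)) \<partial>lborel)" for n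
  have "I \<longlonglongrightarrow> (\<integral>s. indicator {0..1::real} s *\<^sub>R (1::complex) \<partial>lborel)"
    unfolding I_def
  proof (rule integral_dominated_convergence[where w="\<lambda>s::real. indicator {0..1} s *\<^sub>R max 1 K"])
    show "AE s in lborel. (\<lambda>n. indicator {0..1} s *\<^sub>R exp (- (of_real s * y n))) \<longlonglongrightarrow> indicator {0..1} s *\<^sub>R (1::complex)"
    proof (intro AE_I2)
      fix s :: real
      show "(\<lambda>n. indicator {0..1} s *\<^sub>R exp (- (of_real s * y n))) \<longlonglongrightarrow> indicator {0..1} s *\<^sub>R (1::complex)"
        using y[of s] by (cases "s > 0"; cases "s = 0") (auto simp: indicator_def)
    qed
    \<comment> \<open>On \<open>{0..1}\<close> the modulus of \<open>exp (- s y)\<close> is at most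
      the larger of its values at \<open>s = 0\<close> and \<open>s = 1\<close>, and the latter is
      bounded because the sequence \<open>exp (- y n)\<close> converges.\<close>
    show "AE s in lborel. norm (indicator {0..1} s *\<^sub>R exp (- (of_real s * y n))) \<le> indicator {0..1} s *\<^sub>R max 1 K" for n
    proof (intro AE_I2)
      fix s :: real
      have "norm (exp (- (of_real s * y n))) \<le> max 1 K" if "0 \<le> s" "s \<le> 1"
      proof (cases "Re (y n) \<ge> 0")
        case True
        then have "0 \<le> s * Re (y n)" using that by simp
        then have "norm (exp (- (of_real s * y n))) \<le> 1" by simp
        then show ?thesis by linarith
      next
        case False
        then have "Re (y n) \<le> s * Re (y n)" using that mult_right_mono_neg[of s 1 "Re (y n)"] by simp
        then have "norm (exp (- (of_real s * y n))) \<le> norm (exp (- y n))" by simp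
        with K[of n] show ?thesis by linarith
      qed
      then show "norm (indicator {0..1} s *\<^sub>R exp (- (of_real s * y n))) \<le> indicator {0..1} s *\<^sub>R max 1 K"
        by (auto simp: indicator_def)
    qed
  qed auto
  then have I1: "I \<longlonglongrightarrow> 1" by simp
  have eq: "y n * I n = 1 - exp (- y n)" for n
  proof -
    have d: "((\<lambda>s. - exp (- (of_real s * y n))) has_vector_derivative y n * exp (- (of_real s * y n))) (at s within {0..1})" for s
    proof -
      have "((\<lambda>x. - exp (- (x * y n))) has_field_derivative y n * exp (- (of_real s * y n))) (at (of_real s))"
        by (auto intro!: derivative_eq_intros)
      from has_vector_derivative_real_field[OF this] show ?thesis .
    qed
    have "(\<integral>s. indicator {0..1} s *\<^sub>R (y n * exp (- (of_real s * y n))) \<partial>lborel)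
        = - exp (- (of_real 1 * y n)) - - exp (- (of_real 0 * y n))"
      by (rule integral_FTC_atLeastAtMost[OF _ d]) (auto intro!: continuous_intros)
    moreover have "(\<integral>s. indicator {0..1} s *\<^sub>R (y n * exp (- (of_real s * y n))) \<partial>lborel) = y n * I n"
      unfolding I_def by (subst integral_mult_right_zero[symmetric]) simp
    ultimately show ?thesis by simp
  qed
  have "(\<lambda>n. (1 - exp (- y n)) / I n) \<longlonglongrightarrow> (1 - 1) / 1"
    by (intro tendsto_intros y1 I1) simp
  moreover have "eventually (\<lambda>n. (1 - exp (- y n)) / I n = y n) sequentially"
  proof -
    have "eventually (\<lambda>n. I n \<noteq> 0) sequentially" using tendsto_imp_eventually_ne[OF I1] by simp
    then show ?thesis by eventually_elim (simp add: eq[symmetric])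
  qed
  ultimately have "y \<longlonglongrightarrow> 0" by (simp add: tendsto_cong)
  then have "(\<lambda>n. z n - w) \<longlonglongrightarrow> 0" by (simp add: y_def[abs_def])
  then show ?thesis by (rule LIM_zero_cancel)
qed

lemma tendsto_of_exp_scaled_within:
  fixes z :: "real \<Rightarrow> complex"
  assumes "\<And>s. s > 0 \<Longrightarrow> ((\<lambda>t. exp (- (of_real s * z t))) \<longlongrightarrow> exp (- (of_real s * w))) (at u within S)"
  shows "(z \<longlongrightarrow> w) (at u within S)"
  unfolding tendsto_at_iff_sequentially
proof (intro allI impI)
  fix X :: "nat \<Rightarrow> real" assume X: "\<forall>i. X i \<in> S - {u}" "X \<longlonglongrightarrow> u"
  show "(z \<circ> X) \<longlonglongrightarrow> w"
  proof (rule tendsto_of_exp_scaled)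
    fix s :: real assume "s > 0"
    from assms[OF this] X show "(\<lambda>n. exp (- (of_real s * (z \<circ> X) n))) \<longlonglongrightarrow> exp (- (of_real s * w))"
      unfolding tendsto_at_iff_sequentially comp_def by blast
  qed
qed

lemma exp_scaled_inject:
  fixes z w :: complex
  assumes "\<And>s. s > 0 \<Longrightarrow> exp (- (of_real s * z)) = exp (- (of_real s * w))"
  shows "z = w"
proof -
  have "(\<lambda>n::nat. z) \<longlonglongrightarrow> w" by (rule tendsto_of_exp_scaled) (simp add: assms)
  then show ?thesis by (simp add: LIMSEQ_const_iff)
qed

text \<open>The values lie in the discrete set of multiples of \<open>2 pi i\<close>, so a
  continuous function on a connected set is constant there, and the limit at \<open>0\<close>
  selects the constant. This is how the exponential is removed from an identity that was transferred
  in exponentiated form.\<close>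

lemma exp_eq_1_path_constant:
  fixes D :: "real \<Rightarrow> complex"
  assumes cont: "continuous_on {0<..} D" and lim: "(D \<longlongrightarrow> 0) (at_right 0)"
    and one: "\<And>t. t > 0 \<Longrightarrow> exp (D t) = 1" and t: "t > 0"
  shows "D t = 0"
proof -
  have 2: "\<exists>n::int. D s = of_int (2 * n) * pi * \<i>" if s: "s > 0" for s
  proof -
    obtain n :: int where "Re (D s) = 0" "Im (D s) = of_int (2 * n) * pi"
      using one[OF s] unfolding exp_eq_1 by blast
    then show ?thesis by (intro exI[of _ n]) (simp add: complex_eq_iff)
  qed
  have far: "2 * pi \<le> norm (D x - D y)" if x: "x > 0" and y: "y > 0" and ne: "D x \<noteq> D y" for x y
  proof -
    obtain m n :: int where mn: "D x = of_int (2 * m) * pi * \<i>" "D y = of_int (2 * n) * pi * \<i>"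
      using 2[OF x] 2[OF y] by blast
    then have "m \<noteq> n" using ne by auto
    then have "1 \<le> \<bar>real_of_int (m - n)\<bar>" by linarith
    moreover have "D x - D y = of_real (2 * real_of_int (m - n) * pi) * \<i>" using mn by (simp add: algebra_simps)
    then have "norm (D x - D y) = 2 * \<bar>real_of_int (m - n)\<bar> * pi"
      by (simp only: norm_mult norm_of_real norm_ii abs_mult) simp
    ultimately show ?thesis by simp
  qed
  have "D constant_on {0<..}"
  proof (rule continuous_discrete_range_constant[OF _ cont])
    show "connected ({0<..} :: real set)" by simp
    show "\<exists>e>0. \<forall>y. y \<in> {0<..} \<and> D y \<noteq> D x \<longrightarrow> e \<le> norm (D y - D x)" if "x \<in> {0<..}" for x
      using far that by (intro exI[of _ "2 * pi"]) auto
  qed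
  then obtain c where c: "\<And>t. t > 0 \<Longrightarrow> D t = c" by (auto simp: constant_on_def)
  have "((\<lambda>_. c) \<longlongrightarrow> 0) (at_right (0::real))"
    by (rule Lim_transform_eventually[OF lim]) (auto simp: eventually_at_right_field c intro!: exI[of _ 1])
  then have "c = 0" by (simp add: tendsto_const_iff)
  with c t show ?thesis by simp
qed

section \<open>Local averages of bounded functions and one-sided continuity\<close>

lemma integrable_indicator_Ioc: "integrable lborel (indicator {x<..y::real} :: real \<Rightarrow> real)"
proof (cases "x \<le> y")
  case True
  then show ?thesis by (intro integrable_real_indicator) auto
qed simp

text \<open>The positive and negative parts of \<open>v\<close>, restricted to an interval, are
  densities of finite measures that agree on all rays and so coincide. Each of them gives no mass to
  the set where the other density is positive, hence both parts vanish almost everywhere.\<close>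

lemma AE_eq_0_of_interval_integrals:
  fixes v :: "real \<Rightarrow> real"
  assumes v[measurable]: "v \<in> borel_measurable borel" and bd: "\<And>x. \<bar>v x\<bar> \<le> C"
    and zero: "\<And>x y. p < x \<Longrightarrow> x < y \<Longrightarrow> y < q \<Longrightarrow> (\<integral>r. indicator {x<..y} r * v r \<partial>lborel) = 0"
  shows "AE r in lborel. p < r \<and> r < q \<longrightarrow> v r = 0"
proof -
  define A where "A \<sigma> x y = density lborel (\<lambda>r. ennreal (max 0 (\<sigma> * v r)) * indicator {x<..y} r)" for \<sigma> x y
  have eq: "A 1 x y = A (-1) x y" if xy: "p < x" "y < q" for x y
  proof (rule measure_eqI_lessThan)
    fix z :: real
    have int: "integrable lborel (\<lambda>r. indicator {max x z<..y} r * max 0 (\<sigma> * v r))" if "\<bar>\<sigma>\<bar> = 1" for \<sigma>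
    proof (rule Bochner_Integration.integrable_bound)
      show "integrable lborel (\<lambda>r. indicator {max x z<..y} r * C)" using integrable_indicator_Ioc by simp
      have "\<bar>max 0 (\<sigma> * v r)\<bar> \<le> \<bar>C\<bar>" for r
        using bd[of r] that abs_mult[of \<sigma> "v r"] by (auto simp: max_def abs_le_iff)
      then show "AE r in lborel. norm (indicator {max x z<..y} r * max 0 (\<sigma> * v r)) \<le> norm (indicator {max x z<..y} r * C)"
        by (intro AE_I2) (simp add: abs_mult mult_left_mono)
    qed measurable
    have em: "emeasure (A \<sigma> x y) {z<..} = ennreal (\<integral>r. indicator {max x z<..y} r * max 0 (\<sigma> * v r) \<partial>lborel)"
      if "\<bar>\<sigma>\<bar> = 1" for \<sigma>
    proof -
      have "emeasure (A \<sigma> x y) {z<..} = (\<integral>\<^sup>+r. ennreal (indicator {max x z<..y} r * max 0 (\<sigma> * v r)) \<partial>lborel)"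
        unfolding A_def by (subst emeasure_density) (auto intro!: nn_integral_cong simp: indicator_def)
      also have "\<dots> = ennreal (\<integral>r. indicator {max x z<..y} r * max 0 (\<sigma> * v r) \<partial>lborel)"
        by (rule nn_integral_eq_integral[OF int[OF that]]) simp
      finally show ?thesis .
    qed
    show "emeasure (A 1 x y) {z<..} < \<infinity>" using em[of 1] by simp
    have "(\<integral>r. indicator {max x z<..y} r * max 0 (1 * v r) \<partial>lborel)
        - (\<integral>r. indicator {max x z<..y} r * max 0 (-1 * v r) \<partial>lborel)
      = (\<integral>r. indicator {max x z<..y} r * v r \<partial>lborel)"
      by (subst Bochner_Integration.integral_diff[symmetric, OF int int])
        (auto intro!: Bochner_Integration.integral_cong simp: max_def indicator_def)
    also have "\<dots> = 0"
    proof (cases "max x z < y")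
      case True then show ?thesis using zero[of "max x z" y] xy by simp
    next
      case False
      then have "indicator {max x z<..y} r = (0::real)" for r by (auto simp: indicator_def)
      then show ?thesis by (simp only: mult_zero_left Bochner_Integration.integral_zero)
    qed
    finally show "emeasure (A 1 x y) {z<..} = emeasure (A (-1) x y) {z<..}"
      using em[of 1] em[of "-1"] by simp
  qed (simp_all add: A_def)
  have ae: "AE r in lborel. r \<in> {x<..y} \<longrightarrow> v r = 0" if "p < x" "y < q" for x y
  proof -
    have ne: "AE r in lborel. \<not> (r \<in> {x<..y} \<and> \<sigma> * v r > 0)" if s: "\<sigma> = 1 \<or> \<sigma> = -1" for \<sigma>
    proof -
      let ?B = "{r \<in> {x<..y}. \<sigma> * v r > 0}"
      have [measurable]: "?B \<in> sets borel" by measurable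
      have "ennreal (max 0 (-\<sigma> * v r)) * indicator {x<..y} r * indicator ?B r = 0" for r
        by (auto simp: indicator_def max_def)
      then have "emeasure (A (-\<sigma>) x y) ?B = 0"
        unfolding A_def by (subst emeasure_density) (simp_all only: nn_integral_0_iff_AE, simp_all)
      moreover have "A \<sigma> x y = A (-\<sigma>) x y" using s eq[OF \<open>p < x\<close> \<open>y < q\<close>] by auto
      ultimately have "emeasure (A \<sigma> x y) ?B = 0" by simp
      then have "(\<integral>\<^sup>+r. ennreal (max 0 (\<sigma> * v r)) * indicator {x<..y} r * indicator ?B r \<partial>lborel) = 0"
        unfolding A_def by (subst (asm) emeasure_density) auto
      then have "AE r in lborel. ennreal (max 0 (\<sigma> * v r)) * indicator {x<..y} r * indicator ?B r = 0"
        by (subst (asm) nn_integral_0_iff_AE) auto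
      then show ?thesis
        by eventually_elim (auto simp: indicator_def max_def ennreal_eq_0_iff split: if_splits)
    qed
    have "AE r in lborel. \<not> (r \<in> {x<..y} \<and> 1 * v r > 0) \<and> \<not> (r \<in> {x<..y} \<and> (-1) * v r > 0)"
      by (rule AE_conjI) (rule ne, simp)+
    then show ?thesis by (rule AE_mp) (intro AE_I2, auto)
  qed
  \<comment> \<open>The integrals are known to vanish only for intervals whose end points lie
    strictly inside, so the open interval is exhausted from within.\<close>
  have "AE r in lborel. \<forall>n::nat. r \<in> {p + 1 / Suc n<..q - 1 / Suc n} \<longrightarrow> v r = 0"
    unfolding AE_all_countable by (intro allI ae) auto
  then show ?thesis
  proof (rule AE_mp, intro AE_I2 impI)
    fix r assume *: "\<forall>n::nat. r \<in> {p + 1 / Suc n<..q - 1 / Suc n} \<longrightarrow> v r = 0" and r: "p < r \<and> r < q"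
    obtain n where n: "1 / Suc n < min (r - p) (q - r)"
      using nat_approx_posE[of "min (r - p) (q - r)"] r by auto
    then have "r \<in> {p + 1 / Suc n<..q - 1 / Suc n}" by (auto simp: min_less_iff_conj)
    with * show "v r = 0" by blast
  qed
qed

text \<open>After the substitution \<open>r = t s\<close> the scale appears only in the end points
  of the interval of integration, and the primitive \<open>W\<close> of a bounded function is
  Lipschitz. Averaging thus provides the continuity that \<open>v\<close> itself lacks.\<close>

lemma scaled_interval_integral_continuous:
  fixes v :: "real \<Rightarrow> real"
  assumes v[measurable]: "v \<in> borel_measurable borel" and bd: "\<And>x. \<bar>v x\<bar> \<le> C"
    and ab: "0 < a" "a < b" and t0: "t0 > 0"
  shows "isCont (\<lambda>t. \<integral>s. indicator {a<..b} s * v (t * s) \<partial>lborel) t0"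
    and "(\<integral>s. indicator {a<..b} s * v (t0 * s) \<partial>lborel) * t0 = (\<integral>r. indicator {t0 * a<..t0 * b} r * v r \<partial>lborel)"
proof -
  have C0: "C \<ge> 0" using bd[of 0] by linarith
  have int: "integrable lborel (\<lambda>r. indicator {x<..y} r * v r)" for x y
  proof (rule Bochner_Integration.integrable_bound)
    show "integrable lborel (\<lambda>r. indicator {x<..y} r * C)" using integrable_indicator_Ioc by simp
    show "AE r in lborel. norm (indicator {x<..y} r * v r) \<le> norm (indicator {x<..y} r * C)"
      using order_trans[OF bd abs_ge_self] by (intro AE_I2) (simp add: abs_mult mult_left_mono)
  qed measurable
  define W where "W y = (\<integral>r. indicator {0<..y} r * v r \<partial>lborel)" for y
  have Wd: "W y - W x = (\<integral>r. indicator {x<..y} r * v r \<partial>lborel)" if "0 \<le> x" "x \<le> y" for x y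
    unfolding W_def using that
    by (subst Bochner_Integration.integral_diff[symmetric, OF int int])
      (auto intro!: Bochner_Integration.integral_cong simp: indicator_def)
  have Wl: "\<bar>W y - W x\<bar> \<le> C * (y - x)" if "0 \<le> x" "x \<le> y" for x y
  proof -
    have "\<bar>\<integral>r. indicator {x<..y} r * v r \<partial>lborel\<bar> \<le> (\<integral>r. indicator {x<..y} r * C \<partial>lborel)"
      by (rule integral_abs_bound_integral[OF int])
        (use bd C0 integrable_indicator_Ioc[of x y] in \<open>simp_all add: abs_mult mult_left_mono\<close>)
    also have "\<dots> = C * (y - x)" using that by simp
    finally show ?thesis using Wd[OF that] by simp
  qed
  have Wc: "isCont W x" if "x > 0" for x
  proof -
    have "((\<lambda>y. W y - W x) \<longlongrightarrow> 0) (at x)"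
    proof (rule Lim_null_comparison)
      have "eventually (\<lambda>y. y > 0) (at x)" by (rule order_tendstoD(1)[OF tendsto_ident_at that])
      then show "\<forall>\<^sub>F y in at x. norm (W y - W x) \<le> C * \<bar>y - x\<bar>"
      proof eventually_elim
        case (elim y)
        then show ?case using Wl[of x y] Wl[of y x] that by (cases "x \<le> y") (auto simp: abs_minus_commute)
      qed
      show "((\<lambda>y. C * \<bar>y - x\<bar>) \<longlongrightarrow> 0) (at x)"
        by (auto intro!: tendsto_eq_intros)
    qed
    then show ?thesis unfolding isCont_def by (simp add: LIM_zero_iff)
  qed
  have eq: "(\<integral>s. indicator {a<..b} s * v (t * s) \<partial>lborel) * t = (\<integral>r. indicator {t * a<..t * b} r * v r \<partial>lborel)"
    if t: "t > 0" for t
  proof -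
    have "(\<integral>r. indicator {t * a<..t * b} r * v r \<partial>lborel)
      = \<bar>t\<bar> *\<^sub>R (\<integral>s. indicator {t * a<..t * b} (0 + t * s) * v (0 + t * s) \<partial>lborel)"
      by (rule lborel_integral_real_affine) (use t in simp)
    also have "(\<integral>s. indicator {t * a<..t * b} (0 + t * s) * v (0 + t * s) \<partial>lborel)
      = (\<integral>s. indicator {a<..b} s * v (t * s) \<partial>lborel)"
      by (rule Bochner_Integration.integral_cong) (use t in \<open>auto simp: indicator_def\<close>)
    finally show ?thesis using t by simp
  qed
  show "(\<integral>s. indicator {a<..b} s * v (t0 * s) \<partial>lborel) * t0 = (\<integral>r. indicator {t0 * a<..t0 * b} r * v r \<partial>lborel)"
    by (rule eq[OF t0])
  have "isCont (\<lambda>t. (W (t * b) - W (t * a)) / t) t0"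
  proof -
    have "isCont (\<lambda>t. W (t * b)) t0"
      by (rule isCont_o2[where f="\<lambda>t. t * b"]) (use ab t0 in \<open>auto intro!: Wc continuous_intros\<close>)
    moreover have "isCont (\<lambda>t. W (t * a)) t0"
      by (rule isCont_o2[where f="\<lambda>t. t * a"]) (use ab t0 in \<open>auto intro!: Wc continuous_intros\<close>)
    ultimately show ?thesis using t0 by (intro continuous_intros) auto
  qed
  moreover have "eventually (\<lambda>t. (W (t * b) - W (t * a)) / t = (\<integral>s. indicator {a<..b} s * v (t * s) \<partial>lborel)) (nhds t0)"
  proof -
    have "eventually (\<lambda>t. t > 0) (nhds t0)" using t0 by (rule order_tendstoD(1)[OF filterlim_ident])
    then show ?thesis
    proof eventually_elim
      case (elim t)
      have "W (t * b) - W (t * a) = (\<integral>s. indicator {a<..b} s * v (t * s) \<partial>lborel) * t"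
        using Wd[of "t * a" "t * b"] eq[OF elim] elim ab by simp
      then show ?case using elim by simp
    qed
  qed
  ultimately show "isCont (\<lambda>t. \<integral>s. indicator {a<..b} s * v (t * s) \<partial>lborel) t0"
    by (subst (asm) isCont_cong) auto
qed

text \<open>The average \<open>V t = \<integral> v (t s) ds\<close> over an interval is continuous in \<open>t\<close>, and \<open>v V\<close> is
  one-sided continuous; dividing by \<open>V\<close> is possible for some interval unless \<open>v = 0\<close>
  almost everywhere near \<open>t0\<close>.\<close>

lemma one_sided_continuous_of_products:
  fixes v :: "real \<Rightarrow> real"
  assumes v[measurable]: "v \<in> borel_measurable borel" and bd: "\<And>x. \<bar>v x\<bar> \<le> C" and t0: "t0 > 0"
    and T: "T = {t0<..} \<or> T = {0<..<t0}"
    and prod: "\<And>s. s > 0 \<Longrightarrow> ((\<lambda>t. v t * v (t * s)) \<longlongrightarrow> v t0 * v (t0 * s)) (at t0 within T)"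
  shows "(v \<longlongrightarrow> v t0) (at t0 within T)"
proof (cases "v t0 = 0")
  case True
  have "((\<lambda>t. sqrt (v t * v t)) \<longlongrightarrow> sqrt 0) (at t0 within T)"
    using prod[of 1] True by (intro tendsto_intros) simp
  then have "((\<lambda>t. \<bar>v t\<bar>) \<longlongrightarrow> 0) (at t0 within T)" by simp
  then show ?thesis using True by (simp add: tendsto_rabs_zero_iff)
next
  case False
  define V where "V a b t = (\<integral>s. indicator {a<..b} s * v (t * s) \<partial>lborel)" for a b t
  \<comment> \<open>If all averages at \<open>t0\<close> vanished, \<open>v\<close> would be zero
    almost everywhere; but \<open>v t * v t\<close> tends to \<open>v t0 * v t0 > 0\<close>, so
    \<open>v\<close> has no zero on some interval next to \<open>t0\<close>.\<close>
  have "\<exists>a b. 0 < a \<and> a < b \<and> V a b t0 \<noteq> 0"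
  proof (rule ccontr)
    assume "\<not> ?thesis"
    then have V0: "V a b t0 = 0" if "0 < a" "a < b" for a b using that by blast
    have zero: "(\<integral>r. indicator {x<..y} r * v r \<partial>lborel) = 0" if "0 < x" "x < y" for x y
    proof -
      have "V (x / t0) (y / t0) t0 * t0 = (\<integral>r. indicator {t0 * (x / t0)<..t0 * (y / t0)} r * v r \<partial>lborel)"
        unfolding V_def by (rule scaled_interval_integral_continuous(2)[OF v bd])
          (use that t0 in \<open>auto simp: divide_strict_right_mono\<close>)
      then show ?thesis using V0[of "x / t0" "y / t0"] that t0 by (simp add: divide_strict_right_mono)
    qed
    have "((\<lambda>t. v t * v t) \<longlongrightarrow> v t0 * v t0) (at t0 within T)" using prod[of 1] by simp
    then have "eventually (\<lambda>t. v t * v t > 0) (at t0 within T)"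
      by (rule order_tendstoD(1)) (use False in \<open>auto simp: zero_less_mult_iff\<close>)
    then have "\<exists>p q. 0 < p \<and> p < q \<and> (\<forall>t. p < t \<and> t < q \<longrightarrow> v t \<noteq> 0)"
      using T
    proof (elim disjE)
      assume T: "T = {t0<..}" and "eventually (\<lambda>t. v t * v t > 0) (at t0 within T)"
      then obtain b where "b > t0" "\<forall>y>t0. y < b \<longrightarrow> v y * v y > 0" unfolding T eventually_at_right_field by blast
      then show ?thesis using t0 by (intro exI[of _ t0] exI[of _ b]) force
    next
      assume "T = {0<..<t0}" and ev: "eventually (\<lambda>t. v t * v t > 0) (at t0 within T)"
      moreover have "at t0 within {0<..<t0} = at_left t0"
        by (rule at_within_nhd[of _ "{0<..}"]) (use t0 in auto)
      ultimately have T: "at t0 within T = at_left t0" by simp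
      from ev obtain b where "b < t0" "\<forall>y>b. y < t0 \<longrightarrow> v y * v y > 0" unfolding T eventually_at_left_field by blast
      \<comment> \<open>\<open>b\<close> may be negative; the maximum with \<open>t0 / 2\<close>
        keeps the interval in the positive half-line, where the averages are controlled.\<close>
      then show ?thesis using t0 by (intro exI[of _ "max b (t0/2)"] exI[of _ t0]) force
    qed
    then obtain p q where pq: "0 < p" "p < q" "\<And>t. p < t \<Longrightarrow> t < q \<Longrightarrow> v t \<noteq> 0" by blast
    have "AE r in lborel. p < r \<and> r < q \<longrightarrow> v r = 0"
      by (rule AE_eq_0_of_interval_integrals[OF v bd]) (use zero pq in auto)
    then have "AE r in lborel. r \<notin> {p<..<q}" by eventually_elim (use pq in auto)
    then have "emeasure lborel {p<..<q} = 0" 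
      by (rule AE_iff_measurable[THEN iffD1, rotated 2]) auto
    then show False using pq by simp
  qed
  then obtain a b where ab: "0 < a" "a < b" and V0: "V a b t0 \<noteq> 0" by blast
  have Vc: "(V a b \<longlongrightarrow> V a b t0) (at t0 within T)"
    using scaled_interval_integral_continuous(1)[OF v bd ab t0]
    unfolding isCont_def V_def[symmetric] by (rule tendsto_within_subset) simp
  \<comment> \<open>The hypothesis on products, integrated over \<open>s\<close>: the factor
    \<open>v t\<close> comes out of the integral and leaves \<open>v t * V a b t\<close>.\<close>
  have "((\<lambda>t. \<integral>s. v t * v (t * s) \<partial>restrict_space lborel {a<..b}) \<longlongrightarrow> (\<integral>s. v t0 * v (t0 * s) \<partial>restrict_space lborel {a<..b})) (at t0 within T)"
  proof (rule tendsto_integral_bounded_within)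
    show "finite_measure (restrict_space lborel {a<..b})"
      by (rule finite_measureI) (use ab in \<open>simp add: emeasure_restrict_space space_restrict_space\<close>)
    show "norm (v t * v (t * s)) \<le> C * C" for t s
      using mult_mono[OF bd[of t] bd[of "t * s"]] bd[of 0] by (simp add: abs_mult)
    show "((\<lambda>t. v t * v (t * s)) \<longlongrightarrow> v t0 * v (t0 * s)) (at t0 within T)"
      if "s \<in> space (restrict_space lborel {a<..b})" for s
      using prod[of s] that ab by (simp add: space_restrict_space)
  qed (auto intro!: measurable_restrict_space1)
  moreover have "(\<integral>s. v t * v (t * s) \<partial>restrict_space lborel {a<..b}) = v t * V a b t" for t
    unfolding V_def by (subst integral_restrict_space) (auto simp: mult.left_commute intro!: Bochner_Integration.integral_cong)
  ultimately have "((\<lambda>t. v t * V a b t) \<longlongrightarrow> v t0 * V a b t0) (at t0 within T)" by (simp only:)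
  from tendsto_divide[OF this Vc V0]
  have "((\<lambda>t. v t * V a b t / V a b t) \<longlongrightarrow> v t0) (at t0 within T)" using V0 by simp
  moreover have "eventually (\<lambda>t. v t * V a b t / V a b t = v t) (at t0 within T)"
    using tendsto_imp_eventually_ne[OF Vc V0] by eventually_elim simp
  ultimately show ?thesis by (rule Lim_transform_eventually)
qed

section \<open>Strictly stable laws on a cone\<close>

context convex_cone
begin

lemma scl_measurable_pair: "(\<lambda>p. scl (snd p) (fst p)) \<in> measurable (M \<Otimes>\<^sub>M restrict_space borel {0<..}) M"
  using scale_measurable by (simp add: case_prod_beta')

lemma measurable_scl:
  assumes "f \<in> measurable N M" "g \<in> borel_measurable N" "\<And>x. x \<in> space N \<Longrightarrow> g x > 0"
  shows "(\<lambda>x. scl (g x) (f x)) \<in> measurable N M"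
proof -
  have "(\<lambda>x. (f x, g x)) \<in> measurable N (M \<Otimes>\<^sub>M restrict_space borel {0<..})"
    by (rule measurable_Pair) (use assms in \<open>auto intro!: measurable_restrict_space2\<close>)
  from measurable_compose[OF this scl_measurable_pair] show ?thesis by simp
qed

lemma measurable_scl_const: "t > 0 \<Longrightarrow> scl t \<in> measurable M M"
  using measurable_scl[of "\<lambda>x. x" M "\<lambda>_. t"] by simp

end

section \<open>Transforms and exponents of a strictly stable law\<close>

locale stable_cone = convex_cone_involution M add e scl star + prob_space \<mu>
  for M :: "'a measure" and add e scl star and \<mu> :: "'a measure" +
  fixes \<alpha> :: real and side :: "real \<Rightarrow> real set"
  assumes sets_mu: "sets \<mu> = sets M" and alpha_pos: "\<alpha> > 0"
    and stable: "strictly_stable M add scl \<alpha> \<mu>"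
    and side: "side = (\<lambda>t. {t<..}) \<or> side = (\<lambda>t. {0<..<t})"
begin

text \<open>These properties pass to products, conjugates and scaled characters. The set \<open>side t\<close> is the one
  from which \<open>t\<close> is approached in the assumption of one-sided continuity.\<close>

definition regular :: "('a \<Rightarrow> complex) \<Rightarrow> bool" where
  "regular \<psi> \<longleftrightarrow> is_character M add e star \<psi> \<and>
    (\<forall>x. \<forall>t>0. ((\<lambda>u. \<psi> (scl u x)) \<longlongrightarrow> \<psi> (scl t x)) (at t within side t)) \<and>
    (\<forall>x. ((\<lambda>t. Im (\<psi> (scl t x))) \<longlongrightarrow> 0) (at_right 0)) \<and>
    (\<forall>x. \<exists>c>0. eventually (\<lambda>t. c \<le> Re (\<psi> (scl t x))) (at_right 0))"

definition hat :: "('a \<Rightarrow> complex) \<Rightarrow> real \<Rightarrow> complex" where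
  "hat \<psi> t = (\<integral>x. \<psi> (scl t x) \<partial>\<mu>)"

lemma measurable_mu: "measurable \<mu> N = measurable M N"
  by (rule measurable_cong_sets) (auto simp: sets_mu)

lemma regularD:
  assumes "regular \<psi>"
  shows "\<psi> \<in> borel_measurable M" "norm (\<psi> x) \<le> 1" "\<psi> e = 1" "\<psi> (add x y) = \<psi> x * \<psi> y"
    "\<psi> (star x) = cnj (\<psi> x)"
    "t > 0 \<Longrightarrow> ((\<lambda>u. \<psi> (scl u x)) \<longlongrightarrow> \<psi> (scl t x)) (at t within side t)"
    "((\<lambda>t. Im (\<psi> (scl t x))) \<longlongrightarrow> 0) (at_right 0)"
    "\<exists>c>0. eventually (\<lambda>t. c \<le> Re (\<psi> (scl t x))) (at_right 0)"
  using assms unfolding regular_def is_character_def by blast+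

lemma regular_measurable_scl:
  assumes "regular \<psi>" "t > 0"
  shows "(\<lambda>x. \<psi> (scl t x)) \<in> borel_measurable \<mu>"
  unfolding measurable_mu by (rule measurable_compose[OF measurable_scl_const[OF assms(2)] regularD(1)[OF assms(1)]])

lemma regular_one: "regular (\<lambda>x. 1)"
  unfolding regular_def is_character_def by (auto intro!: exI[of _ 1])

lemma regular_cnj:
  assumes "regular \<psi>" shows "regular (\<lambda>x. cnj (\<psi> x))"
proof -
  have "(\<lambda>x. cnj (\<psi> x)) \<in> borel_measurable M"
    by (rule measurable_compose[OF regularD(1)[OF assms] borel_measurable_continuous_onI])
      (intro continuous_intros)
  moreover have "((\<lambda>u. cnj (\<psi> (scl u x))) \<longlongrightarrow> cnj (\<psi> (scl t x))) (at t within side t)" if "t > 0" for t x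
    by (rule tendsto_cnj[OF regularD(6)[OF assms that]])
  moreover have "((\<lambda>t. - Im (\<psi> (scl t x))) \<longlongrightarrow> 0) (at_right 0)" for x
    using tendsto_minus[OF regularD(7)[OF assms, of x]] by simp
  ultimately show ?thesis
    using regularD(2-5,8)[OF assms] unfolding regular_def is_character_def by simp
qed

text \<open>Positive lower bounds on real parts alone do not pass to products. The clause of
  \<open>regular\<close> on imaginary parts makes \<open>Im f * Im g\<close> negligible near
  \<open>0\<close> against the product of the two lower bounds.\<close>

lemma regular_mult:
  assumes f: "regular f" and g: "regular g" shows "regular (\<lambda>x. f x * g x)"
proof -
  have "(\<lambda>x. f x * g x) \<in> borel_measurable M"
    using regularD(1)[OF f] regularD(1)[OF g] by measurable
  moreover have "norm (f x * g x) \<le> 1" for x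
    using mult_mono[OF regularD(2)[OF f] regularD(2)[OF g], of x x] by (simp add: norm_mult)
  moreover have "((\<lambda>u. f (scl u x) * g (scl u x)) \<longlongrightarrow> f (scl t x) * g (scl t x)) (at t within side t)" if "t > 0" for t x
    by (rule tendsto_mult[OF regularD(6)[OF f that] regularD(6)[OF g that]])
  moreover have "((\<lambda>t. Im (f (scl t x) * g (scl t x))) \<longlongrightarrow> 0) (at_right 0)" for x
  proof (rule Lim_null_comparison)
    have "\<bar>Im (f (scl t x) * g (scl t x))\<bar> \<le> \<bar>Im (f (scl t x))\<bar> + \<bar>Im (g (scl t x))\<bar>" for t
    proof -
      have "\<bar>Re (f (scl t x))\<bar> \<le> 1" "\<bar>Re (g (scl t x))\<bar> \<le> 1"
        using abs_Re_le_cmod order_trans regularD(2)[OF f] regularD(2)[OF g] by blast+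
      then have "\<bar>Re (f (scl t x)) * Im (g (scl t x))\<bar> \<le> \<bar>Im (g (scl t x))\<bar>"
        "\<bar>Im (f (scl t x)) * Re (g (scl t x))\<bar> \<le> \<bar>Im (f (scl t x))\<bar>"
        by (simp_all add: abs_mult mult_left_le_one_le mult_right_le_one_le)
      then show ?thesis unfolding times_complex.sel by linarith
    qed
    then show "\<forall>\<^sub>F t in at_right 0. norm (Im (f (scl t x) * g (scl t x))) \<le> \<bar>Im (f (scl t x))\<bar> + \<bar>Im (g (scl t x))\<bar>"
      by (intro always_eventually allI) (simp only: real_norm_def)
    show "((\<lambda>t. \<bar>Im (f (scl t x))\<bar> + \<bar>Im (g (scl t x))\<bar>) \<longlongrightarrow> 0) (at_right 0)"
      using tendsto_add[OF tendsto_rabs[OF regularD(7)[OF f]] tendsto_rabs[OF regularD(7)[OF g]], of x x] by simp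
  qed
  moreover have "\<exists>c>0. eventually (\<lambda>t. c \<le> Re (f (scl t x) * g (scl t x))) (at_right 0)" for x
  proof -
    obtain a where a: "a > 0" "eventually (\<lambda>t. a \<le> Re (f (scl t x))) (at_right 0)" using regularD(8)[OF f] by blast
    obtain b where b: "b > 0" "eventually (\<lambda>t. b \<le> Re (g (scl t x))) (at_right 0)" using regularD(8)[OF g] by blast
    have "((\<lambda>t. Im (f (scl t x)) * Im (g (scl t x))) \<longlongrightarrow> 0 * 0) (at_right 0)"
      by (rule tendsto_mult[OF regularD(7)[OF f] regularD(7)[OF g]])
    then have "eventually (\<lambda>t. Im (f (scl t x)) * Im (g (scl t x)) < a * b / 2) (at_right 0)"
      by (rule order_tendstoD(2)) (use a b in simp)
    with a(2) b(2) have "eventually (\<lambda>t. a * b / 2 \<le> Re (f (scl t x) * g (scl t x))) (at_right 0)"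
    proof eventually_elim
      case (elim t)
      then have "a * b \<le> Re (f (scl t x)) * Re (g (scl t x))" using a b by (intro mult_mono) auto
      then show ?case unfolding times_complex.sel using elim by (simp add: field_simps)
    qed
    then show ?thesis using a b by (intro exI[of _ "a * b / 2"]) simp
  qed
  ultimately show ?thesis
    using regularD(3-5)[OF f] regularD(3-5)[OF g] unfolding regular_def is_character_def by (simp add: mult_ac)
qed

lemma filterlim_mult_at_right_0: "c > 0 \<Longrightarrow> filterlim (\<lambda>t::real. t * c) (at_right 0) (at_right 0)"
  unfolding filterlim_at
  by (auto intro!: tendsto_eq_intros simp: eventually_at_right_field intro: exI[of _ 1])

text \<open>The semigroup of given characters may not be closed under scaling, but this class is. It
  is the reason for working with \<open>regular\<close>, since homogeneity compares a character with
  its scaled versions.\<close>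

lemma regular_scale:
  assumes f: "regular f" and s: "s > 0" shows "regular (\<lambda>x. f (scl s x))"
proof -
  have "(\<lambda>x. f (scl s x)) \<in> borel_measurable M"
    by (rule measurable_compose[OF measurable_scl_const[OF s] regularD(1)[OF f]])
  moreover have "((\<lambda>u. f (scl s (scl u x))) \<longlongrightarrow> f (scl s (scl t x))) (at t within side t)" if t: "t > 0" for t x
  proof -
    have "((\<lambda>u. f (scl u (scl s x))) \<longlongrightarrow> f (scl t (scl s x))) (at t within side t)"
      by (rule regularD(6)[OF f t])
    moreover have "f (scl s (scl t x)) = f (scl t (scl s x))" using s t by (simp add: scale_scale mult.commute)
    moreover have "eventually (\<lambda>u. f (scl u (scl s x)) = f (scl s (scl u x))) (at t within side t)"
      using order_tendstoD(1)[OF tendsto_ident_at t]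
      by eventually_elim (use s in \<open>simp add: scale_scale mult.commute\<close>)
    ultimately show ?thesis by (simp add: Lim_transform_eventually)
  qed
  moreover have ev: "eventually (\<lambda>u. scl u (scl s x) = scl s (scl u x)) (at_right 0)" for x
    by (rule eventually_mono[OF eventually_at_right_less[of 0]]) (use s in \<open>simp add: scale_scale mult.commute\<close>)
  have "((\<lambda>t. Im (f (scl s (scl t x)))) \<longlongrightarrow> 0) (at_right 0)" for x
    by (rule Lim_transform_eventually[OF regularD(7)[OF f, of "scl s x"]])
      (rule eventually_mono[OF ev[of x]], simp)
  moreover have "\<exists>c>0. eventually (\<lambda>t. c \<le> Re (f (scl s (scl t x)))) (at_right 0)" for x
  proof -
    obtain c where c: "c > 0" "eventually (\<lambda>t. c \<le> Re (f (scl t (scl s x)))) (at_right 0)" using regularD(8)[OF f] by blast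
    have "eventually (\<lambda>t. c \<le> Re (f (scl s (scl t x)))) (at_right 0)"
      using c(2) ev[of x] by eventually_elim simp
    with c(1) show ?thesis by blast
  qed
  moreover have "f (scl s (star x)) = cnj (f (scl s x))" for x
    using star_scale[OF s, of x] regularD(5)[OF f, of "scl s x"] by simp
  ultimately show ?thesis
    using regularD(2-4)[OF f] s unfolding regular_def is_character_def
    by (simp add: scale_add scale_neutral)
qed

lemma norm_hat_le: "regular \<psi> \<Longrightarrow> t > 0 \<Longrightarrow> integrable \<mu> (\<lambda>x. \<psi> (scl t x))"
  by (rule integrable_const_bound[where B=1]) (auto intro: regularD(2) regular_measurable_scl)

text \<open>A character turns the sum of independent copies into a product. In the parameter
  \<open>t powr \<alpha>\<close> the transform becomes multiplicative, as
  \<open>multiplicative_imp_exp\<close> requires.\<close>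

lemma hat_add:
  assumes \<psi>: "regular \<psi>" and st: "s > 0" "t > 0"
  shows "hat \<psi> ((s + t) powr (1 / \<alpha>)) = hat \<psi> (s powr (1 / \<alpha>)) * hat \<psi> (t powr (1 / \<alpha>))"
proof -
  interpret pair_prob_space \<mu> \<mu> ..
  define a where "a = s powr (1 / \<alpha>)" define b where "b = t powr (1 / \<alpha>)"
  define c where "c = (s + t) powr (1 / \<alpha>)"
  have pos: "a > 0" "b > 0" "c > 0" using st by (simp_all add: a_def b_def c_def)
  note [measurable] = regularD(1)[OF \<psi>] regular_measurable_scl[OF \<psi>]
  have m: "(\<lambda>(x, y). add (scl a x) (scl b y)) \<in> measurable (\<mu> \<Otimes>\<^sub>M \<mu>) M"
  proof -
    have sm: "scl a \<in> measurable \<mu> M" "scl b \<in> measurable \<mu> M"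
      unfolding measurable_mu using measurable_scl_const pos by auto
    have "(\<lambda>p. (scl a (fst p), scl b (snd p))) \<in> measurable (\<mu> \<Otimes>\<^sub>M \<mu>) (M \<Otimes>\<^sub>M M)"
      by (intro measurable_Pair measurable_compose[OF measurable_fst sm(1)] measurable_compose[OF measurable_snd sm(2)])
    from measurable_compose[OF this add_measurable] show ?thesis by (simp add: case_prod_beta')
  qed
  have "hat \<psi> c = (\<integral>x. \<psi> x \<partial>distr \<mu> M (scl c))"
    unfolding hat_def by (rule integral_distr[symmetric])
      (use measurable_scl_const pos regularD(1)[OF \<psi>] in \<open>auto simp: measurable_mu\<close>)
  also have "distr \<mu> M (scl c) = distr (\<mu> \<Otimes>\<^sub>M \<mu>) M (\<lambda>(x, y). add (scl a x) (scl b y))"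
    using stable st unfolding strictly_stable_def a_def b_def c_def by simp
  also have "(\<integral>x. \<psi> x \<partial>\<dots>) = (\<integral>p. \<psi> ((\<lambda>(x, y). add (scl a x) (scl b y)) p) \<partial>(\<mu> \<Otimes>\<^sub>M \<mu>))"
    by (rule integral_distr[OF m regularD(1)[OF \<psi>]])
  also have "\<dots> = (\<integral>p. \<psi> (scl a (fst p)) * \<psi> (scl b (snd p)) \<partial>(\<mu> \<Otimes>\<^sub>M \<mu>))"
    by (simp add: case_prod_beta' regularD(4)[OF \<psi>])
  also have "\<dots> = (\<integral>x. (\<integral>y. \<psi> (scl a x) * \<psi> (scl b y) \<partial>\<mu>) \<partial>\<mu>)"
  proof (subst integral_fst'[symmetric])
    show "integrable (\<mu> \<Otimes>\<^sub>M \<mu>) (\<lambda>p. \<psi> (scl a (fst p)) * \<psi> (scl b (snd p)))"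
    proof (rule P.integrable_const_bound[where B=1])
      show "AE p in \<mu> \<Otimes>\<^sub>M \<mu>. norm (\<psi> (scl a (fst p)) * \<psi> (scl b (snd p))) \<le> 1"
        using mult_mono[OF regularD(2)[OF \<psi>] regularD(2)[OF \<psi>]] by (intro AE_I2) (simp add: norm_mult)
    qed (use pos in measurable)
  qed simp
  also have "\<dots> = hat \<psi> a * hat \<psi> b" unfolding hat_def by simp
  finally show ?thesis by (simp add: a_def b_def c_def)
qed

lemma filterlim_powr_at_right_0: "p > 0 \<Longrightarrow> filterlim (\<lambda>s::real. s powr p) (at_right 0) (at_right 0)"
proof -
  assume p: "p > 0"
  have "((\<lambda>s::real. s powr p) \<longlongrightarrow> 0) (at_right 0)"
  proof -
    have "((\<lambda>s::real. s powr p) \<longlongrightarrow> 0 powr p) (at_right 0)"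
      by (rule tendsto_powr'[OF tendsto_ident_at tendsto_const])
        (use p in \<open>auto simp: eventually_at_right_field intro: exI[of _ 1]\<close>)
    then show ?thesis by simp
  qed
  then show ?thesis unfolding filterlim_at
    by (auto simp: eventually_at_right_field intro: exI[of _ 1])
qed

text \<open>If \<open>hat \<psi>\<close> vanished somewhere, it would vanish along a sequence of scales decreasing to
  \<open>0\<close>, against Fatou's lemma for \<open>1 + Re \<psi>\<close>.\<close>

lemma hat_nonzero:
  assumes \<psi>: "regular \<psi>" and t: "t > 0"
  shows "hat \<psi> t \<noteq> 0"
proof
  assume 0: "hat \<psi> t = 0"
  \<comment> \<open>Halving takes place in the parameter \<open>t powr \<alpha>\<close>: by
    \<open>hat_add\<close> the value belonging to \<open>u n\<close> is the square of the one
    belonging to \<open>u (Suc n)\<close>, so a zero is inherited by all these smaller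
    scales.\<close>
  define u where "u n = t powr \<alpha> / 2 ^ n" for n :: nat
  have u: "u n > 0" for n using t by (simp add: u_def)
  have hu: "hat \<psi> (u n powr (1 / \<alpha>)) = 0" for n
  proof (induction n)
    case 0 then show ?case using \<open>hat \<psi> t = 0\<close> t alpha_pos by (simp add: u_def powr_powr)
  next
    case (Suc n)
    have "u (Suc n) + u (Suc n) = u n" by (simp add: u_def)
    with hat_add[OF \<psi> u[of "Suc n"] u[of "Suc n"]] Suc show ?case by simp
  qed
  define d where "d n = u n powr (1 / \<alpha>)" for n
  have d: "d n > 0" for n using u[of n] by (simp add: d_def)
  have "u \<longlonglongrightarrow> 0"
    using tendsto_mult[OF tendsto_const[of "t powr \<alpha>"] LIMSEQ_inverse_realpow_zero[of 2]]
    by (simp add: divide_inverse u_def[abs_def])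
  then have "filterlim u (at_right 0) sequentially"
    unfolding filterlim_at using u by (auto intro!: always_eventually simp: less_imp_neq[OF u, symmetric])
  then have dlim: "filterlim d (at_right 0) sequentially"
    unfolding d_def by (rule filterlim_compose[OF filterlim_powr_at_right_0, rotated]) (use alpha_pos in simp)
  define g where "g n x = ennreal (1 + Re (\<psi> (scl (d n) x)))" for n x
  have Re1: "\<bar>Re (\<psi> x)\<bar> \<le> 1" for x using abs_Re_le_cmod[of "\<psi> x"] regularD(2)[OF \<psi>, of x] by linarith
  have gm[measurable]: "g n \<in> borel_measurable \<mu>" for n
    unfolding g_def using regular_measurable_scl[OF \<psi> d[of n]] by measurable
  have gi: "(\<integral>\<^sup>+x. g n x \<partial>\<mu>) = 1" for n
  proof -
    have i: "integrable \<mu> (\<lambda>x. \<psi> (scl (d n) x))" by (rule norm_hat_le[OF \<psi> d])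
    have "(\<integral>\<^sup>+x. g n x \<partial>\<mu>) = ennreal (\<integral>x. 1 + Re (\<psi> (scl (d n) x)) \<partial>\<mu>)"
      unfolding g_def
    proof (rule nn_integral_eq_integral)
      show "integrable \<mu> (\<lambda>x. 1 + Re (\<psi> (scl (d n) x)))" using i by simp
      show "AE x in \<mu>. 0 \<le> 1 + Re (\<psi> (scl (d n) x))"
      proof (intro AE_I2)
        fix x show "0 \<le> 1 + Re (\<psi> (scl (d n) x))" using Re1[of "scl (d n) x"] by linarith
      qed
    qed
    also have "(\<integral>x. 1 + Re (\<psi> (scl (d n) x)) \<partial>\<mu>) = 1 + Re (hat \<psi> (d n))"
      unfolding hat_def using i by (simp add: prob_space)
    finally show ?thesis using hu[of n] by (simp add: d_def)
  qed
  define f where "f x = liminf (\<lambda>n. g n x)" for x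
  have fm[measurable]: "f \<in> borel_measurable \<mu>" unfolding f_def by measurable
  have f1: "f x > 1" for x
  proof -
    obtain c where c: "c > 0" "eventually (\<lambda>t. c \<le> Re (\<psi> (scl t x))) (at_right 0)" using regularD(8)[OF \<psi>] by blast
    have "eventually (\<lambda>n. c \<le> Re (\<psi> (scl (d n) x))) sequentially"
      using eventually_compose_filterlim[OF c(2) dlim] .
    then have "eventually (\<lambda>n. ennreal (1 + c) \<le> g n x) sequentially"
      by eventually_elim (simp add: g_def ennreal_leI)
    then have "ennreal (1 + c) \<le> f x" unfolding f_def by (rule Liminf_bounded)
    moreover have "1 < ennreal (1 + c)" using c(1) by simp
    ultimately show ?thesis by (rule less_le_trans[rotated])
  qed
  have fi: "(\<integral>\<^sup>+x. f x \<partial>\<mu>) \<le> 1"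
    using nn_integral_liminf[of g \<mu>] gi by (simp add: f_def Liminf_const)
  \<comment> \<open>All integrals of \<open>g n\<close> equal \<open>1\<close>, so the integral of
    the lower limit \<open>f\<close> is at most \<open>1\<close>. As \<open>f > 1\<close>
    everywhere, this is impossible on a probability space.\<close>
  have "(\<integral>\<^sup>+x. f x - 1 \<partial>\<mu>) = (\<integral>\<^sup>+x. f x \<partial>\<mu>) - (\<integral>\<^sup>+x. 1 \<partial>\<mu>)"
    by (rule nn_integral_diff) (use f1 in \<open>auto intro!: AE_I2 less_imp_le simp: emeasure_space_1\<close>)
  also have "\<dots> = 0" using fi le_less_trans[OF fi, of top] by (simp add: emeasure_space_1 diff_eq_0_iff_ennreal)
  finally have "AE x in \<mu>. f x - 1 = 0" by (subst (asm) nn_integral_0_iff_AE) auto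
  then have "AE x in \<mu>. False"
    by eventually_elim (use f1 in \<open>auto simp: diff_eq_0_iff_ennreal dest: leD\<close>)
  then show False by simp
qed

lemma hat_mult_nat:
  assumes \<psi>: "regular \<psi>" and s: "s > 0"
  shows "hat \<psi> ((real (Suc n) * s) powr (1 / \<alpha>)) = hat \<psi> (s powr (1 / \<alpha>)) ^ Suc n"
proof (induction n)
  case (Suc n)
  have "real (Suc (Suc n)) * s = real (Suc n) * s + s" by (simp add: algebra_simps)
  then show ?case using hat_add[OF \<psi>, of "real (Suc n) * s" s] s Suc by (simp add: mult.commute)
qed simp

lemma norm_hat_le_1: "regular \<psi> \<Longrightarrow> t > 0 \<Longrightarrow> norm (hat \<psi> t) \<le> 1"
proof -
  assume \<psi>: "regular \<psi>" and t: "t > 0"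
  have "norm (hat \<psi> t) \<le> (\<integral>x. norm (\<psi> (scl t x)) \<partial>\<mu>)" unfolding hat_def by (rule integral_norm_bound)
  also have "\<dots> \<le> (\<integral>x. 1 \<partial>\<mu>)"
    by (rule integral_mono) (use norm_hat_le[OF \<psi> t] regularD(2)[OF \<psi>] in auto)
  finally show ?thesis by (simp add: prob_space)
qed

text \<open>If \<open>n * t powr \<alpha> < 1\<close>, then \<open>hat \<psi> 1\<close> is
  \<open>hat \<psi> t ^ n\<close> times a factor of modulus at most \<open>1\<close>, so
  \<open>norm (hat \<psi> t)\<close> is at least the \<open>n\<close>-th root of
  \<open>norm (hat \<psi> 1)\<close>. These roots tend to \<open>1\<close> because this number is
  positive by \<open>hat_nonzero\<close>.\<close>

lemma norm_hat_tendsto_1: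
  assumes \<psi>: "regular \<psi>"
  shows "((\<lambda>t. norm (hat \<psi> t)) \<longlongrightarrow> 1) (at_right 0)"
proof (rule order_tendstoI)
  fix a :: real assume a: "a < 1"
  have p: "norm (hat \<psi> 1) > 0" using hat_nonzero[OF \<psi>, of 1] by simp
  have "eventually (\<lambda>n. root n (norm (hat \<psi> 1)) > a) sequentially"
    by (rule order_tendstoD(1)[OF LIMSEQ_root_const[OF p] a])
  then obtain m where "\<And>n. n \<ge> m \<Longrightarrow> root n (norm (hat \<psi> 1)) > a"
    unfolding eventually_sequentially by blast
  then have "root (Suc m) (norm (hat \<psi> 1)) > a" by simp
  then obtain n where m: "n = Suc m" and n: "n > 0" "root n (norm (hat \<psi> 1)) > a" by blast
  show "eventually (\<lambda>t. a < norm (hat \<psi> t)) (at_right 0)"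
    unfolding eventually_at_right_field
  proof (intro exI[of _ "(1 / n) powr (1 / \<alpha>)"] conjI allI impI)
    show "(1 / real n) powr (1 / \<alpha>) > 0" using n by simp
    fix t :: real assume t: "0 < t" "t < (1 / n) powr (1 / \<alpha>)"
    define s where "s = t powr \<alpha>"
    have s: "s > 0" "t = s powr (1 / \<alpha>)" using t alpha_pos by (simp_all add: s_def powr_powr)
    have "s < 1 / n"
      using powr_less_mono2[OF alpha_pos _ t(2)] t alpha_pos n by (simp add: s_def powr_powr)
    then have ns: "real n * s < 1" using n by (simp add: field_simps)
    have "hat \<psi> 1 = hat \<psi> ((real n * s) powr (1 / \<alpha>)) * hat \<psi> ((1 - real n * s) powr (1 / \<alpha>))"
      using hat_add[OF \<psi>, of "real n * s" "1 - real n * s"] ns n s by simp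
    then have "norm (hat \<psi> 1) \<le> norm (hat \<psi> ((real n * s) powr (1 / \<alpha>)))"
      using norm_hat_le_1[OF \<psi>, of "(1 - real n * s) powr (1 / \<alpha>)"] ns
      by (simp add: norm_mult mult_left_le)
    also have "\<dots> = norm (hat \<psi> t) ^ n"
      using hat_mult_nat[OF \<psi> s(1), of m] s(2) by (simp add: m norm_power norm_mult)
    finally have "root n (norm (hat \<psi> 1)) \<le> root n (norm (hat \<psi> t) ^ n)" using n by simp
    also have "\<dots> = norm (hat \<psi> t)" using n by (simp add: real_root_power_cancel)
    finally show "a < norm (hat \<psi> t)" using n by simp
  qed
next
  fix a :: real assume "1 < a"
  then show "eventually (\<lambda>t. norm (hat \<psi> t) < a) (at_right 0)"
    using norm_hat_le_1[OF \<psi>] by (intro eventually_mono[OF eventually_at_right_less[of 0]]) (meson le_less_trans)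
qed

lemma tendsto_L1_at_0:
  assumes \<psi>: "regular \<psi>"
  shows "((\<lambda>t. \<integral>x. norm (\<psi> (scl t x) - 1) \<partial>\<mu>) \<longlongrightarrow> 0) (at_right 0)"
proof (rule tendsto_sandwich[OF _ _ tendsto_const])
  let ?r = "\<lambda>t x. norm (\<psi> (scl t x) - of_real (norm (\<psi> (scl t x))))"
  have "((\<lambda>t. \<integral>x. ?r t x \<partial>\<mu>) \<longlongrightarrow> (\<integral>x. 0 \<partial>\<mu>)) (at 0 within {0<..})"
  proof (rule tendsto_integral_bounded_within[where C=2])
    show "finite_measure \<mu>" by unfold_locales
    show "?r t \<in> borel_measurable \<mu>" if "t \<in> {0<..}" for t
    proof -
      have [measurable]: "(\<lambda>x. \<psi> (scl t x)) \<in> borel_measurable \<mu>"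
        using regular_measurable_scl[OF \<psi>, of t] that by simp
      show ?thesis by measurable
    qed
    show "norm (?r t x) \<le> 2" for t x
      using norm_triangle_ineq4[of "\<psi> (scl t x)" "of_real (norm (\<psi> (scl t x)))"] regularD(2)[OF \<psi>, of "scl t x"] by simp
    show "((\<lambda>t. ?r t x) \<longlongrightarrow> 0) (at 0 within {0<..})" for x
    proof (rule Lim_null_comparison)
      obtain c where c: "c > 0" "eventually (\<lambda>t. c \<le> Re (\<psi> (scl t x))) (at_right 0)" using regularD(8)[OF \<psi>] by blast
      from c(2) show "\<forall>\<^sub>F t in at_right 0. norm (?r t x) \<le> 2 * \<bar>Im (\<psi> (scl t x))\<bar>"
      proof eventually_elim
        case (elim t)
        let ?z = "\<psi> (scl t x)"
        have "norm ?z \<le> \<bar>Re ?z\<bar> + \<bar>Im ?z\<bar>" by (rule cmod_le)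
        moreover have "\<bar>Re ?z\<bar> \<le> norm ?z" by (rule abs_Re_le_cmod)
        moreover have "norm (?z - of_real (norm ?z)) \<le> \<bar>Re (?z - of_real (norm ?z))\<bar> + \<bar>Im (?z - of_real (norm ?z))\<bar>"
          by (rule cmod_le)
        moreover have "Re ?z > 0" using elim c by linarith
        ultimately show ?case by simp
      qed
      show "((\<lambda>t. 2 * \<bar>Im (\<psi> (scl t x))\<bar>) \<longlongrightarrow> 0) (at_right 0)"
        using tendsto_mult[OF tendsto_const[of 2] tendsto_rabs[OF regularD(7)[OF \<psi>, of x]]] by simp
    qed
  qed simp
  then have "((\<lambda>t. (1 - norm (hat \<psi> t)) + (\<integral>x. ?r t x \<partial>\<mu>)) \<longlongrightarrow> (1 - 1) + 0) (at_right 0)"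
    by (intro tendsto_intros norm_hat_tendsto_1[OF \<psi>]) simp
  then show "((\<lambda>t. (1 - norm (hat \<psi> t)) + (\<integral>x. ?r t x \<partial>\<mu>)) \<longlongrightarrow> 0) (at_right 0)" by simp
  show "\<forall>\<^sub>F t in at_right 0. (\<integral>x. norm (\<psi> (scl t x) - 1) \<partial>\<mu>) \<le> (1 - norm (hat \<psi> t)) + (\<integral>x. ?r t x \<partial>\<mu>)"
  proof (rule eventually_mono[OF eventually_at_right_less[of 0]])
    fix t :: real assume t: "0 < t"
    note [measurable] = regular_measurable_scl[OF \<psi> t]
    have i: "integrable \<mu> (\<lambda>x. \<psi> (scl t x))" by (rule norm_hat_le[OF \<psi> t])
    have "(\<integral>x. norm (\<psi> (scl t x) - 1) \<partial>\<mu>) \<le> (\<integral>x. (1 - norm (\<psi> (scl t x))) + ?r t x \<partial>\<mu>)"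
    proof (rule integral_mono)
      show "norm (\<psi> (scl t x) - 1) \<le> (1 - norm (\<psi> (scl t x))) + ?r t x" for x
      proof -
        have "norm (of_real (norm (\<psi> (scl t x))) - (1::complex)) = 1 - norm (\<psi> (scl t x))"
          using regularD(2)[OF \<psi>, of "scl t x"]
          by (subst of_real_1[symmetric], subst of_real_diff[symmetric], subst norm_of_real) simp
        then show ?thesis
          using norm_triangle_ineq[of "\<psi> (scl t x) - of_real (norm (\<psi> (scl t x)))" "of_real (norm (\<psi> (scl t x))) - 1"] by simp
      qed
    qed (use i in auto)
    also have "\<dots> = (1 - (\<integral>x. norm (\<psi> (scl t x)) \<partial>\<mu>)) + (\<integral>x. ?r t x \<partial>\<mu>)"
      using i by (simp add: prob_space)
    also have "\<dots> \<le> (1 - norm (hat \<psi> t)) + (\<integral>x. ?r t x \<partial>\<mu>)"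
      unfolding hat_def using integral_norm_bound[of \<mu> "\<lambda>x. \<psi> (scl t x)"] by simp
    finally show "(\<integral>x. norm (\<psi> (scl t x) - 1) \<partial>\<mu>) \<le> (1 - norm (hat \<psi> t)) + (\<integral>x. ?r t x \<partial>\<mu>)" .
  qed
qed (simp add: always_eventually)

lemma hat_eq_exp:
  assumes \<psi>: "regular \<psi>"
  shows "\<exists>c. \<forall>t>0. hat \<psi> t = exp (- (of_real (t powr \<alpha>) * c))"
proof -
  have lim: "(hat \<psi> \<longlongrightarrow> 1) (at_right 0)"
  proof -
    have "((\<lambda>t. hat \<psi> t - 1) \<longlongrightarrow> 0) (at_right 0)"
    proof (rule Lim_null_comparison[OF _ tendsto_L1_at_0[OF \<psi>]])
      show "\<forall>\<^sub>F t in at_right 0. norm (hat \<psi> t - 1) \<le> (\<integral>x. norm (\<psi> (scl t x) - 1) \<partial>\<mu>)"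
      proof (rule eventually_mono[OF eventually_at_right_less[of 0]])
        fix t :: real assume "0 < t"
        then have "hat \<psi> t - 1 = (\<integral>x. \<psi> (scl t x) - 1 \<partial>\<mu>)"
          unfolding hat_def using norm_hat_le[OF \<psi>, of t] by (simp add: prob_space)
        then show "norm (hat \<psi> t - 1) \<le> (\<integral>x. norm (\<psi> (scl t x) - 1) \<partial>\<mu>)"
          by (simp add: integral_norm_bound)
      qed
    qed
    then show ?thesis by (rule LIM_zero_cancel)
  qed
  have "((\<lambda>s. hat \<psi> (s powr (1 / \<alpha>))) \<longlongrightarrow> 1) (at_right 0)"
    by (rule filterlim_compose[OF lim filterlim_powr_at_right_0]) (use alpha_pos in simp)
  then obtain c where c: "\<And>s. s > 0 \<Longrightarrow> hat \<psi> (s powr (1 / \<alpha>)) = exp (- (of_real s * c))"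
    using multiplicative_imp_exp[of "\<lambda>s. hat \<psi> (s powr (1 / \<alpha>))"] hat_add[OF \<psi>] by blast
  have "hat \<psi> t = exp (- (of_real (t powr \<alpha>) * c))" if "t > 0" for t
    using c[of "t powr \<alpha>"] that alpha_pos by (simp add: powr_powr)
  then show ?thesis by blast
qed

text \<open>Requiring the formula at all scales fixes the branch of the logarithm and makes
  \<open>expo\<close> homogeneous of degree \<open>\<alpha>\<close>. On \<open>H\<close> it agrees
  with the Laplace exponent a priori only modulo multiples of \<open>2 pi i\<close>.\<close>

definition expo :: "('a \<Rightarrow> complex) \<Rightarrow> complex" where
  "expo \<psi> = (SOME c. \<forall>t>0. hat \<psi> t = exp (- (of_real (t powr \<alpha>) * c)))"

lemma hat_expo: "regular \<psi> \<Longrightarrow> t > 0 \<Longrightarrow> hat \<psi> t = exp (- (of_real (t powr \<alpha>) * expo \<psi>))"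
  unfolding expo_def using someI_ex[OF hat_eq_exp] by blast

lemma expo_unique:
  assumes "regular \<psi>" "\<And>t. t > 0 \<Longrightarrow> hat \<psi> t = exp (- (of_real (t powr \<alpha>) * c))"
  shows "expo \<psi> = c"
proof (rule exp_scaled_inject)
  fix s :: real assume s: "s > 0"
  show "exp (- (of_real s * expo \<psi>)) = exp (- (of_real s * c))"
    using hat_expo[OF assms(1), of "s powr (1 / \<alpha>)"] assms(2)[of "s powr (1 / \<alpha>)"] s alpha_pos by (simp add: powr_powr)
qed

lemma expo_scale:
  assumes \<psi>: "regular \<psi>" and s: "s > 0"
  shows "expo (\<lambda>x. \<psi> (scl s x)) = of_real (s powr \<alpha>) * expo \<psi>"
proof (rule expo_unique[OF regular_scale[OF \<psi> s]])
  fix t :: real assume t: "t > 0"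
  have "hat (\<lambda>x. \<psi> (scl s x)) t = hat \<psi> (s * t)" unfolding hat_def using s t by (simp add: scale_scale)
  then show "hat (\<lambda>x. \<psi> (scl s x)) t = exp (- (of_real (t powr \<alpha>) * (of_real (s powr \<alpha>) * expo \<psi>)))"
    using hat_expo[OF \<psi>, of "s * t"] s t by (simp add: powr_mult mult_ac)
qed

lemma expo_cnj:
  assumes \<psi>: "regular \<psi>"
  shows "expo (\<lambda>x. cnj (\<psi> x)) = cnj (expo \<psi>)"
proof (rule expo_unique[OF regular_cnj[OF \<psi>]])
  fix t :: real assume t: "t > 0"
  have "hat (\<lambda>x. cnj (\<psi> x)) t = cnj (hat \<psi> t)" unfolding hat_def by simp
  then show "hat (\<lambda>x. cnj (\<psi> x)) t = exp (- (of_real (t powr \<alpha>) * cnj (expo \<psi>)))"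
    using hat_expo[OF \<psi> t] by (simp add: exp_cnj)
qed

lemma expo_one: "expo (\<lambda>x. 1) = 0"
  by (rule expo_unique[OF regular_one]) (simp add: hat_def prob_space)

text \<open>The scale enters as the factor \<open>t powr \<alpha>\<close> of the exponent, so
  convergence of the transforms at all scales is what \<open>tendsto_of_exp_scaled_within\<close>
  asks for.\<close>

lemma expo_tendsto:
  fixes S :: "real set"
  assumes X: "\<And>u. u \<in> S \<Longrightarrow> regular (X u)" and Y: "regular Y"
    and lim: "\<And>t. t > 0 \<Longrightarrow> ((\<lambda>u. hat (X u) t) \<longlongrightarrow> hat Y t) (at u0 within S)"
  shows "((\<lambda>u. expo (X u)) \<longlongrightarrow> expo Y) (at u0 within S)"
proof (rule tendsto_of_exp_scaled_within)
  fix s :: real assume s: "s > 0"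
  have e: "exp (- (of_real s * expo Z)) = hat Z (s powr (1 / \<alpha>))" if "regular Z" for Z
    using hat_expo[OF that, of "s powr (1 / \<alpha>)"] s alpha_pos by (simp add: powr_powr)
  have "((\<lambda>u. hat (X u) (s powr (1 / \<alpha>))) \<longlongrightarrow> hat Y (s powr (1 / \<alpha>))) (at u0 within S)"
    by (rule lim) (use s in simp)
  then have "((\<lambda>u. hat (X u) (s powr (1 / \<alpha>))) \<longlongrightarrow> exp (- (of_real s * expo Y))) (at u0 within S)"
    by (simp only: e[OF Y])
  moreover have "\<forall>\<^sub>F u in at u0 within S. hat (X u) (s powr (1 / \<alpha>)) = exp (- (of_real s * expo (X u)))"
    unfolding eventually_at_filter by (rule always_eventually) (simp add: e X)
  ultimately show "((\<lambda>u. exp (- (of_real s * expo (X u)))) \<longlongrightarrow> exp (- (of_real s * expo Y))) (at u0 within S)"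
    by (rule Lim_transform_eventually)
qed

end

lemma (in prob_space) norm_integral_square_le:
  fixes f :: "'a \<Rightarrow> 'b::{banach, second_countable_topology}"
  assumes f[measurable]: "f \<in> borel_measurable M" and bd: "\<And>x. x \<in> space M \<Longrightarrow> norm (f x) \<le> C"
  shows "(\<integral>x. norm (f x) \<partial>M)\<^sup>2 \<le> (\<integral>x. (norm (f x))\<^sup>2 \<partial>M)"
proof -
  have i1: "integrable M (\<lambda>x. norm (f x))"
    by (rule integrable_const_bound[where B=C]) (use bd in auto)
  have i2: "integrable M (\<lambda>x. (norm (f x))\<^sup>2)"
    by (rule integrable_const_bound[where B="C\<^sup>2"]) (use bd in \<open>auto intro!: power_mono\<close>)
  have "0 \<le> variance (\<lambda>x. norm (f x))" by (rule variance_positive)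
  then show ?thesis using variance_eq[OF i1 i2] by simp
qed

lemma cmod_diff_square: "(norm (a - b))\<^sup>2 = Re (a * cnj a) + Re (b * cnj b) - 2 * Re (a * cnj b)"
  unfolding cmod_power2 by (simp add: power2_eq_square algebra_simps)

lemma integral_mult_pair_prob:
  fixes f :: "'a \<Rightarrow> complex" and g :: "'b \<Rightarrow> complex"
  assumes "prob_space A" "prob_space B"
    and f[measurable]: "f \<in> borel_measurable A" and g[measurable]: "g \<in> borel_measurable B"
    and fb: "\<And>x. norm (f x) \<le> 1" and gb: "\<And>x. norm (g x) \<le> 1"
  shows "(\<integral>p. f (fst p) * g (snd p) \<partial>(A \<Otimes>\<^sub>M B)) = (\<integral>x. f x \<partial>A) * (\<integral>x. g x \<partial>B)"
proof -
  interpret A: prob_space A by fact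
  interpret B: prob_space B by fact
  interpret pair_prob_space A B ..
  have "(\<integral>p. f (fst p) * g (snd p) \<partial>(A \<Otimes>\<^sub>M B)) = (\<integral>x. (\<integral>y. f x * g y \<partial>B) \<partial>A)"
  proof (subst integral_fst'[symmetric])
    show "integrable (A \<Otimes>\<^sub>M B) (\<lambda>p. f (fst p) * g (snd p))"
    proof (rule P.integrable_const_bound[where B=1])
      show "AE p in A \<Otimes>\<^sub>M B. norm (f (fst p) * g (snd p)) \<le> 1"
        using mult_mono[OF fb gb] by (intro AE_I2) (simp add: norm_mult)
    qed measurable
  qed simp
  then show ?thesis by simp
qed

lemma integral_poisson_pmf_power:
  fixes z :: complex
  assumes r: "r > 0" and z: "norm z \<le> 1"
  shows "(\<integral>n. z ^ n \<partial>measure_pmf (poisson_pmf r)) = exp (of_real r * (z - 1))"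
proof -
  have s: "(\<lambda>n. (of_real r * z) ^ n /\<^sub>R fact n) sums exp (of_real r * z)" by (rule exp_converges)
  have s': "(\<lambda>n. pmf (poisson_pmf r) n *\<^sub>R z ^ n) sums (exp (of_real (-r)) * exp (of_real r * z))"
  proof -
    have "(\<lambda>n. exp (of_real (-r)) * ((of_real r * z) ^ n /\<^sub>R fact n)) sums (exp (of_real (-r)) * exp (of_real r * z))"
      by (rule sums_mult[OF s])
    moreover have "exp (of_real (-r)) * ((of_real r * z) ^ n /\<^sub>R fact n) = pmf (poisson_pmf r) n *\<^sub>R z ^ n" for n
      using r by (simp add: scaleR_conv_of_real power_mult_distrib divide_inverse exp_of_real[symmetric] mult_ac del: exp_of_real)
    ultimately show ?thesis by simp
  qed
  have int: "integrable (count_space UNIV) (\<lambda>n. pmf (poisson_pmf r) n *\<^sub>R z ^ n)"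
  proof (rule Bochner_Integration.integrable_bound)
    show "integrable (count_space UNIV) (pmf (poisson_pmf r))" by (rule integrable_pmf)
    show "AE n in count_space UNIV. norm (pmf (poisson_pmf r) n *\<^sub>R z ^ n) \<le> norm (pmf (poisson_pmf r) n)"
      using z by (intro AE_I2) (simp add: norm_power power_le_one mult_left_le)
  qed simp
  have "(\<integral>n. z ^ n \<partial>measure_pmf (poisson_pmf r)) = (\<integral>n. pmf (poisson_pmf r) n *\<^sub>R z ^ n \<partial>count_space UNIV)"
    unfolding measure_pmf_eq_density by (subst integral_density) auto
  also have "\<dots> = (\<Sum>n. pmf (poisson_pmf r) n *\<^sub>R z ^ n)" by (rule integral_count_space_nat[OF int])
  also have "\<dots> = exp (of_real (-r)) * exp (of_real r * z)" using s' by (simp add: sums_iff)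
  also have "\<dots> = exp (of_real r * (z - 1))" by (simp add: exp_add[symmetric] algebra_simps)
  finally show ?thesis .
qed

section \<open>Mean continuity of characters under scaling\<close>

context stable_cone
begin

text \<open>One-sided continuity of characters gives the limit from one side only. The identity
  \<open>G r = r powr \<alpha> * cnj (G (inverse r))\<close>, obtained by conjugating and rescaling,
  reflects it to the other side; the limit is real and hence unchanged by conjugation.\<close>

lemma expo_near_1:
  assumes \<psi>: "regular \<psi>"
  shows "((\<lambda>r. expo (\<lambda>x. \<psi> (scl r x) * cnj (\<psi> x))) \<longlongrightarrow> expo (\<lambda>x. \<psi> x * cnj (\<psi> x))) (at 1)"
proof -
  define G where "G r = expo (\<lambda>x. \<psi> (scl r x) * cnj (\<psi> x))" for r
  define A where "A = expo (\<lambda>x. \<psi> x * cnj (\<psi> x))"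
  have gA: "regular (\<lambda>x. \<psi> x * cnj (\<psi> x))" by (intro regular_mult regular_cnj \<psi>)
  have gG: "regular (\<lambda>x. \<psi> (scl r x) * cnj (\<psi> x))" if "r > 0" for r by (intro regular_mult regular_cnj regular_scale \<psi> that)
  have A: "cnj A = A"
    unfolding A_def expo_cnj[OF gA, symmetric] by (simp add: mult.commute)
  have sub: "side 1 \<subseteq> {0<..}" using side by auto
  have one: "(G \<longlongrightarrow> A) (at 1 within side 1)"
    unfolding G_def A_def
  proof (rule expo_tendsto[OF gG gA])
    show "0 < u" if "u \<in> side 1" for u using sub that by auto
    fix t :: real assume t: "t > 0"
    show "((\<lambda>u. hat (\<lambda>x. \<psi> (scl u x) * cnj (\<psi> x)) t) \<longlongrightarrow> hat (\<lambda>x. \<psi> x * cnj (\<psi> x)) t) (at 1 within side 1)"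
      unfolding hat_def
    proof (rule tendsto_integral_bounded_within[where C=1])
      show "finite_measure \<mu>" by unfold_locales
      show "(\<lambda>x. \<psi> (scl u (scl t x)) * cnj (\<psi> (scl t x))) \<in> borel_measurable \<mu>" if "u \<in> side 1" for u
        using regular_measurable_scl[OF gG t, of u] sub that by auto
      show "(\<lambda>x. \<psi> (scl t x) * cnj (\<psi> (scl t x))) \<in> borel_measurable \<mu>"
        using regular_measurable_scl[OF gA t] .
      show "norm (\<psi> (scl u (scl t x)) * cnj (\<psi> (scl t x))) \<le> 1" for u x
        using mult_mono[OF regularD(2)[OF \<psi>, of "scl u (scl t x)"] regularD(2)[OF \<psi>, of "scl t x"]] by (simp add: norm_mult)
      show "((\<lambda>u. \<psi> (scl u (scl t x)) * cnj (\<psi> (scl t x))) \<longlongrightarrow> \<psi> (scl t x) * cnj (\<psi> (scl t x))) (at 1 within side 1)" for x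
        using tendsto_mult[OF regularD(6)[OF \<psi>, of 1 "scl t x"] tendsto_const] by (simp add: scale_one)
    qed
  qed
  have inv: "of_real (r powr \<alpha>) * cnj (G (inverse r)) = G r" if r: "r > 0" for r
  proof -
    have "cnj (G (inverse r)) = expo (\<lambda>x. cnj (\<psi> (scl (inverse r) x) * cnj (\<psi> x)))"
      unfolding G_def by (rule expo_cnj[symmetric, OF gG]) (use r in simp)
    also have "of_real (r powr \<alpha>) * \<dots> = expo (\<lambda>x. cnj (\<psi> (scl (inverse r) (scl r x)) * cnj (\<psi> (scl r x))))"
      by (rule expo_scale[symmetric, OF regular_cnj[OF gG]]) (use r in auto)
    also have "\<dots> = G r" unfolding G_def using r by (simp add: scale_scale scale_one mult.commute)
    finally show ?thesis .
  qed
  have other: "(G \<longlongrightarrow> A) F" if F: "filterlim inverse (at 1 within side 1) F" and ev: "eventually (\<lambda>r. r > 0) F"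
    and id: "((\<lambda>r. r) \<longlongrightarrow> 1) F" for F
  proof -
    have "((\<lambda>r. of_real (r powr \<alpha>) * cnj (G (inverse r))) \<longlongrightarrow> of_real (1 powr \<alpha>) * cnj A) F"
      by (intro tendsto_intros filterlim_compose[OF one F] id) simp
    then have "((\<lambda>r. of_real (r powr \<alpha>) * cnj (G (inverse r))) \<longlongrightarrow> A) F" using A by simp
    then show ?thesis by (rule Lim_transform_eventually) (rule eventually_mono[OF ev inv])
  qed
  have evp: "eventually (\<lambda>r::real. r > 0) (at 1 within T)" for T
    by (rule order_tendstoD(1)[OF tendsto_ident_at]) simp
  have invt: "(inverse \<longlongrightarrow> 1) (at (1::real) within T)" for T
    using tendsto_inverse[OF tendsto_ident_at[of "1::real" T]] by simp
  have "(G \<longlongrightarrow> A) (at_left 1) \<and> (G \<longlongrightarrow> A) (at_right 1)"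
    using side
  proof
    assume s: "side = (\<lambda>t. {t<..})"
    have "filterlim inverse (at_right 1) (at_left (1::real))"
      unfolding filterlim_at
      by (intro conjI invt) (auto simp: eventually_at_left_field one_less_inverse intro!: exI[of _ 0])
    from other[unfolded s, OF this evp tendsto_ident_at] one[unfolded s] show ?thesis by blast
  next
    assume s: "side = (\<lambda>t. {0<..<t})"
    have e: "at 1 within {0<..<1} = at_left (1::real)"
      by (rule at_within_nhd[of _ "{0<..}"]) auto
    have "filterlim inverse (at_left 1) (at_right (1::real))"
      unfolding filterlim_at
      by (intro conjI invt) (auto simp: eventually_at_right_field inverse_less_1_iff intro!: exI[of _ 2])
    from other[unfolded s e, OF this evp tendsto_ident_at] one[unfolded s e] show ?thesis by blast
  qed
  then have "(G \<longlongrightarrow> A) (at 1)" using filterlim_split_at by blast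
  then show ?thesis unfolding G_def A_def .
qed

text \<open>The mean square of the increment is a combination of transforms of
  \<open>\<psi> x * cnj (\<psi> x)\<close> and
  \<open>\<psi> (scl (u / t) x) * cnj (\<psi> x)\<close>, hence a function \<open>Q\<close> of their
  exponents, and by \<open>expo_near_1\<close> it tends to \<open>0\<close> from both sides of
  \<open>t\<close>. The mean is bounded by the root of the mean square.\<close>

lemma tendsto_L1:
  assumes \<psi>: "regular \<psi>" and t: "t > 0"
  shows "((\<lambda>u. \<integral>x. norm (\<psi> (scl u x) - \<psi> (scl t x)) \<partial>\<mu>) \<longlongrightarrow> 0) (at t within {0<..})"
proof -
  define A where "A = expo (\<lambda>x. \<psi> x * cnj (\<psi> x))"
  define G where "G r = expo (\<lambda>x. \<psi> (scl r x) * cnj (\<psi> x))" for r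
  have gA: "regular (\<lambda>x. \<psi> x * cnj (\<psi> x))" by (intro regular_mult regular_cnj \<psi>)
  have gG: "regular (\<lambda>x. \<psi> (scl r x) * cnj (\<psi> x))" if "r > 0" for r by (intro regular_mult regular_cnj regular_scale \<psi> that)
  define Q where "Q u = Re (exp (- (of_real (u powr \<alpha>) * A))) + Re (exp (- (of_real (t powr \<alpha>) * A)))
    - 2 * Re (exp (- (of_real (t powr \<alpha>) * G (u / t))))" for u
  have Q: "(\<integral>x. (norm (\<psi> (scl u x) - \<psi> (scl t x)))\<^sup>2 \<partial>\<mu>) = Q u" if u: "u > 0" for u
  proof -
    have i: "integrable \<mu> (\<lambda>x. \<psi> (scl u x) * cnj (\<psi> (scl u x)))" "integrable \<mu> (\<lambda>x. \<psi> (scl t x) * cnj (\<psi> (scl t x)))"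
      using norm_hat_le[OF gA] u t by auto
    have eq: "\<psi> (scl (u / t) (scl t x)) = \<psi> (scl u x)" for x using u t by (simp add: scale_scale)
    have i2: "integrable \<mu> (\<lambda>x. \<psi> (scl u x) * cnj (\<psi> (scl t x)))"
      using norm_hat_le[OF gG[of "u / t"] t] u t by (simp add: eq)
    have h: "hat (\<lambda>x. \<psi> x * cnj (\<psi> x)) u = (\<integral>x. \<psi> (scl u x) * cnj (\<psi> (scl u x)) \<partial>\<mu>)"
      "hat (\<lambda>x. \<psi> x * cnj (\<psi> x)) t = (\<integral>x. \<psi> (scl t x) * cnj (\<psi> (scl t x)) \<partial>\<mu>)"
      "hat (\<lambda>x. \<psi> (scl (u / t) x) * cnj (\<psi> x)) t = (\<integral>x. \<psi> (scl u x) * cnj (\<psi> (scl t x)) \<partial>\<mu>)"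
      unfolding hat_def by (simp_all add: eq)
    have "(\<integral>x. (norm (\<psi> (scl u x) - \<psi> (scl t x)))\<^sup>2 \<partial>\<mu>)
      = (\<integral>x. Re (\<psi> (scl u x) * cnj (\<psi> (scl u x))) + Re (\<psi> (scl t x) * cnj (\<psi> (scl t x)))
          - 2 * Re (\<psi> (scl u x) * cnj (\<psi> (scl t x))) \<partial>\<mu>)"
      by (simp only: cmod_diff_square)
    also have "\<dots> = Re (hat (\<lambda>x. \<psi> x * cnj (\<psi> x)) u) + Re (hat (\<lambda>x. \<psi> x * cnj (\<psi> x)) t)
        - 2 * Re (hat (\<lambda>x. \<psi> (scl (u / t) x) * cnj (\<psi> x)) t)"
      unfolding h integral_Re[OF i(1), symmetric] integral_Re[OF i(2), symmetric] integral_Re[OF i2, symmetric]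
      using integrable_Re[OF i(1)] integrable_Re[OF i(2)] integrable_Re[OF i2]
      by (subst Bochner_Integration.integral_diff) (simp_all only: Bochner_Integration.integrable_add Bochner_Integration.integral_add integrable_mult_right integral_mult_right_zero)
    also have "\<dots> = Q u"
      using hat_expo[OF gA u] hat_expo[OF gA t] hat_expo[OF gG[of "u / t"] t] u t
      by (simp only: Q_def A_def G_def divide_pos_pos)
    finally show ?thesis .
  qed
  have "(Q \<longlongrightarrow> 0) (at t within {0<..})"
  proof -
    have "((\<lambda>u. G (u / t)) \<longlongrightarrow> A) (at t)"
    proof -
      have "filterlim (\<lambda>u. u / t) (at 1) (at t)"
        unfolding filterlim_at using t
        by (auto intro!: tendsto_eq_intros simp: eventually_at_filter)
      from filterlim_compose[OF expo_near_1[OF \<psi>] this] show ?thesis by (simp add: G_def A_def)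
    qed
    then have "((\<lambda>u. G (u / t)) \<longlongrightarrow> A) (at t within {0<..})" by (rule tendsto_within_subset) simp
    then have "(Q \<longlongrightarrow> Re (exp (- (of_real (t powr \<alpha>) * A))) + Re (exp (- (of_real (t powr \<alpha>) * A)))
      - 2 * Re (exp (- (of_real (t powr \<alpha>) * A)))) (at t within {0<..})"
      unfolding Q_def using t by (intro tendsto_intros) auto
    then show ?thesis by simp
  qed
  then have "((\<lambda>u. sqrt (Q u)) \<longlongrightarrow> sqrt 0) (at t within {0<..})" by (rule tendsto_real_sqrt)
  then have lim: "((\<lambda>u. sqrt (Q u)) \<longlongrightarrow> 0) (at t within {0<..})" by simp
  show ?thesis
  proof (rule Lim_null_comparison[OF _ lim])
    show "\<forall>\<^sub>F u in at t within {0<..}. norm (\<integral>x. norm (\<psi> (scl u x) - \<psi> (scl t x)) \<partial>\<mu>) \<le> sqrt (Q u)"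
      unfolding eventually_at_filter
    proof (intro always_eventually allI impI)
      fix u :: real assume "u \<in> {0<..}"
      then have u: "u > 0" by simp
      have [measurable]: "(\<lambda>x. \<psi> (scl u x)) \<in> borel_measurable \<mu>" "(\<lambda>x. \<psi> (scl t x)) \<in> borel_measurable \<mu>"
        using regular_measurable_scl[OF \<psi>] u t by auto
      have "(\<integral>x. norm (\<psi> (scl u x) - \<psi> (scl t x)) \<partial>\<mu>)\<^sup>2 \<le> (\<integral>x. (norm (\<psi> (scl u x) - \<psi> (scl t x)))\<^sup>2 \<partial>\<mu>)"
      proof (rule norm_integral_square_le)
        show "norm (\<psi> (scl u x) - \<psi> (scl t x)) \<le> 1 + 1" for x
          by (rule order_trans[OF norm_triangle_ineq4 add_mono]) (rule regularD(2)[OF \<psi>])+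
      qed measurable
      then show "norm (\<integral>x. norm (\<psi> (scl u x) - \<psi> (scl t x)) \<partial>\<mu>) \<le> sqrt (Q u)"
        unfolding Q[OF u] by (simp add: real_le_rsqrt)
    qed
  qed
qed

text \<open>A fixed factor of modulus at most \<open>1\<close> does not increase distances in mean,
  so mean continuity of one path suffices for the exponents of all its products.\<close>

lemma expo_tendsto_mult:
  fixes S :: "real set"
  assumes X: "\<And>u. u \<in> S \<Longrightarrow> regular (X u)" and Y: "regular Y" and \<eta>: "regular \<eta>"
    and lim: "\<And>s. s > 0 \<Longrightarrow> ((\<lambda>u. \<integral>x. norm (X u (scl s x) - Y (scl s x)) \<partial>\<mu>) \<longlongrightarrow> 0) (at u0 within S)"
  shows "((\<lambda>u. expo (\<lambda>x. X u x * \<eta> x)) \<longlongrightarrow> expo (\<lambda>x. Y x * \<eta> x)) (at u0 within S)"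
proof (rule expo_tendsto)
  fix t :: real assume t: "t > 0"
  have "((\<lambda>u. hat (\<lambda>x. X u x * \<eta> x) t - hat (\<lambda>x. Y x * \<eta> x) t) \<longlongrightarrow> 0) (at u0 within S)"
  proof (rule Lim_null_comparison[OF _ lim[OF t]])
    show "\<forall>\<^sub>F u in at u0 within S. norm (hat (\<lambda>x. X u x * \<eta> x) t - hat (\<lambda>x. Y x * \<eta> x) t)
        \<le> (\<integral>x. norm (X u (scl t x) - Y (scl t x)) \<partial>\<mu>)"
      unfolding eventually_at_filter
    proof (intro always_eventually allI impI)
      fix u assume u: "u \<in> S"
      have i: "integrable \<mu> (\<lambda>x. X u (scl t x) * \<eta> (scl t x))" "integrable \<mu> (\<lambda>x. Y (scl t x) * \<eta> (scl t x))"
        "integrable \<mu> (\<lambda>x. X u (scl t x))" "integrable \<mu> (\<lambda>x. Y (scl t x))"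
        using norm_hat_le[OF regular_mult[OF X[OF u] \<eta>] t] norm_hat_le[OF regular_mult[OF Y \<eta>] t]
          norm_hat_le[OF X[OF u] t] norm_hat_le[OF Y t] by auto
      have "hat (\<lambda>x. X u x * \<eta> x) t - hat (\<lambda>x. Y x * \<eta> x) t
        = (\<integral>x. X u (scl t x) * \<eta> (scl t x) - Y (scl t x) * \<eta> (scl t x) \<partial>\<mu>)"
        unfolding hat_def by (rule Bochner_Integration.integral_diff[symmetric, OF i(1,2)])
      also have "norm \<dots> \<le> (\<integral>x. norm (X u (scl t x) * \<eta> (scl t x) - Y (scl t x) * \<eta> (scl t x)) \<partial>\<mu>)"
        by (rule integral_norm_bound)
      also have "\<dots> \<le> (\<integral>x. norm (X u (scl t x) - Y (scl t x)) \<partial>\<mu>)"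
      proof (rule integral_mono)
        show "norm (X u (scl t x) * \<eta> (scl t x) - Y (scl t x) * \<eta> (scl t x)) \<le> norm (X u (scl t x) - Y (scl t x))" for x
          unfolding left_diff_distrib[symmetric] norm_mult using regularD(2)[OF \<eta>] by (rule mult_right_le_one_le[OF norm_ge_zero norm_ge_zero])
      qed (use i in auto)
      finally show "norm (hat (\<lambda>x. X u x * \<eta> x) t - hat (\<lambda>x. Y x * \<eta> x) t)
        \<le> (\<integral>x. norm (X u (scl t x) - Y (scl t x)) \<partial>\<mu>)" .
    qed
  qed
  then show "((\<lambda>u. hat (\<lambda>x. X u x * \<eta> x) t) \<longlongrightarrow> hat (\<lambda>x. Y x * \<eta> x) t) (at u0 within S)"
    by (rule LIM_zero_cancel)
qed (intro regular_mult X Y \<eta>; assumption)+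

lemma expo_path_tendsto:
  assumes \<psi>: "regular \<psi>" and \<eta>: "regular \<eta>" and t: "t > 0"
  shows "((\<lambda>u. expo (\<lambda>x. \<psi> (scl u x) * \<eta> x)) \<longlongrightarrow> expo (\<lambda>x. \<psi> (scl t x) * \<eta> x)) (at t within {0<..})"
proof (rule expo_tendsto_mult[OF _ _ \<eta>])
  fix s :: real assume s: "s > 0"
  have *: "((\<lambda>u. \<integral>x. norm (\<psi> (scl u x) - \<psi> (scl (t * s) x)) \<partial>\<mu>) \<longlongrightarrow> 0) (at (t * s))"
    using tendsto_L1[OF \<psi>, of "t * s"] s t at_within_open[of "t * s" "{0<..}"] by simp
  have "filterlim (\<lambda>u. u * s) (at (t * s)) (at t)"
    unfolding filterlim_at using s by (auto intro!: tendsto_eq_intros simp: eventually_at_filter)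
  from filterlim_compose[OF * this]
  have "((\<lambda>u. \<integral>x. norm (\<psi> (scl (u * s) x) - \<psi> (scl (t * s) x)) \<partial>\<mu>) \<longlongrightarrow> 0) (at t within {0<..})"
    by (rule tendsto_within_subset) simp
  then show "((\<lambda>u. \<integral>x. norm (\<psi> (scl u (scl s x)) - \<psi> (scl t (scl s x))) \<partial>\<mu>) \<longlongrightarrow> 0) (at t within {0<..})"
    by (rule Lim_transform_eventually)
      (auto simp: eventually_at_filter scale_scale s t intro!: always_eventually)
qed (use regular_scale[OF \<psi>] t in auto)

lemma expo_path_tendsto_0:
  assumes \<psi>: "regular \<psi>" and \<eta>: "regular \<eta>"
  shows "((\<lambda>u. expo (\<lambda>x. \<psi> (scl u x) * \<eta> x)) \<longlongrightarrow> expo \<eta>) (at_right 0)"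
proof -
  have "((\<lambda>u. expo (\<lambda>x. \<psi> (scl u x) * \<eta> x)) \<longlongrightarrow> expo (\<lambda>x. 1 * \<eta> x)) (at_right 0)"
  proof (rule expo_tendsto_mult[OF _ regular_one \<eta>])
    fix s :: real assume s: "s > 0"
    have "((\<lambda>u. \<integral>x. norm (\<psi> (scl (u * s) x) - 1) \<partial>\<mu>) \<longlongrightarrow> 0) (at_right 0)"
      by (rule filterlim_compose[OF tendsto_L1_at_0[OF \<psi>] filterlim_mult_at_right_0[OF s]])
    then show "((\<lambda>u. \<integral>x. norm (\<psi> (scl u (scl s x)) - 1) \<partial>\<mu>) \<longlongrightarrow> 0) (at_right 0)"
      by (rule Lim_transform_eventually)
        (auto simp: eventually_at_filter scale_scale s intro!: always_eventually)
  qed (use regular_scale[OF \<psi>] in auto)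
  then show ?thesis by simp
qed

end

section \<open>Compound Poisson laws and second differences of the exponent\<close>

context stable_cone
begin

primrec partial_sum :: "(nat \<Rightarrow> 'a) \<Rightarrow> nat \<Rightarrow> 'a" where
  "partial_sum z 0 = e"
| "partial_sum z (Suc n) = add (z n) (partial_sum z n)"

lemma measurable_add:
  assumes "f \<in> measurable N M" "g \<in> measurable N M"
  shows "(\<lambda>x. add (f x) (g x)) \<in> measurable N M"
  using measurable_compose[OF measurable_Pair[OF assms] add_measurable] by simp

lemma partial_sum_measurable:
  assumes \<rho>: "sets \<rho> = sets M"
  shows "(\<lambda>z. partial_sum z n) \<in> measurable (PiM UNIV (\<lambda>_. \<rho>)) M"
proof (induction n)
  case 0 then show ?case by (simp add: space_M)
next
  case (Suc n)
  have "(\<lambda>z. z n) \<in> measurable (PiM UNIV (\<lambda>_. \<rho>)) \<rho>" by (rule measurable_component_singleton) simp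
  then have "(\<lambda>z. z n) \<in> measurable (PiM UNIV (\<lambda>_. \<rho>)) M"
    using measurable_cong_sets[OF refl \<rho>] by blast
  from measurable_add[OF this Suc] show ?case by simp
qed

lemma regular_partial_sum: "regular \<psi> \<Longrightarrow> \<psi> (partial_sum z n) = (\<Prod>i<n. \<psi> (z i))"
  by (induction n) (simp_all add: regularD(3,4) mult.commute)

lemma integral_partial_sum:
  assumes \<rho>: "prob_space \<rho>" "sets \<rho> = sets M" and \<psi>: "regular \<psi>"
  shows "(\<integral>z. \<psi> (partial_sum z n) \<partial>PiM UNIV (\<lambda>_. \<rho>)) = (\<integral>x. \<psi> x \<partial>\<rho>) ^ n"
proof -
  have "\<psi> \<in> borel_measurable \<rho>"
    using regularD(1)[OF \<psi>] measurable_cong_sets[OF \<rho>(2) refl] by blast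
  then show ?thesis
    using integral_prod_PiM_nat[OF \<rho>(1), of "\<lambda>_. \<psi>" n] regularD(2)[OF \<psi>] by (simp add: regular_partial_sum[OF \<psi>])
qed

text \<open>Both sides are transforms of finite complex measures on the cone, the exponential being that
  of a compound Poisson law. Hence the identity extends from the determining
  class \<open>H\<close> to all characters, in particular to the scaled ones.\<close>

lemma transfer_identity:
  assumes H: "character_semigroup H" and gen: "generates H M" and Hg: "\<And>f. f \<in> H \<Longrightarrow> regular f"
    and \<eta>: "regular \<eta>" and \<rho>: "prob_space \<rho>" "sets \<rho> = sets M" and r: "r > 0"
    and eq: "\<And>f. f \<in> H \<Longrightarrow> hat (\<lambda>x. f x * \<eta> x) 1 * hat (\<lambda>x. f x * cnj (\<eta> x)) 1
      * exp (of_real q + of_real r * (\<integral>x. f x \<partial>\<rho>)) = (hat f 1)\<^sup>2"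
    and \<psi>: "regular \<psi>"
  shows "hat (\<lambda>x. \<psi> x * \<eta> x) 1 * hat (\<lambda>x. \<psi> x * cnj (\<eta> x)) 1
      * exp (of_real q + of_real r * (\<integral>x. \<psi> x \<partial>\<rho>)) = (hat \<psi> 1)\<^sup>2"
proof -
  interpret R: prob_space \<rho> by fact
  interpret PR: product_prob_space "\<lambda>_. \<rho>" "UNIV :: nat set" ..
  let ?Z = "PiM (UNIV :: nat set) (\<lambda>_. \<rho>)"
  let ?N = "measure_pmf (poisson_pmf r)"
  \<comment> \<open>This product carries a Poisson number of summands and an independent i.i.d.
    sequence with law \<open>\<rho>\<close>; the random sum \<open>ps\<close> is compound
    Poisson.\<close>
  define K where "K = ?N \<Otimes>\<^sub>M ?Z"
  interpret pN: pair_prob_space ?N ?Z ..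
  have K: "prob_space K" unfolding K_def by (rule pN.P.prob_space_axioms)
  interpret K: prob_space K by (rule K)
  interpret MM: pair_prob_space \<mu> \<mu> ..
  interpret P1: pair_prob_space "\<mu> \<Otimes>\<^sub>M \<mu>" K ..
  define ps where "ps p = partial_sum (snd p) (fst p)" for p :: "nat \<times> (nat \<Rightarrow> 'a)"
  have ps: "ps \<in> measurable K M"
  proof -
    have "(\<lambda>p. (\<lambda>n p. partial_sum (snd p) n) (fst p) p) \<in> measurable K M"
    proof (rule measurable_compose_countable'[where I=UNIV and g=fst and f="\<lambda>n p. partial_sum (snd p) n"])
      show "(\<lambda>p. partial_sum (snd p) n) \<in> measurable K M" for n
        unfolding K_def by (rule measurable_compose[OF measurable_snd partial_sum_measurable[OF \<rho>(2)]])
      have "fst \<in> measurable K ?N" unfolding K_def by (rule measurable_fst)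
      then show "fst \<in> measurable K (count_space UNIV)"
        
        using measurable_cong_sets[of K K ?N "count_space UNIV"] by simp
    qed simp
    then show ?thesis by (simp add: ps_def[abs_def])
  qed
  have Kint: "(\<integral>p. f (ps p) \<partial>K) = exp (of_real r * ((\<integral>x. f x \<partial>\<rho>) - 1))" if f: "regular f" for f
  proof -
    have fm: "(\<lambda>p. f (ps p)) \<in> borel_measurable K" by (rule measurable_compose[OF ps regularD(1)[OF f]])
    have i: "integrable K (\<lambda>p. f (ps p))"
      by (rule K.integrable_const_bound[where B=1]) (use regularD(2)[OF f] fm in auto)
    have \<psi>m: "f \<in> borel_measurable \<rho>"
      using regularD(1)[OF f] measurable_cong_sets[OF \<rho>(2) refl] by blast
    have z: "norm (\<integral>x. f x \<partial>\<rho>) \<le> 1"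
    proof -
      have "norm (\<integral>x. f x \<partial>\<rho>) \<le> (\<integral>x. norm (f x) \<partial>\<rho>)" by (rule integral_norm_bound)
      also have "\<dots> \<le> (\<integral>x. 1 \<partial>\<rho>)"
      proof (rule integral_mono)
        show "integrable \<rho> (\<lambda>x. norm (f x))"
          by (rule R.integrable_const_bound[where B=1]) (use regularD(2)[OF f] \<psi>m in auto)
      qed (use regularD(2)[OF f] in auto)
      finally show ?thesis by (simp add: R.prob_space)
    qed
    have "(\<integral>p. f (ps p) \<partial>K) = (\<integral>n. (\<integral>z. f (ps (n, z)) \<partial>?Z) \<partial>?N)"
      using i unfolding K_def by (rule pN.integral_fst'[symmetric])
    also have "\<dots> = (\<integral>n. (\<integral>x. f x \<partial>\<rho>) ^ n \<partial>?N)"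
      by (simp add: ps_def integral_partial_sum[OF \<rho> f])
    also have "\<dots> = exp (of_real r * ((\<integral>x. f x \<partial>\<rho>) - 1))"
      by (rule integral_poisson_pmf_power[OF r z])
    finally show ?thesis .
  qed
  \<comment> \<open>The two transforms of products with \<open>\<eta>\<close> and
    \<open>cnj \<eta>\<close> come from two independent copies of the stable element, weighted by
    \<open>\<eta>\<close> and \<open>cnj \<eta>\<close>; the independent element \<open>ps\<close>
    supplies the exponential.\<close>
  define X1 where "X1 p = add (add (fst (fst p)) (snd (fst p))) (ps (snd p))" for p
  define w1 where "w1 p = \<eta> (fst (fst p)) * cnj (\<eta> (snd (fst p)))" for p :: "('a \<times> 'a) \<times> nat \<times> (nat \<Rightarrow> 'a)"
  define X2 where "X2 p = add (fst p) (snd p)" for p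
  \<comment> \<open>With \<open>c\<close> the transform of \<open>\<rho>\<close>, the compound
    Poisson transform is \<open>exp (r * (c - 1))\<close> instead of \<open>exp (q + r * c)\<close>.
    The quotient is the constant \<open>exp (- (q + r))\<close>, which becomes the weight on the
    other side.\<close>
  define w2 where "w2 p = (exp (- of_real (q + r)) :: complex)" for p :: "'a \<times> 'a"
  have idM: "(\<lambda>x. x) \<in> measurable \<mu> M" by (simp add: measurable_mu)
  note mf = measurable_compose[OF measurable_fst idM] and ms = measurable_compose[OF measurable_snd idM]
  have X1: "X1 \<in> measurable ((\<mu> \<Otimes>\<^sub>M \<mu>) \<Otimes>\<^sub>M K) M"
    unfolding X1_def
    by (intro measurable_add measurable_compose[OF measurable_fst mf] measurable_compose[OF measurable_fst ms]
      measurable_compose[OF measurable_snd ps])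
  have X2: "X2 \<in> measurable (\<mu> \<Otimes>\<^sub>M \<mu>) M"
    unfolding X2_def by (intro measurable_add mf ms)
  have hat1: "hat f 1 = (\<integral>x. f x \<partial>\<mu>)" for f unfolding hat_def by (simp add: scale_one)
  have gm: "f \<in> borel_measurable \<mu>" if "regular f" for f
    using regularD(1)[OF that] by (simp add: measurable_mu)
  have cn: "regular (\<lambda>x. cnj (\<eta> x))" by (rule regular_cnj[OF \<eta>])
  have pairm: "(\<lambda>p. f (fst p) * g (snd p)) \<in> borel_measurable (\<mu> \<Otimes>\<^sub>M \<mu>)" if "regular f" "regular g" for f g
    by (intro borel_measurable_times measurable_compose[OF measurable_fst gm] measurable_compose[OF measurable_snd gm] that)
  have w1: "integrable ((\<mu> \<Otimes>\<^sub>M \<mu>) \<Otimes>\<^sub>M K) w1"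
  proof (rule P1.P.integrable_const_bound[where B=1])
    show "AE p in (\<mu> \<Otimes>\<^sub>M \<mu>) \<Otimes>\<^sub>M K. norm (w1 p) \<le> 1"
      using mult_mono[OF regularD(2)[OF \<eta>] regularD(2)[OF \<eta>]] by (intro AE_I2) (simp add: norm_mult w1_def)
    show "w1 \<in> borel_measurable ((\<mu> \<Otimes>\<^sub>M \<mu>) \<Otimes>\<^sub>M K)"
      unfolding w1_def by (rule measurable_compose[OF measurable_fst pairm[OF \<eta> cn]])
  qed
  have w2: "integrable (\<mu> \<Otimes>\<^sub>M \<mu>) w2" unfolding w2_def by simp
  have I1: "(\<integral>p. f (X1 p) * w1 p \<partial>((\<mu> \<Otimes>\<^sub>M \<mu>) \<Otimes>\<^sub>M K))
    = hat (\<lambda>x. f x * \<eta> x) 1 * hat (\<lambda>x. f x * cnj (\<eta> x)) 1 * exp (of_real r * ((\<integral>x. f x \<partial>\<rho>) - 1))"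
    if f: "regular f" for f
  proof -
    have g1: "regular (\<lambda>x. f x * \<eta> x)" "regular (\<lambda>x. f x * cnj (\<eta> x))" by (intro regular_mult f \<eta> cn)+
    let ?g = "\<lambda>q. (f (fst q) * \<eta> (fst q)) * (f (snd q) * cnj (\<eta> (snd q)))"
    have "f (X1 p) * w1 p = ?g (fst p) * f (ps (snd p))" for p
      by (simp add: X1_def w1_def regularD(4)[OF f] mult_ac)
    then have "(\<integral>p. f (X1 p) * w1 p \<partial>((\<mu> \<Otimes>\<^sub>M \<mu>) \<Otimes>\<^sub>M K)) = (\<integral>p. ?g (fst p) * f (ps (snd p)) \<partial>((\<mu> \<Otimes>\<^sub>M \<mu>) \<Otimes>\<^sub>M K))"
      by (simp only:)
    also have "\<dots> = (\<integral>q. ?g q \<partial>(\<mu> \<Otimes>\<^sub>M \<mu>)) * (\<integral>p. f (ps p) \<partial>K)"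
    proof (rule integral_mult_pair_prob[OF MM.P.prob_space_axioms K])
      show "?g \<in> borel_measurable (\<mu> \<Otimes>\<^sub>M \<mu>)" by (rule pairm[OF g1])
      show "(\<lambda>p. f (ps p)) \<in> borel_measurable K" by (rule measurable_compose[OF ps regularD(1)[OF f]])
      show "norm (?g x) \<le> 1" for x
        using mult_mono[OF regularD(2)[OF g1(1), of "fst x"] regularD(2)[OF g1(2), of "snd x"]] by (simp only: norm_mult mult_1) auto
    qed (rule regularD(2)[OF f])
    also have "(\<integral>q. ?g q \<partial>(\<mu> \<Otimes>\<^sub>M \<mu>)) = (\<integral>x. f x * \<eta> x \<partial>\<mu>) * (\<integral>x. f x * cnj (\<eta> x) \<partial>\<mu>)"
      by (rule integral_mult_pair_prob[OF prob_space_axioms prob_space_axioms gm[OF g1(1)] gm[OF g1(2)] regularD(2)[OF g1(1)] regularD(2)[OF g1(2)]])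
    finally show ?thesis by (simp add: Kint[OF f] hat1)
  qed
  have I2: "(\<integral>p. f (X2 p) * w2 p \<partial>(\<mu> \<Otimes>\<^sub>M \<mu>)) = (hat f 1)\<^sup>2 * exp (- of_real (q + r))" if f: "regular f" for f
  proof -
    have "(\<integral>p. f (X2 p) * w2 p \<partial>(\<mu> \<Otimes>\<^sub>M \<mu>)) = (\<integral>p. f (fst p) * f (snd p) \<partial>(\<mu> \<Otimes>\<^sub>M \<mu>)) * exp (- of_real (q + r))"
      unfolding X2_def w2_def regularD(4)[OF f] by (rule Bochner_Integration.integral_mult_left_zero)
    also have "(\<integral>p. f (fst p) * f (snd p) \<partial>(\<mu> \<Otimes>\<^sub>M \<mu>)) = (\<integral>x. f x \<partial>\<mu>) * (\<integral>x. f x \<partial>\<mu>)"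
      by (rule integral_mult_pair_prob[OF prob_space_axioms prob_space_axioms gm[OF f] gm[OF f] regularD(2)[OF f] regularD(2)[OF f]])
    finally show ?thesis by (simp add: hat1 power2_eq_square)
  qed
  have E: "exp (of_real r * (c - 1)) = exp (of_real q + of_real r * c) * exp (- of_real (q + r) :: complex)" for c
    by (simp add: exp_add[symmetric] algebra_simps)
  have "(\<integral>p. \<psi> (X1 p) * w1 p \<partial>((\<mu> \<Otimes>\<^sub>M \<mu>) \<Otimes>\<^sub>M K)) = (\<integral>p. \<psi> (X2 p) * w2 p \<partial>(\<mu> \<Otimes>\<^sub>M \<mu>))"
  proof (rule character_semigroup_determines[OF space_M H gen _ _ X1 X2 w1 w2 _ regularD(1)[OF \<psi>] regularD(2)[OF \<psi>]])
    show "f \<in> borel_measurable M" if "f \<in> H" for f by (rule regularD(1)[OF Hg[OF that]])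
    show "norm (f x) \<le> 1" if "f \<in> H" for f x by (rule regularD(2)[OF Hg[OF that]])
    show "(\<integral>p. f (X1 p) * w1 p \<partial>((\<mu> \<Otimes>\<^sub>M \<mu>) \<Otimes>\<^sub>M K)) = (\<integral>p. f (X2 p) * w2 p \<partial>(\<mu> \<Otimes>\<^sub>M \<mu>))" if "f \<in> H" for f
      unfolding I1[OF Hg[OF that]] I2[OF Hg[OF that]] E eq[OF that, symmetric] by (simp only: mult.assoc)
  qed
  then show ?thesis unfolding I1[OF \<psi>] I2[OF \<psi>] E by (simp only: mult.assoc[symmetric] mult_right_cancel[OF exp_not_eq_zero])
qed

text \<open>The difference \<open>D\<close> of the two sides satisfies \<open>exp (D f) = 1\<close>
  and is followed along the scaled characters down to scale \<open>0\<close>, where it tends to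
  \<open>0\<close>. Continuity of the integral against \<open>\<rho>\<close> on this path cannot be
  taken from the stable law, as \<open>\<rho>\<close> is an arbitrary probability measure; it is
  extracted from the identity itself, whose real part carries no ambiguity.\<close>

lemma expo_second_difference:
  assumes \<eta>: "regular \<eta>" and \<rho>: "prob_space \<rho>" "sets \<rho> = sets M" and r: "r > 0"
    and eq: "\<And>f. regular f \<Longrightarrow> hat (\<lambda>x. f x * \<eta> x) 1 * hat (\<lambda>x. f x * cnj (\<eta> x)) 1
      * exp (of_real q + of_real r * (\<integral>x. f x \<partial>\<rho>)) = (hat f 1)\<^sup>2"
    and \<psi>: "regular \<psi>"
  shows "of_real q + of_real r * (\<integral>x. \<psi> x \<partial>\<rho>)
    = expo (\<lambda>x. \<psi> x * \<eta> x) + expo (\<lambda>x. \<psi> x * cnj (\<eta> x)) - 2 * expo \<psi>"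
proof -
  interpret R: prob_space \<rho> by fact
  have cn: "regular (\<lambda>x. cnj (\<eta> x))" by (rule regular_cnj[OF \<eta>])
  have rm: "f \<in> borel_measurable \<rho>" if "regular f" for f
    using regularD(1)[OF that] measurable_cong_sets[OF \<rho>(2) refl] by blast
  have ri: "integrable \<rho> f" if "regular f" for f
    by (rule R.integrable_const_bound[where B=1]) (use regularD(2)[OF that] rm[OF that] in auto)
  define B where "B f = expo (\<lambda>x. f x * \<eta> x) + expo (\<lambda>x. f x * cnj (\<eta> x)) - 2 * expo f" for f
  define D where "D f = of_real q + of_real r * (\<integral>x. f x \<partial>\<rho>) - B f" for f
  have expD: "exp (D f) = 1" if f: "regular f" for f
  proof -
    have h: "hat g 1 = exp (- expo g)" if "regular g" for g using hat_expo[OF that, of 1] by simp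
    have g1: "regular (\<lambda>x. f x * \<eta> x)" "regular (\<lambda>x. f x * cnj (\<eta> x))" by (intro regular_mult f \<eta> cn)+
    have "exp (- expo (\<lambda>x. f x * \<eta> x)) * exp (- expo (\<lambda>x. f x * cnj (\<eta> x)))
        * exp (of_real q + of_real r * (\<integral>x. f x \<partial>\<rho>)) = exp (- expo f) * exp (- expo f)"
      using eq[OF f] by (simp only: h[OF g1(1)] h[OF g1(2)] h[OF f] power2_eq_square)
    then have "exp (- expo (\<lambda>x. f x * \<eta> x)) * exp (- expo (\<lambda>x. f x * cnj (\<eta> x)))
        * exp (of_real q + of_real r * (\<integral>x. f x \<partial>\<rho>)) * (exp (expo f) * exp (expo f))
        = exp (- expo f) * exp (- expo f) * (exp (expo f) * exp (expo f))" by simp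
    then show ?thesis by (simp add: D_def B_def exp_add[symmetric] algebra_simps)
  qed
  \<comment> \<open>The ambiguity of the logarithm is purely imaginary, so real parts of integrals
    against \<open>\<rho>\<close> are functions of exponents, and these are continuous along scaled
    characters.\<close>
  have Re0: "Re (\<integral>x. f x \<partial>\<rho>) = (Re (B f) - q) / r" if "regular f" for f
  proof -
    have "Re (D f) = 0" using expD[OF that] by (simp add: exp_eq_1)
    then show ?thesis using r by (simp add: D_def field_simps)
  qed
  have gp: "regular (\<lambda>x. f (scl u x))" if "regular f" "u > 0" for f u by (rule regular_scale[OF that])
  have Bt: "((\<lambda>u. B (\<lambda>x. f (scl u x) * g x)) \<longlongrightarrow> B (\<lambda>x. f (scl t x) * g x)) (at t within {0<..})"
    if f: "regular f" and g: "regular g" and t: "t > 0" for f g t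
  proof -
    have "regular (\<lambda>x. g x * \<eta> x)" "regular (\<lambda>x. g x * cnj (\<eta> x))" by (intro regular_mult g \<eta> cn)+
    then show ?thesis unfolding B_def mult.assoc
      by (intro tendsto_intros expo_path_tendsto f g t)
  qed
  have Bt1: "((\<lambda>u. B (\<lambda>x. f (scl u x))) \<longlongrightarrow> B (\<lambda>x. f (scl t x))) (at t within {0<..})"
    if "regular f" "t > 0" for f t
    using Bt[OF that(1) regular_one that(2)] by simp
  have B1: "B (\<lambda>x. 1) = of_real (2 * Re (expo \<eta>))"
    unfolding B_def by (simp add: expo_one expo_cnj[OF \<eta>] complex_add_cnj)
  \<comment> \<open>The constant character evaluates \<open>q + r\<close>, which makes the limits of
    the two sides at scale \<open>0\<close> agree.\<close>
  have q1: "q + r = 2 * Re (expo \<eta>)"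
    using Re0[OF regular_one] r by (simp add: B1 R.prob_space field_simps)
  have B0: "((\<lambda>u. B (\<lambda>x. \<psi> (scl u x))) \<longlongrightarrow> of_real (q + r)) (at_right 0)"
  proof -
    have "((\<lambda>u. expo (\<lambda>x. \<psi> (scl u x) * 1)) \<longlongrightarrow> expo (\<lambda>x. 1)) (at_right 0)"
      by (rule expo_path_tendsto_0[OF \<psi> regular_one])
    then have "((\<lambda>u. B (\<lambda>x. \<psi> (scl u x))) \<longlongrightarrow> expo \<eta> + expo (\<lambda>x. cnj (\<eta> x)) - 2 * 0) (at_right 0)"
      unfolding B_def
      by (intro tendsto_intros expo_path_tendsto_0 \<psi> \<eta> cn) (simp add: expo_one)
    moreover have "expo \<eta> + expo (\<lambda>x. cnj (\<eta> x)) - 2 * 0 = of_real (q + r)"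
      unfolding q1 expo_cnj[OF \<eta>] by (simp add: complex_add_cnj)
    ultimately show ?thesis by (simp only:)
  qed
  have rho0: "((\<lambda>u. \<integral>x. \<psi> (scl u x) \<partial>\<rho>) \<longlongrightarrow> 1) (at_right 0)"
  proof -
    have "((\<lambda>u. (Re (B (\<lambda>x. \<psi> (scl u x))) - q) / r) \<longlongrightarrow> (Re (of_real (q + r)) - q) / r) (at_right 0)"
      by (intro tendsto_intros B0) (use r in simp)
    from tendsto_real_sqrt[OF tendsto_mult[OF tendsto_const tendsto_diff[OF tendsto_const this]], of 2 1]
    have l: "((\<lambda>u. sqrt (2 * (1 - (Re (B (\<lambda>x. \<psi> (scl u x))) - q) / r))) \<longlongrightarrow> 0) (at_right 0)"
      using r by simp
    have "((\<lambda>u. (\<integral>x. \<psi> (scl u x) \<partial>\<rho>) - 1) \<longlongrightarrow> 0) (at_right 0)"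
    proof (rule Lim_null_comparison[OF _ l])
      show "\<forall>\<^sub>F u in at_right 0. norm ((\<integral>x. \<psi> (scl u x) \<partial>\<rho>) - 1) \<le> sqrt (2 * (1 - (Re (B (\<lambda>x. \<psi> (scl u x))) - q) / r))"
      proof (rule eventually_mono[OF eventually_at_right_less[of 0]])
        fix u :: real assume u: "0 < u"
        define z where "z = (\<integral>x. \<psi> (scl u x) \<partial>\<rho>)"
        have "norm z \<le> (\<integral>x. norm (\<psi> (scl u x)) \<partial>\<rho>)" unfolding z_def by (rule integral_norm_bound)
        also have "\<dots> \<le> (\<integral>x. 1 \<partial>\<rho>)"
          by (rule integral_mono) (use ri[OF gp[OF \<psi> u]] regularD(2)[OF \<psi>] in auto)
        finally have "norm z \<le> 1" by (simp add: R.prob_space)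
        then have "(norm z)\<^sup>2 \<le> 1" by (simp add: power_le_one)
        \<comment> \<open>In the unit disc, closeness of \<open>Re z\<close> to \<open>1\<close>
          forces closeness of \<open>z\<close> to \<open>1\<close>, so control of real parts
          suffices.\<close>
        then have "(norm (z - 1))\<^sup>2 \<le> 2 * (1 - Re z)"
          unfolding cmod_power2 by (simp add: power2_eq_square algebra_simps)
        then have "norm (z - 1) \<le> sqrt (2 * (1 - Re z))" by (rule real_le_rsqrt)
        then show "norm ((\<integral>x. \<psi> (scl u x) \<partial>\<rho>) - 1) \<le> sqrt (2 * (1 - (Re (B (\<lambda>x. \<psi> (scl u x))) - q) / r))"
          by (simp only: z_def Re0[OF gp[OF \<psi> u]])
      qed
    qed
    then show ?thesis by (rule LIM_zero_cancel)
  qed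
  have rhot: "((\<lambda>u. \<integral>x. \<psi> (scl u x) \<partial>\<rho>) \<longlongrightarrow> (\<integral>x. \<psi> (scl t x) \<partial>\<rho>)) (at t within {0<..})" if t: "t > 0" for t
  proof -
    let ?\<psi>\<psi> = "\<lambda>x. \<psi> x * cnj (\<psi> x)"
    have g2: "regular ?\<psi>\<psi>" by (intro regular_mult regular_cnj \<psi>)
    have gc: "regular (\<lambda>x. cnj (\<psi> (scl t x)))" by (rule regular_cnj[OF gp[OF \<psi> t]])
    define J where "J f = (Re (B f) - q) / r" for f
    \<comment> \<open>As for the stable law, the mean square of the increment under
      \<open>\<rho>\<close> involves only real parts of integrals of characters, which
      \<open>Re0\<close> expresses by exponents.\<close>
    define Q where "Q u = J (\<lambda>x. \<psi> (scl u x) * cnj (\<psi> (scl u x))) + J (\<lambda>x. \<psi> (scl t x) * cnj (\<psi> (scl t x)))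
      - 2 * J (\<lambda>x. \<psi> (scl u x) * cnj (\<psi> (scl t x)))" for u
    have "((\<lambda>u. J (\<lambda>x. \<psi> (scl u x) * cnj (\<psi> (scl u x)))) \<longlongrightarrow> J (\<lambda>x. \<psi> (scl t x) * cnj (\<psi> (scl t x)))) (at t within {0<..})"
      unfolding J_def by (intro tendsto_intros Bt1[OF g2 t]) (use r in simp)
    moreover have "((\<lambda>u. J (\<lambda>x. \<psi> (scl u x) * cnj (\<psi> (scl t x)))) \<longlongrightarrow> J (\<lambda>x. \<psi> (scl t x) * cnj (\<psi> (scl t x)))) (at t within {0<..})"
      unfolding J_def by (intro tendsto_intros Bt[OF \<psi> gc t]) (use r in simp)
    ultimately have "(Q \<longlongrightarrow> J (\<lambda>x. \<psi> (scl t x) * cnj (\<psi> (scl t x))) + J (\<lambda>x. \<psi> (scl t x) * cnj (\<psi> (scl t x)))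
      - 2 * J (\<lambda>x. \<psi> (scl t x) * cnj (\<psi> (scl t x)))) (at t within {0<..})"
      unfolding Q_def by (intro tendsto_intros)
    then have "((\<lambda>u. sqrt (Q u)) \<longlongrightarrow> sqrt 0) (at t within {0<..})" by (intro tendsto_real_sqrt) simp
    then have lim: "((\<lambda>u. sqrt (Q u)) \<longlongrightarrow> 0) (at t within {0<..})" by simp
    have "((\<lambda>u. (\<integral>x. \<psi> (scl u x) \<partial>\<rho>) - (\<integral>x. \<psi> (scl t x) \<partial>\<rho>)) \<longlongrightarrow> 0) (at t within {0<..})"
    proof (rule Lim_null_comparison[OF _ lim])
      show "\<forall>\<^sub>F u in at t within {0<..}. norm ((\<integral>x. \<psi> (scl u x) \<partial>\<rho>) - (\<integral>x. \<psi> (scl t x) \<partial>\<rho>)) \<le> sqrt (Q u)"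
        unfolding eventually_at_filter
      proof (intro always_eventually allI impI)
        fix u :: real assume "u \<in> {0<..}"
        then have u: "u > 0" by simp
        have g: "regular (\<lambda>x. \<psi> (scl u x) * cnj (\<psi> (scl u x)))" "regular (\<lambda>x. \<psi> (scl t x) * cnj (\<psi> (scl t x)))"
          "regular (\<lambda>x. \<psi> (scl u x) * cnj (\<psi> (scl t x)))"
          by (intro regular_mult regular_cnj gp \<psi> u t)+
        have [measurable]: "(\<lambda>x. \<psi> (scl u x)) \<in> borel_measurable \<rho>" "(\<lambda>x. \<psi> (scl t x)) \<in> borel_measurable \<rho>"
          using rm gp[OF \<psi>] u t by auto
        have "(\<integral>x. \<psi> (scl u x) \<partial>\<rho>) - (\<integral>x. \<psi> (scl t x) \<partial>\<rho>) = (\<integral>x. \<psi> (scl u x) - \<psi> (scl t x) \<partial>\<rho>)"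
          by (rule Bochner_Integration.integral_diff[symmetric]) (intro ri gp \<psi> u t)+
        then have "norm ((\<integral>x. \<psi> (scl u x) \<partial>\<rho>) - (\<integral>x. \<psi> (scl t x) \<partial>\<rho>)) \<le> (\<integral>x. norm (\<psi> (scl u x) - \<psi> (scl t x)) \<partial>\<rho>)"
          by (simp only: integral_norm_bound)
        moreover have "(\<integral>x. norm (\<psi> (scl u x) - \<psi> (scl t x)) \<partial>\<rho>)\<^sup>2 \<le> (\<integral>x. (norm (\<psi> (scl u x) - \<psi> (scl t x)))\<^sup>2 \<partial>\<rho>)"
        proof (rule R.norm_integral_square_le)
          show "norm (\<psi> (scl u x) - \<psi> (scl t x)) \<le> 1 + 1" for x
            by (rule order_trans[OF norm_triangle_ineq4 add_mono]) (rule regularD(2)[OF \<psi>])+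
        qed measurable
        moreover have "(\<integral>x. (norm (\<psi> (scl u x) - \<psi> (scl t x)))\<^sup>2 \<partial>\<rho>) = Q u"
        proof -
          have "(\<integral>x. (norm (\<psi> (scl u x) - \<psi> (scl t x)))\<^sup>2 \<partial>\<rho>)
            = (\<integral>x. Re (\<psi> (scl u x) * cnj (\<psi> (scl u x))) + Re (\<psi> (scl t x) * cnj (\<psi> (scl t x)))
                - 2 * Re (\<psi> (scl u x) * cnj (\<psi> (scl t x))) \<partial>\<rho>)"
            by (simp only: cmod_diff_square)
          also have "\<dots> = Re (\<integral>x. \<psi> (scl u x) * cnj (\<psi> (scl u x)) \<partial>\<rho>) + Re (\<integral>x. \<psi> (scl t x) * cnj (\<psi> (scl t x)) \<partial>\<rho>)
            - 2 * Re (\<integral>x. \<psi> (scl u x) * cnj (\<psi> (scl t x)) \<partial>\<rho>)"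
            unfolding integral_Re[OF ri[OF g(1)], symmetric] integral_Re[OF ri[OF g(2)], symmetric] integral_Re[OF ri[OF g(3)], symmetric]
            using integrable_Re[OF ri[OF g(1)]] integrable_Re[OF ri[OF g(2)]] integrable_Re[OF ri[OF g(3)]]
            by (subst Bochner_Integration.integral_diff) (simp_all only: Bochner_Integration.integrable_add Bochner_Integration.integral_add integrable_mult_right integral_mult_right_zero)
          also have "\<dots> = Q u" by (simp only: Re0[OF g(1)] Re0[OF g(2)] Re0[OF g(3)] Q_def J_def)
          finally show ?thesis .
        qed
        ultimately show "norm ((\<integral>x. \<psi> (scl u x) \<partial>\<rho>) - (\<integral>x. \<psi> (scl t x) \<partial>\<rho>)) \<le> sqrt (Q u)"
          by (metis order_trans real_le_rsqrt)
      qed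
    qed
    then show ?thesis by (rule LIM_zero_cancel)
  qed
  have "D (\<lambda>x. \<psi> (scl 1 x)) = 0"
  proof (rule exp_eq_1_path_constant[where D="\<lambda>t. D (\<lambda>x. \<psi> (scl t x))"])
    show "continuous_on {0<..} (\<lambda>t. D (\<lambda>x. \<psi> (scl t x)))"
      unfolding continuous_on_def D_def
      by (intro ballI tendsto_intros rhot Bt1 \<psi>) auto
    have "((\<lambda>t. D (\<lambda>x. \<psi> (scl t x))) \<longlongrightarrow> of_real q + of_real r * 1 - of_real (q + r)) (at_right 0)"
      unfolding D_def by (intro tendsto_intros rho0 B0)
    then show "((\<lambda>t. D (\<lambda>x. \<psi> (scl t x))) \<longlongrightarrow> 0) (at_right 0)" by simp
    show "exp (D (\<lambda>x. \<psi> (scl t x))) = 1" if "t > 0" for t by (rule expD[OF gp[OF \<psi> that]])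
  qed simp
  then show ?thesis by (simp add: D_def B_def scale_one)
qed

end

section \<open>Homogeneity of the Levy measure\<close>

lemma star_additive_pair:
  assumes l: "star_additive H l" and f: "f \<in> H" and g: "g \<in> H" and c: "(\<lambda>x. cnj (g x)) \<in> H"
  shows "l (\<lambda>x. f x * g x) + l (\<lambda>x. f x * cnj (g x)) = 2 * l f"
proof -
  have A: "\<forall>f\<in>H. \<forall>g\<in>H. l (\<lambda>x. f x * g x) = l f + l g" "\<forall>f\<in>H. l (\<lambda>x. cnj (f x)) = - l f"
    using l unfolding star_additive_def by simp_all
  show ?thesis using A(1)[rule_format, OF f g] A(1)[rule_format, OF f c] A(2)[rule_format, OF g] by simp
qed

section \<open>Second differences in the Levy-Khinchin formula\<close>

locale levy_stable_cone = stable_cone M add e scl star \<mu> \<alpha> side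
  for M :: "'a measure" and add e scl star \<mu> \<alpha> side +
  fixes H :: "('a \<Rightarrow> complex) set" and L \<phi> and \<nu> :: "'a measure"
  assumes H_semigroup: "character_semigroup H" and H_generates: "generates H M"
    and H_countable: "countable H" and H_separating: "separating H"
    and H_regular: "f \<in> H \<Longrightarrow> regular f"
    and L_levy: "levy_function H L" and phi_exponent: "laplace_exponent H \<mu> \<phi>"
    and nu_levy: "admits_levy_measure M e H L \<phi> \<nu>"
begin

lemma H_one: "(\<lambda>x. 1) \<in> H" and H_mult: "f \<in> H \<Longrightarrow> g \<in> H \<Longrightarrow> (\<lambda>x. f x * g x) \<in> H"
  and H_cnj: "f \<in> H \<Longrightarrow> (\<lambda>x. cnj (f x)) \<in> H"
  using H_semigroup by (auto simp: character_semigroup_def)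

lemma sets_nu: "sets \<nu> = sets (restrict_space M (- {e}))"
  using nu_levy by (simp add: admits_levy_measure_def punctured_def)

lemma space_nu: "space \<nu> = - {e}"
  using sets_eq_imp_space_eq[OF sets_nu] by (simp add: space_restrict_space space_M)

lemma measurable_nu: "f \<in> measurable M N \<Longrightarrow> f \<in> measurable \<nu> N"
  using measurable_cong_sets[OF sets_nu refl] measurable_restrict_space1 by blast

text \<open>Separation singles out \<open>e\<close> as the only common solution of the countably
  many equations \<open>f x = 1\<close>.\<close>

lemma neutral_sets: "- {e} \<in> sets M"
proof -
  have "{e} = (\<Inter>f\<in>H. {x \<in> space M. f x = 1})"
  proof (intro equalityI subsetI)
    fix x assume "x \<in> (\<Inter>f\<in>H. {x \<in> space M. f x = 1})"
    then have "\<forall>f\<in>H. f x = f e" using regularD(3)[OF H_regular] by auto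
    then show "x \<in> {e}" using H_separating unfolding separating_def by blast
  qed (auto simp: space_M regularD(3)[OF H_regular])
  moreover have "(\<Inter>f\<in>H. {x \<in> space M. f x = 1}) \<in> sets M"
  proof (rule sets.countable_INT'[OF H_countable])
    show "H \<noteq> {}" using H_one by auto
    show "(\<lambda>f. {x \<in> space M. f x = 1}) ` H \<subseteq> sets M"
    proof safe
      fix f assume "f \<in> H"
      then have [measurable]: "f \<in> borel_measurable M" using regularD(1)[OF H_regular] by simp
      show "{x \<in> space M. f x = 1} \<in> sets M" by measurable
    qed
  qed
  ultimately have "{e} \<in> sets M" by (simp only:)
  then have "space M - {e} \<in> sets M" by (rule sets.compl_sets)
  then show ?thesis by (simp add: space_M Compl_eq_Diff_UNIV)
qed

lemma char_embedding_measurable: "char_embedding H \<in> measurable \<nu> (punctured_dual H)"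
  unfolding punctured_dual_def
proof (rule measurable_restrict_space2)
  show "char_embedding H \<in> measurable \<nu> (PiM H (\<lambda>_. borel))"
    unfolding char_embedding_def
    by (rule measurable_restrict) (rule measurable_nu[OF regularD(1)[OF H_regular]])
  show "char_embedding H \<in> space \<nu> \<rightarrow> dual_chars H - {\<lambda>f\<in>H. 1}"
  proof
    fix x assume "x \<in> space \<nu>"
    then have "x \<noteq> e" by (simp add: space_nu)
    then obtain f where f: "f \<in> H" "f x \<noteq> f e" using H_separating unfolding separating_def by blast
    then have "char_embedding H x f \<noteq> (\<lambda>f\<in>H. 1) f" by (simp add: char_embedding_def regularD(3)[OF H_regular])
    then have "char_embedding H x \<noteq> (\<lambda>f\<in>H. 1)" by auto
    moreover have "char_embedding H x \<in> dual_chars H"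
      unfolding dual_chars_def char_embedding_def
      using H_one H_mult H_cnj regularD(2)[OF H_regular] by simp
    ultimately show "char_embedding H x \<in> dual_chars H - {\<lambda>f\<in>H. 1}" by simp
  qed
qed

lemma one_minus_Re_ge_0: "regular f \<Longrightarrow> 0 \<le> 1 - Re (f x)"
  using regularD(2)[of f x] complex_Re_le_cmod[of "f x"] by linarith

lemma one_minus_Re_le: "regular f \<Longrightarrow> 1 - Re (f x) \<le> 2"
  using regularD(2)[of f x] abs_Re_le_cmod[of "f x"] by linarith

lemma nn_integral_levy_finite:
  assumes "f \<in> H"
  shows "(\<integral>\<^sup>+x. ennreal (1 - Re (f x)) \<partial>\<nu>) < \<infinity>"
proof -
  have "(\<integral>\<^sup>+\<rho>. ennreal (1 - Re (\<rho> f)) \<partial>distr \<nu> (punctured_dual H) (char_embedding H)) < \<infinity>"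
    using nu_levy assms unfolding admits_levy_measure_def levy_khinchin_def levy_integrator_def by blast
  moreover have "(\<lambda>\<rho>. ennreal (1 - Re (\<rho> f))) \<in> borel_measurable (punctured_dual H)"
  proof -
    have [measurable]: "(\<lambda>\<rho>. \<rho> f) \<in> borel_measurable (punctured_dual H)"
      unfolding punctured_dual_def
      by (rule measurable_restrict_space1) (rule measurable_component_singleton[OF assms])
    show ?thesis by measurable
  qed
  ultimately show ?thesis
    using assms by (simp add: nn_integral_distr[OF char_embedding_measurable] char_embedding_def)
qed

lemma integrable_levy:
  assumes f: "f \<in> H" shows "integrable \<nu> (\<lambda>x. 1 - Re (f x))"
proof (rule integrableI_nonneg)
  have "f \<in> borel_measurable \<nu>" by (rule measurable_nu[OF regularD(1)[OF H_regular[OF f]]])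
  then show "(\<lambda>x. 1 - Re (f x)) \<in> borel_measurable \<nu>" by measurable
  show "AE x in \<nu>. 0 \<le> 1 - Re (f x)" using one_minus_Re_ge_0[OF H_regular[OF f]] by (intro AE_I2)
qed (rule nn_integral_levy_finite[OF f])

lemma integrable_levy_mult:
  fixes g :: "'a \<Rightarrow> complex"
  assumes f: "f \<in> H" and g: "g \<in> borel_measurable M" and gb: "\<And>x. norm (g x) \<le> C"
  shows "integrable \<nu> (\<lambda>x. g x * of_real (1 - Re (f x)))"
proof (rule Bochner_Integration.integrable_bound)
  show "integrable \<nu> (\<lambda>x. C * (1 - Re (f x)))" using integrable_levy[OF f] by simp
  have [measurable]: "f \<in> borel_measurable \<nu>" "g \<in> borel_measurable \<nu>"
    using measurable_nu[OF regularD(1)[OF H_regular[OF f]]] measurable_nu[OF g] by auto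
  show "(\<lambda>x. g x * of_real (1 - Re (f x))) \<in> borel_measurable \<nu>" by measurable
  have "norm (g x * of_real (1 - Re (f x))) \<le> norm (C * (1 - Re (f x)))" for x
  proof -
    have "norm (g x * of_real (1 - Re (f x))) = norm (g x) * (1 - Re (f x))"
      using one_minus_Re_ge_0[OF H_regular[OF f], of x] by (simp only: norm_mult norm_of_real abs_of_nonneg)
    also have "\<dots> \<le> C * (1 - Re (f x))"
      by (rule mult_right_mono[OF gb one_minus_Re_ge_0[OF H_regular[OF f]]])
    finally show ?thesis by simp
  qed
  then show "AE x in \<nu>. norm (g x * of_real (1 - Re (f x))) \<le> norm (C * (1 - Re (f x)))" by (intro AE_I2)
qed

text \<open>Second differences remove the additive part and the compensating term.\<close>

lemma phi_second_difference:
  obtains q :: "('a \<Rightarrow> complex) \<Rightarrow> real" where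
    "\<And>f \<eta>. f \<in> H \<Longrightarrow> \<eta> \<in> H \<Longrightarrow> \<phi> (\<lambda>x. f x * \<eta> x) + \<phi> (\<lambda>x. f x * cnj (\<eta> x)) - 2 * \<phi> f
      = of_real (2 * q \<eta>) + 2 * (\<integral>x. f x * of_real (1 - Re (\<eta> x)) \<partial>\<nu>)"
proof -
  let ?\<kappa> = "distr \<nu> (punctured_dual H) (char_embedding H)"
  let ?E = "char_embedding H"
  have "levy_khinchin H L \<phi> ?\<kappa>" using nu_levy unfolding admits_levy_measure_def by blast
  then obtain l q where li: "levy_integrator H ?\<kappa>" and l: "star_additive H l" and q: "nonneg_quadratic_form H q"
    and phi: "\<And>f. f \<in> H \<Longrightarrow> \<phi> f = \<phi> (\<lambda>x. 1) + \<i> * of_real (l f) + of_real (q f)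
                   + (\<integral>\<rho>. (1 - \<rho> f + \<i> * of_real (L f \<rho>)) \<partial>?\<kappa>)"
    unfolding levy_khinchin_def by blast
  define T where "T f x = 1 - f x + \<i> * of_real (L f (?E x))" for f x
  have int: "integrable ?\<kappa> (\<lambda>\<rho>. 1 - \<rho> f + \<i> * of_real (L f \<rho>))" if "f \<in> H" for f
    using L_levy li that unfolding levy_function_def by blast
  have Eapp: "?E x f = f x" if "f \<in> H" for x f using that by (simp add: char_embedding_def)
  have Tint: "integrable \<nu> (T f)" if f: "f \<in> H" for f
    using integrable_distr[OF char_embedding_measurable int[OF f]] unfolding T_def[abs_def] by (simp add: Eapp[OF f])
  have phiT: "\<phi> f = \<phi> (\<lambda>x. 1) + \<i> * of_real (l f) + of_real (q f) + (\<integral>x. T f x \<partial>\<nu>)" if f: "f \<in> H" for f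
  proof -
    have m: "(\<lambda>\<rho>. 1 - \<rho> f + \<i> * of_real (L f \<rho>)) \<in> borel_measurable (punctured_dual H)"
      using borel_measurable_integrable[OF int[OF f]] by simp
    have "(\<integral>\<rho>. (1 - \<rho> f + \<i> * of_real (L f \<rho>)) \<partial>?\<kappa>) = (\<integral>x. T f x \<partial>\<nu>)"
      unfolding integral_distr[OF char_embedding_measurable m] T_def by (simp add: Eapp[OF f])
    with phi[OF f] show ?thesis by simp
  qed
  show thesis
  proof (rule that[of q])
    fix f \<eta> assume f: "f \<in> H" and \<eta>: "\<eta> \<in> H"
    let ?a = "\<lambda>x. f x * \<eta> x" let ?b = "\<lambda>x. f x * cnj (\<eta> x)"
    have a: "?a \<in> H" and b: "?b \<in> H" and c: "(\<lambda>x. cnj (\<eta> x)) \<in> H"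
      using H_mult[OF f \<eta>] H_mult[OF f H_cnj[OF \<eta>]] H_cnj[OF \<eta>] .
    have lab: "l ?a + l ?b = 2 * l f"
      by (rule star_additive_pair[OF l f \<eta> c])
    \<comment> \<open>The parallelogram law leaves the constant \<open>2 * q \<eta>\<close>,
      independent of \<open>f\<close>; it is all that remains of the quadratic part.\<close>
    have qab: "q ?a + q ?b = 2 * q f + 2 * q \<eta>"
      using q f \<eta> unfolding nonneg_quadratic_form_def by simp
    have "T ?a x + T ?b x - 2 * T f x = 2 * (f x * of_real (1 - Re (\<eta> x)))" if "x \<in> space \<nu>" for x
    proof -
      have "?E x \<in> space (punctured_dual H)" by (rule measurable_space[OF char_embedding_measurable that])
      then have "star_additive H (\<lambda>f. L f (?E x))" using L_levy unfolding levy_function_def by blast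
      from star_additive_pair[OF this f \<eta> c]
      have "L ?a (?E x) + L ?b (?E x) - 2 * L f (?E x) = 0" by simp
      moreover have "T ?a x + T ?b x - 2 * T f x = f x * (2 - (\<eta> x + cnj (\<eta> x)))
          + \<i> * of_real (L ?a (?E x) + L ?b (?E x) - 2 * L f (?E x))"
        unfolding T_def by (simp add: algebra_simps)
      ultimately have "T ?a x + T ?b x - 2 * T f x = f x * (2 - (\<eta> x + cnj (\<eta> x)))"
        by (simp only: of_real_0 mult_zero_right add_0_right)
      then show ?thesis unfolding complex_add_cnj by (simp add: algebra_simps)
    qed
    then have "(\<integral>x. T ?a x + T ?b x - 2 * T f x \<partial>\<nu>) = (\<integral>x. 2 * (f x * of_real (1 - Re (\<eta> x))) \<partial>\<nu>)"
      by (rule Bochner_Integration.integral_cong[OF refl])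
    then have Tab: "(\<integral>x. T ?a x \<partial>\<nu>) + (\<integral>x. T ?b x \<partial>\<nu>) - 2 * (\<integral>x. T f x \<partial>\<nu>) = 2 * (\<integral>x. f x * of_real (1 - Re (\<eta> x)) \<partial>\<nu>)"
      using Tint[OF a] Tint[OF b] Tint[OF f] by simp
    have "\<phi> ?a + \<phi> ?b - 2 * \<phi> f = \<i> * of_real (l ?a + l ?b - 2 * l f) + of_real (q ?a + q ?b - 2 * q f)
      + ((\<integral>x. T ?a x \<partial>\<nu>) + (\<integral>x. T ?b x \<partial>\<nu>) - 2 * (\<integral>x. T f x \<partial>\<nu>))"
      by (subst phiT[OF a], subst phiT[OF b], subst phiT[OF f]) (simp add: algebra_simps)
    then show "\<phi> ?a + \<phi> ?b - 2 * \<phi> f = of_real (2 * q \<eta>) + 2 * (\<integral>x. f x * of_real (1 - Re (\<eta> x)) \<partial>\<nu>)"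
      unfolding Tab lab qab by simp
  qed
qed

text \<open>The measure with density \<open>1 - Re \<eta>\<close> with respect to
  \<open>\<nu>\<close> is finite and, after normalization, plays the role of \<open>\<rho>\<close>
  in the transfer from \<open>H\<close> to all regular \<open>\<psi>\<close>. The number
  \<open>q \<eta>\<close> stays unknown, but it does not depend on \<open>\<psi>\<close>.\<close>

lemma levy_second_difference:
  obtains q :: "('a \<Rightarrow> complex) \<Rightarrow> real" where
    "\<And>\<psi> \<eta>. regular \<psi> \<Longrightarrow> \<eta> \<in> H \<Longrightarrow> of_real (2 * q \<eta>) + 2 * (\<integral>x. \<psi> x * of_real (1 - Re (\<eta> x)) \<partial>\<nu>)
      = expo (\<lambda>x. \<psi> x * \<eta> x) + expo (\<lambda>x. \<psi> x * cnj (\<eta> x)) - 2 * expo \<psi>"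
proof -
  obtain q where q: "\<And>f \<eta>. f \<in> H \<Longrightarrow> \<eta> \<in> H \<Longrightarrow> \<phi> (\<lambda>x. f x * \<eta> x) + \<phi> (\<lambda>x. f x * cnj (\<eta> x)) - 2 * \<phi> f
      = of_real (2 * q \<eta>) + 2 * (\<integral>x. f x * of_real (1 - Re (\<eta> x)) \<partial>\<nu>)"
    using phi_second_difference by blast
  have hphi: "hat f 1 = exp (- \<phi> f)" if "f \<in> H" for f
    using phi_exponent that unfolding laplace_exponent_def hat_def by (simp add: scale_one)
  have eqH: "hat (\<lambda>x. f x * \<eta> x) 1 * hat (\<lambda>x. f x * cnj (\<eta> x)) 1
      * exp (of_real (2 * q \<eta>) + 2 * (\<integral>x. f x * of_real (1 - Re (\<eta> x)) \<partial>\<nu>)) = (hat f 1)\<^sup>2"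
    if f: "f \<in> H" and \<eta>: "\<eta> \<in> H" for f \<eta>
    unfolding q[OF f \<eta>, symmetric] hphi[OF H_mult[OF f \<eta>]] hphi[OF H_mult[OF f H_cnj[OF \<eta>]]] hphi[OF f]
    by (simp add: power2_eq_square exp_add[symmetric])
  show thesis
  proof (rule that[of q])
    fix \<psi> \<eta> assume \<psi>: "regular \<psi>" and \<eta>: "\<eta> \<in> H"
    note g\<eta> = H_regular[OF \<eta>]
    define m where "m = (\<integral>x. 1 - Re (\<eta> x) \<partial>\<nu>)"
    have m0: "m \<ge> 0" unfolding m_def by (rule Bochner_Integration.integral_nonneg) (rule one_minus_Re_ge_0[OF g\<eta>])
    have [measurable]: "\<eta> \<in> borel_measurable \<nu>" by (rule measurable_nu[OF regularD(1)[OF g\<eta>]])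
    \<comment> \<open>The transfer lemmas ask for a probability measure and a positive rate. If the
      density has mass zero, the Dirac measure at \<open>e\<close> with rate \<open>1\<close> serves
      instead, and its constant contribution is compensated by subtracting \<open>1\<close> in
      \<open>p\<close>.\<close>
    have "\<exists>\<rho> r p. prob_space \<rho> \<and> sets \<rho> = sets M \<and> r > 0 \<and> (\<forall>f. regular f \<longrightarrow>
      of_real p + of_real r * (\<integral>x. f x \<partial>\<rho>) = of_real (2 * q \<eta>) + 2 * (\<integral>x. f x * of_real (1 - Re (\<eta> x)) \<partial>\<nu>))"
    proof (cases "m = 0")
      case True
      have "AE x in \<nu>. 1 - Re (\<eta> x) = 0"
        using integral_nonneg_eq_0_iff_AE[OF integrable_levy[OF \<eta>]] one_minus_Re_ge_0[OF g\<eta>] True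
        by (simp add: m_def)
      then have z: "(\<integral>x. f x * of_real (1 - Re (\<eta> x)) \<partial>\<nu>) = 0" if "regular f" for f
      proof -
        have "(\<integral>x. f x * of_real (1 - Re (\<eta> x)) \<partial>\<nu>) = (\<integral>x. 0 \<partial>\<nu>)"
        proof (rule integral_cong_AE)
          have [measurable]: "f \<in> borel_measurable \<nu>" by (rule measurable_nu[OF regularD(1)[OF that]])
          show "(\<lambda>x. f x * of_real (1 - Re (\<eta> x))) \<in> borel_measurable \<nu>" by measurable
          show "AE x in \<nu>. f x * of_real (1 - Re (\<eta> x)) = 0"
            using \<open>AE x in \<nu>. 1 - Re (\<eta> x) = 0\<close> by eventually_elim simp
        qed simp
        then show ?thesis by simp
      qed
      have "(\<integral>x. f x \<partial>return M e) = 1" if "regular f" for f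
        by (subst integral_return) (auto simp: space_M regularD(1,3)[OF that])
      then show ?thesis using z
        by (intro exI[of _ "return M e"] exI[of _ 1] exI[of _ "2 * q \<eta> - 1"])
          (simp add: prob_space_return space_M)
    next
      case False
      then have m: "m > 0" using m0 by simp
      define d where "d x = (1 - Re (\<eta> x)) / m" for x
      have d0: "0 \<le> d x" for x unfolding d_def using one_minus_Re_ge_0[OF g\<eta>] m by simp
      have [measurable]: "d \<in> borel_measurable \<nu>" unfolding d_def[abs_def] by measurable
      define \<rho> where "\<rho> = distr (density \<nu> d) M (\<lambda>x. x)"
      have idm: "(\<lambda>x. x) \<in> measurable (density \<nu> d) M"
        using measurable_nu[of "\<lambda>x. x" M] by simp
      have "emeasure (density \<nu> d) (space \<nu>) = (\<integral>\<^sup>+x. ennreal (d x) \<partial>\<nu>)"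
        by (subst emeasure_density) (auto intro!: nn_integral_cong)
      also have "\<dots> = ennreal (\<integral>x. d x \<partial>\<nu>)"
        by (rule nn_integral_eq_integral) (use integrable_levy[OF \<eta>] d0 in \<open>auto simp: d_def\<close>)
      also have "(\<integral>x. d x \<partial>\<nu>) = 1" unfolding d_def using m by (simp add: m_def)
      finally have "prob_space (density \<nu> d)" by (intro prob_spaceI) simp
      then have p: "prob_space \<rho>" unfolding \<rho>_def by (rule prob_space.prob_space_distr[OF _ idm])
      have "(\<integral>x. f x \<partial>\<rho>) = (\<integral>x. f x * of_real (1 - Re (\<eta> x)) \<partial>\<nu>) / of_real m" if f: "regular f" for f
      proof -
        have "(\<integral>x. f x \<partial>\<rho>) = (\<integral>x. f x \<partial>density \<nu> d)"
          unfolding \<rho>_def by (rule integral_distr[OF idm regularD(1)[OF f]])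
        also have "\<dots> = (\<integral>x. d x *\<^sub>R f x \<partial>\<nu>)"
          by (rule integral_density) (use measurable_nu[OF regularD(1)[OF f]] d0 in auto)
        also have "\<dots> = (\<integral>x. f x * of_real (1 - Re (\<eta> x)) / of_real m \<partial>\<nu>)"
          by (simp add: d_def scaleR_conv_of_real mult.commute)
        finally show ?thesis by simp
      qed
      then show ?thesis using p m
        by (intro exI[of _ \<rho>] exI[of _ "2 * m"] exI[of _ "2 * q \<eta>"]) (simp add: \<rho>_def)
    qed
    then obtain \<rho> r p where \<rho>: "prob_space \<rho>" "sets \<rho> = sets M" and r: "r > 0"
      and eq: "\<And>f. regular f \<Longrightarrow> of_real p + of_real r * (\<integral>x. f x \<partial>\<rho>)
        = of_real (2 * q \<eta>) + 2 * (\<integral>x. f x * of_real (1 - Re (\<eta> x)) \<partial>\<nu>)" by blast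
    have "of_real p + of_real r * (\<integral>x. \<psi> x \<partial>\<rho>) = expo (\<lambda>x. \<psi> x * \<eta> x) + expo (\<lambda>x. \<psi> x * cnj (\<eta> x)) - 2 * expo \<psi>"
    proof (rule expo_second_difference[OF g\<eta> \<rho> r _ \<psi>])
      fix f assume "regular f"
      then show "hat (\<lambda>x. f x * \<eta> x) 1 * hat (\<lambda>x. f x * cnj (\<eta> x)) 1
        * exp (of_real p + of_real r * (\<integral>x. f x \<partial>\<rho>)) = (hat f 1)\<^sup>2"
      proof (rule transfer_identity[OF H_semigroup H_generates H_regular g\<eta> \<rho> r, rotated 2])
        fix f assume f: "f \<in> H"
        show "hat (\<lambda>x. f x * \<eta> x) 1 * hat (\<lambda>x. f x * cnj (\<eta> x)) 1
          * exp (of_real p + of_real r * (\<integral>x. f x \<partial>\<rho>)) = (hat f 1)\<^sup>2"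
          unfolding eq[OF H_regular[OF f]] by (rule eqH[OF f \<eta>])
      qed
    qed
    then show "of_real (2 * q \<eta>) + 2 * (\<integral>x. \<psi> x * of_real (1 - Re (\<eta> x)) \<partial>\<nu>)
      = expo (\<lambda>x. \<psi> x * \<eta> x) + expo (\<lambda>x. \<psi> x * cnj (\<eta> x)) - 2 * expo \<psi>"
      unfolding eq[OF \<psi>] .
  qed
qed

text \<open>\<open>\<nu>\<close> may be infinite, so characters do not determine it directly. They
  determine the finite measures with densities \<open>W n\<close> and their counterparts under
  \<open>T\<close>. A summable combination \<open>V\<close> of the weights is finite, and positive
  away from \<open>e\<close>; dividing by it recovers \<open>\<nu>\<close>.\<close>

lemma nn_integral_transform:
  fixes W :: "nat \<Rightarrow> 'a \<Rightarrow> real"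
  assumes T: "T \<in> measurable M M" and Te: "\<And>x. x \<noteq> e \<Longrightarrow> T x \<noteq> e" and c: "c > 0"
    and Wm: "\<And>n. W n \<in> borel_measurable M" and W0: "\<And>n x. 0 \<le> W n x" and W4: "\<And>n x. W n x \<le> 4"
    and Wpos: "\<And>x. x \<noteq> e \<Longrightarrow> \<exists>n. W n x > 0"
    and i1: "\<And>n. integrable \<nu> (\<lambda>x. W n (T x))" and i2: "\<And>n. integrable \<nu> (W n)"
    and eq: "\<And>f n. f \<in> H \<Longrightarrow> (\<integral>x. f (T x) * of_real (W n (T x)) \<partial>\<nu>) = of_real c * (\<integral>x. f x * of_real (W n x) \<partial>\<nu>)"
    and g: "g \<in> borel_measurable M"
  shows "(\<integral>\<^sup>+x. g (T x) \<partial>\<nu>) = ennreal c * (\<integral>\<^sup>+x. g x \<partial>\<nu>)"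
proof -
  note [measurable] = Wm g T
  have Tn[measurable]: "T \<in> measurable \<nu> M" by (rule measurable_nu[OF T])
  have idn[measurable]: "(\<lambda>x. x) \<in> measurable \<nu> M" by (rule measurable_nu) simp
  have [measurable]: "W n \<in> borel_measurable \<nu>" "g \<in> borel_measurable \<nu>" for n
    by (rule measurable_nu, measurable)+
  have sets_eq: "(\<integral>\<^sup>+x. indicator E (T x) * ennreal (W n (T x)) \<partial>\<nu>)
      = ennreal c * (\<integral>\<^sup>+x. indicator E x * ennreal (W n x) \<partial>\<nu>)" if E: "E \<in> sets M" for E n
  proof -
    note [measurable] = E
    have I: "integrable \<nu> (\<lambda>x. indicator E (T x) * W n (T x))" "integrable \<nu> (\<lambda>x. indicator E x * W n x)"
      by (rule Bochner_Integration.integrable_bound[OF i1[of n]], measurable, simp add: indicator_def)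
        (rule Bochner_Integration.integrable_bound[OF i2[of n]], measurable, simp add: indicator_def)
    have "(\<integral>x. indicator E (T x) * complex_of_real (W n (T x)) \<partial>\<nu>) = (\<integral>x. indicator E x * complex_of_real (c * W n x) \<partial>\<nu>)"
    proof (rule character_semigroup_determines_sets[OF space_M H_semigroup H_generates _ _ Tn idn _ _ _ E])
      show "f \<in> borel_measurable M" if "f \<in> H" for f by (rule regularD(1)[OF H_regular[OF that]])
      show "norm (f x) \<le> 1" if "f \<in> H" for f x by (rule regularD(2)[OF H_regular[OF that]])
      show "complex_integrable \<nu> (\<lambda>x. complex_of_real (W n (T x)))" using i1[of n] by simp
      show "complex_integrable \<nu> (\<lambda>x. complex_of_real (c * W n x))" using i2[of n] by simp
      show "(\<integral>x. f (T x) * complex_of_real (W n (T x)) \<partial>\<nu>) = (\<integral>x. f x * complex_of_real (c * W n x) \<partial>\<nu>)" if "f \<in> H" for f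
        unfolding eq[OF that] by (simp add: mult.left_commute)
    qed
    moreover have "(\<integral>x. indicator E (T x) * complex_of_real (W n (T x)) \<partial>\<nu>) = complex_of_real (\<integral>x. indicator E (T x) * W n (T x) \<partial>\<nu>)"
    proof -
      have "indicator E (T x) * complex_of_real (W n (T x)) = complex_of_real (indicator E (T x) * W n (T x))" for x
        by (simp add: indicator_def)
      then show ?thesis by (simp only: integral_complex_of_real)
    qed
    moreover have "(\<integral>x. indicator E x * complex_of_real (c * W n x) \<partial>\<nu>) = complex_of_real (c * (\<integral>x. indicator E x * W n x \<partial>\<nu>))"
    proof -
      have "indicator E x * complex_of_real (c * W n x) = complex_of_real (c * (indicator E x * W n x))" for x
        by (simp add: indicator_def)
      then show ?thesis by (simp only: integral_complex_of_real integral_mult_right_zero)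
    qed
    ultimately have r: "(\<integral>x. indicator E (T x) * W n (T x) \<partial>\<nu>) = c * (\<integral>x. indicator E x * W n x \<partial>\<nu>)"
      by (simp only: of_real_eq_iff)
    have n1: "(\<integral>\<^sup>+x. indicator E (T x) * ennreal (W n (T x)) \<partial>\<nu>) = ennreal (\<integral>x. indicator E (T x) * W n (T x) \<partial>\<nu>)"
      by (subst nn_integral_eq_integral[OF I(1), symmetric])
        (use W0 in \<open>auto intro!: nn_integral_cong simp: indicator_def\<close>)
    have n2: "(\<integral>\<^sup>+x. indicator E x * ennreal (W n x) \<partial>\<nu>) = ennreal (\<integral>x. indicator E x * W n x \<partial>\<nu>)"
      by (subst nn_integral_eq_integral[OF I(2), symmetric])
        (use W0 in \<open>auto intro!: nn_integral_cong simp: indicator_def\<close>)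
    show ?thesis unfolding n1 n2 r using c by (simp add: ennreal_mult')
  qed
  \<comment> \<open>The factors \<open>(1/2) ^ n\<close> make the sum finite, as the weights are
    bounded by \<open>4\<close>, the bound for a product of two factors
    \<open>1 - Re f\<close>.\<close>
  define V where "V x = (\<Sum>n. ennreal (W n x) * ennreal ((1/2) ^ n))" for x
  have Vm[measurable]: "V \<in> borel_measurable M" unfolding V_def[abs_def] by measurable
  have Vn[measurable]: "V \<in> borel_measurable \<nu>" by (rule measurable_nu[OF Vm])
  have Vpos: "V x \<noteq> 0" if x: "x \<noteq> e" for x
  proof -
    obtain n where "W n x > 0" using Wpos[OF x] by blast
    then have "ennreal (W n x) * ennreal ((1/2) ^ n) \<noteq> 0" by simp
    then show ?thesis unfolding V_def using suminf_eq_zero_iff[of "\<lambda>n. ennreal (W n x) * ennreal ((1/2) ^ n)"] by auto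
  qed
  have Vfin: "V x \<noteq> \<top>" for x
  proof -
    have "V x \<le> (\<Sum>n. ennreal (4 * (1/2) ^ n))"
      unfolding V_def
      by (rule suminf_le) (use W4 in \<open>auto simp: ennreal_mult[symmetric] W0 intro!: ennreal_leI\<close>)
    also have "\<dots> = ennreal (\<Sum>n. 4 * (1/2) ^ n)"
      by (rule suminf_ennreal2) (auto intro!: summable_mult summable_geometric)
    finally have "V x < \<top>" by (rule le_less_trans) (rule ennreal_less_top)
    then show ?thesis by simp
  qed
  have Veq: "(\<integral>\<^sup>+x. indicator E (T x) * V (T x) \<partial>\<nu>) = ennreal c * (\<integral>\<^sup>+x. indicator E x * V x \<partial>\<nu>)" if E[measurable]: "E \<in> sets M" for E
  proof -
    have 1: "(\<integral>\<^sup>+x. indicator E (T x) * V (T x) \<partial>\<nu>) = (\<Sum>n. (\<integral>\<^sup>+x. indicator E (T x) * ennreal (W n (T x)) \<partial>\<nu>) * ennreal ((1/2) ^ n))"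
    proof -
      have "(\<integral>\<^sup>+x. indicator E (T x) * V (T x) \<partial>\<nu>) = (\<integral>\<^sup>+x. (\<Sum>n. indicator E (T x) * ennreal (W n (T x)) * ennreal ((1/2) ^ n)) \<partial>\<nu>)"
        unfolding V_def by (simp only: ennreal_suminf_cmult mult.assoc)
      also have "\<dots> = (\<Sum>n. \<integral>\<^sup>+x. indicator E (T x) * ennreal (W n (T x)) * ennreal ((1/2) ^ n) \<partial>\<nu>)"
        by (rule nn_integral_suminf) measurable
      also have "\<dots> = (\<Sum>n. (\<integral>\<^sup>+x. indicator E (T x) * ennreal (W n (T x)) \<partial>\<nu>) * ennreal ((1/2) ^ n))"
        by (intro suminf_cong nn_integral_multc) measurable
      finally show ?thesis .
    qed
    have 2: "(\<integral>\<^sup>+x. indicator E x * V x \<partial>\<nu>) = (\<Sum>n. (\<integral>\<^sup>+x. indicator E x * ennreal (W n x) \<partial>\<nu>) * ennreal ((1/2) ^ n))"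
    proof -
      have "(\<integral>\<^sup>+x. indicator E x * V x \<partial>\<nu>) = (\<integral>\<^sup>+x. (\<Sum>n. indicator E x * ennreal (W n x) * ennreal ((1/2) ^ n)) \<partial>\<nu>)"
        unfolding V_def by (simp only: ennreal_suminf_cmult mult.assoc)
      also have "\<dots> = (\<Sum>n. \<integral>\<^sup>+x. indicator E x * ennreal (W n x) * ennreal ((1/2) ^ n) \<partial>\<nu>)"
        by (rule nn_integral_suminf) measurable
      also have "\<dots> = (\<Sum>n. (\<integral>\<^sup>+x. indicator E x * ennreal (W n x) \<partial>\<nu>) * ennreal ((1/2) ^ n))"
        by (intro suminf_cong nn_integral_multc) measurable
      finally show ?thesis .
    qed
    show ?thesis unfolding 1 2 sets_eq[OF E] by (simp only: ennreal_suminf_cmult mult.assoc)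
  qed
  have meas: "density (distr \<nu> M T) V = density (distr \<nu> M (\<lambda>x. x)) (\<lambda>x. ennreal c * V x)"
  proof (rule measure_eqI)
    fix E assume "E \<in> sets (density (distr \<nu> M T) V)"
    then have E[measurable]: "E \<in> sets M" by simp
    show "emeasure (density (distr \<nu> M T) V) E = emeasure (density (distr \<nu> M (\<lambda>x. x)) (\<lambda>x. ennreal c * V x)) E"
      using Veq[OF E] by (simp add: emeasure_density nn_integral_distr mult.commute mult.left_commute nn_integral_cmult)
  qed simp
  have cancel: "V x * (g x / V x) = g x" if "x \<noteq> e" for x
    unfolding ennreal_times_divide mult.commute[of "V x"]
    by (rule mult_divide_eq_ennreal[OF Vpos[OF that] Vfin])
  have "(\<integral>\<^sup>+x. g (T x) \<partial>\<nu>) = (\<integral>\<^sup>+x. V (T x) * (g (T x) / V (T x)) \<partial>\<nu>)"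
    by (rule nn_integral_cong) (simp add: cancel Te space_nu)
  also have "\<dots> = (\<integral>\<^sup>+x. g x / V x \<partial>density (distr \<nu> M T) V)"
    by (simp add: nn_integral_density nn_integral_distr)
  also have "\<dots> = (\<integral>\<^sup>+x. ennreal c * V x * (g x / V x) \<partial>\<nu>)"
    unfolding meas by (simp add: nn_integral_density nn_integral_distr)
  also have "\<dots> = (\<integral>\<^sup>+x. ennreal c * g x \<partial>\<nu>)"
    by (rule nn_integral_cong) (simp add: cancel space_nu mult.assoc)
  also have "\<dots> = ennreal c * (\<integral>\<^sup>+x. g x \<partial>\<nu>)" by (rule nn_integral_cmult) measurable
  finally show ?thesis .
qed

text \<open>In the unit disc \<open>1\<close> is the only point with real part \<open>1\<close>, so
  a character that separates \<open>x\<close> from \<open>e\<close> gives a positive weight at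
  \<open>x\<close>.\<close>

lemma exists_levy_weight:
  assumes "x \<noteq> e" shows "\<exists>f\<in>H. 1 - Re (f x) > 0"
proof -
  obtain f where f: "f \<in> H" "f x \<noteq> f e" using H_separating assms unfolding separating_def by blast
  have "1 - Re (f x) \<noteq> 0"
  proof
    assume "1 - Re (f x) = 0"
    then have "Re (f x) = 1" by simp
    moreover have "(Re (f x))\<^sup>2 + (Im (f x))\<^sup>2 \<le> 1"
      using power_le_one[OF norm_ge_zero regularD(2)[OF H_regular[OF f(1)], of x], of 2] cmod_power2[of "f x"] by simp
    ultimately have "f x = 1" by (simp add: complex_eq_iff)
    with f show False using regularD(3)[OF H_regular[OF f(1)]] by simp
  qed
  then show ?thesis using f(1) one_minus_Re_ge_0[OF H_regular[OF f(1)], of x]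
    by (intro bexI[of _ f]) (simp_all add: less_le)
qed

text \<open>With \<open>t = inverse s\<close>, the weight
  \<open>(1 - Re (\<eta> x)) * (1 - Re (\<zeta> (scl t x)))\<close> becomes
  \<open>(1 - Re (\<eta> (scl s x))) * (1 - Re (\<zeta> x))\<close> when \<open>x\<close> is
  replaced by \<open>scl s x\<close>. Either form contains one factor with an unscaled element of
  \<open>H\<close>, so \<open>levy_second_difference\<close> evaluates both integrals by exponents,
  and \<open>expo_scale\<close> relates them term by term.\<close>

theorem nu_homogeneous:
  assumes s: "s > 0" and g: "g \<in> borel_measurable M"
  shows "(\<integral>\<^sup>+x. g (scl s x) \<partial>\<nu>) = ennreal (s powr \<alpha>) * (\<integral>\<^sup>+x. g x \<partial>\<nu>)"
proof -
  obtain q where q: "\<And>\<psi> \<eta>. regular \<psi> \<Longrightarrow> \<eta> \<in> H \<Longrightarrow> of_real (2 * q \<eta>) + 2 * (\<integral>x. \<psi> x * of_real (1 - Re (\<eta> x)) \<partial>\<nu>)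
      = expo (\<lambda>x. \<psi> x * \<eta> x) + expo (\<lambda>x. \<psi> x * cnj (\<eta> x)) - 2 * expo \<psi>"
    using levy_second_difference by blast
  define t where "t = inverse s"
  have t: "t > 0" using s by (simp add: t_def)
  have ts: "scl t (scl s x) = x" "scl s (scl t x) = x" for x
    using s t by (simp_all add: scale_scale t_def scale_one)
  have sne: "scl s x \<noteq> e" if "x \<noteq> e" for x
    using that ts(1)[of x] scale_neutral[OF t] by auto
  define J where "J \<eta> \<psi> = (\<integral>x. \<psi> x * of_real (1 - Re (\<eta> x)) \<partial>\<nu>)" for \<eta> \<psi> :: "'a \<Rightarrow> complex"
  have J: "J \<eta> \<psi> = (expo (\<lambda>x. \<psi> x * \<eta> x) + expo (\<lambda>x. \<psi> x * cnj (\<eta> x)) - 2 * expo \<psi> - of_real (2 * q \<eta>)) / 2"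
    if "regular \<psi>" "\<eta> \<in> H" for \<psi> \<eta>
  proof -
    have "2 * J \<eta> \<psi> = expo (\<lambda>x. \<psi> x * \<eta> x) + expo (\<lambda>x. \<psi> x * cnj (\<eta> x)) - 2 * expo \<psi> - of_real (2 * q \<eta>)"
      unfolding q[OF that, symmetric] J_def by simp
    then show ?thesis by (simp add: field_simps)
  qed
  \<comment> \<open>The additional factor \<open>1 - Re \<zeta>\<close> is expanded by
    \<open>Re \<zeta> = (\<zeta> + cnj \<zeta>) / 2\<close>. In the resulting difference the
    constant \<open>q \<eta>\<close>, about whose behaviour under scaling nothing is known,
    cancels.\<close>
  define I where "I \<eta> \<psi> \<zeta> = J \<eta> \<psi> - (J \<eta> (\<lambda>x. \<psi> x * \<zeta> x) + J \<eta> (\<lambda>x. \<psi> x * cnj (\<zeta> x))) / 2" for \<eta> \<psi> \<zeta>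
  have I: "(\<integral>x. \<psi> x * of_real ((1 - Re (\<zeta> x)) * (1 - Re (\<eta> x))) \<partial>\<nu>) = I \<eta> \<psi> \<zeta>"
    if \<psi>: "regular \<psi>" and \<zeta>: "regular \<zeta>" and \<eta>: "\<eta> \<in> H" for \<psi> \<zeta> \<eta>
  proof -
    have g1: "regular (\<lambda>x. \<psi> x * \<zeta> x)" "regular (\<lambda>x. \<psi> x * cnj (\<zeta> x))" by (intro regular_mult regular_cnj \<psi> \<zeta>)+
    have i: "integrable \<nu> (\<lambda>x. f x * of_real (1 - Re (\<eta> x)))" if "regular f" for f
      by (rule integrable_levy_mult[OF \<eta> regularD(1)[OF that] regularD(2)[OF that]])
    have "\<psi> x * of_real ((1 - Re (\<zeta> x)) * (1 - Re (\<eta> x))) = \<psi> x * of_real (1 - Re (\<eta> x))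
      - (\<psi> x * \<zeta> x * of_real (1 - Re (\<eta> x)) + \<psi> x * cnj (\<zeta> x) * of_real (1 - Re (\<eta> x))) / 2" for x
    proof -
      have "complex_of_real (1 - Re (\<zeta> x)) = 1 - (\<zeta> x + cnj (\<zeta> x)) / 2" by (simp add: complex_add_cnj)
      moreover have "a * ((1 - (z + w) / 2) * c) = a * c - (a * z * c + a * w * c) / 2" for a z w c :: complex
        by (simp add: field_simps)
      ultimately show ?thesis unfolding of_real_mult by (simp only:)
    qed
    then show ?thesis unfolding I_def J_def using i[OF \<psi>] i[OF g1(1)] i[OF g1(2)] by simp
  qed
  define W where "W \<eta> \<zeta> x = (1 - Re (\<eta> x)) * (1 - Re (\<zeta> (scl t x)))" for \<eta> \<zeta> :: "'a \<Rightarrow> complex" and x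
  have eq: "(\<integral>x. f (scl s x) * of_real (W \<eta> \<zeta> (scl s x)) \<partial>\<nu>) = of_real (s powr \<alpha>) * (\<integral>x. f x * of_real (W \<eta> \<zeta> x) \<partial>\<nu>)"
    if f: "f \<in> H" and \<eta>: "\<eta> \<in> H" and \<zeta>: "\<zeta> \<in> H" for f \<eta> \<zeta>
  proof -
    note gf = H_regular[OF f] and g\<eta> = H_regular[OF \<eta>] and g\<zeta> = H_regular[OF \<zeta>]
    have "(\<integral>x. f (scl s x) * of_real (W \<eta> \<zeta> (scl s x)) \<partial>\<nu>) = I \<zeta> (\<lambda>x. f (scl s x)) (\<lambda>x. \<eta> (scl s x))"
      unfolding W_def ts by (rule I[OF regular_scale[OF gf s] regular_scale[OF g\<eta> s] \<zeta>])
    moreover have "(\<integral>x. f x * of_real (W \<eta> \<zeta> x) \<partial>\<nu>) = I \<eta> f (\<lambda>x. \<zeta> (scl t x))"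
    proof -
      have "W \<eta> \<zeta> x = (1 - Re (\<zeta> (scl t x))) * (1 - Re (\<eta> x))" for x by (simp add: W_def mult.commute)
      then show ?thesis using I[OF gf regular_scale[OF g\<zeta> t] \<eta>] by simp
    qed
    moreover have "I \<zeta> (\<lambda>x. f (scl s x)) (\<lambda>x. \<eta> (scl s x)) = of_real (s powr \<alpha>) * I \<eta> f (\<lambda>x. \<zeta> (scl t x))"
    proof -
      have sc: "of_real (s powr \<alpha>) * expo h = expo (\<lambda>x. h (scl s x))" if "regular h" for h
        using expo_scale[OF that s] by simp
      note gm = regular_mult regular_cnj gf g\<eta> g\<zeta> regular_scale s t
      have L: "I \<zeta> (\<lambda>x. f (scl s x)) (\<lambda>x. \<eta> (scl s x)) =
         (expo (\<lambda>x. f (scl s x) * \<zeta> x) + expo (\<lambda>x. f (scl s x) * cnj (\<zeta> x)) - 2 * expo (\<lambda>x. f (scl s x))) / 2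
         - (expo (\<lambda>x. f (scl s x) * \<eta> (scl s x) * \<zeta> x) + expo (\<lambda>x. f (scl s x) * \<eta> (scl s x) * cnj (\<zeta> x))
             - 2 * expo (\<lambda>x. f (scl s x) * \<eta> (scl s x))) / 4
         - (expo (\<lambda>x. f (scl s x) * cnj (\<eta> (scl s x)) * \<zeta> x) + expo (\<lambda>x. f (scl s x) * cnj (\<eta> (scl s x)) * cnj (\<zeta> x))
             - 2 * expo (\<lambda>x. f (scl s x) * cnj (\<eta> (scl s x)))) / 4"
        unfolding I_def
        by (subst J, (intro gm)?, (rule \<zeta>)?)+ (simp add: field_simps)
      have R: "I \<eta> f (\<lambda>x. \<zeta> (scl t x)) =
         (expo (\<lambda>x. f x * \<eta> x) + expo (\<lambda>x. f x * cnj (\<eta> x)) - 2 * expo f) / 2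
         - (expo (\<lambda>x. f x * \<zeta> (scl t x) * \<eta> x) + expo (\<lambda>x. f x * \<zeta> (scl t x) * cnj (\<eta> x))
             - 2 * expo (\<lambda>x. f x * \<zeta> (scl t x))) / 4
         - (expo (\<lambda>x. f x * cnj (\<zeta> (scl t x)) * \<eta> x) + expo (\<lambda>x. f x * cnj (\<zeta> (scl t x)) * cnj (\<eta> x))
             - 2 * expo (\<lambda>x. f x * cnj (\<zeta> (scl t x)))) / 4"
        unfolding I_def
        by (subst J, (intro gm)?, (rule \<eta>)?)+ (simp add: field_simps)
      \<comment> \<open>Multiplication by \<open>s powr \<alpha>\<close> scales the argument by
        \<open>s\<close> and undoes \<open>scl t\<close>; the nine exponents of \<open>R\<close>
        become those of \<open>L\<close> in another order.\<close>
      have e1: "of_real (s powr \<alpha>) * expo (\<lambda>x. f x * \<eta> x) = expo (\<lambda>x. f (scl s x) * \<eta> (scl s x))"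
        "of_real (s powr \<alpha>) * expo (\<lambda>x. f x * cnj (\<eta> x)) = expo (\<lambda>x. f (scl s x) * cnj (\<eta> (scl s x)))"
        "of_real (s powr \<alpha>) * expo f = expo (\<lambda>x. f (scl s x))"
        by (rule sc; intro gm)+
      have e2: "of_real (s powr \<alpha>) * expo (\<lambda>x. f x * \<zeta> (scl t x) * \<eta> x) = expo (\<lambda>x. f (scl s x) * \<eta> (scl s x) * \<zeta> x)"
        "of_real (s powr \<alpha>) * expo (\<lambda>x. f x * \<zeta> (scl t x) * cnj (\<eta> x)) = expo (\<lambda>x. f (scl s x) * cnj (\<eta> (scl s x)) * \<zeta> x)"
        "of_real (s powr \<alpha>) * expo (\<lambda>x. f x * \<zeta> (scl t x)) = expo (\<lambda>x. f (scl s x) * \<zeta> x)"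
        "of_real (s powr \<alpha>) * expo (\<lambda>x. f x * cnj (\<zeta> (scl t x)) * \<eta> x) = expo (\<lambda>x. f (scl s x) * \<eta> (scl s x) * cnj (\<zeta> x))"
        "of_real (s powr \<alpha>) * expo (\<lambda>x. f x * cnj (\<zeta> (scl t x)) * cnj (\<eta> x)) = expo (\<lambda>x. f (scl s x) * cnj (\<eta> (scl s x)) * cnj (\<zeta> x))"
        "of_real (s powr \<alpha>) * expo (\<lambda>x. f x * cnj (\<zeta> (scl t x))) = expo (\<lambda>x. f (scl s x) * cnj (\<zeta> x))"
        by (subst sc, (intro gm), simp only: ts mult_ac)+
      have dist: "c * ((a1 + a2 - 2 * a3) / 2 - (b1 + b2 - 2 * b3) / 4 - (d1 + d2 - 2 * d3) / 4)
        = (c * a1 + c * a2 - 2 * (c * a3)) / 2 - (c * b1 + c * b2 - 2 * (c * b3)) / 4 - (c * d1 + c * d2 - 2 * (c * d3)) / 4"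
        for c a1 a2 a3 b1 b2 b3 d1 d2 d3 :: complex
        by (simp add: algebra_simps add_divide_distrib diff_divide_distrib)
      show ?thesis unfolding L R dist e1 e2 by (simp add: field_simps)
    qed
    ultimately show ?thesis by simp
  qed
  have Wb: "0 \<le> W \<eta> \<zeta> x" "W \<eta> \<zeta> x \<le> 4" if "\<eta> \<in> H" "\<zeta> \<in> H" for \<eta> \<zeta> x
    using one_minus_Re_ge_0[OF H_regular[OF that(1)], of x] one_minus_Re_ge_0[OF H_regular[OF that(2)], of "scl t x"]
      mult_mono[OF one_minus_Re_le[OF H_regular[OF that(1)], of x] one_minus_Re_le[OF H_regular[OF that(2)], of "scl t x"]]
    by (simp_all add: W_def)
  have Wm: "W \<eta> \<zeta> \<in> borel_measurable M" if "\<eta> \<in> H" "\<zeta> \<in> H" for \<eta> \<zeta>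
  proof -
    have [measurable]: "\<eta> \<in> borel_measurable M" "(\<lambda>x. \<zeta> (scl t x)) \<in> borel_measurable M"
      using regularD(1)[OF H_regular[OF that(1)]] regularD(1)[OF regular_scale[OF H_regular[OF that(2)] t]] .
    show ?thesis unfolding W_def[abs_def] by measurable
  qed
  have Wi: "integrable \<nu> (W \<eta> \<zeta>)" if "\<eta> \<in> H" "\<zeta> \<in> H" for \<eta> \<zeta>
  proof (rule Bochner_Integration.integrable_bound)
    show "integrable \<nu> (\<lambda>x. 2 * (1 - Re (\<eta> x)))" by (rule integrable_mult_right[OF integrable_levy[OF that(1)]])
    show "W \<eta> \<zeta> \<in> borel_measurable \<nu>" by (rule measurable_nu[OF Wm[OF that]])
    show "AE x in \<nu>. norm (W \<eta> \<zeta> x) \<le> norm (2 * (1 - Re (\<eta> x)))"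
    proof (intro AE_I2)
      fix x
      show "norm (W \<eta> \<zeta> x) \<le> norm (2 * (1 - Re (\<eta> x)))"
        using one_minus_Re_ge_0[OF H_regular[OF that(1)], of x] one_minus_Re_ge_0[OF H_regular[OF that(2)], of "scl t x"]
          mult_left_mono[OF one_minus_Re_le[OF H_regular[OF that(2)], of "scl t x"] one_minus_Re_ge_0[OF H_regular[OF that(1)], of x]]
        by (simp only: W_def real_norm_def abs_mult abs_of_nonneg abs_numeral mult.commute)
    qed
  qed
  have Wi': "integrable \<nu> (\<lambda>x. W \<eta> \<zeta> (scl s x))" if "\<eta> \<in> H" "\<zeta> \<in> H" for \<eta> \<zeta>
  proof (rule Bochner_Integration.integrable_bound)
    show "integrable \<nu> (\<lambda>x. 2 * (1 - Re (\<zeta> x)))" by (rule integrable_mult_right[OF integrable_levy[OF that(2)]])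
    show "(\<lambda>x. W \<eta> \<zeta> (scl s x)) \<in> borel_measurable \<nu>"
      by (rule measurable_nu[OF measurable_compose[OF measurable_scl_const[OF s] Wm[OF that]]])
    show "AE x in \<nu>. norm (W \<eta> \<zeta> (scl s x)) \<le> norm (2 * (1 - Re (\<zeta> x)))"
    proof (intro AE_I2)
      fix x
      show "norm (W \<eta> \<zeta> (scl s x)) \<le> norm (2 * (1 - Re (\<zeta> x)))"
        using one_minus_Re_ge_0[OF H_regular[OF that(1)], of "scl s x"] one_minus_Re_ge_0[OF H_regular[OF that(2)], of x]
          mult_right_mono[OF one_minus_Re_le[OF H_regular[OF that(1)], of "scl s x"] one_minus_Re_ge_0[OF H_regular[OF that(2)], of x]]
        by (simp only: W_def ts real_norm_def abs_mult abs_of_nonneg abs_numeral)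
    qed
  qed
  have ne: "H \<times> H \<noteq> {}" using H_one by auto
  have cnt: "countable (H \<times> H)" using H_countable by simp
  define p where "p = from_nat_into (H \<times> H)"
  have p: "fst (p n) \<in> H" "snd (p n) \<in> H" for n
    using from_nat_into[OF ne, of n] by (auto simp: p_def mem_Times_iff)
  show ?thesis
  proof (rule nn_integral_transform[where W="\<lambda>n. W (fst (p n)) (snd (p n))"])
    show "scl s \<in> measurable M M" by (rule measurable_scl_const[OF s])
    show "s powr \<alpha> > 0" using s by simp
    fix x assume x: "x \<noteq> e"
    have "scl t x \<noteq> e" using x ts(2)[of x] scale_neutral[OF s] by auto
    then obtain \<eta> \<zeta> where h: "\<eta> \<in> H" "\<zeta> \<in> H" "1 - Re (\<eta> x) > 0" "1 - Re (\<zeta> (scl t x)) > 0"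
      using exists_levy_weight[OF x] exists_levy_weight by blast
    obtain n where "p n = (\<eta>, \<zeta>)" unfolding p_def using from_nat_into_surj[OF cnt, of "(\<eta>, \<zeta>)"] h by auto
    then show "\<exists>n. W (fst (p n)) (snd (p n)) x > 0" using h by (intro exI[of _ n]) (simp add: W_def)
  qed (use sne Wm[OF p] Wb[OF p] Wi[OF p] Wi'[OF p] eq[OF _ p] g in auto)
qed

text \<open>Symmetry of the law makes all exponents real, hence also the integrals of
  \<open>f x * (1 - Re (\<eta> x))\<close>, and composition with \<open>star\<close> merely
  conjugates these. The passage to \<open>\<nu>\<close> is the one used for homogeneity, with
  \<open>c = 1\<close>.\<close>

theorem nu_symmetric:
  assumes sym: "distr \<mu> M star = \<mu>" and g: "g \<in> borel_measurable M"
  shows "(\<integral>\<^sup>+x. g (star x) \<partial>\<nu>) = (\<integral>\<^sup>+x. g x \<partial>\<nu>)"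
proof -
  obtain q where q: "\<And>\<psi> \<eta>. regular \<psi> \<Longrightarrow> \<eta> \<in> H \<Longrightarrow> of_real (2 * q \<eta>) + 2 * (\<integral>x. \<psi> x * of_real (1 - Re (\<eta> x)) \<partial>\<nu>)
      = expo (\<lambda>x. \<psi> x * \<eta> x) + expo (\<lambda>x. \<psi> x * cnj (\<eta> x)) - 2 * expo \<psi>"
    using levy_second_difference by blast
  have star\<mu>: "star \<in> measurable \<mu> M" using star_measurable by (simp add: measurable_mu)
  have real: "cnj (expo f) = expo f" if f: "regular f" for f
    unfolding expo_cnj[OF f, symmetric]
  proof (rule expo_unique[OF regular_cnj[OF f]])
    fix t :: real assume t: "t > 0"
    have "hat f t = (\<integral>x. f (scl t x) \<partial>distr \<mu> M star)" unfolding hat_def sym ..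
    also have "\<dots> = (\<integral>x. f (scl t (star x)) \<partial>\<mu>)"
      by (rule integral_distr[OF star\<mu>]) (rule regularD(1)[OF regular_scale[OF f t]])
    also have "\<dots> = hat (\<lambda>x. cnj (f x)) t"
      unfolding hat_def star_scale[OF t, symmetric] regularD(5)[OF f] ..
    finally show "hat (\<lambda>x. cnj (f x)) t = exp (- (of_real (t powr \<alpha>) * expo f))" using hat_expo[OF f t] by simp
  qed
  have star_e: "star x \<noteq> e" if "x \<noteq> e" for x
  proof
    assume *: "star x = e"
    have "star e = e" using star_add[of e "star e"] star_star[of e] add_neutral[of "star e"] add_commute[of "star e" e]
      by (metis add_neutral add_commute)
    with * star_star[of x] that show False by simp
  qed
  have eq: "(\<integral>x. f (star x) * of_real (1 - Re (\<eta> (star x))) \<partial>\<nu>) = of_real 1 * (\<integral>x. f x * of_real (1 - Re (\<eta> x)) \<partial>\<nu>)"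
    if f: "f \<in> H" and \<eta>: "\<eta> \<in> H" for f \<eta>
  proof -
    note gf = H_regular[OF f] and g\<eta> = H_regular[OF \<eta>]
    let ?I = "\<integral>x. f x * of_real (1 - Re (\<eta> x)) \<partial>\<nu>"
    have "(\<integral>x. f (star x) * of_real (1 - Re (\<eta> (star x))) \<partial>\<nu>) = (\<integral>x. cnj (f x * of_real (1 - Re (\<eta> x))) \<partial>\<nu>)"
      by (simp add: regularD(5)[OF gf] regularD(5)[OF g\<eta>])
    also have "\<dots> = cnj ?I"
      by (rule integral_bounded_linear[OF bounded_linear_cnj])
        (rule integrable_levy_mult[OF \<eta> regularD(1)[OF gf] regularD(2)[OF gf]])
    also have "\<dots> = ?I"
    proof -
      have I: "?I = (expo (\<lambda>x. f x * \<eta> x) + expo (\<lambda>x. f x * cnj (\<eta> x)) - 2 * expo f - of_real (2 * q \<eta>)) / 2"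
        unfolding q[OF gf \<eta>, symmetric] by simp
      have r: "cnj (expo (\<lambda>x. f x * \<eta> x)) = expo (\<lambda>x. f x * \<eta> x)"
        "cnj (expo (\<lambda>x. f x * cnj (\<eta> x))) = expo (\<lambda>x. f x * cnj (\<eta> x))"
        by (intro real regular_mult regular_cnj gf g\<eta>)+
      show ?thesis unfolding I
        by (simp only: complex_cnj_divide complex_cnj_diff complex_cnj_add complex_cnj_mult r real[OF gf] complex_cnj_complex_of_real complex_cnj_numeral)
    qed
    finally show ?thesis by simp
  qed
  define p where "p = from_nat_into H"
  have p: "p n \<in> H" for n unfolding p_def by (rule from_nat_into) (use H_one in auto)
  have "(\<integral>\<^sup>+x. g (star x) \<partial>\<nu>) = ennreal 1 * (\<integral>\<^sup>+x. g x \<partial>\<nu>)"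
  proof (rule nn_integral_transform[where W="\<lambda>n x. 1 - Re (p n x)"])
    show "(\<lambda>x. 1 - Re (p n x)) \<in> borel_measurable M" for n
    proof -
      have [measurable]: "p n \<in> borel_measurable M" by (rule regularD(1)[OF H_regular[OF p]])
      show ?thesis by measurable
    qed
    show "0 \<le> 1 - Re (p n x)" for n x by (rule one_minus_Re_ge_0[OF H_regular[OF p]])
    show "1 - Re (p n x) \<le> 4" for n x using one_minus_Re_le[OF H_regular[OF p], of n x] by simp
    show "integrable \<nu> (\<lambda>x. 1 - Re (p n (star x)))" for n
      using integrable_levy[OF p] by (simp add: regularD(5)[OF H_regular[OF p]])
    fix x assume "x \<noteq> e"
    then obtain f where f: "f \<in> H" "1 - Re (f x) > 0" using exists_levy_weight by blast
    obtain n where "p n = f" unfolding p_def using from_nat_into_surj[OF H_countable f(1)] by auto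
    then show "\<exists>n. 1 - Re (p n x) > 0" using f by (intro exI[of _ n]) simp
  qed (use star_measurable star_e integrable_levy[OF p] eq[OF _ p] g in auto)
  then show ?thesis by simp
qed

end

section \<open>Polar decomposition of homogeneous measures\<close>

text \<open>The substitution is made on compact intervals and extended by monotone convergence;
  \<open>Suc n\<close> keeps these intervals nondegenerate.\<close>

lemma nn_integral_exp_substitution:
  fixes h :: "real \<Rightarrow> ennreal"
  assumes h[measurable]: "h \<in> borel_measurable borel"
  shows "(\<integral>\<^sup>+t. h t * indicator {0<..} t \<partial>lborel) = (\<integral>\<^sup>+y. h (exp y) * ennreal (exp y) \<partial>lborel)"
proof -
  have eq: "(\<integral>\<^sup>+t. h t * indicator {exp (- real (Suc n))..exp (real (Suc n))} t \<partial>lborel)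
      = (\<integral>\<^sup>+y. h (exp y) * ennreal (exp y) * indicator {- real (Suc n)..real (Suc n)} y \<partial>lborel)" for n
    by (rule nn_integral_substitution_aux) (auto intro!: derivative_eq_intros continuous_intros)
  have inc: "incseq (\<lambda>n t. h t * indicator {exp (- real (Suc n))..exp (real (Suc n))} t)"
    "incseq (\<lambda>n y. h (exp y) * ennreal (exp y) * indicator {- real (Suc n)..real (Suc n)} y)"
  proof -
    have sub: "{exp (- real (Suc m))..exp (real (Suc m))} \<subseteq> {exp (- real (Suc n))..exp (real (Suc n))}"
      "{- real (Suc m)..real (Suc m)} \<subseteq> {- real (Suc n)..real (Suc n)}" if "m \<le> n" for m n
      using that by (simp_all add: atLeastatMost_subset_iff)
    show "incseq (\<lambda>n t. h t * indicator {exp (- real (Suc n))..exp (real (Suc n))} t)"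
      unfolding incseq_def le_fun_def
    proof (intro allI impI)
      fix m n :: nat and t assume "m \<le> n"
      from subsetD[OF sub(1)[OF this], of t]
      show "h t * indicator {exp (- real (Suc m))..exp (real (Suc m))} t
          \<le> h t * indicator {exp (- real (Suc n))..exp (real (Suc n))} t"
        by (intro mult_left_mono) (simp_all add: indicator_def)
    qed
    show "incseq (\<lambda>n y. h (exp y) * ennreal (exp y) * indicator {- real (Suc n)..real (Suc n)} y)"
      unfolding incseq_def le_fun_def
    proof (intro allI impI)
      fix m n :: nat and t assume "m \<le> n"
      from subsetD[OF sub(2)[OF this], of t]
      show "h (exp t) * ennreal (exp t) * indicator {- real (Suc m)..real (Suc m)} t
          \<le> h (exp t) * ennreal (exp t) * indicator {- real (Suc n)..real (Suc n)} t"
        by (intro mult_left_mono) (simp_all add: indicator_def)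
    qed
  qed
  have sup1: "(SUP n. h t * indicator {exp (- real (Suc n))..exp (real (Suc n))} t) = h t * indicator {0<..} t" for t
  proof (cases "t > 0")
    case True
    obtain N where N: "\<bar>ln t\<bar> \<le> real N" using real_arch_simple[of "\<bar>ln t\<bar>"] by blast
    then have "- real (Suc N) \<le> ln t" "ln t \<le> real (Suc N)" by auto
    then have "t \<in> {exp (- real (Suc N))..exp (real (Suc N))}"
      using exp_le_cancel_iff[of "- real (Suc N)" "ln t"] exp_le_cancel_iff[of "ln t" "real (Suc N)"] exp_ln[OF True]
      by (simp only: atLeastAtMost_iff)
    then have "h t * indicator {exp (- real (Suc N))..exp (real (Suc N))} t = h t" by simp
    then have "h t \<le> (SUP n. h t * indicator {exp (- real (Suc n))..exp (real (Suc n))} t)"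
      by (intro SUP_upper2[of N]) auto
    moreover have "(SUP n. h t * indicator {exp (- real (Suc n))..exp (real (Suc n))} t) \<le> h t"
      by (rule SUP_least) (auto simp: indicator_def)
    ultimately show ?thesis using True by (simp add: antisym)
  next
    case False
    then have "\<not> exp a \<le> t" for a using exp_gt_zero[of a] by linarith
    then show ?thesis using False by (simp add: indicator_def)
  qed
  have sup2: "(SUP n. h (exp y) * ennreal (exp y) * indicator {- real (Suc n)..real (Suc n)} y) = h (exp y) * ennreal (exp y)" for y
  proof (rule antisym)
    obtain N where N: "\<bar>y\<bar> \<le> real N" using real_arch_simple[of "\<bar>y\<bar>"] by blast
    then have "y \<in> {- real (Suc N)..real (Suc N)}" by auto
    then show "h (exp y) * ennreal (exp y) \<le> (SUP n. h (exp y) * ennreal (exp y) * indicator {- real (Suc n)..real (Suc n)} y)"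
      by (intro SUP_upper2[of N]) auto
    show "(SUP n. h (exp y) * ennreal (exp y) * indicator {- real (Suc n)..real (Suc n)} y) \<le> h (exp y) * ennreal (exp y)"
      by (rule SUP_least) (auto simp: indicator_def)
  qed
  have m: "(\<lambda>t. h t * indicator {exp (- real (Suc n))..exp (real (Suc n))} t) \<in> borel_measurable lborel"
    "(\<lambda>y. h (exp y) * ennreal (exp y) * indicator {- real (Suc n)..real (Suc n)} y) \<in> borel_measurable lborel" for n
    by measurable
  have "(\<integral>\<^sup>+t. h t * indicator {0<..} t \<partial>lborel)
      = (SUP n. \<integral>\<^sup>+t. h t * indicator {exp (- real (Suc n))..exp (real (Suc n))} t \<partial>lborel)"
    using nn_integral_monotone_convergence_SUP[OF inc(1) m(1)] by (simp only: sup1)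
  also have "\<dots> = (SUP n. \<integral>\<^sup>+y. h (exp y) * ennreal (exp y) * indicator {- real (Suc n)..real (Suc n)} y \<partial>lborel)"
    unfolding eq ..
  also have "\<dots> = (\<integral>\<^sup>+y. h (exp y) * ennreal (exp y) \<partial>lborel)"
    using nn_integral_monotone_convergence_SUP[OF inc(2) m(2)] by (simp only: sup2)
  finally show ?thesis .
qed

lemma sets_theta: "sets (theta \<alpha>) = sets (restrict_space borel {0<..})"
  unfolding theta_def by (simp add: sets_restrict_space)

lemma space_theta: "space (theta \<alpha>) = {0<..}"
  unfolding theta_def by (simp add: space_restrict_space)

text \<open>The logarithmic coordinate \<open>y = ln t\<close> turns scaling into translation, so
  that orbits of the scaling become orbits of a flow of the additive group.\<close>

lemma nn_integral_theta:
  fixes h :: "real \<Rightarrow> ennreal"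
  assumes \<alpha>: "\<alpha> > 0" and h[measurable]: "h \<in> borel_measurable (restrict_space borel {0<..})"
  shows "(\<integral>\<^sup>+t. h t \<partial>theta \<alpha>) = (\<integral>\<^sup>+y. h (exp y) * ennreal (\<alpha> * exp (- \<alpha> * y)) \<partial>lborel)"
proof -
  have hm[measurable]: "(\<lambda>t. h t * indicator {0<..} t) \<in> borel_measurable borel"
    using h by (subst (asm) borel_measurable_restrict_space_iff_ennreal) auto
  have "(\<integral>\<^sup>+t. h t \<partial>theta \<alpha>) = (\<integral>\<^sup>+t. ennreal (\<alpha> * t powr (- (\<alpha> + 1))) * h t \<partial>restrict_space lborel {0<..})"
  proof -
    have "h \<in> borel_measurable (restrict_space lborel {0<..})"
      using h by (simp cong: measurable_cong_sets add: sets_restrict_space)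
    then show ?thesis unfolding theta_def
      by (subst nn_integral_density) (auto intro!: measurable_restrict_space1)
  qed
  also have "\<dots> = (\<integral>\<^sup>+t. ennreal (\<alpha> * t powr (- (\<alpha> + 1))) * h t * indicator {0<..} t \<partial>lborel)"
    by (subst nn_integral_restrict_space) auto
  also have "\<dots> = (\<integral>\<^sup>+t. (ennreal (\<alpha> * t powr (- (\<alpha> + 1))) * (h t * indicator {0<..} t)) * indicator {0<..} t \<partial>lborel)"
    by (rule nn_integral_cong) (auto simp: indicator_def)
  also have "\<dots> = (\<integral>\<^sup>+y. ennreal (\<alpha> * exp y powr (- (\<alpha> + 1))) * (h (exp y) * indicator {0<..} (exp y)) * ennreal (exp y) \<partial>lborel)"
    by (rule nn_integral_exp_substitution) measurable
  also have "\<dots> = (\<integral>\<^sup>+y. h (exp y) * ennreal (\<alpha> * exp (- \<alpha> * y)) \<partial>lborel)"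
  proof (rule nn_integral_cong)
    fix y :: real
    have "\<alpha> * exp y powr (- (\<alpha> + 1)) * exp y = \<alpha> * exp (- \<alpha> * y)"
      by (simp add: powr_def algebra_simps flip: exp_add)
    moreover have "ennreal (\<alpha> * exp y powr (- (\<alpha> + 1))) * ennreal (exp y) = ennreal (\<alpha> * exp y powr (- (\<alpha> + 1)) * exp y)"
      using \<alpha> by (intro ennreal_mult[symmetric]) auto
    ultimately have p: "ennreal (\<alpha> * exp y powr (- (\<alpha> + 1))) * ennreal (exp y) = ennreal (\<alpha> * exp (- \<alpha> * y))"
      by (simp only:)
    have "a * (b * indicator {0<..} (exp y)) * c = b * (a * c)" for a b c :: ennreal
      by (simp add: mult_ac)
    then show "ennreal (\<alpha> * exp y powr (- (\<alpha> + 1))) * (h (exp y) * indicator {0<..} (exp y)) * ennreal (exp y)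
      = h (exp y) * ennreal (\<alpha> * exp (- \<alpha> * y))"
      by (simp only: p)
  qed
  finally show ?thesis .
qed

text \<open>\<open>t powr (- (1 / \<alpha>)) > r\<close> means
  \<open>t < r powr (- \<alpha>)\<close>, and this bound is the mass of \<open>{r<..}\<close> under
  \<open>theta \<alpha>\<close>. The lemma turns the points of a unit Poisson process into the
  radial parts of the points of \<open>\<nu>\<close>.\<close>

lemma nn_integral_theta_powr:
  fixes h :: "real \<Rightarrow> ennreal"
  assumes \<alpha>: "\<alpha> > 0" and h[measurable]: "h \<in> borel_measurable (restrict_space borel {0<..})"
  shows "(\<integral>\<^sup>+t. h (t powr (- (1 / \<alpha>))) \<partial>restrict_space lborel {0<..}) = (\<integral>\<^sup>+t. h t \<partial>theta \<alpha>)"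
proof -
  define k where "k t = h t * indicator {0<..} t" for t
  have k[measurable]: "k \<in> borel_measurable borel" unfolding k_def
    using h by (subst (asm) borel_measurable_restrict_space_iff_ennreal) auto
  have "(\<integral>\<^sup>+t. h (t powr (- (1 / \<alpha>))) \<partial>restrict_space lborel {0<..})
    = (\<integral>\<^sup>+t. h (t powr (- (1 / \<alpha>))) * indicator {0<..} t \<partial>lborel)"
    by (subst nn_integral_restrict_space) auto
  also have "\<dots> = (\<integral>\<^sup>+t. k (t powr (- (1 / \<alpha>))) * indicator {0<..} t \<partial>lborel)"
    by (rule nn_integral_cong) (auto simp: k_def indicator_def)
  also have "\<dots> = (\<integral>\<^sup>+y. k (exp y powr (- (1 / \<alpha>))) * ennreal (exp y) \<partial>lborel)"
    by (rule nn_integral_exp_substitution) measurable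
  also have "\<dots> = (\<integral>\<^sup>+y. k (exp (- y / \<alpha>)) * ennreal (exp y) \<partial>lborel)"
    by (simp add: powr_def)
  also have "\<dots> = ennreal \<bar>-\<alpha>\<bar> * (\<integral>\<^sup>+z. k (exp (- (0 + (-\<alpha>) * z) / \<alpha>)) * ennreal (exp (0 + (-\<alpha>) * z)) \<partial>lborel)"
    by (rule nn_integral_real_affine) (use \<alpha> in auto)
  also have "\<dots> = (\<integral>\<^sup>+z. ennreal \<bar>-\<alpha>\<bar> * (k (exp (- (0 + (-\<alpha>) * z) / \<alpha>)) * ennreal (exp (0 + (-\<alpha>) * z))) \<partial>lborel)"
    by (rule nn_integral_cmult[symmetric]) measurable
  also have "\<dots> = (\<integral>\<^sup>+z. h (exp z) * ennreal (\<alpha> * exp (- \<alpha> * z)) \<partial>lborel)"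
    by (rule nn_integral_cong) (use \<alpha> in \<open>simp add: k_def ennreal_mult' mult_ac\<close>)
  also have "\<dots> = (\<integral>\<^sup>+t. h t \<partial>theta \<alpha>)" by (rule nn_integral_theta[OF \<alpha> h, symmetric])
  finally show ?thesis .
qed

lemma nn_integral_exp_atLeast:
  assumes "\<alpha> > (0::real)"
  shows "(\<integral>\<^sup>+y. ennreal (\<alpha> * exp (- \<alpha> * y)) * indicator {a..} y \<partial>lborel) = ennreal (exp (- \<alpha> * a))"
proof -
  have "(\<integral>\<^sup>+y. ennreal (\<alpha> * exp (- \<alpha> * y)) * indicator {a..} y \<partial>lborel) = 0 - (- exp (- \<alpha> * a))"
  proof (rule nn_integral_FTC_atLeast)
    show "((\<lambda>y. - exp (- \<alpha> * y)) has_real_derivative \<alpha> * exp (- \<alpha> * x)) (at x)" for x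
      by (auto intro!: derivative_eq_intros)
    have "((\<lambda>y. exp (- \<alpha> * y)) \<longlongrightarrow> 0) at_top"
      using assms by (intro filterlim_compose[OF exp_at_bot] filterlim_tendsto_neg_mult_at_bot[OF tendsto_const _ filterlim_ident]) auto
    from tendsto_minus[OF this] show "((\<lambda>y. - exp (- \<alpha> * y)) \<longlongrightarrow> 0) at_top" by simp
  qed (use assms in auto)
  then show ?thesis by simp
qed

section \<open>Flows that multiply a sigma-finite measure by an exponential factor\<close>

locale homogeneous_flow = sigma_finite_measure \<nu> for \<nu> :: "'a measure" +
  fixes T :: "real \<Rightarrow> 'a \<Rightarrow> 'a" and \<alpha> :: real
  assumes T_measurable: "(\<lambda>p. T (snd p) (fst p)) \<in> measurable (\<nu> \<Otimes>\<^sub>M borel) \<nu>"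
    and T_add: "x \<in> space \<nu> \<Longrightarrow> T y (T z x) = T (y + z) x"
    and T_0: "x \<in> space \<nu> \<Longrightarrow> T 0 x = x"
    and alpha_pos: "\<alpha> > 0"
    and homogeneous: "g \<in> borel_measurable \<nu> \<Longrightarrow> (\<integral>\<^sup>+x. g (T s x) \<partial>\<nu>) = ennreal (exp (\<alpha> * s)) * (\<integral>\<^sup>+x. g x \<partial>\<nu>)"
    and nonzero: "emeasure \<nu> (space \<nu>) \<noteq> 0"
begin

sublocale P: pair_sigma_finite \<nu> lborel ..

lemma T_meas[measurable (raw)]:
  assumes "f \<in> measurable N \<nu>" "u \<in> borel_measurable N"
  shows "(\<lambda>x. T (u x) (f x)) \<in> measurable N \<nu>"
  using measurable_compose[OF measurable_Pair[OF assms] T_measurable] by simp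

lemma T_space: "x \<in> space \<nu> \<Longrightarrow> T y x \<in> space \<nu>"
  using measurable_space[OF T_meas[of "\<lambda>x. x" \<nu> "\<lambda>_. y"]] by simp

text \<open>The integral of \<open>f\<close> along the orbit of \<open>x\<close> with respect to
  \<open>theta\<close>, in the logarithmic coordinate.\<close>

definition F :: "('a \<Rightarrow> ennreal) \<Rightarrow> 'a \<Rightarrow> ennreal" where
  "F f x = (\<integral>\<^sup>+y. f (T y x) * ennreal (\<alpha> * exp (- \<alpha> * y)) \<partial>lborel)"

lemma F_measurable[measurable]:
  assumes [measurable]: "f \<in> borel_measurable \<nu>"
  shows "F f \<in> borel_measurable \<nu>"
  unfolding F_def[abs_def] by measurable

lemma shift_integral:
  assumes [measurable]: "f \<in> borel_measurable \<nu>" and x: "x \<in> space \<nu>"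
  shows "(\<integral>\<^sup>+y. f (T (y + s) x) * ennreal (\<alpha> * exp (- \<alpha> * y)) \<partial>lborel) = ennreal (exp (\<alpha> * s)) * F f x"
proof -
  have m: "(\<lambda>y. f (T y x)) \<in> borel_measurable borel" using x by measurable
  note [measurable] = m
  have "F f x = ennreal \<bar>1\<bar> * (\<integral>\<^sup>+y. f (T (s + 1 * y) x) * ennreal (\<alpha> * exp (- \<alpha> * (s + 1 * y))) \<partial>lborel)"
    unfolding F_def by (rule nn_integral_real_affine) auto
  also have "\<dots> = (\<integral>\<^sup>+y. ennreal (exp (- \<alpha> * s)) * (f (T (y + s) x) * ennreal (\<alpha> * exp (- \<alpha> * y))) \<partial>lborel)"
  proof -
    have e: "\<alpha> * exp (- \<alpha> * (s + 1 * y)) = exp (- \<alpha> * s) * (\<alpha> * exp (- \<alpha> * y))" for y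
      by (simp add: algebra_simps flip: exp_add)
    have "ennreal (\<alpha> * exp (- \<alpha> * (s + 1 * y))) = ennreal (exp (- \<alpha> * s)) * ennreal (\<alpha> * exp (- \<alpha> * y))" for y
      unfolding e by (rule ennreal_mult) (use alpha_pos in auto)
    then have "f (T (s + 1 * y) x) * ennreal (\<alpha> * exp (- \<alpha> * (s + 1 * y)))
        = ennreal (exp (- \<alpha> * s)) * (f (T (y + s) x) * ennreal (\<alpha> * exp (- \<alpha> * y)))" for y
      by (simp only: add.commute[of s] mult_1_left mult.left_commute)
    then show ?thesis by (simp only: abs_one ennreal_1 mult_1_left)
  qed
  also have "\<dots> = ennreal (exp (- \<alpha> * s)) * (\<integral>\<^sup>+y. f (T (y + s) x) * ennreal (\<alpha> * exp (- \<alpha> * y)) \<partial>lborel)"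
    by (rule nn_integral_cmult) measurable
  finally have "ennreal (exp (\<alpha> * s)) * F f x = ennreal (exp (\<alpha> * s)) * ennreal (exp (- \<alpha> * s)) * (\<integral>\<^sup>+y. f (T (y + s) x) * ennreal (\<alpha> * exp (- \<alpha> * y)) \<partial>lborel)"
    by (simp only: mult.assoc)
  also have "ennreal (exp (\<alpha> * s)) * ennreal (exp (- \<alpha> * s)) = 1"
    by (simp add: ennreal_mult[symmetric] exp_add[symmetric] ennreal_1[symmetric] del: ennreal_1)
  finally show ?thesis by simp
qed

lemma F_T:
  assumes "f \<in> borel_measurable \<nu>" and x: "x \<in> space \<nu>"
  shows "F f (T s x) = ennreal (exp (\<alpha> * s)) * F f x"
proof -
  have "F f (T s x) = (\<integral>\<^sup>+y. f (T (y + s) x) * ennreal (\<alpha> * exp (- \<alpha> * y)) \<partial>lborel)"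
    unfolding F_def by (simp add: T_add x)
  with shift_integral[OF assms] show ?thesis by (simp only:)
qed

text \<open>Given \<open>f\<close> with \<open>\<integral> f d\<nu> = 1\<close> and \<open>0 < F f < \<infinity>\<close>, the function \<open>F f\<close> is
  homogeneous of degree \<open>\<alpha>\<close>, so \<open>x \<mapsto> T (- ln (F f x) / \<alpha>) x\<close> projects onto the angular component
  and the image of \<open>f d\<nu>\<close> under it is the desired probability measure.\<close>

lemma polar_of_density:
  assumes f[measurable]: "f \<in> borel_measurable \<nu>" and f1: "(\<integral>\<^sup>+x. f x \<partial>\<nu>) = 1"
    and Fpos: "AE x in \<nu>. F f x \<noteq> 0" and Ffin: "AE x in \<nu>. F f x \<noteq> \<infinity>"
  shows "\<exists>\<pi>. prob_space \<pi> \<and> sets \<pi> = sets \<nu> \<and> (\<forall>g\<in>borel_measurable \<nu>.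
    (\<integral>\<^sup>+x. (\<integral>\<^sup>+y. g (T y x) * ennreal (\<alpha> * exp (- \<alpha> * y)) \<partial>lborel) \<partial>\<pi>) = (\<integral>\<^sup>+x. g x \<partial>\<nu>))"
proof -
  \<comment> \<open>Chosen such that \<open>F f (T (r x) x) = 1\<close> wherever
    \<open>F f x\<close> is positive and finite; on the remaining null set the value produced by
    \<open>enn2real\<close> does not affect integrals.\<close>
  define r where "r x = - ln (enn2real (F f x)) / \<alpha>" for x
  have r[measurable]: "r \<in> borel_measurable \<nu>" unfolding r_def by measurable
  define \<pi> where "\<pi> = distr (density \<nu> f) \<nu> (\<lambda>x. T (r x) x)"
  have m: "(\<lambda>x. T (r x) x) \<in> measurable (density \<nu> f) \<nu>" by measurable
  have "prob_space (density \<nu> f)"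
    by (rule prob_spaceI) (use f1 in \<open>simp add: emeasure_density cong: nn_integral_cong\<close>)
  then have p: "prob_space \<pi>" unfolding \<pi>_def by (rule prob_space.prob_space_distr[OF _ m])
  have "(\<integral>\<^sup>+x. (\<integral>\<^sup>+y. g (T y x) * ennreal (\<alpha> * exp (- \<alpha> * y)) \<partial>lborel) \<partial>\<pi>) = (\<integral>\<^sup>+x. g x \<partial>\<nu>)"
    if g[measurable]: "g \<in> borel_measurable \<nu>" for g
  proof -
    have "(\<integral>\<^sup>+x. (\<integral>\<^sup>+y. g (T y x) * ennreal (\<alpha> * exp (- \<alpha> * y)) \<partial>lborel) \<partial>\<pi>) = (\<integral>\<^sup>+x. F g x \<partial>\<pi>)"
      by (simp add: F_def)
    also have "\<dots> = (\<integral>\<^sup>+x. F g (T (r x) x) \<partial>density \<nu> f)"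
      unfolding \<pi>_def by (rule nn_integral_distr[OF m]) measurable
    also have "\<dots> = (\<integral>\<^sup>+x. f x * F g (T (r x) x) \<partial>\<nu>)" by (rule nn_integral_density) measurable
    also have "\<dots> = (\<integral>\<^sup>+x. f x * (F g x / F f x) \<partial>\<nu>)"
    proof (rule nn_integral_cong_AE)
      show "AE x in \<nu>. f x * F g (T (r x) x) = f x * (F g x / F f x)"
        using Fpos Ffin AE_space
      proof eventually_elim
        case (elim x)
        obtain c where c: "F f x = ennreal c" "c > 0"
          using elim by (cases "F f x") (auto simp: ennreal_eq_0_iff less_le)
        have "exp (\<alpha> * r x) = 1 / c"
          using c alpha_pos by (simp add: r_def exp_minus inverse_eq_divide)
        then have "ennreal (exp (\<alpha> * r x)) = 1 / F f x"
          using c by (simp add: divide_ennreal[symmetric] ennreal_1[symmetric] del: ennreal_1)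
        then have "F g (T (r x) x) = F g x / F f x"
          using F_T[OF g elim(3), of "r x"] by (simp add: ennreal_times_divide mult.commute)
        then show ?case by simp
      qed
    qed
    also have "\<dots> = (\<integral>\<^sup>+x. (\<integral>\<^sup>+y. f x / F f x * (g (T y x) * ennreal (\<alpha> * exp (- \<alpha> * y))) \<partial>lborel) \<partial>\<nu>)"
    proof (rule nn_integral_cong)
      fix x assume x: "x \<in> space \<nu>"
      have [measurable]: "(\<lambda>y. g (T y x)) \<in> borel_measurable borel" using x by measurable
      have "f x * (F g x / F f x) = f x / F f x * F g x"
        by (simp add: ennreal_times_divide mult.commute)
      also have "\<dots> = (\<integral>\<^sup>+y. f x / F f x * (g (T y x) * ennreal (\<alpha> * exp (- \<alpha> * y))) \<partial>lborel)"
        unfolding F_def[of g] by (rule nn_integral_cmult[symmetric]) measurable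
      finally show "f x * (F g x / F f x) = (\<integral>\<^sup>+y. f x / F f x * (g (T y x) * ennreal (\<alpha> * exp (- \<alpha> * y))) \<partial>lborel)" .
    qed
    also have "\<dots> = (\<integral>\<^sup>+y. (\<integral>\<^sup>+x. f x / F f x * (g (T y x) * ennreal (\<alpha> * exp (- \<alpha> * y))) \<partial>\<nu>) \<partial>lborel)"
      by (rule P.Fubini'[symmetric]) measurable
    \<comment> \<open>For fixed \<open>y\<close> the flow is shifted from \<open>g\<close> to
      \<open>f\<close>. Homogeneity of the measure gives one factor
      \<open>exp (\<alpha> * y)\<close> and homogeneity of \<open>F f\<close> in the denominator
      another; together they turn \<open>exp (- \<alpha> * y)\<close> into
      \<open>exp (\<alpha> * y)\<close>.\<close>
    also have "\<dots> = (\<integral>\<^sup>+y. (\<integral>\<^sup>+x. g x / F f x * (f (T (- y) x) * ennreal (\<alpha> * exp (\<alpha> * y))) \<partial>\<nu>) \<partial>lborel)"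
    proof (rule nn_integral_cong)
      fix y :: real
      define h where "h x = f (T (- y) x) / F f (T (- y) x) * (g x * ennreal (\<alpha> * exp (- \<alpha> * y)))" for x
      have h[measurable]: "h \<in> borel_measurable \<nu>" unfolding h_def by measurable
      have "(\<integral>\<^sup>+x. f x / F f x * (g (T y x) * ennreal (\<alpha> * exp (- \<alpha> * y))) \<partial>\<nu>) = (\<integral>\<^sup>+x. h (T y x) \<partial>\<nu>)"
        by (rule nn_integral_cong) (simp add: h_def T_add T_0)
      also have "\<dots> = ennreal (exp (\<alpha> * y)) * (\<integral>\<^sup>+x. h x \<partial>\<nu>)" by (rule homogeneous[OF h])
      also have "\<dots> = (\<integral>\<^sup>+x. ennreal (exp (\<alpha> * y)) * h x \<partial>\<nu>)" by (rule nn_integral_cmult[symmetric]) measurable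
      also have "\<dots> = (\<integral>\<^sup>+x. g x / F f x * (f (T (- y) x) * ennreal (\<alpha> * exp (\<alpha> * y))) \<partial>\<nu>)"
      proof (rule nn_integral_cong_AE)
        show "AE x in \<nu>. ennreal (exp (\<alpha> * y)) * h x = g x / F f x * (f (T (- y) x) * ennreal (\<alpha> * exp (\<alpha> * y)))"
          using Fpos Ffin AE_space
        proof eventually_elim
          case (elim x)
          obtain c where c: "F f x = ennreal c" "c > 0"
            using elim by (cases "F f x") (auto simp: ennreal_eq_0_iff less_le)
          have F1: "F f (T (- y) x) = ennreal (exp (- \<alpha> * y) * c)"
            using F_T[OF f elim(3), of "- y"] c by (simp add: ennreal_mult')
          have d: "a / ennreal b = a * ennreal (1 / b)" if "b > 0" for a b
            using that by (simp add: divide_ennreal_def inverse_ennreal inverse_eq_divide)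
          have cc: "exp (\<alpha> * y) * (1 / (exp (- \<alpha> * y) * c) * (\<alpha> * exp (- \<alpha> * y))) = 1 / c * (\<alpha> * exp (\<alpha> * y))"
            using c(2) by simp
          have prod: "ennreal (exp (\<alpha> * y)) * (ennreal (1 / (exp (- \<alpha> * y) * c)) * ennreal (\<alpha> * exp (- \<alpha> * y)))
            = ennreal (1 / c) * ennreal (\<alpha> * exp (\<alpha> * y))"
          proof -
            have n: "0 \<le> exp (\<alpha> * y)" "0 \<le> 1 / (exp (- \<alpha> * y) * c)" "0 \<le> \<alpha> * exp (- \<alpha> * y)"
              "0 \<le> 1 / (exp (- \<alpha> * y) * c) * (\<alpha> * exp (- \<alpha> * y))" "0 \<le> 1 / c" "0 \<le> \<alpha> * exp (\<alpha> * y)"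
              using c(2) alpha_pos by auto
            show ?thesis
              by (simp only: ennreal_mult[OF n(2,3), symmetric] ennreal_mult[OF n(1,4), symmetric] ennreal_mult[OF n(5,6), symmetric] cc)
          qed
          have "ennreal (exp (\<alpha> * y)) * h x = f (T (- y) x) * g x
              * (ennreal (exp (\<alpha> * y)) * (ennreal (1 / (exp (- \<alpha> * y) * c)) * ennreal (\<alpha> * exp (- \<alpha> * y))))"
            unfolding h_def F1 using c(2) by (subst d) (simp_all only: mult_ac, simp)
          also have "\<dots> = f (T (- y) x) * g x * (ennreal (1 / c) * ennreal (\<alpha> * exp (\<alpha> * y)))"
            unfolding prod ..
          also have "\<dots> = g x / F f x * (f (T (- y) x) * ennreal (\<alpha> * exp (\<alpha> * y)))"
            unfolding c(1) d[OF c(2)] by (simp only: mult_ac)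
          finally show ?case .
        qed
      qed
      finally show "(\<integral>\<^sup>+x. f x / F f x * (g (T y x) * ennreal (\<alpha> * exp (- \<alpha> * y))) \<partial>\<nu>)
        = (\<integral>\<^sup>+x. g x / F f x * (f (T (- y) x) * ennreal (\<alpha> * exp (\<alpha> * y))) \<partial>\<nu>)" .
    qed
    also have "\<dots> = (\<integral>\<^sup>+x. (\<integral>\<^sup>+y. g x / F f x * (f (T (- y) x) * ennreal (\<alpha> * exp (\<alpha> * y))) \<partial>lborel) \<partial>\<nu>)"
      by (rule P.Fubini') measurable
    also have "\<dots> = (\<integral>\<^sup>+x. g x \<partial>\<nu>)"
    proof (rule nn_integral_cong_AE)
      show "AE x in \<nu>. (\<integral>\<^sup>+y. g x / F f x * (f (T (- y) x) * ennreal (\<alpha> * exp (\<alpha> * y))) \<partial>lborel) = g x"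
        using Fpos Ffin AE_space
      proof eventually_elim
        case (elim x)
        have [measurable]: "(\<lambda>y. f (T y x)) \<in> borel_measurable borel" using elim(3) by measurable
        \<comment> \<open>The reflection of \<open>y\<close> turns the inner integral back into
          \<open>F f x\<close>, which cancels the denominator.\<close>
        have "F f x = ennreal \<bar>-1\<bar> * (\<integral>\<^sup>+y. f (T (0 + (-1) * y) x) * ennreal (\<alpha> * exp (- \<alpha> * (0 + (-1) * y))) \<partial>lborel)"
          unfolding F_def by (rule nn_integral_real_affine) auto
        then have "(\<integral>\<^sup>+y. f (T (- y) x) * ennreal (\<alpha> * exp (\<alpha> * y)) \<partial>lborel) = F f x" by simp
        moreover have "(\<integral>\<^sup>+y. g x / F f x * (f (T (- y) x) * ennreal (\<alpha> * exp (\<alpha> * y))) \<partial>lborel)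
          = g x / F f x * (\<integral>\<^sup>+y. f (T (- y) x) * ennreal (\<alpha> * exp (\<alpha> * y)) \<partial>lborel)"
          by (rule nn_integral_cmult) measurable
        ultimately show ?case using elim
          by (simp add: ennreal_times_divide mult.commute mult_divide_eq_ennreal)
      qed
    qed
    finally show ?thesis .
  qed
  then show ?thesis using p by (intro exI[of _ \<pi>]) (simp add: \<pi>_def)
qed

text \<open>The density is built from the averages \<open>a x = \<integral>\<^sub>0\<^sup>1 f (T y x) dy\<close> of a strictly positive
  integrable \<open>f \<le> 1\<close>. Homogeneity makes \<open>\<integral> f (T y x) dy\<close> over \<open>y < 0\<close> finite almost everywhere, so
  \<open>a (T y x)\<close> tends to \<open>0\<close> as \<open>y\<close> decreases, and the part of the orbit where \<open>a\<close> exceeds half of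
  its supremum is open, not empty and bounded from below.\<close>

lemma exists_density:
  "\<exists>f. f \<in> borel_measurable \<nu> \<and> (\<integral>\<^sup>+x. f x \<partial>\<nu>) = 1 \<and> (AE x in \<nu>. F f x \<noteq> 0) \<and> (AE x in \<nu>. F f x \<noteq> \<infinity>)"
proof -
  obtain h where h: "h \<in> borel_measurable \<nu>" "(\<integral>\<^sup>+x. h x \<partial>\<nu>) \<noteq> \<infinity>" "\<And>x. x \<in> space \<nu> \<Longrightarrow> 0 < h x \<and> h x < \<infinity>"
    using Ex_finite_integrable_function by blast
  note [measurable] = h(1)
  \<comment> \<open>The cap at \<open>1\<close> bounds the averages \<open>a\<close> and makes them
    Lipschitz along orbits.\<close>
  define f where "f x = enn2real (min (h x) 1)" for x
  have f[measurable]: "f \<in> borel_measurable \<nu>" unfolding f_def by measurable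
  have ef: "ennreal (f x) = min (h x) 1" for x
    unfolding f_def by (rule ennreal_enn2real) (simp add: min_less_iff_disj)
  have f0: "0 \<le> f x" for x by (simp add: f_def)
  have f1: "f x \<le> 1" for x
  proof -
    have "ennreal (f x) \<le> ennreal 1" unfolding ef by simp
    then show ?thesis by (simp only: ennreal_le_iff zero_le_one)
  qed
  have fpos: "0 < f x" if "x \<in> space \<nu>" for x
  proof -
    have "0 < ennreal (f x)" unfolding ef using h(3)[OF that] by (simp add: min_def)
    then show ?thesis by (simp add: ennreal_less_zero_iff)
  qed
  have ffin: "(\<integral>\<^sup>+x. ennreal (f x) \<partial>\<nu>) < \<infinity>"
  proof -
    have "(\<integral>\<^sup>+x. ennreal (f x) \<partial>\<nu>) \<le> (\<integral>\<^sup>+x. h x \<partial>\<nu>)" by (rule nn_integral_mono) (simp add: ef)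
    also have "\<dots> < \<infinity>" using h(2) by (simp add: less_top)
    finally show ?thesis .
  qed
  have orb[measurable]: "(\<lambda>y. f (T y x)) \<in> borel_measurable borel" if "x \<in> space \<nu>" for x using that by measurable
  define a where "a x = (\<integral>y. indicator {0<..1} y * f (T y x) \<partial>lborel)" for x
  have a[measurable]: "a \<in> borel_measurable \<nu>" unfolding a_def[abs_def] by measurable
  have int: "integrable lborel (\<lambda>y. indicator {s<..t} y * f (T y x))" if x: "x \<in> space \<nu>" for s t x
  proof (rule Bochner_Integration.integrable_bound)
    show "integrable lborel (indicator {s<..t} :: real \<Rightarrow> real)"
      by (cases "s \<le> t") (auto intro!: integrable_real_indicator)
    show "(\<lambda>y. indicator {s<..t} y * f (T y x)) \<in> borel_measurable lborel" using orb[OF x] by measurable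
    show "AE y in lborel. norm (indicator {s<..t} y * f (T y x)) \<le> norm (indicator {s<..t} y :: real)"
      by (intro AE_I2) (simp add: indicator_def f0 f1)
  qed
  have aT: "a (T t x) = (\<integral>y. indicator {t<..t + 1} y * f (T y x) \<partial>lborel)" if x: "x \<in> space \<nu>" for t x
  proof -
    have "(\<integral>y. indicator {t<..t + 1} y * f (T y x) \<partial>lborel)
        = \<bar>1\<bar> *\<^sub>R (\<integral>y. indicator {t<..t + 1} (t + 1 * y) * f (T (t + 1 * y) x) \<partial>lborel)"
      by (rule lborel_integral_real_affine) simp
    also have "\<dots> = a (T t x)"
      unfolding a_def by (auto intro!: Bochner_Integration.integral_cong simp: indicator_def T_add[OF x] add.commute)
    finally show ?thesis by simp
  qed
  have a0: "0 \<le> a x" for x unfolding a_def by (rule Bochner_Integration.integral_nonneg) (simp add: f0)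
  have a1: "a x \<le> 1" if x: "x \<in> space \<nu>" for x
  proof -
    have "a x \<le> (\<integral>y. indicator {0<..1::real} y \<partial>lborel)"
      unfolding a_def
    proof (rule integral_mono[OF int[OF x]])
      show "integrable lborel (indicator {0<..1::real} :: real \<Rightarrow> real)" by (auto intro!: integrable_real_indicator)
    qed (simp add: indicator_def f0 f1)
    then show ?thesis by simp
  qed
  have apos: "0 < a x" if x: "x \<in> space \<nu>" for x
  proof -
    have "a x \<noteq> 0"
    proof
      assume "a x = 0"
      then have "AE y in lborel. indicator {0<..1} y * f (T y x) = 0"
        unfolding a_def using integral_nonneg_eq_0_iff_AE[OF int[OF x], of 0 1] by (simp add: f0)
      then have "AE y in lborel. y \<notin> {0<..1::real}"
      proof eventually_elim
        case (elim y)
        then show ?case using fpos[OF T_space[OF x], of y] by (auto simp: indicator_def split: if_splits)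
      qed
      then have "emeasure lborel {0<..1::real} = 0"
        by (rule AE_iff_measurable[THEN iffD1, rotated 2]) auto
      then show False by simp
    qed
    with a0[of x] show ?thesis by simp
  qed
  have alip: "\<bar>a (T t x) - a (T s x)\<bar> \<le> 2 * \<bar>t - s\<bar>" if x: "x \<in> space \<nu>" for s t x
  proof -
    have main: "\<bar>a (T t x) - a (T s x)\<bar> \<le> 2 * (t - s)" if st: "s \<le> t" for s t
    proof -
      have "a (T t x) - a (T s x) = (\<integral>y. indicator {t<..t + 1} y * f (T y x) - indicator {s<..s + 1} y * f (T y x) \<partial>lborel)"
        unfolding aT[OF x] by (rule Bochner_Integration.integral_diff[symmetric, OF int[OF x] int[OF x]])
      also have "\<bar>\<dots>\<bar> \<le> (\<integral>y. indicator {s<..t} y + indicator {s + 1<..t + 1} y \<partial>lborel)"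
      proof (rule integral_abs_bound_integral)
        show "integrable lborel (\<lambda>y. indicator {t<..t + 1} y * f (T y x) - indicator {s<..s + 1} y * f (T y x))"
          by (intro Bochner_Integration.integrable_diff int[OF x])
        show "integrable lborel (\<lambda>y. indicator {s<..t} y + indicator {s + 1<..t + 1} y :: real)"
          using st by (intro Bochner_Integration.integrable_add integrable_real_indicator) auto
        show "\<bar>indicator {t<..t + 1} y * f (T y x) - indicator {s<..s + 1} y * f (T y x)\<bar>
            \<le> indicator {s<..t} y + indicator {s + 1<..t + 1} y" for y
          using st f0[of "T y x"] f1[of "T y x"] by (auto simp: indicator_def)
      qed
      also have "\<dots> = 2 * (t - s)"
        using st by (subst Bochner_Integration.integral_add) (auto intro!: integrable_real_indicator)
      finally show ?thesis .
    qed
    show ?thesis using main[of s t] main[of t s] by (cases "s \<le> t") (auto simp: abs_minus_commute)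
  qed
  define Z where "Z x = (SUP t. a (T t x))" for x
  have bdd: "bdd_above (range (\<lambda>t. a (T t x)))" if x: "x \<in> space \<nu>" for x
    by (rule bdd_aboveI[of _ 1]) (use a1 T_space[OF x] in auto)
  have Zge: "a (T t x) \<le> Z x" if "x \<in> space \<nu>" for t x
    unfolding Z_def by (rule cSUP_upper[OF UNIV_I bdd[OF that]])
  have Zpos: "0 < Z x" if x: "x \<in> space \<nu>" for x
    using apos[OF x] Zge[OF x, of 0] by (simp add: T_0[OF x])
  have Zless: "c < Z x \<longleftrightarrow> (\<exists>t. c < a (T t x))" if "x \<in> space \<nu>" for c x
    unfolding Z_def using less_cSUP_iff[OF UNIV_not_empty bdd[OF that]] by simp
  have near: "\<exists>d>0. \<forall>s. \<bar>s - t\<bar> < d \<longrightarrow> c < a (T s x)" if x: "x \<in> space \<nu>" and c: "c < a (T t x)" for c t x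
  proof (intro exI[of _ "(a (T t x) - c) / 2"] conjI allI impI)
    fix s assume "\<bar>s - t\<bar> < (a (T t x) - c) / 2"
    moreover have "a (T t x) - a (T s x) \<le> 2 * \<bar>t - s\<bar>"
      using alip[OF x, of t s] by (rule order_trans[OF abs_ge_self])
    ultimately show "c < a (T s x)" by (simp add: abs_minus_commute field_simps)
  qed (use c in simp)
  have Z[measurable]: "Z \<in> borel_measurable \<nu>"
    unfolding borel_measurable_iff_greater
  proof
    fix c
    \<comment> \<open>The supremum runs over uncountably many \<open>t\<close>; continuity of
      \<open>a\<close> along orbits reduces it to rational ones.\<close>
    have "{x \<in> space \<nu>. c < Z x} = (\<Union>q::rat. {x \<in> space \<nu>. c < a (T (of_rat q) x)})"
    proof (intro equalityI subsetI)
      fix x assume "x \<in> {x \<in> space \<nu>. c < Z x}"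
      then have x: "x \<in> space \<nu>" and "c < Z x" by auto
      then obtain t where "c < a (T t x)" using Zless by blast
      from near[OF x this] obtain d where d: "d > 0" "\<And>s. \<bar>s - t\<bar> < d \<Longrightarrow> c < a (T s x)" by blast
      obtain q where "t < of_rat q" "of_rat q < t + d" using of_rat_dense[of t "t + d"] d(1) by auto
      then have "c < a (T (of_rat q) x)" by (intro d(2)) simp
      with x show "x \<in> (\<Union>q::rat. {x \<in> space \<nu>. c < a (T (of_rat q) x)})" by blast
    qed (auto simp: Zless)
    moreover have "\<dots> \<in> sets \<nu>" by measurable
    ultimately show "{w \<in> space \<nu>. c < Z w} \<in> sets \<nu>" by simp
  qed
  have ZT: "Z (T s x) = Z x" if x: "x \<in> space \<nu>" for s x
  proof (rule antisym)
    show "Z (T s x) \<le> Z x" unfolding Z_def[of "T s x"]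
      by (rule cSUP_least) (simp_all add: T_add[OF x] Zge[OF x])
    show "Z x \<le> Z (T s x)" unfolding Z_def[of x]
    proof (rule cSUP_least)
      fix t show "a (T t x) \<le> Z (T s x)" using Zge[OF T_space[OF x], of "t - s" s] by (simp add: T_add[OF x])
    qed simp
  qed
  \<comment> \<open>\<open>Z\<close> is constant along orbits, so the threshold is the same at all
    points of an orbit; any fixed fraction of the supremum strictly between \<open>0\<close> and
    \<open>1\<close> would serve as well as one half.\<close>
  define f2 where "f2 x = (if a x > Z x / 2 then ennreal (a x) else 0)" for x
  have f2[measurable]: "f2 \<in> borel_measurable \<nu>" unfolding f2_def by measurable
  have f2T: "f2 (T y x) = (if a (T y x) > Z x / 2 then ennreal (a (T y x)) else 0)" if "x \<in> space \<nu>" for x y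
    by (simp add: f2_def ZT[OF that])
  \<comment> \<open>The half-line \<open>{..1}\<close> covers both the negative axis, for the decay
    of \<open>a\<close>, and the window \<open>{0<..1}\<close>, for the integrability of
    \<open>f2\<close>. By homogeneity the integral over \<open>x\<close> is proportional to
    \<open>exp (\<alpha> * y)\<close>, which is integrable there.\<close>
  have half: "(\<integral>\<^sup>+x. (\<integral>\<^sup>+y. ennreal (f (T y x)) * indicator {..1} y \<partial>lborel) \<partial>\<nu>) < \<infinity>"
  proof -
    have "(\<integral>\<^sup>+x. (\<integral>\<^sup>+y. ennreal (f (T y x)) * indicator {..1} y \<partial>lborel) \<partial>\<nu>)
        = (\<integral>\<^sup>+y. (\<integral>\<^sup>+x. ennreal (f (T y x)) * indicator {..1} y \<partial>\<nu>) \<partial>lborel)"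
      by (rule P.Fubini'[symmetric]) measurable
    also have "\<dots> = (\<integral>\<^sup>+y. ennreal (exp (\<alpha> * y)) * indicator {..1} y * (\<integral>\<^sup>+x. ennreal (f x) \<partial>\<nu>) \<partial>lborel)"
    proof (rule nn_integral_cong)
      fix y :: real
      have "(\<integral>\<^sup>+x. ennreal (f (T y x)) * indicator {..1} y \<partial>\<nu>) = (\<integral>\<^sup>+x. ennreal (f (T y x)) \<partial>\<nu>) * indicator {..1} y"
        by (rule nn_integral_multc) measurable
      also have "(\<integral>\<^sup>+x. ennreal (f (T y x)) \<partial>\<nu>) = ennreal (exp (\<alpha> * y)) * (\<integral>\<^sup>+x. ennreal (f x) \<partial>\<nu>)"
        by (rule homogeneous) measurable
      finally show "(\<integral>\<^sup>+x. ennreal (f (T y x)) * indicator {..1} y \<partial>\<nu>)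
        = ennreal (exp (\<alpha> * y)) * indicator {..1} y * (\<integral>\<^sup>+x. ennreal (f x) \<partial>\<nu>)" by (simp only: mult_ac)
    qed
    also have "\<dots> = (\<integral>\<^sup>+y. ennreal (exp (\<alpha> * y)) * indicator {..1} y \<partial>lborel) * (\<integral>\<^sup>+x. ennreal (f x) \<partial>\<nu>)"
      by (rule nn_integral_multc) measurable
    also have "(\<integral>\<^sup>+y. ennreal (exp (\<alpha> * y)) * indicator {..1} y \<partial>lborel) < \<infinity>"
    proof -
      have "(\<integral>\<^sup>+y. ennreal (exp (\<alpha> * y)) * indicator {..1} y \<partial>lborel)
        = ennreal \<bar>-1\<bar> * (\<integral>\<^sup>+y. ennreal (exp (\<alpha> * (0 + (-1) * y))) * indicator {..1} (0 + (-1) * y) \<partial>lborel)"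
        by (rule nn_integral_real_affine) auto
      also have "\<dots> = (\<integral>\<^sup>+y. ennreal (1 / \<alpha>) * (ennreal (\<alpha> * exp (- \<alpha> * y)) * indicator {-1..} y) \<partial>lborel)"
        using alpha_pos by (auto intro!: nn_integral_cong simp: indicator_def ennreal_mult[symmetric])
      also have "\<dots> = ennreal (1 / \<alpha>) * ennreal (exp (- \<alpha> * - 1))"
        by (subst nn_integral_cmult) (simp_all only: nn_integral_exp_atLeast[OF alpha_pos], measurable)
      also have "\<dots> < \<infinity>" by (simp add: ennreal_mult_less_top)
      finally show ?thesis .
    qed
    then have "(\<integral>\<^sup>+y. ennreal (exp (\<alpha> * y)) * indicator {..1} y \<partial>lborel) * (\<integral>\<^sup>+x. ennreal (f x) \<partial>\<nu>) < \<infinity>"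
      using ffin by (simp add: ennreal_mult_less_top)
    finally show ?thesis .
  qed
  have aefin: "AE x in \<nu>. (\<integral>\<^sup>+y. ennreal (f (T y x)) * indicator {..1} y \<partial>lborel) \<noteq> \<infinity>"
    by (rule nn_integral_PInf_AE) (use half in auto)
  have f2i: "(\<integral>\<^sup>+x. f2 x \<partial>\<nu>) < \<infinity>"
  proof -
    have "(\<integral>\<^sup>+x. f2 x \<partial>\<nu>) \<le> (\<integral>\<^sup>+x. (\<integral>\<^sup>+y. ennreal (f (T y x)) * indicator {..1} y \<partial>lborel) \<partial>\<nu>)"
    proof (rule nn_integral_mono)
      fix x assume x: "x \<in> space \<nu>"
      have "f2 x \<le> ennreal (a x)" by (simp add: f2_def)
      also have "\<dots> = (\<integral>\<^sup>+y. ennreal (indicator {0<..1} y * f (T y x)) \<partial>lborel)"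
        unfolding a_def by (rule nn_integral_eq_integral[OF int[OF x], symmetric]) (simp add: f0)
      also have "\<dots> \<le> (\<integral>\<^sup>+y. ennreal (f (T y x)) * indicator {..1} y \<partial>lborel)"
        by (rule nn_integral_mono) (auto simp: indicator_def)
      finally show "f2 x \<le> (\<integral>\<^sup>+y. ennreal (f (T y x)) * indicator {..1} y \<partial>lborel)" .
    qed
    with half show ?thesis by (rule le_less_trans[rotated])
  qed
  have Fpos: "F f2 x \<noteq> 0" if x: "x \<in> space \<nu>" for x
  proof
    have [measurable]: "(\<lambda>y. f2 (T y x)) \<in> borel_measurable borel" using x by measurable
    assume "F f2 x = 0"
    then have "AE y in lborel. f2 (T y x) * ennreal (\<alpha> * exp (- \<alpha> * y)) = 0"
      unfolding F_def by (subst (asm) nn_integral_0_iff_AE) auto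
    then have ae: "AE y in lborel. \<not> a (T y x) > Z x / 2"
    proof eventually_elim
      case (elim y)
      then have "f2 (T y x) = 0" using alpha_pos by (auto simp: ennreal_eq_0_iff mult_le_0_iff not_le)
      then show ?case unfolding f2T[OF x] using apos[OF T_space[OF x], of y] by (auto simp: ennreal_eq_0_iff split: if_splits)
    qed
    obtain t where "Z x / 2 < a (T t x)" using Zless[OF x, of "Z x / 2"] Zpos[OF x] by auto
    from near[OF x this] obtain d where d: "d > 0" "\<And>s. \<bar>s - t\<bar> < d \<Longrightarrow> Z x / 2 < a (T s x)" by blast
    from ae have "AE y in lborel. y \<notin> {t<..<t + d}"
    proof eventually_elim
      case (elim y) then show ?case using d(2)[of y] by auto
    qed
    then have "emeasure lborel {t<..<t + d} = 0"
      by (rule AE_iff_measurable[THEN iffD1, rotated 2]) auto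
    then show False using d(1) by simp
  qed
  have Ffin: "AE x in \<nu>. F f2 x \<noteq> \<infinity>"
    using aefin AE_space
  proof eventually_elim
    case (elim x)
    note x = elim(2)
    let ?G = "\<lambda>y. f (T y x) * indicator {..1} y"
    have G: "integrable lborel ?G"
    proof (rule integrableI_nonneg)
      show "?G \<in> borel_measurable lborel" using orb[OF x] by measurable
      have "(\<integral>\<^sup>+y. ennreal (?G y) \<partial>lborel) = (\<integral>\<^sup>+y. ennreal (f (T y x)) * indicator {..1} y \<partial>lborel)"
        by (rule nn_integral_cong) (simp add: indicator_def)
      then show "(\<integral>\<^sup>+y. ennreal (?G y) \<partial>lborel) < \<infinity>" using elim(1) by (simp add: less_top)
    qed (simp add: f0)
    define K where "K n = (\<integral>y. indicator {..- real n} y * ?G y \<partial>lborel)" for n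
    have Ki: "integrable lborel (\<lambda>y. indicator {..- real n} y * ?G y)" for n
      by (rule Bochner_Integration.integrable_bound[OF G]) (use orb[OF x] in \<open>auto simp: indicator_def\<close>)
    have "K \<longlonglongrightarrow> (\<integral>y. 0 \<partial>(lborel :: real measure))"
      unfolding K_def
    proof (rule integral_dominated_convergence[where w="?G"])
      show "AE y in lborel. (\<lambda>n. indicator {..- real n} y * ?G y) \<longlonglongrightarrow> 0"
      proof (intro AE_I2)
        fix y :: real
        obtain N where N: "\<bar>y\<bar> < real N" using reals_Archimedean2[of "\<bar>y\<bar>"] by blast
        have "eventually (\<lambda>n. indicator {..- real n} y * ?G y = 0) sequentially"
        proof (rule eventually_sequentiallyI[of N])
          fix n assume "N \<le> n"
          then have "\<not> y \<le> - real n" using N by linarith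
          then show "indicator {..- real n} y * ?G y = 0" by simp
        qed
        then show "(\<lambda>n. indicator {..- real n} y * ?G y) \<longlonglongrightarrow> 0" by (rule tendsto_eventually)
      qed
      show "AE y in lborel. norm (indicator {..- real n} y * ?G y) \<le> ?G y" for n
        by (intro AE_I2) (simp add: indicator_def f0)
    qed (use G Ki in auto)
    then have "K \<longlonglongrightarrow> 0" by simp
    then have "eventually (\<lambda>n. K n < Z x / 2) sequentially"
      by (rule order_tendstoD(2)) (use Zpos[OF x] in simp)
    then obtain n where n: "K n < Z x / 2" by (auto simp: eventually_sequentially)
    \<comment> \<open>The averaging window \<open>{y<..y + 1}\<close> lies to the left of
      \<open>- n\<close>, so the average is at most the tail \<open>K n\<close>, which is below the
      threshold.\<close>
    have small: "f2 (T y x) = 0" if y: "y < - real n - 1" for y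
    proof -
      have "a (T y x) \<le> K n"
        unfolding aT[OF x] K_def
      proof (rule integral_mono[OF int[OF x] Ki])
        show "indicator {y<..y + 1} z * f (T z x) \<le> indicator {..- real n} z * ?G z" for z
          using y by (auto simp: indicator_def f0)
      qed
      then show ?thesis using n by (simp add: f2T[OF x])
    qed
    have "F f2 x \<le> (\<integral>\<^sup>+y. ennreal (\<alpha> * exp (- \<alpha> * y)) * indicator {- real n - 1..} y \<partial>lborel)"
      unfolding F_def
    proof (rule nn_integral_mono)
      fix y :: real
      have "f2 (T y x) \<le> 1"
        unfolding f2T[OF x] using a1[OF T_space[OF x], of y] ennreal_leI[of _ 1] by auto
      then show "f2 (T y x) * ennreal (\<alpha> * exp (- \<alpha> * y)) \<le> ennreal (\<alpha> * exp (- \<alpha> * y)) * indicator {- real n - 1..} y"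
        using small[of y] mult_right_mono[of "f2 (T y x)" 1 "ennreal (\<alpha> * exp (- \<alpha> * y))"]
        by (cases "y < - real n - 1") simp_all
    qed
    also have "\<dots> < \<infinity>" unfolding nn_integral_exp_atLeast[OF alpha_pos] by simp
    finally show ?case by simp
  qed
  define c where "c = (\<integral>\<^sup>+x. f2 x \<partial>\<nu>)"
  \<comment> \<open>If \<open>f2\<close> had integral zero, so would its translates along the flow,
    and \<open>F f2\<close> would vanish almost everywhere; it is positive everywhere and the
    measure is not zero.\<close>
  have c_ne: "c \<noteq> 0"
  proof
    assume "c = 0"
    then have z: "(\<integral>\<^sup>+x. f2 (T y x) \<partial>\<nu>) = 0" for y using homogeneous[OF f2, of y] by (simp add: c_def)
    have "(\<integral>\<^sup>+x. F f2 x \<partial>\<nu>) = (\<integral>\<^sup>+y. (\<integral>\<^sup>+x. f2 (T y x) * ennreal (\<alpha> * exp (- \<alpha> * y)) \<partial>\<nu>) \<partial>lborel)"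
      unfolding F_def by (rule P.Fubini'[symmetric]) measurable
    also have "\<dots> = (\<integral>\<^sup>+y. (\<integral>\<^sup>+x. f2 (T y x) \<partial>\<nu>) * ennreal (\<alpha> * exp (- \<alpha> * y)) \<partial>lborel)"
      by (intro nn_integral_cong nn_integral_multc) measurable
    also have "\<dots> = 0" by (simp add: z)
    finally have "AE x in \<nu>. F f2 x = 0" by (subst (asm) nn_integral_0_iff_AE) auto
    then have "AE x in \<nu>. False" using AE_space by eventually_elim (use Fpos in auto)
    then have "emeasure \<nu> (space \<nu>) = 0" by (subst (asm) AE_iff_measurable[of "space \<nu>"]) auto
    with nonzero show False by simp
  qed
  have c_fin: "c \<noteq> \<infinity>" using f2i by (simp add: c_def)
  define f3 where "f3 x = f2 x / c" for x
  have f3[measurable]: "f3 \<in> borel_measurable \<nu>" unfolding f3_def by measurable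
  have "(\<integral>\<^sup>+x. f3 x \<partial>\<nu>) = c / c" unfolding f3_def c_def by (rule nn_integral_divide) measurable
  then have one: "(\<integral>\<^sup>+x. f3 x \<partial>\<nu>) = 1"
    using mult_divide_eq_ennreal[of c 1] c_ne c_fin by simp
  have F3: "F f3 x = F f2 x / c" if x: "x \<in> space \<nu>" for x
  proof -
    have [measurable]: "(\<lambda>y. f2 (T y x)) \<in> borel_measurable borel" using x by measurable
    have "F f3 x = (\<integral>\<^sup>+y. f2 (T y x) * ennreal (\<alpha> * exp (- \<alpha> * y)) / c \<partial>lborel)"
      unfolding F_def f3_def by (simp only: divide_ennreal_def mult_ac)
    also have "\<dots> = F f2 x / c" unfolding F_def by (rule nn_integral_divide) measurable
    finally show ?thesis .
  qed
  show ?thesis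
  proof (intro exI[of _ f3] conjI f3 one)
    show "AE x in \<nu>. F f3 x \<noteq> 0"
      using AE_space by eventually_elim (use Fpos c_fin in \<open>simp add: F3 ennreal_divide_eq_0_iff\<close>)
    show "AE x in \<nu>. F f3 x \<noteq> \<infinity>"
      using Ffin AE_space by eventually_elim (use c_ne in \<open>simp add: F3 ennreal_divide_eq_top_iff\<close>)
  qed
qed

theorem polar_decomposition:
  "\<exists>\<pi>. prob_space \<pi> \<and> sets \<pi> = sets \<nu> \<and> (\<forall>g\<in>borel_measurable \<nu>.
    (\<integral>\<^sup>+x. (\<integral>\<^sup>+y. g (T y x) * ennreal (\<alpha> * exp (- \<alpha> * y)) \<partial>lborel) \<partial>\<pi>) = (\<integral>\<^sup>+x. g x \<partial>\<nu>))"
  using exists_density polar_of_density by blast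

end

section \<open>Laplace functionals of Poisson processes\<close>

text \<open>\<open>exp (- x)\<close> with the value \<open>0\<close> at infinity. Sums over point
  processes may be infinite, and this extension remains multiplicative, continuous and injective on
  \<open>ennreal\<close>.\<close>

definition expm :: "ennreal \<Rightarrow> real" where
  "expm x = (if x = \<top> then 0 else exp (- enn2real x))"

lemma expm_top[simp]: "expm \<top> = 0" and expm_0[simp]: "expm 0 = 1"
  and expm_ennreal: "0 \<le> r \<Longrightarrow> expm (ennreal r) = exp (- r)"
  by (simp_all add: expm_def)

lemma expm_nonneg[simp]: "0 \<le> expm x" and expm_le_1[simp]: "expm x \<le> 1"
  by (simp_all add: expm_def)

lemma expm_add: "expm (x + y) = expm x * expm y"
  by (cases x; cases y) (simp_all add: expm_ennreal ennreal_plus[symmetric] exp_add[symmetric] del: ennreal_plus)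

lemma expm_sum: "expm (\<Sum>i\<in>I. f i) = (\<Prod>i\<in>I. expm (f i))"
  by (induction I rule: infinite_finite_induct) (simp_all add: expm_add)

lemma expm_eq_0_iff: "expm x = 0 \<longleftrightarrow> x = \<top>"
  by (simp add: expm_def)

lemma expm_inject: "expm x = expm y \<longleftrightarrow> x = y"
  by (cases x; cases y) (auto simp: expm_ennreal)

lemma expm_measurable[measurable]: "expm \<in> borel_measurable borel"
  unfolding expm_def[abs_def] by measurable

lemma tendsto_expm:
  assumes "(f \<longlonglongrightarrow> x)"
  shows "(\<lambda>n. expm (f n)) \<longlonglongrightarrow> expm x"
proof (cases x)
  case (real r)
  have "eventually (\<lambda>n. f n < \<top>) sequentially"
    by (rule order_tendstoD(2)[OF assms]) (simp add: real)
  then have "eventually (\<lambda>n. exp (- enn2real (f n)) = expm (f n)) sequentially"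
    by eventually_elim (simp add: expm_def)
  moreover have "(\<lambda>n. exp (- enn2real (f n))) \<longlonglongrightarrow> exp (- r)"
    by (intro tendsto_intros) (use assms real in auto)
  ultimately show ?thesis using real by (simp add: expm_ennreal tendsto_cong)
next
  case top
  show ?thesis unfolding top expm_top
  proof (rule order_tendstoI)
    fix a :: real assume "a < 0"
    then have "a < expm (f n)" for n using expm_nonneg[of "f n"] by linarith
    then show "eventually (\<lambda>n. a < expm (f n)) sequentially" by simp
  next
    fix a :: real assume a: "0 < a"
    have "eventually (\<lambda>n. ennreal (max 0 (1 - ln a)) < f n) sequentially"
      by (rule order_tendstoD(1)[OF assms]) (simp add: top)
    then show "eventually (\<lambda>n. expm (f n) < a) sequentially"
    proof eventually_elim
      case (elim n)
      show ?case
      proof (cases "f n")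
        case (real r)
        then have "max 0 (1 - ln a) < r" using elim by (simp only: ennreal_less_iff[OF max.cobounded1])
        then have "exp (- r) < exp (ln a)" by (subst exp_less_cancel_iff) linarith
        then show ?thesis using real a by (simp add: expm_ennreal)
      qed (use a in simp)
    qed
  qed
qed

text \<open>Inverse to \<open>expm\<close> on the unit interval. It turns averages of
  \<open>expm\<close> back into functions to which a Laplace functional applies.\<close>

definition logm :: "real \<Rightarrow> ennreal" where
  "logm z = (if z \<le> 0 then \<top> else ennreal (- ln z))"

lemma expm_logm: "0 \<le> z \<Longrightarrow> z \<le> 1 \<Longrightarrow> expm (logm z) = z"
  by (simp add: logm_def expm_ennreal)

lemma logm_measurable[measurable]: "logm \<in> borel_measurable borel"
  unfolding logm_def[abs_def] by measurable

text \<open>The variable stands for \<open>exp (- s)\<close> with \<open>s > 0\<close>, so only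
  \<open>0 < z < 1\<close> is available. The lowest coefficient of the difference is its limit at
  \<open>0\<close> from the right, and induction removes the coefficients one after another.\<close>

lemma power_series_unique_on_unit:
  fixes a b :: "nat \<Rightarrow> real"
  assumes a: "\<And>n. \<bar>a n\<bar> \<le> C" and b: "\<And>n. \<bar>b n\<bar> \<le> C"
    and eq: "\<And>z. 0 < z \<Longrightarrow> z < 1 \<Longrightarrow> (\<Sum>n. a n * z ^ n) = (\<Sum>n. b n * z ^ n)"
  shows "a = b"
proof -
  have C: "0 \<le> C" using a[of 0] by linarith
  have main: "d 0 = 0"
    if d: "\<And>n. \<bar>d n\<bar> \<le> K" and zero: "\<And>z. 0 < z \<Longrightarrow> z < 1 \<Longrightarrow> (\<Sum>n. d n * z ^ n) = 0" for d :: "nat \<Rightarrow> real" and K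
  proof -
    have s: "summable (\<lambda>n. d n * z ^ n)" if "norm z < 1" for z
    proof (rule summable_comparison_test')
      show "summable (\<lambda>n. K * norm z ^ n)" using that by (intro summable_mult summable_geometric) simp
      show "norm (d n * z ^ n) \<le> K * norm z ^ n" for n
        using d[of n] by (simp add: abs_mult power_abs mult_right_mono)
    qed
    have "((\<lambda>z. \<Sum>n. d n * z ^ n) \<longlongrightarrow> d 0) (at 0)"
      by (rule powser_limit_0_strong[where s=1]) (use s in \<open>auto intro: summable_sums\<close>)
    then have "((\<lambda>z. \<Sum>n. d n * z ^ n) \<longlongrightarrow> d 0) (at_right 0)" by (rule tendsto_within_subset) simp
    moreover have "((\<lambda>z. \<Sum>n. d n * z ^ n) \<longlongrightarrow> 0) (at_right 0)"
      by (rule tendsto_eventually) (auto simp: eventually_at_right_field zero intro!: exI[of _ 1])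
    ultimately show ?thesis by (rule tendsto_unique[rotated]) simp
  qed
  have sa: "summable (\<lambda>n. c n * z ^ n)" if c: "\<And>n. \<bar>c n\<bar> \<le> C" and z: "0 < z" "z < 1" for c :: "nat \<Rightarrow> real" and z
  proof (rule summable_comparison_test')
    show "summable (\<lambda>n. C * z ^ n)" using z by (intro summable_mult summable_geometric) simp
    show "norm (c n * z ^ n) \<le> C * z ^ n" for n
      using c[of n] z by (simp add: abs_mult mult_right_mono)
  qed
  have d0: "\<forall>i<n. a i = b i" for n
  proof (induction n)
    case (Suc n)
    have "(\<lambda>i. a (i + n) - b (i + n)) 0 = 0"
    proof (rule main)
      show "\<bar>a (i + n) - b (i + n)\<bar> \<le> C + C" for i
        by (rule order_trans[OF abs_triangle_ineq4 add_mono[OF a b]])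
      fix z :: real assume z: "0 < z" "z < 1"
      have sd: "summable (\<lambda>i. (a i - b i) * z ^ i)"
        using summable_diff[OF sa[of a, OF a z] sa[of b, OF b z]] by (simp add: left_diff_distrib)
      have "(\<Sum>i. (a i - b i) * z ^ i) = 0"
        using suminf_diff[OF sa[of a, OF a z] sa[of b, OF b z]] eq[OF z] by (simp add: left_diff_distrib)
      then have "(\<Sum>i. (a (i + n) - b (i + n)) * z ^ (i + n)) + (\<Sum>i<n. (a i - b i) * z ^ i) = 0"
        using suminf_split_initial_segment[OF sd, of n] by simp
      then have "(\<Sum>i. ((a (i + n) - b (i + n)) * z ^ i) * z ^ n) = 0" using Suc by (simp add: power_add mult.assoc)
      moreover have "summable (\<lambda>i. (a (i + n) - b (i + n)) * z ^ i)"
        using summable_diff[OF sa[of "\<lambda>i. a (i + n)", OF a z] sa[of "\<lambda>i. b (i + n)", OF b z]] by (simp add: left_diff_distrib)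
      ultimately have "(\<Sum>i. (a (i + n) - b (i + n)) * z ^ i) * z ^ n = 0" by (simp add: suminf_mult2)
      then show "(\<Sum>i. (a (i + n) - b (i + n)) * z ^ i) = 0" using z by simp
    qed
    then show ?case using Suc by (auto simp: less_Suc_eq)
  qed simp
  show ?thesis by (rule ext) (use d0 in blast)
qed

lemma expm_of_nat_mult: "expm (ennreal s * of_nat k) = expm (ennreal s) ^ k" if "0 \<le> s"
proof -
  have "ennreal s * of_nat k = ennreal (real k * s)"
    using that by (simp add: ennreal_mult' ennreal_of_nat_eq_real_of_nat mult.commute)
  then show ?thesis using that by (simp add: expm_ennreal exp_of_nat_mult[symmetric])
qed

text \<open>Splitting according to the value of \<open>N\<close> gives a power series in
  \<open>exp (- s)\<close> whose coefficients are the weighted masses of the events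
  \<open>N = k\<close>; an infinite value contributes nothing. The weight \<open>w\<close> permits
  this expansion inside a product over several sets.\<close>

lemma integral_expm_count:
  fixes N :: "'w \<Rightarrow> ennreal"
  assumes P: "prob_space P" and N[measurable]: "N \<in> borel_measurable P"
    and vals: "AE \<omega> in P. N \<omega> \<in> range of_nat \<or> N \<omega> = \<top>" and w: "integrable P w" and s: "0 < s"
  shows "(\<lambda>k. (\<integral>\<omega>. indicator {\<omega>\<in>space P. N \<omega> = of_nat k} \<omega> * w \<omega> \<partial>P) * exp (- s) ^ k) sums
    (\<integral>\<omega>. expm (ennreal s * N \<omega>) * w \<omega> \<partial>P :: real)"
proof -
  interpret prob_space P by fact
  have wm[measurable]: "w \<in> borel_measurable P" using w by simp
  define E where "E k = {\<omega>\<in>space P. N \<omega> = of_nat k}" for k :: nat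
  have E[measurable]: "E k \<in> sets P" for k unfolding E_def by measurable
  define z where "z = exp (- s)"
  have z: "0 < z" "z < 1" using s by (simp_all add: z_def)
  have "(\<lambda>n. \<integral>\<omega>. (\<Sum>k<n. indicator (E k) \<omega> * z ^ k) * w \<omega> \<partial>P) \<longlonglongrightarrow> (\<integral>\<omega>. expm (ennreal s * N \<omega>) * w \<omega> \<partial>P)"
  proof (rule integral_dominated_convergence[where w="\<lambda>\<omega>. norm (w \<omega>)"])
    have point: "(\<lambda>n. \<Sum>k<n. indicator (E k) \<omega> * z ^ k) \<longlonglongrightarrow> expm (ennreal s * N \<omega>) \<and> (\<forall>n. \<bar>\<Sum>k<n. indicator (E k) \<omega> * z ^ k\<bar> \<le> 1)"
      if \<omega>: "\<omega> \<in> space P" and v: "N \<omega> \<in> range of_nat \<or> N \<omega> = \<top>" for \<omega>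
    proof (cases "N \<omega> = \<top>")
      case True
      then have "indicator (E k) \<omega> = (0::real)" for k by (auto simp: E_def indicator_def)
      then show ?thesis using True s by (simp add: ennreal_mult_top)
    next
      case False
      then obtain m where m: "N \<omega> = of_nat m" using v by auto
      have ind: "indicator (E k) \<omega> = (if k = m then 1 else 0::real)" for k
        using \<omega> m by (simp add: E_def indicator_def)
      have sum: "(\<Sum>k<n. indicator (E k) \<omega> * z ^ k) = (if m < n then z ^ m else 0)" for n
      proof -
        have "(\<Sum>k<n. indicator (E k) \<omega> * z ^ k) = (\<Sum>k<n. if k = m then z ^ k else 0)"
          by (rule sum.cong) (auto simp: ind)
        then show ?thesis by (simp add: sum.delta)
      qed
      have "eventually (\<lambda>n. (\<Sum>k<n. indicator (E k) \<omega> * z ^ k) = z ^ m) sequentially"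
        by (rule eventually_sequentiallyI[of "Suc m"]) (simp add: sum)
      then have "(\<lambda>n. \<Sum>k<n. indicator (E k) \<omega> * z ^ k) \<longlonglongrightarrow> z ^ m" by (rule tendsto_eventually)
      moreover have "expm (ennreal s * N \<omega>) = z ^ m"
        unfolding m using s by (simp add: expm_of_nat_mult expm_ennreal z_def)
      moreover have "\<bar>z ^ m\<bar> \<le> 1" using z by (simp add: power_abs power_le_one)
      ultimately show ?thesis by (simp add: sum)
    qed
    show "AE \<omega> in P. (\<lambda>n. (\<Sum>k<n. indicator (E k) \<omega> * z ^ k) * w \<omega>) \<longlonglongrightarrow> expm (ennreal s * N \<omega>) * w \<omega>"
      using vals AE_space by eventually_elim (intro tendsto_mult tendsto_const conjunct1[OF point])
    show "AE \<omega> in P. norm ((\<Sum>k<n. indicator (E k) \<omega> * z ^ k) * w \<omega>) \<le> norm (w \<omega>)" for n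
      using vals AE_space
    proof eventually_elim
      case (elim \<omega>)
      have "\<bar>\<Sum>k<n. indicator (E k) \<omega> * z ^ k\<bar> \<le> 1" using point[OF elim(2,1)] by blast
      then show ?case unfolding real_norm_def abs_mult by (intro mult_left_le_one_le) auto
    qed
    show "integrable P (\<lambda>\<omega>. norm (w \<omega>))" using w by simp
  qed measurable
  moreover have "(\<integral>\<omega>. (\<Sum>k<n. indicator (E k) \<omega> * z ^ k) * w \<omega> \<partial>P) = (\<Sum>k<n. (\<integral>\<omega>. indicator (E k) \<omega> * w \<omega> \<partial>P) * z ^ k)" for n
  proof -
    have i: "integrable P (\<lambda>\<omega>. indicator (E k) \<omega> * w \<omega>)" for k
      by (rule Bochner_Integration.integrable_bound[OF w]) (auto simp: indicator_def)
    have "(\<Sum>k<n. indicator (E k) \<omega> * z ^ k) * w \<omega> = (\<Sum>k<n. indicator (E k) \<omega> * w \<omega> * z ^ k)" for \<omega>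
      unfolding sum_distrib_right by (rule sum.cong) (simp_all only: mult_ac)
    then show ?thesis using i by simp
  qed
  ultimately show ?thesis unfolding sums_def E_def z_def by simp
qed

lemma poisson_sums: "(\<lambda>k. x ^ k / fact k * exp (- x) * z ^ k) sums exp (- (1 - z) * x)" for x z :: real
proof -
  have "(\<lambda>k. exp (- x) * ((x * z) ^ k /\<^sub>R fact k)) sums (exp (- x) * exp (x * z))"
    by (rule sums_mult[OF exp_converges])
  moreover have "exp (- x) * ((x * z) ^ k /\<^sub>R fact k) = x ^ k / fact k * exp (- x) * z ^ k" for k
    by (simp add: power_mult_distrib divide_inverse)
  moreover have "exp (- x) * exp (x * z) = exp (- (1 - z) * x)"
    by (simp add: algebra_simps flip: exp_add)
  ultimately show ?thesis by simp
qed

text \<open>For one set this is the generating function of the Poisson distribution, for simple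
  functions independence over disjoint level sets multiplies such factors, and monotone limits give
  the general case.\<close>

theorem laplace_functional_of_poisson:
  fixes g :: "'b \<Rightarrow> ennreal"
  assumes pp: "poisson_process P \<nu> \<eta>" and g[measurable]: "g \<in> borel_measurable \<nu>"
  shows "(\<integral>\<omega>. expm (\<integral>\<^sup>+x. g x \<partial>\<eta> \<omega>) \<partial>P) = expm (\<integral>\<^sup>+x. ennreal (1 - expm (g x)) \<partial>\<nu>)"
    and "(\<lambda>\<omega>. \<integral>\<^sup>+x. g x \<partial>\<eta> \<omega>) \<in> borel_measurable P"
proof -
  have P: "prob_space P" using pp by (simp add: poisson_process_def)
  interpret prob_space P by fact
  have sets_\<eta>: "sets (\<eta> \<omega>) = sets \<nu>" if "\<omega> \<in> space P" for \<omega> using pp that by (simp add: poisson_process_def)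
  have em[measurable]: "(\<lambda>\<omega>. emeasure (\<eta> \<omega>) A) \<in> borel_measurable P" if "A \<in> sets \<nu>" for A
    using pp that by (simp add: poisson_process_def)
  have single: "(\<integral>\<omega>. expm (y * emeasure (\<eta> \<omega>) A) \<partial>P) = expm (ennreal (1 - expm y) * emeasure \<nu> A)"
    if A: "A \<in> sets \<nu>" for A y
  proof -
    note [measurable] = em[OF A]
    show ?thesis
    proof (cases "y = 0")
      case True then show ?thesis by (simp add: prob_space)
    next
      case y: False
      show ?thesis
      proof (cases "emeasure \<nu> A = \<infinity>")
        case True
        then have "AE \<omega> in P. emeasure (\<eta> \<omega>) A = \<infinity>" using pp A by (simp add: poisson_process_def)
        then have "AE \<omega> in P. expm (y * emeasure (\<eta> \<omega>) A) = 0"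
          by eventually_elim (use y in \<open>simp add: ennreal_mult_top\<close>)
        then have "(\<integral>\<omega>. expm (y * emeasure (\<eta> \<omega>) A) \<partial>P) = (\<integral>\<omega>. 0 \<partial>P)" by (intro integral_cong_AE) auto
        moreover have "1 - expm y > 0"
          using y expm_le_1[of y] expm_inject[of y 0] by (simp add: less_le)
        ultimately show ?thesis using True by (simp add: ennreal_mult_top)
      next
        case False
        define x where "x = measure \<nu> A"
        have x: "emeasure \<nu> A = ennreal x" "0 \<le> x"
          using False by (simp_all add: x_def emeasure_eq_ennreal_measure)
        define E where "E k = {\<omega> \<in> space P. emeasure (\<eta> \<omega>) A = of_nat k}" for k :: nat
        have E[measurable]: "E k \<in> sets P" for k unfolding E_def by measurable
        have pE: "prob (E k) = x ^ k / fact k * exp (- x)" for k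
          using pp A False unfolding poisson_process_def E_def x_def by (simp add: less_top)
        \<comment> \<open>\<open>poisson_process\<close> does not say that counts are integers;
          almost surely they are, because the Poisson probabilities sum to \<open>1\<close>.\<close>
        have "prob (\<Union>k. E k) = 1"
        proof -
          have "(\<lambda>k. prob (E k)) sums prob (\<Union>k. E k)"
            by (rule finite_measure_UNION) (auto simp: disjoint_family_on_def E_def)
          moreover have "(\<lambda>k. prob (E k)) sums 1"
            using poisson_sums[of x 1] by (simp add: pE)
          ultimately show ?thesis by (rule sums_unique2)
        qed
        then have ae: "AE \<omega> in P. \<omega> \<in> (\<Union>k. E k)" by (subst AE_in_set_eq_1) auto
        then have vals: "AE \<omega> in P. emeasure (\<eta> \<omega>) A \<in> range of_nat \<or> emeasure (\<eta> \<omega>) A = \<top>"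
          by eventually_elim (auto simp: E_def)
        show ?thesis
        proof (cases y)
          case (real s)
          then have s: "0 < s" using y by (simp add: less_le)
          have "(\<lambda>k. (\<integral>\<omega>. indicator (E k) \<omega> * 1 \<partial>P) * exp (- s) ^ k) sums (\<integral>\<omega>. expm (ennreal s * emeasure (\<eta> \<omega>) A) * 1 \<partial>P)"
            unfolding E_def by (rule integral_expm_count[OF P em[OF A] vals _ s]) simp
          then have "(\<lambda>k. x ^ k / fact k * exp (- x) * exp (- s) ^ k) sums (\<integral>\<omega>. expm (y * emeasure (\<eta> \<omega>) A) \<partial>P)"
            by (simp add: pE real)
          then have "(\<integral>\<omega>. expm (y * emeasure (\<eta> \<omega>) A) \<partial>P) = exp (- (1 - exp (- s)) * x)"
            by (rule sums_unique2[OF _ poisson_sums])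
          also have "\<dots> = expm (ennreal (1 - expm y) * emeasure \<nu> A)"
          proof -
            have "ennreal (1 - expm y) * emeasure \<nu> A = ennreal ((1 - exp (- s)) * x)"
              using real s x by (simp add: expm_ennreal ennreal_mult)
            moreover have "0 \<le> (1 - exp (- s)) * x" using s x by simp
            ultimately show ?thesis by (simp only: expm_ennreal minus_mult_left)
          qed
          finally show ?thesis .
        next
          case top
          \<comment> \<open>For infinite \<open>y\<close> the product is \<open>0\<close> if the
            count is \<open>0\<close> and infinite otherwise, so the functional is the probability
            of finding no point in \<open>A\<close>.\<close>
          have "AE \<omega> in P. expm (y * emeasure (\<eta> \<omega>) A) = indicator (E 0) \<omega>"
            using ae AE_space
          proof eventually_elim
            case (elim \<omega>)
            show ?case
            proof (cases "emeasure (\<eta> \<omega>) A = 0")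
              case True then show ?thesis using elim by (simp add: E_def)
            next
              case False then show ?thesis using top by (simp add: E_def ennreal_top_mult)
            qed
          qed
          then have "(\<integral>\<omega>. expm (y * emeasure (\<eta> \<omega>) A) \<partial>P) = (\<integral>\<omega>. indicator (E 0) \<omega> \<partial>P)"
            by (intro integral_cong_AE) auto
          also have "\<dots> = exp (- x)" using pE[of 0] by simp
          finally show ?thesis using top x by (simp add: expm_ennreal)
        qed
      qed
    qed
  qed
  have simple: "(\<integral>\<omega>. expm (\<integral>\<^sup>+x. s x \<partial>\<eta> \<omega>) \<partial>P) = expm (\<integral>\<^sup>+x. ennreal (1 - expm (s x)) \<partial>\<nu>)
      \<and> (\<lambda>\<omega>. \<integral>\<^sup>+x. s x \<partial>\<eta> \<omega>) \<in> borel_measurable P" if s: "simple_function \<nu> s" for s :: "'b \<Rightarrow> ennreal"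
  proof -
    have fin: "finite (s ` space \<nu>)" using s by (rule simple_functionD(1))
    \<comment> \<open>Enumerating the values without repetition makes the level sets
      \<open>A i\<close> disjoint, as the independence clause demands.\<close>
    obtain n and v :: "nat \<Rightarrow> ennreal" where v: "s ` space \<nu> = v ` {i. i < n}" "inj_on v {i. i < n}"
      using finite_imp_nat_seg_image_inj_on[OF fin] by blast
    define A where "A i = s -` {v i} \<inter> space \<nu>" for i
    have A[measurable]: "A i \<in> sets \<nu>" for i unfolding A_def by (rule simple_functionD(2)[OF s])
    have disj: "disjoint_family_on A {..<n}"
      using v(2) by (auto simp: disjoint_family_on_def A_def inj_on_def)
    have ind: "indep_vars (\<lambda>_. borel) (\<lambda>i \<omega>. emeasure (\<eta> \<omega>) (A i)) {..<n}"
      using pp A disj unfolding poisson_process_def by blast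
    have rep: "s x = (\<Sum>i<n. v i * indicator (A i) x)" if x: "x \<in> space \<nu>" for x
    proof -
      obtain j where j: "j < n" "s x = v j" using v(1) x by blast
      have "(\<Sum>i<n. v i * indicator (A i) x) = (\<Sum>i<n. if i = j then v i else 0)"
        using v(2) j x by (intro sum.cong refl) (auto simp: A_def indicator_def inj_on_def)
      then show ?thesis using j by simp
    qed
    have int: "(\<integral>\<^sup>+x. s x \<partial>\<eta> \<omega>) = (\<Sum>i<n. v i * emeasure (\<eta> \<omega>) (A i))" if \<omega>: "\<omega> \<in> space P" for \<omega>
    proof -
      have sp: "space (\<eta> \<omega>) = space \<nu>" by (rule sets_eq_imp_space_eq[OF sets_\<eta>[OF \<omega>]])
      have Am: "A i \<in> sets (\<eta> \<omega>)" for i using A sets_\<eta>[OF \<omega>] by simp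
      have "(\<integral>\<^sup>+x. s x \<partial>\<eta> \<omega>) = (\<integral>\<^sup>+x. (\<Sum>i<n. v i * indicator (A i) x) \<partial>\<eta> \<omega>)"
        by (rule nn_integral_cong) (simp add: rep sp)
      also have "\<dots> = (\<Sum>i<n. v i * emeasure (\<eta> \<omega>) (A i))"
        using Am by (subst nn_integral_sum) (auto simp: nn_integral_cmult_indicator)
      finally show ?thesis .
    qed
    have "(\<integral>\<omega>. expm (\<integral>\<^sup>+x. s x \<partial>\<eta> \<omega>) \<partial>P) = (\<integral>\<omega>. (\<Prod>i<n. expm (v i * emeasure (\<eta> \<omega>) (A i))) \<partial>P)"
      by (rule Bochner_Integration.integral_cong) (simp_all add: int expm_sum)
    also have "\<dots> = (\<Prod>i<n. \<integral>\<omega>. expm (v i * emeasure (\<eta> \<omega>) (A i)) \<partial>P)"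
    proof (rule indep_vars_lebesgue_integral)
      show "indep_vars (\<lambda>_. borel) (\<lambda>i \<omega>. expm (v i * emeasure (\<eta> \<omega>) (A i))) {..<n}"
        by (rule indep_vars_compose2[OF ind]) measurable
      show "integrable P (\<lambda>\<omega>. expm (v i * emeasure (\<eta> \<omega>) (A i)))" for i
        using em[OF A[of i]] by (intro integrable_const_bound[where B=1]) auto
    qed simp
    also have "\<dots> = expm (\<Sum>i<n. ennreal (1 - expm (v i)) * emeasure \<nu> (A i))"
      by (simp add: single expm_sum)
    also have "(\<Sum>i<n. ennreal (1 - expm (v i)) * emeasure \<nu> (A i)) = (\<integral>\<^sup>+x. (\<Sum>i<n. ennreal (1 - expm (v i)) * indicator (A i) x) \<partial>\<nu>)"
      by (subst nn_integral_sum) (auto simp: nn_integral_cmult_indicator)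
    also have "\<dots> = (\<integral>\<^sup>+x. ennreal (1 - expm (s x)) \<partial>\<nu>)"
    proof (rule nn_integral_cong)
      fix x assume x: "x \<in> space \<nu>"
      obtain j where j: "j < n" "s x = v j" using v(1) x by blast
      have "(\<Sum>i<n. ennreal (1 - expm (v i)) * indicator (A i) x) = (\<Sum>i<n. if i = j then ennreal (1 - expm (v i)) else 0)"
        using v(2) j x by (intro sum.cong refl) (auto simp: A_def indicator_def inj_on_def)
      then show "(\<Sum>i<n. ennreal (1 - expm (v i)) * indicator (A i) x) = ennreal (1 - expm (s x))" using j by simp
    qed
    finally have 1: "(\<integral>\<omega>. expm (\<integral>\<^sup>+x. s x \<partial>\<eta> \<omega>) \<partial>P) = expm (\<integral>\<^sup>+x. ennreal (1 - expm (s x)) \<partial>\<nu>)" .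
    have "(\<lambda>\<omega>. \<Sum>i<n. v i * emeasure (\<eta> \<omega>) (A i)) \<in> borel_measurable P"
      using em[OF A] by measurable
    then have "(\<lambda>\<omega>. \<integral>\<^sup>+x. s x \<partial>\<eta> \<omega>) \<in> borel_measurable P" by (subst measurable_cong[OF int])
    with 1 show ?thesis by blast
  qed
  obtain s where s: "\<And>i. simple_function \<nu> (s i)" "incseq s" "\<And>x. (SUP i. s i x) = g x"
    using borel_measurable_implies_simple_function_sequence'[OF g] by metis
  have sm[measurable]: "s i \<in> borel_measurable \<nu>" for i by (rule borel_measurable_simple_function[OF s(1)])
  have sx: "incseq (\<lambda>i. s i x)" for x using s(2) by (auto simp: incseq_def le_fun_def)
  have sup: "(\<integral>\<^sup>+x. g x \<partial>\<eta> \<omega>) = (SUP i. \<integral>\<^sup>+x. s i x \<partial>\<eta> \<omega>)" if \<omega>: "\<omega> \<in> space P" for \<omega>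
  proof -
    have "s i \<in> borel_measurable (\<eta> \<omega>)" for i
      using sm[of i] measurable_cong_sets[OF sets_\<eta>[OF \<omega>] refl] by blast
    from nn_integral_monotone_convergence_SUP[OF s(2) this] show ?thesis by (simp add: s(3))
  qed
  have lim: "(\<lambda>i. \<integral>\<^sup>+x. s i x \<partial>\<eta> \<omega>) \<longlonglongrightarrow> (\<integral>\<^sup>+x. g x \<partial>\<eta> \<omega>)" if "\<omega> \<in> space P" for \<omega>
    unfolding sup[OF that]
    by (rule LIMSEQ_SUP) (auto intro!: incseq_SucI nn_integral_mono incseq_SucD[OF sx])
  have "(\<lambda>\<omega>. SUP i. \<integral>\<^sup>+x. s i x \<partial>\<eta> \<omega>) \<in> borel_measurable P"
    using simple[OF s(1)] by (intro borel_measurable_SUP) auto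
  then show gm: "(\<lambda>\<omega>. \<integral>\<^sup>+x. g x \<partial>\<eta> \<omega>) \<in> borel_measurable P" by (subst measurable_cong[OF sup])
  have m[measurable]: "(\<lambda>\<omega>. \<integral>\<^sup>+x. s i x \<partial>\<eta> \<omega>) \<in> borel_measurable P" for i using simple[OF s(1)] by blast
  note [measurable] = gm
  have L1: "(\<lambda>i. \<integral>\<omega>. expm (\<integral>\<^sup>+x. s i x \<partial>\<eta> \<omega>) \<partial>P) \<longlonglongrightarrow> (\<integral>\<omega>. expm (\<integral>\<^sup>+x. g x \<partial>\<eta> \<omega>) \<partial>P)"
  proof (rule integral_dominated_convergence[where w="\<lambda>_. 1"])
    show "AE \<omega> in P. (\<lambda>i. expm (\<integral>\<^sup>+x. s i x \<partial>\<eta> \<omega>)) \<longlonglongrightarrow> expm (\<integral>\<^sup>+x. g x \<partial>\<eta> \<omega>)"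
      by (intro AE_I2 tendsto_expm lim)
  qed auto
  have expm_antimono: "x \<le> y \<Longrightarrow> expm y \<le> expm x" for x y
    by (cases x; cases y) (auto simp: expm_ennreal top_unique)
  have inc: "incseq (\<lambda>i x. ennreal (1 - expm (s i x)))"
    by (auto simp: incseq_def le_fun_def intro!: ennreal_leI expm_antimono incseqD[OF sx])
  have pt: "(SUP i. ennreal (1 - expm (s i x))) = ennreal (1 - expm (g x))" for x
  proof (rule LIMSEQ_unique[OF LIMSEQ_SUP])
    show "incseq (\<lambda>i. ennreal (1 - expm (s i x)))" using inc by (auto simp: incseq_def le_fun_def)
    have "(\<lambda>i. s i x) \<longlonglongrightarrow> g x" unfolding s(3)[symmetric] by (rule LIMSEQ_SUP[OF sx])
    then show "(\<lambda>i. ennreal (1 - expm (s i x))) \<longlonglongrightarrow> ennreal (1 - expm (g x))"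
      by (intro tendsto_ennrealI tendsto_diff tendsto_const tendsto_expm)
  qed
  have "(\<integral>\<^sup>+x. ennreal (1 - expm (g x)) \<partial>\<nu>) = (SUP i. \<integral>\<^sup>+x. ennreal (1 - expm (s i x)) \<partial>\<nu>)"
    using nn_integral_monotone_convergence_SUP[OF inc, of \<nu>] by (simp add: pt)
  moreover have "(\<lambda>i. \<integral>\<^sup>+x. ennreal (1 - expm (s i x)) \<partial>\<nu>) \<longlonglongrightarrow> (SUP i. \<integral>\<^sup>+x. ennreal (1 - expm (s i x)) \<partial>\<nu>)"
    by (rule LIMSEQ_SUP) (use inc in \<open>auto simp: incseq_def le_fun_def intro!: nn_integral_mono\<close>)
  ultimately have "(\<lambda>i. expm (\<integral>\<^sup>+x. ennreal (1 - expm (s i x)) \<partial>\<nu>)) \<longlonglongrightarrow> expm (\<integral>\<^sup>+x. ennreal (1 - expm (g x)) \<partial>\<nu>)"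
    by (intro tendsto_expm) simp
  moreover have "expm (\<integral>\<^sup>+x. ennreal (1 - expm (s i x)) \<partial>\<nu>) = (\<integral>\<omega>. expm (\<integral>\<^sup>+x. s i x \<partial>\<eta> \<omega>) \<partial>P)" for i
    using simple[OF s(1)] by simp
  ultimately show "(\<integral>\<omega>. expm (\<integral>\<^sup>+x. g x \<partial>\<eta> \<omega>) \<partial>P) = expm (\<integral>\<^sup>+x. ennreal (1 - expm (g x)) \<partial>\<nu>)"
    using LIMSEQ_unique[OF L1] by simp
qed

text \<open>Combinations of indicators of disjoint sets, inserted for \<open>g\<close>, give the
  joint Laplace transform of the counts in product form. As counts are integers or infinite, it is a
  power series in each variable \<open>exp (- s)\<close>, and comparison of coefficients yields both
  the Poisson probabilities and the independence.\<close>

theorem poisson_of_laplace_functional: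
  assumes P: "prob_space P" and sets_\<eta>: "\<And>\<omega>. \<omega> \<in> space P \<Longrightarrow> sets (\<eta> \<omega>) = sets \<nu>"
    and em: "\<And>A. A \<in> sets \<nu> \<Longrightarrow> (\<lambda>\<omega>. emeasure (\<eta> \<omega>) A) \<in> borel_measurable P"
    and vals: "\<And>A \<omega>. A \<in> sets \<nu> \<Longrightarrow> \<omega> \<in> space P \<Longrightarrow> emeasure (\<eta> \<omega>) A \<in> range of_nat \<or> emeasure (\<eta> \<omega>) A = \<top>"
    and lap: "\<And>g. g \<in> borel_measurable \<nu> \<Longrightarrow> (\<integral>\<omega>. expm (\<integral>\<^sup>+x. g x \<partial>\<eta> \<omega>) \<partial>P) = expm (\<integral>\<^sup>+x. ennreal (1 - expm (g x)) \<partial>\<nu>)"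
  shows "poisson_process P \<nu> \<eta>"
proof -
  interpret prob_space P by fact
  note [measurable] = em
  define E where "E A k = {\<omega> \<in> space P. emeasure (\<eta> \<omega>) A = of_nat k}" for A and k :: nat
  have Em[measurable]: "E A k \<in> sets P" if [measurable]: "A \<in> sets \<nu>" for A k unfolding E_def by measurable
  have joint: "(\<integral>\<omega>. (\<Prod>i\<in>I. expm (ennreal (s i) * emeasure (\<eta> \<omega>) (A i))) \<partial>P)
      = (\<Prod>i\<in>I. expm (ennreal (1 - exp (- s i)) * emeasure \<nu> (A i)))"
    if I: "finite I" and A: "\<And>i. i \<in> I \<Longrightarrow> A i \<in> sets \<nu>" and disj: "disjoint_family_on A I" and s: "\<And>i. i \<in> I \<Longrightarrow> 0 < s i"
    for I :: "nat set" and A s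
  proof -
    define g where "g x = (\<Sum>i\<in>I. ennreal (s i) * indicator (A i) x)" for x
    have g[measurable]: "g \<in> borel_measurable \<nu>" unfolding g_def using A by (intro borel_measurable_sum) auto
    have int: "(\<integral>\<^sup>+x. g x \<partial>\<eta> \<omega>) = (\<Sum>i\<in>I. ennreal (s i) * emeasure (\<eta> \<omega>) (A i))" if \<omega>: "\<omega> \<in> space P" for \<omega>
    proof -
      have Am: "A i \<in> sets (\<eta> \<omega>)" if "i \<in> I" for i using A[OF that] sets_\<eta>[OF \<omega>] by simp
      show ?thesis unfolding g_def using Am by (subst nn_integral_sum) (auto simp: nn_integral_cmult_indicator)
    qed
    have pt: "ennreal (1 - expm (g x)) = (\<Sum>i\<in>I. ennreal (1 - exp (- s i)) * indicator (A i) x)" for x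
    proof (cases "\<exists>j\<in>I. x \<in> A j")
      case True
      then obtain j where j: "j \<in> I" "x \<in> A j" by blast
      have ind: "indicator (A i) x = (if i = j then 1 else 0 :: ennreal)" if "i \<in> I" for i
        using disj j that unfolding disjoint_family_on_def indicator_def by auto
      have "g x = (\<Sum>i\<in>I. if i = j then ennreal (s i) else 0)"
        unfolding g_def by (rule sum.cong) (auto simp: ind)
      then have gx: "g x = ennreal (s j)" using I j by simp
      have "(\<Sum>i\<in>I. ennreal (1 - exp (- s i)) * indicator (A i) x) = (\<Sum>i\<in>I. if i = j then ennreal (1 - exp (- s i)) else 0)"
        by (rule sum.cong) (auto simp: ind)
      then have "(\<Sum>i\<in>I. ennreal (1 - exp (- s i)) * indicator (A i) x) = ennreal (1 - exp (- s j))" using I j by simp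
      then show ?thesis unfolding gx using s[OF j(1)] by (simp add: expm_ennreal)
    next
      case False
      then have "indicator (A i) x = (0::ennreal)" if "i \<in> I" for i using that by (auto simp: indicator_def)
      then show ?thesis unfolding g_def by simp
    qed
    have "(\<integral>\<omega>. (\<Prod>i\<in>I. expm (ennreal (s i) * emeasure (\<eta> \<omega>) (A i))) \<partial>P) = (\<integral>\<omega>. expm (\<integral>\<^sup>+x. g x \<partial>\<eta> \<omega>) \<partial>P)"
      by (rule Bochner_Integration.integral_cong) (simp_all add: int expm_sum)
    also have "\<dots> = expm (\<Sum>i\<in>I. ennreal (1 - exp (- s i)) * emeasure \<nu> (A i))"
      unfolding lap[OF g] pt using A by (subst nn_integral_sum) (auto simp: nn_integral_cmult_indicator)
    finally show ?thesis by (simp add: expm_sum)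
  qed
  have single: "(\<integral>\<omega>. expm (ennreal s * emeasure (\<eta> \<omega>) A) \<partial>P) = expm (ennreal (1 - exp (- s)) * emeasure \<nu> A)"
    if "A \<in> sets \<nu>" "0 < s" for A s
    using joint[of "{0}" "\<lambda>_. A" "\<lambda>_. s"] that by (simp add: disjoint_family_on_def)
  have valsAE: "AE \<omega> in P. emeasure (\<eta> \<omega>) A \<in> range of_nat \<or> emeasure (\<eta> \<omega>) A = \<top>" if "A \<in> sets \<nu>" for A
    using vals[OF that] by (intro AE_I2)
  have sums1: "(\<lambda>k. prob (E A k) * exp (- s) ^ k) sums expm (ennreal (1 - exp (- s)) * emeasure \<nu> A)"
    if A: "A \<in> sets \<nu>" and s: "0 < s" for A s
  proof -
    have "(\<lambda>k. (\<integral>\<omega>. indicator (E A k) \<omega> * 1 \<partial>P) * exp (- s) ^ k) sums (\<integral>\<omega>. expm (ennreal s * emeasure (\<eta> \<omega>) A) * 1 \<partial>P)"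
      unfolding E_def by (rule integral_expm_count[OF P em[OF A] valsAE[OF A] _ s]) simp
    then show ?thesis using single[OF A s] A by simp
  qed
  have fin: "prob (E A k) = measure \<nu> A ^ k / fact k * exp (- measure \<nu> A)"
    if A: "A \<in> sets \<nu>" and f: "emeasure \<nu> A < \<infinity>" for A k
  proof -
    define x where "x = measure \<nu> A"
    have x: "emeasure \<nu> A = ennreal x" "0 \<le> x" using f by (simp_all add: x_def emeasure_eq_ennreal_measure less_top)
    have pb: "\<bar>x ^ k / fact k * exp (- x)\<bar> \<le> 1" for k
    proof -
      have n: "0 \<le> x ^ k / fact k * exp (- x)" for k using x by simp
      have "(\<lambda>k. x ^ k / fact k * exp (- x)) sums 1" using poisson_sums[of x 1] by simp
      then have "(\<Sum>i\<in>{k}. x ^ i / fact i * exp (- x)) \<le> 1"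
        using sum_le_suminf[of "\<lambda>k. x ^ k / fact k * exp (- x)" "{k}"] n by (simp add: sums_iff)
      then have "x ^ k / fact k * exp (- x) \<le> 1" by simp
      then show ?thesis using abs_of_nonneg[OF n[of k]] by (simp only:)
    qed
    have "(\<lambda>k. prob (E A k)) = (\<lambda>k. x ^ k / fact k * exp (- x))"
    proof (rule power_series_unique_on_unit)
      show "\<bar>prob (E A k)\<bar> \<le> 1" for k by simp
      fix z :: real assume z: "0 < z" "z < 1"
      define s where "s = - ln z"
      have s: "0 < s" "exp (- s) = z" using z by (simp_all add: s_def)
      have "ennreal (1 - z) * emeasure \<nu> A = ennreal ((1 - z) * x)" using x z by (simp add: ennreal_mult)
      moreover have "0 \<le> (1 - z) * x" using x z by simp
      ultimately have "expm (ennreal (1 - z) * emeasure \<nu> A) = exp (- (1 - z) * x)"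
        by (simp only: expm_ennreal minus_mult_left)
      then have "(\<lambda>k. prob (E A k) * z ^ k) sums exp (- (1 - z) * x)"
        using sums1[OF A s(1)] by (simp only: s(2))
      then show "(\<Sum>k. prob (E A k) * z ^ k) = (\<Sum>k. x ^ k / fact k * exp (- x) * z ^ k)"
        using poisson_sums[of x z] by (simp only: sums_iff)
    qed (rule pb)
    then show ?thesis unfolding x_def by (rule fun_cong)
  qed
  have infin: "AE \<omega> in P. emeasure (\<eta> \<omega>) A = \<infinity>" if A: "A \<in> sets \<nu>" and i: "emeasure \<nu> A = \<infinity>" for A
  proof -
    have "(\<integral>\<omega>. expm (ennreal 1 * emeasure (\<eta> \<omega>) A) \<partial>P) = 0"
      using single[OF A, of 1] i by (simp add: ennreal_mult_top)
    then have "AE \<omega> in P. expm (ennreal 1 * emeasure (\<eta> \<omega>) A) = 0"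
      using em[OF A] by (subst (asm) integral_nonneg_eq_0_iff_AE) (auto intro!: integrable_const_bound[where B=1])
    then show ?thesis by eventually_elim (simp add: expm_eq_0_iff)
  qed
  have indep: "indep_vars (\<lambda>_. borel) (\<lambda>i \<omega>. emeasure (\<eta> \<omega>) (A i)) {..<n}"
    if A: "\<forall>i<n. A i \<in> sets \<nu>" and disj: "disjoint_family_on A {..<n}" for n :: nat and A
  proof -
    \<comment> \<open>A mixed formula: for indices in \<open>I\<close> the Laplace factor has
      already been replaced by the event of a given count, for those in \<open>J\<close> it is still
      present. The induction moves one index \<open>j\<close> at a time to \<open>I\<close> by
      comparing coefficients in \<open>exp (- r)\<close>; all other factors form the weight
      \<open>w\<close>.\<close>
    have prodE: "(\<integral>\<omega>. (\<Prod>i\<in>I. indicator (E (A i) (k i)) \<omega>) * (\<Prod>i\<in>J. expm (ennreal (s i) * emeasure (\<eta> \<omega>) (A i))) \<partial>P)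
      = (\<Prod>i\<in>I. prob (E (A i) (k i))) * (\<Prod>i\<in>J. expm (ennreal (1 - exp (- s i)) * emeasure \<nu> (A i)))"
      if "finite I" "I \<subseteq> {..<n}" "J \<subseteq> {..<n}" "I \<inter> J = {}" "\<And>i. i \<in> J \<Longrightarrow> 0 < s i" for I J k s
      using that
    proof (induction I arbitrary: J s rule: finite_induct)
      case empty
      have "finite J" using empty by (meson finite_lessThan finite_subset)
      moreover have "disjoint_family_on A J" using disj empty by (meson disjoint_family_on_mono)
      ultimately show ?case using joint[of J A s] A empty by auto
    next
      case (insert j I)
      let ?W = "\<lambda>\<omega>. (\<Prod>i\<in>I. indicator (E (A i) (k i)) \<omega>) * (\<Prod>i\<in>J. expm (ennreal (s i) * emeasure (\<eta> \<omega>) (A i)))"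
      define w where "w = ?W"
      define c where "c = (\<Prod>i\<in>I. prob (E (A i) (k i))) * (\<Prod>i\<in>J. expm (ennreal (1 - exp (- s i)) * emeasure \<nu> (A i)))"
      have jn: "j < n" "A j \<in> sets \<nu>" using insert A by auto
      have fJ: "finite J" using insert by (meson finite_lessThan finite_subset)
      have AI: "A i \<in> sets \<nu>" if "i \<in> I \<or> i \<in> J" for i using that insert A by auto
      have wm[measurable]: "w \<in> borel_measurable P" unfolding w_def
        using AI by (intro borel_measurable_times borel_measurable_prod) auto
      have w1: "\<bar>w \<omega>\<bar> \<le> 1" for \<omega>
      proof -
        have "0 \<le> w \<omega>" unfolding w_def by (intro mult_nonneg_nonneg prod_nonneg) auto
        moreover have "w \<omega> \<le> 1" unfolding w_def
          by (intro mult_le_one prod_le_1 prod_nonneg) (auto simp: indicator_def)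
        ultimately show ?thesis by simp
      qed
      have wi: "integrable P w" by (rule integrable_const_bound[where B=1]) (use w1 in auto)
      have c1: "\<bar>c\<bar> \<le> 1"
      proof -
        have "0 \<le> c" unfolding c_def by (intro mult_nonneg_nonneg prod_nonneg) auto
        moreover have "c \<le> 1" unfolding c_def
          by (intro mult_le_one prod_le_1 prod_nonneg) auto
        ultimately show ?thesis by simp
      qed
      have "(\<lambda>m. \<integral>\<omega>. indicator (E (A j) m) \<omega> * w \<omega> \<partial>P) = (\<lambda>m. prob (E (A j) m) * c)"
      proof (rule power_series_unique_on_unit)
        show "\<bar>\<integral>\<omega>. indicator (E (A j) m) \<omega> * w \<omega> \<partial>P\<bar> \<le> 1" for m
        proof -
          have "\<bar>\<integral>\<omega>. indicator (E (A j) m) \<omega> * w \<omega> \<partial>P\<bar> \<le> (\<integral>\<omega>. \<bar>indicator (E (A j) m) \<omega> * w \<omega>\<bar> \<partial>P)"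
            by (rule integral_abs_bound)
          also have "\<dots> \<le> (\<integral>\<omega>. 1 \<partial>P)"
          proof (rule integral_mono)
            show "integrable P (\<lambda>\<omega>. \<bar>indicator (E (A j) m) \<omega> * w \<omega>\<bar>)"
              using jn w1 by (intro integrable_const_bound[where B=1]) (auto simp: indicator_def)
          qed (use w1 in \<open>auto simp: indicator_def\<close>)
          finally show ?thesis by (simp add: prob_space)
        qed
        show "\<bar>prob (E (A j) m) * c\<bar> \<le> 1" for m using c1 by (simp add: abs_mult mult_le_one)
        fix z :: real assume z: "0 < z" "z < 1"
        define r where "r = - ln z"
        have r: "0 < r" "exp (- r) = z" using z by (simp_all add: r_def)
        define s' where "s' = s(j := r)"
        have jI: "j \<notin> I" "j \<notin> J" using insert by auto
        have sJ: "(\<Prod>i\<in>J. expm (ennreal (s' i) * emeasure (\<eta> \<omega>) (A i))) = (\<Prod>i\<in>J. expm (ennreal (s i) * emeasure (\<eta> \<omega>) (A i)))" for \<omega>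
          using jI by (intro prod.cong) (auto simp: s'_def)
        have sJ': "(\<Prod>i\<in>J. expm (ennreal (1 - exp (- s' i)) * emeasure \<nu> (A i))) = (\<Prod>i\<in>J. expm (ennreal (1 - exp (- s i)) * emeasure \<nu> (A i)))"
          using jI by (intro prod.cong) (auto simp: s'_def)
        have "(\<integral>\<omega>. (\<Prod>i\<in>I. indicator (E (A i) (k i)) \<omega>) * (\<Prod>i\<in>insert j J. expm (ennreal (s' i) * emeasure (\<eta> \<omega>) (A i))) \<partial>P)
          = (\<Prod>i\<in>I. prob (E (A i) (k i))) * (\<Prod>i\<in>insert j J. expm (ennreal (1 - exp (- s' i)) * emeasure \<nu> (A i)))"
          by (rule insert.IH) (use insert r in \<open>auto simp: s'_def\<close>)
        then have "(\<integral>\<omega>. expm (ennreal r * emeasure (\<eta> \<omega>) (A j)) * w \<omega> \<partial>P) = expm (ennreal (1 - z) * emeasure \<nu> (A j)) * c"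
          unfolding prod.insert[OF fJ jI(2)] sJ sJ' w_def c_def by (simp add: s'_def r(2) mult_ac)
        moreover have "(\<lambda>m. (\<integral>\<omega>. indicator (E (A j) m) \<omega> * w \<omega> \<partial>P) * exp (- r) ^ m) sums (\<integral>\<omega>. expm (ennreal r * emeasure (\<eta> \<omega>) (A j)) * w \<omega> \<partial>P)"
          unfolding E_def by (rule integral_expm_count[OF P em[OF jn(2)] valsAE[OF jn(2)] wi r(1)])
        moreover have "(\<lambda>m. prob (E (A j) m) * exp (- r) ^ m * c) sums (expm (ennreal (1 - exp (- r)) * emeasure \<nu> (A j)) * c)"
          by (rule sums_mult2[OF sums1[OF jn(2) r(1)]])
        ultimately show "(\<Sum>m. (\<integral>\<omega>. indicator (E (A j) m) \<omega> * w \<omega> \<partial>P) * z ^ m) = (\<Sum>m. prob (E (A j) m) * c * z ^ m)"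
          unfolding r(2) by (simp add: sums_iff mult_ac)
      qed
      from fun_cong[OF this, of "k j"] show ?case
        unfolding prod.insert[OF insert(1,2)] w_def c_def by (simp only: mult.assoc)
    qed
    \<comment> \<open>For fixed \<open>i\<close> the events \<open>E (A i) k\<close> are pairwise
      disjoint. Together with the empty set they are stable under intersection, which allows
      independence to pass to the generated sigma-algebra.\<close>
    define G where "G i = insert {} (range (E (A i)))" for i
    have EG: "indep_sets G {..<n}"
    proof (rule indep_setsI)
      show "G i \<subseteq> events" if "i \<in> {..<n}" for i using A that by (auto simp: G_def)
      fix B J assume J: "J \<noteq> {}" "J \<subseteq> {..<n}" "finite J" and B: "\<forall>j\<in>J. B j \<in> G j"
      show "prob (\<Inter>j\<in>J. B j) = (\<Prod>j\<in>J. prob (B j))"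
      proof (cases "\<exists>j\<in>J. B j = {}")
        case True
        then obtain j where j: "j \<in> J" "B j = {}" by blast
        then have "(\<Inter>j\<in>J. B j) = {}" by auto
        moreover have "(\<Prod>j\<in>J. prob (B j)) = 0"
          by (rule prod_zero[OF J(3)]) (use j in \<open>auto intro!: bexI[of _ j]\<close>)
        ultimately show ?thesis by simp
      next
        case False
        then have "\<forall>j\<in>J. \<exists>k. B j = E (A j) k" using B unfolding G_def by blast
        then obtain k where k: "\<And>j. j \<in> J \<Longrightarrow> B j = E (A j) (k j)" by (auto simp: bchoice_iff)
        have "(\<integral>\<omega>. (\<Prod>j\<in>J. indicator (E (A j) (k j)) \<omega>) \<partial>P) = (\<Prod>j\<in>J. prob (E (A j) (k j)))"
          using prodE[of J "{}" k] J by simp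
        moreover have "(\<Prod>j\<in>J. indicator (E (A j) (k j)) \<omega>) = (indicator (\<Inter>j\<in>J. B j) \<omega> :: real)" for \<omega>
          using J k by (simp add: indicator_def prod_zero_iff)
        moreover have "(\<Inter>j\<in>J. B j) \<in> events"
          using J A k by (intro sets.finite_INT) auto
        ultimately show ?thesis using k by simp
      qed
    qed
    have "indep_sets (\<lambda>i. sigma_sets (space P) (G i)) {..<n}"
    proof (rule indep_sets_sigma[OF EG])
      show "Int_stable (G i)" for i
      proof (rule Int_stableI)
        fix a b assume "a \<in> G i" "b \<in> G i"
        then show "a \<inter> b \<in> G i" unfolding G_def E_def by auto
      qed
    qed
    moreover have "{(\<lambda>\<omega>. emeasure (\<eta> \<omega>) (A i)) -` B \<inter> space P | B. B \<in> sets borel} \<subseteq> sigma_sets (space P) (G i)" if i: "i < n" for i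
    proof safe
      fix B :: "ennreal set"
      have Ai: "A i \<in> sets \<nu>" using A i by simp
      have Esig: "(\<Union>k\<in>K. E (A i) k) \<in> sigma_sets (space P) (G i)" for K
        by (rule sigma_sets_UNION) (auto simp: G_def intro: sigma_sets.Basic)
      let ?K = "{k. of_nat k \<in> B}"
      show "(\<lambda>\<omega>. emeasure (\<eta> \<omega>) (A i)) -` B \<inter> space P \<in> sigma_sets (space P) (G i)"
      proof (cases "\<top> \<in> B")
        case False
        have "(\<lambda>\<omega>. emeasure (\<eta> \<omega>) (A i)) -` B \<inter> space P = (\<Union>k\<in>?K. E (A i) k)"
        proof (intro equalityI subsetI)
          fix \<omega> assume "\<omega> \<in> (\<lambda>\<omega>. emeasure (\<eta> \<omega>) (A i)) -` B \<inter> space P"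
          then show "\<omega> \<in> (\<Union>k\<in>?K. E (A i) k)" using vals[OF Ai, of \<omega>] False by (auto simp: E_def)
        qed (auto simp: E_def)
        then show ?thesis using Esig by simp
      next
        case True
        \<comment> \<open>The event of an infinite count is not a generator; it is reached through
          the complement of finite counts.\<close>
        have "(\<lambda>\<omega>. emeasure (\<eta> \<omega>) (A i)) -` B \<inter> space P = space P - (\<Union>k\<in>- ?K. E (A i) k)"
        proof (intro equalityI subsetI)
          fix \<omega> assume "\<omega> \<in> space P - (\<Union>k\<in>- ?K. E (A i) k)"
          then show "\<omega> \<in> (\<lambda>\<omega>. emeasure (\<eta> \<omega>) (A i)) -` B \<inter> space P" using vals[OF Ai, of \<omega>] True by (auto simp: E_def)
        qed (auto simp: E_def)
        then show ?thesis using sigma_sets.Compl[OF Esig] by simp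
      qed
    qed
    ultimately have "indep_sets (\<lambda>i. {(\<lambda>\<omega>. emeasure (\<eta> \<omega>) (A i)) -` B \<inter> space P | B. B \<in> sets borel}) {..<n}"
      by (rule indep_sets_mono_sets) auto
    then show ?thesis unfolding indep_vars_def2 using em A by auto
  qed
  show ?thesis
    unfolding poisson_process_def
    using P sets_\<eta> em fin infin indep unfolding E_def by blast
qed

section \<open>Marked Poisson processes\<close>

lemma point_process_of_sets: "sets (point_process_of N X \<omega>) = sets N"
  by (simp add: point_process_of_def)

lemma nn_integral_point_process_of:
  assumes X: "\<And>i. X i \<omega> \<in> space N" and g: "g \<in> borel_measurable N"
  shows "(\<integral>\<^sup>+x. g x \<partial>point_process_of N X \<omega>) = (\<Sum>i. g (X i \<omega>))"
  unfolding point_process_of_def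
  by (subst nn_integral_distr) (use X g in \<open>auto simp: nn_integral_count_space_nat\<close>)

lemma emeasure_point_process_of:
  assumes X: "\<And>i. X i \<omega> \<in> space N" and A: "A \<in> sets N"
  shows "emeasure (point_process_of N X \<omega>) A = (\<Sum>i. indicator A (X i \<omega>))"
    and "emeasure (point_process_of N X \<omega>) A \<in> range of_nat \<or> emeasure (point_process_of N X \<omega>) A = \<top>"
proof -
  have "emeasure (point_process_of N X \<omega>) A = (\<integral>\<^sup>+x. indicator A x \<partial>point_process_of N X \<omega>)"
    using A by (simp add: point_process_of_sets)
  then show "emeasure (point_process_of N X \<omega>) A = (\<Sum>i. indicator A (X i \<omega>))"
    using nn_integral_point_process_of[of X \<omega> N "indicator A", OF X] A by simp
  have "emeasure (point_process_of N X \<omega>) A = emeasure (count_space UNIV) ((\<lambda>i. X i \<omega>) -` A)"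
    unfolding point_process_of_def by (subst emeasure_distr) (use X A in auto)
  then show "emeasure (point_process_of N X \<omega>) A \<in> range of_nat \<or> emeasure (point_process_of N X \<omega>) A = \<top>"
    by (cases "finite ((\<lambda>i. X i \<omega>) -` A)") auto
qed

text \<open>The counting measure of a sequence takes only integer or infinite values, so the Laplace
  functional alone decides whether it is a Poisson process.\<close>

lemma poisson_point_process_of_laplace:
  assumes P: "prob_space P" and X: "\<And>i. X i \<in> measurable P N" and \<nu>: "sets \<nu> = sets N"
    and lap: "\<And>g. g \<in> borel_measurable N \<Longrightarrow> (\<integral>\<omega>. expm (\<Sum>i. g (X i \<omega>)) \<partial>P) = expm (\<integral>\<^sup>+x. ennreal (1 - expm (g x)) \<partial>\<nu>)"
  shows "poisson_process P \<nu> (point_process_of N X)"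
proof (rule poisson_of_laplace_functional[OF P])
  have sp: "X i \<omega> \<in> space N" if "\<omega> \<in> space P" for i \<omega> by (rule measurable_space[OF X that])
  show "sets (point_process_of N X \<omega>) = sets \<nu>" for \<omega> by (simp add: point_process_of_sets \<nu>)
  show "(\<lambda>\<omega>. emeasure (point_process_of N X \<omega>) A) \<in> borel_measurable P" if "A \<in> sets \<nu>" for A
  proof -
    have [measurable]: "A \<in> sets N" "\<And>i. X i \<in> measurable P N" using that \<nu> X by simp_all
    have "(\<lambda>\<omega>. \<Sum>i. indicator A (X i \<omega>) :: ennreal) \<in> borel_measurable P" by measurable
    then show ?thesis
      by (subst measurable_cong[OF emeasure_point_process_of(1)[where X=X and N=N, OF sp]]) (use that \<nu> in auto)
  qed
  show "emeasure (point_process_of N X \<omega>) A \<in> range of_nat \<or> emeasure (point_process_of N X \<omega>) A = \<top>"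
    if "A \<in> sets \<nu>" "\<omega> \<in> space P" for A \<omega>
    by (rule emeasure_point_process_of(2)[where X=X and N=N and \<omega>=\<omega>, OF sp[OF that(2)]]) (use that \<nu> in simp)
  fix g :: "'b \<Rightarrow> ennreal" assume "g \<in> borel_measurable \<nu>"
  then have g: "g \<in> borel_measurable N" using measurable_cong_sets[OF \<nu> refl] by blast
  have "(\<integral>\<omega>. expm (\<integral>\<^sup>+x. g x \<partial>point_process_of N X \<omega>) \<partial>P) = (\<integral>\<omega>. expm (\<Sum>i. g (X i \<omega>)) \<partial>P)"
    by (rule Bochner_Integration.integral_cong) (simp_all add: nn_integral_point_process_of[where X=X and N=N, OF sp g])
  with lap[OF g] show "(\<integral>\<omega>. expm (\<integral>\<^sup>+x. g x \<partial>point_process_of N X \<omega>) \<partial>P) = expm (\<integral>\<^sup>+x. ennreal (1 - expm (g x)) \<partial>\<nu>)"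
    by simp
qed

text \<open>Conditionally on the points \<open>\<Gamma>\<close>, the marks turn the functional \<open>\<Prod>\<^sub>i exp (- g)\<close> into the functional
  of \<open>\<Gamma>\<close> alone for \<open>k t = - ln (E exp (- g (f t \<epsilon>)))\<close>.\<close>

theorem poisson_marking:
  fixes f :: "'c \<Rightarrow> 'a \<Rightarrow> 'b" and \<Gamma> :: "nat \<Rightarrow> 'w \<Rightarrow> 'c" and \<epsilon> :: "nat \<Rightarrow> 'w \<Rightarrow> 'a"
  assumes P: "prob_space P" and \<pi>: "prob_space \<pi>"
    and \<Gamma>m: "\<And>i. \<Gamma> i \<in> measurable P \<rho>" and \<Gamma>: "poisson_process P \<rho> (point_process_of \<rho> \<Gamma>)"
    and \<epsilon>: "prob_space.indep_vars P (\<lambda>_. \<pi>) \<epsilon> UNIV" "\<And>i. distr P \<pi> (\<epsilon> i) = \<pi>"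
    and ind: "prob_space.indep_set P
       {(\<lambda>\<omega> i. \<epsilon> i \<omega>) -` A \<inter> space P | A. A \<in> sets (PiM UNIV (\<lambda>_. \<pi>))}
       {(\<lambda>\<omega> i. \<Gamma> i \<omega>) -` B \<inter> space P | B. B \<in> sets (PiM UNIV (\<lambda>_. \<rho>))}"
    and f: "(\<lambda>p. f (fst p) (snd p)) \<in> measurable (\<rho> \<Otimes>\<^sub>M \<pi>) N" and \<nu>: "sets \<nu> = sets N"
    and image: "\<And>g. g \<in> borel_measurable N \<Longrightarrow> (\<integral>\<^sup>+t. (\<integral>\<^sup>+x. g (f t x) \<partial>\<pi>) \<partial>\<rho>) = (\<integral>\<^sup>+x. g x \<partial>\<nu>)"
  shows "poisson_process P \<nu> (point_process_of N (\<lambda>i \<omega>. f (\<Gamma> i \<omega>) (\<epsilon> i \<omega>)))"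
proof (rule poisson_point_process_of_laplace[OF P _ \<nu>])
  interpret prob_space P by fact
  interpret pi: prob_space \<pi> by fact
  have \<epsilon>m: "\<epsilon> i \<in> measurable P \<pi>" for i using \<epsilon>(1) unfolding indep_vars_def by blast
  show "(\<lambda>\<omega>. f (\<Gamma> i \<omega>) (\<epsilon> i \<omega>)) \<in> measurable P N" for i
    using measurable_compose[OF measurable_Pair[OF \<Gamma>m \<epsilon>m] f] by simp
  fix g :: "'b \<Rightarrow> ennreal" assume g: "g \<in> borel_measurable N"
  define G where "G p = g (f (fst p) (snd p))" for p
  have G[measurable]: "G \<in> borel_measurable (\<rho> \<Otimes>\<^sub>M \<pi>)"
    unfolding G_def by (rule measurable_compose[OF f g])
  define E where "E = PiM (UNIV :: nat set) (\<lambda>_. \<pi>)"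
  \<comment> \<open>Only the sigma-algebra of \<open>V\<close> matters, since \<open>\<rho>\<close>
    may be infinite; the law of the sequence of points is \<open>R\<close>.\<close>
  define V where "V = PiM (UNIV :: nat set) (\<lambda>_. \<rho>)"
  interpret E: product_prob_space "\<lambda>_. \<pi>" "UNIV :: nat set" ..
  have Ep: "prob_space E" unfolding E_def by (rule E.P.prob_space_axioms)
  define e where "e \<omega> = (\<lambda>i. \<epsilon> i \<omega>)" for \<omega>
  define c where "c \<omega> = (\<lambda>i. \<Gamma> i \<omega>)" for \<omega>
  have em: "e \<in> measurable P E" unfolding e_def E_def
    by (rule measurable_PiM_single') (use \<epsilon>m in \<open>auto dest: measurable_space\<close>)
  have cm: "c \<in> measurable P V" unfolding c_def V_def
    by (rule measurable_PiM_single') (use \<Gamma>m in \<open>auto dest: measurable_space\<close>)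
  have de: "distr P E e = E"
    using indep_vars_iff_distr_eq_PiM[where I=UNIV and M'="\<lambda>_. \<pi>" and X=\<epsilon>] \<epsilon> \<epsilon>m
    unfolding E_def e_def by (simp add: restrict_UNIV)
  define R where "R = distr P V c"
  have Rp: "prob_space R" unfolding R_def by (rule prob_space_distr[OF cm])
  interpret ER: pair_prob_space E R
    using Ep Rp by (simp add: pair_prob_space_def pair_sigma_finite_def prob_space_imp_sigma_finite)
  have setsR: "sets R = sets V" by (simp add: R_def)
  have pm: "(\<lambda>\<omega>. (e \<omega>, c \<omega>)) \<in> measurable P (E \<Otimes>\<^sub>M V)" by (rule measurable_Pair[OF em cm])
  \<comment> \<open>Independence of marks and points in product form, so that the marks can be
    integrated first with the points held fixed.\<close>
  have joint: "E \<Otimes>\<^sub>M R = distr P (E \<Otimes>\<^sub>M V) (\<lambda>\<omega>. (e \<omega>, c \<omega>))"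
  proof (rule pair_measure_eqI)
    show "sigma_finite_measure E" "sigma_finite_measure R"
      using Ep Rp by (simp_all add: prob_space_imp_sigma_finite)
    show "sets (E \<Otimes>\<^sub>M R) = sets (distr P (E \<Otimes>\<^sub>M V) (\<lambda>\<omega>. (e \<omega>, c \<omega>)))"
      by (simp add: sets_pair_measure_cong[OF refl setsR])
    fix A B assume A: "A \<in> sets E" and "B \<in> sets R"
    then have B: "B \<in> sets V" by (simp add: setsR)
    have "prob ((e -` A \<inter> space P) \<inter> (c -` B \<inter> space P)) = prob (e -` A \<inter> space P) * prob (c -` B \<inter> space P)"
      by (rule indep_setD[OF ind]) (use A B in \<open>auto simp: e_def c_def E_def V_def\<close>)
    moreover have "(\<lambda>\<omega>. (e \<omega>, c \<omega>)) -` (A \<times> B) \<inter> space P = (e -` A \<inter> space P) \<inter> (c -` B \<inter> space P)" by auto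
    moreover have "emeasure E A = emeasure P (e -` A \<inter> space P)"
      using emeasure_distr[OF em A] by (simp add: de)
    moreover have "emeasure R B = emeasure P (c -` B \<inter> space P)"
      unfolding R_def by (rule emeasure_distr[OF cm B])
    moreover have "emeasure (distr P (E \<Otimes>\<^sub>M V) (\<lambda>\<omega>. (e \<omega>, c \<omega>))) (A \<times> B) = emeasure P ((\<lambda>\<omega>. (e \<omega>, c \<omega>)) -` (A \<times> B) \<inter> space P)"
      by (rule emeasure_distr[OF pm]) (use A B in simp)
    ultimately show "emeasure E A * emeasure R B = emeasure (distr P (E \<Otimes>\<^sub>M V) (\<lambda>\<omega>. (e \<omega>, c \<omega>))) (A \<times> B)"
      by (simp add: emeasure_eq_measure ennreal_mult')
  qed
  have compE: "(\<lambda>z. z i) \<in> measurable E \<pi>" and compV: "(\<lambda>z. z i) \<in> measurable V \<rho>" for i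
    unfolding E_def V_def by (rule measurable_component_singleton, simp)+
  have compR: "(\<lambda>z. z i) \<in> measurable R \<rho>" for i
    using compV measurable_cong_sets[OF setsR refl] by blast
  have Gi: "(\<lambda>p. G (snd p i, fst p i)) \<in> borel_measurable (E \<Otimes>\<^sub>M R)" for i
    by (intro measurable_compose[OF _ G] measurable_Pair measurable_compose[OF measurable_fst compE] measurable_compose[OF measurable_snd compR])
  define \<Phi> where "\<Phi> p = expm (\<Sum>i. G (snd p i, fst p i))" for p
  have \<Phi>m: "\<Phi> \<in> borel_measurable (E \<Otimes>\<^sub>M R)"
    unfolding \<Phi>_def using Gi by (intro measurable_compose[OF _ expm_measurable] borel_measurable_suminf_order) simp
  have \<Phi>m': "\<Phi> \<in> borel_measurable (E \<Otimes>\<^sub>M V)"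
    using \<Phi>m measurable_cong_sets[OF sets_pair_measure_cong[OF refl setsR] refl] by blast
  have "(\<integral>\<omega>. expm (\<Sum>i. g (f (\<Gamma> i \<omega>) (\<epsilon> i \<omega>))) \<partial>P) = (\<integral>\<omega>. \<Phi> (e \<omega>, c \<omega>) \<partial>P)"
    by (simp add: \<Phi>_def G_def e_def c_def)
  also have "\<dots> = (\<integral>p. \<Phi> p \<partial>(E \<Otimes>\<^sub>M R))" unfolding joint by (rule integral_distr[OF pm \<Phi>m', symmetric])
  also have "\<dots> = (\<integral>\<gamma>. (\<integral>z. \<Phi> (z, \<gamma>) \<partial>E) \<partial>R)"
  proof -
    have "integrable (E \<Otimes>\<^sub>M R) \<Phi>"
      using \<Phi>m by (intro ER.P.integrable_const_bound[where B=1]) (auto simp: \<Phi>_def)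
    then show ?thesis using ER.integral_snd[where f="\<lambda>z \<gamma>. \<Phi> (z, \<gamma>)"] by simp
  qed
  also have "\<dots> = (\<integral>\<gamma>. expm (\<Sum>i. logm (\<integral>x. expm (G (\<gamma> i, x)) \<partial>\<pi>)) \<partial>R)"
  proof (rule Bochner_Integration.integral_cong[OF refl])
    fix \<gamma> assume "\<gamma> \<in> space R"
    then have sp: "\<gamma> i \<in> space \<rho>" for i using measurable_space[OF compR] by blast
    have Gx: "(\<lambda>x. G (\<gamma> i, x)) \<in> borel_measurable \<pi>" for i
      using measurable_compose[OF measurable_Pair1'[OF sp] G] by simp
    define h where "h i = (\<integral>x. expm (G (\<gamma> i, x)) \<partial>\<pi>)" for i
    have h: "0 \<le> h i" "h i \<le> 1" for i
    proof -
      show "0 \<le> h i" unfolding h_def by (rule Bochner_Integration.integral_nonneg) simp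
      have "h i \<le> (\<integral>x. 1 \<partial>\<pi>)" unfolding h_def
        by (rule integral_mono) (use Gx[of i] in \<open>auto intro!: pi.integrable_const_bound[where B=1]\<close>)
      then show "h i \<le> 1" by (simp add: pi.prob_space)
    qed
    have s: "(\<lambda>n. \<Sum>i<n. G (\<gamma> i, z i)) \<longlonglongrightarrow> (\<Sum>i. G (\<gamma> i, z i))" for z
      by (rule summable_LIMSEQ) simp
    have Gz: "(\<lambda>z. G (\<gamma> i, z i)) \<in> borel_measurable E" for i by (rule measurable_compose[OF compE Gx])
    have "(\<lambda>n. \<integral>z. expm (\<Sum>i<n. G (\<gamma> i, z i)) \<partial>E) \<longlonglongrightarrow> (\<integral>z. \<Phi> (z, \<gamma>) \<partial>E)"
    proof (rule integral_dominated_convergence[where w="\<lambda>_. 1"])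
      show "AE z in E. (\<lambda>n. expm (\<Sum>i<n. G (\<gamma> i, z i))) \<longlonglongrightarrow> \<Phi> (z, \<gamma>)"
        unfolding \<Phi>_def by (intro AE_I2 tendsto_expm) (simp add: s)
      show "(\<lambda>z. \<Phi> (z, \<gamma>)) \<in> borel_measurable E"
        unfolding \<Phi>_def using Gz by (intro measurable_compose[OF _ expm_measurable] borel_measurable_suminf_order) simp
      show "(\<lambda>z. expm (\<Sum>i<n. G (\<gamma> i, z i))) \<in> borel_measurable E" for n
        using Gz by (intro measurable_compose[OF _ expm_measurable] borel_measurable_sum)
      show "integrable E (\<lambda>_. 1::real)" unfolding E_def by simp
    qed simp
    moreover have "(\<integral>z. expm (\<Sum>i<n. G (\<gamma> i, z i)) \<partial>E) = expm (\<Sum>i<n. logm (h i))" for n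
    proof -
      have "(\<integral>z. (\<Prod>i<n. expm (G (\<gamma> i, z i))) \<partial>E) = (\<Prod>i<n. h i)"
        unfolding E_def h_def
        by (rule integral_prod_PiM_nat[OF \<pi>, where f="\<lambda>i x. expm (G (\<gamma> i, x))"]) (use measurable_compose[OF Gx expm_measurable] in auto)
      then show ?thesis by (simp add: expm_sum expm_logm h)
    qed
    moreover have "(\<lambda>n. expm (\<Sum>i<n. logm (h i))) \<longlonglongrightarrow> expm (\<Sum>i. logm (h i))"
      by (intro tendsto_expm summable_LIMSEQ) simp
    ultimately have "(\<integral>z. \<Phi> (z, \<gamma>) \<partial>E) = expm (\<Sum>i. logm (h i))"
      by (simp only: LIMSEQ_unique)
    then show "(\<integral>z. \<Phi> (z, \<gamma>) \<partial>E) = expm (\<Sum>i. logm (\<integral>x. expm (G (\<gamma> i, x)) \<partial>\<pi>))"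
      by (simp only: h_def)
  qed
  also have "\<dots> = (\<integral>\<omega>. expm (\<Sum>i. logm (\<integral>x. expm (G (\<Gamma> i \<omega>, x)) \<partial>\<pi>)) \<partial>P)"
  proof -
    have "(\<lambda>t. \<integral>x. expm (G (t, x)) \<partial>\<pi>) \<in> borel_measurable \<rho>"
      by (rule pi.borel_measurable_lebesgue_integral) (use measurable_compose[OF G expm_measurable] in \<open>simp add: case_prod_beta'\<close>)
    then have "(\<lambda>\<gamma>. expm (\<Sum>i. logm (\<integral>x. expm (G (\<gamma> i, x)) \<partial>\<pi>))) \<in> borel_measurable V"
      by (intro measurable_compose[OF _ expm_measurable] borel_measurable_suminf_order measurable_compose[OF _ logm_measurable] measurable_compose[OF compV])
    then show ?thesis unfolding R_def by (subst integral_distr[OF cm]) (simp_all add: c_def)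
  qed
  also have "\<dots> = expm (\<integral>\<^sup>+x. ennreal (1 - expm (g x)) \<partial>\<nu>)"
  proof -
    define k where "k t = logm (\<integral>x. expm (G (t, x)) \<partial>\<pi>)" for t
    have Im: "(\<lambda>t. \<integral>x. expm (G (t, x)) \<partial>\<pi>) \<in> borel_measurable \<rho>"
      by (rule pi.borel_measurable_lebesgue_integral) (use measurable_compose[OF G expm_measurable] in \<open>simp add: case_prod_beta'\<close>)
    have km: "k \<in> borel_measurable \<rho>" unfolding k_def by (rule measurable_compose[OF Im logm_measurable])
    have "(\<integral>\<omega>. expm (\<Sum>i. k (\<Gamma> i \<omega>)) \<partial>P) = (\<integral>\<omega>. expm (\<integral>\<^sup>+t. k t \<partial>point_process_of \<rho> \<Gamma> \<omega>) \<partial>P)"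
      by (rule Bochner_Integration.integral_cong)
        (simp_all add: nn_integral_point_process_of[where X=\<Gamma> and N=\<rho>, OF measurable_space[OF \<Gamma>m] km])
    also have "\<dots> = expm (\<integral>\<^sup>+t. ennreal (1 - expm (k t)) \<partial>\<rho>)"
      by (rule laplace_functional_of_poisson(1)[OF \<Gamma> km])
    also have "(\<integral>\<^sup>+t. ennreal (1 - expm (k t)) \<partial>\<rho>) = (\<integral>\<^sup>+t. (\<integral>\<^sup>+x. ennreal (1 - expm (g (f t x))) \<partial>\<pi>) \<partial>\<rho>)"
    proof (rule nn_integral_cong)
      fix t assume t: "t \<in> space \<rho>"
      have Gx: "(\<lambda>x. G (t, x)) \<in> borel_measurable \<pi>"
        using measurable_compose[OF measurable_Pair1'[OF t] G] by simp
      have i: "integrable \<pi> (\<lambda>x. expm (G (t, x)))"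
        using Gx by (intro pi.integrable_const_bound[where B=1]) auto
      have h: "0 \<le> (\<integral>x. expm (G (t, x)) \<partial>\<pi>)" "(\<integral>x. expm (G (t, x)) \<partial>\<pi>) \<le> 1"
      proof -
        show "0 \<le> (\<integral>x. expm (G (t, x)) \<partial>\<pi>)" by (rule Bochner_Integration.integral_nonneg) simp
        have "(\<integral>x. expm (G (t, x)) \<partial>\<pi>) \<le> (\<integral>x. 1 \<partial>\<pi>)" by (rule integral_mono) (use i in auto)
        then show "(\<integral>x. expm (G (t, x)) \<partial>\<pi>) \<le> 1" by (simp add: pi.prob_space)
      qed
      have "ennreal (1 - expm (k t)) = ennreal (\<integral>x. 1 - expm (G (t, x)) \<partial>\<pi>)"
        unfolding k_def expm_logm[OF h] using i by (simp add: pi.prob_space)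
      also have "\<dots> = (\<integral>\<^sup>+x. ennreal (1 - expm (G (t, x))) \<partial>\<pi>)"
        by (rule nn_integral_eq_integral[symmetric]) (use i in auto)
      finally show "ennreal (1 - expm (k t)) = (\<integral>\<^sup>+x. ennreal (1 - expm (g (f t x))) \<partial>\<pi>)" by (simp add: G_def)
    qed
    also have "\<dots> = (\<integral>\<^sup>+x. ennreal (1 - expm (g x)) \<partial>\<nu>)"
      by (rule image) (use measurable_compose[OF g expm_measurable] in measurable)
    finally show ?thesis by (simp add: k_def)
  qed
  finally show "(\<integral>\<omega>. expm (\<Sum>i. g (f (\<Gamma> i \<omega>) (\<epsilon> i \<omega>))) \<partial>P) = expm (\<integral>\<^sup>+x. ennreal (1 - expm (g x)) \<partial>\<nu>)" .
qed

section \<open>The unit Poisson process from exponential gaps\<close>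

definition half_line :: "real measure" where
  "half_line = restrict_space lborel {0<..}"

text \<open>The exponential law of rate \<open>1\<close>, realized on the open half-line so that
  partial sums are positive and increasing everywhere and not only almost surely:
  \<open>successive_unit_poisson_points\<close> asks for random variables with values in
  \<open>{0<..}\<close>.\<close>

definition unit_gap_law :: "real measure" where
  "unit_gap_law = density half_line (\<lambda>t. ennreal (exp (- t)))"

definition unit_gap_sequences :: "(nat \<Rightarrow> real) measure" where
  "unit_gap_sequences = PiM UNIV (\<lambda>_. unit_gap_law)"

definition arrival :: "nat \<Rightarrow> (nat \<Rightarrow> real) \<Rightarrow> real" where
  "arrival i z = (\<Sum>j\<le>i. z j)"

lemma space_half_line: "space half_line = {0<..}"
  by (simp add: half_line_def space_restrict_space)

lemma id_half_line: "(\<lambda>x. x) \<in> borel_measurable half_line"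
  unfolding half_line_def by (rule measurable_restrict_space1) simp

lemma sets_unit_gap_law: "sets unit_gap_law = sets half_line"
  by (simp add: unit_gap_law_def)

lemma space_unit_gap_law: "space unit_gap_law = {0<..}"
  by (simp add: unit_gap_law_def space_half_line)

lemma measurable_half_line: "f \<in> borel_measurable borel \<Longrightarrow> f \<in> borel_measurable half_line"
  by (rule measurable_compose[OF id_half_line])

lemma measurable_to_half_line:
  assumes "f \<in> borel_measurable N" "\<And>x. x \<in> space N \<Longrightarrow> 0 < f x"
  shows "f \<in> measurable N half_line"
  unfolding half_line_def by (rule measurable_restrict_space2) (use assms in auto)

lemma nn_integral_half_line:
  "(\<integral>\<^sup>+t. g t \<partial>half_line) = (\<integral>\<^sup>+t. g t * indicator {0<..} t \<partial>lborel)"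
  unfolding half_line_def by (subst nn_integral_restrict_space) auto

lemma prob_space_unit_gap_law: "prob_space unit_gap_law"
proof
  have "emeasure unit_gap_law (space unit_gap_law) = (\<integral>\<^sup>+t. ennreal (exp (- t)) * indicator (space half_line) t \<partial>half_line)"
    unfolding unit_gap_law_def space_density
    by (rule emeasure_density) (auto intro: measurable_half_line)
  also have "\<dots> = (\<integral>\<^sup>+t. ennreal (exp (- t)) \<partial>half_line)"
    by (rule nn_integral_cong) simp
  also have "\<dots> = (\<integral>\<^sup>+t. ennreal (exponential_density 1 t) * indicator (space lborel) t \<partial>lborel)"
    unfolding nn_integral_half_line
    by (rule nn_integral_cong_AE, rule AE_mp[OF AE_lborel_singleton[of 0]])
      (auto simp: exponential_density_def indicator_def intro!: AE_I2)
  also have "\<dots> = emeasure (density lborel (exponential_density 1)) (space (density lborel (exponential_density 1)))"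
    by (subst emeasure_density) auto
  also have "\<dots> = 1" using prob_space.emeasure_space_1[OF prob_space_exponential_density[of 1]] by simp
  finally show "emeasure unit_gap_law (space unit_gap_law) = 1" .
qed

interpretation unit_gaps: sequence_space unit_gap_law
  by (simp add: sequence_space_def product_prob_space_def product_sigma_finite_def product_prob_space_axioms_def
      prob_space_unit_gap_law prob_space_imp_sigma_finite)

lemma prob_space_unit_gap_sequences: "prob_space unit_gap_sequences"
  unfolding unit_gap_sequences_def by (rule unit_gaps.P.prob_space_axioms)

lemma gap_measurable: "(\<lambda>z. z i) \<in> borel_measurable unit_gap_sequences"
proof -
  have "(\<lambda>z. z i) \<in> measurable unit_gap_sequences unit_gap_law"
    unfolding unit_gap_sequences_def by (rule measurable_component_singleton) simp
  then have "(\<lambda>z. z i) \<in> measurable unit_gap_sequences half_line"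
    using measurable_cong_sets[OF refl sets_unit_gap_law] by blast
  from measurable_compose[OF this id_half_line] show ?thesis .
qed

lemma gap_pos: "z \<in> space unit_gap_sequences \<Longrightarrow> 0 < z i"
  by (auto simp: unit_gap_sequences_def space_PiM space_unit_gap_law PiE_iff)

lemma arrival_borel_measurable: "arrival i \<in> borel_measurable unit_gap_sequences"
  unfolding arrival_def[abs_def] by (intro borel_measurable_sum gap_measurable)

lemma arrival_pos: "z \<in> space unit_gap_sequences \<Longrightarrow> 0 < arrival i z"
  unfolding arrival_def by (rule sum_pos) (auto simp: gap_pos)

lemma arrival_less_Suc: "z \<in> space unit_gap_sequences \<Longrightarrow> arrival i z < arrival (Suc i) z"
  by (simp add: arrival_def gap_pos)

lemma arrival_measurable: "arrival i \<in> measurable unit_gap_sequences half_line"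
  by (intro measurable_to_half_line arrival_borel_measurable arrival_pos)

lemma arrival_case_nat: "arrival 0 (case_nat s z) = s" "arrival (Suc i) (case_nat s z) = s + arrival i z"
  unfolding arrival_def by (simp, subst sum.atMost_Suc_shift, simp)

text \<open>Dividing \<open>{0..T}\<close> into \<open>n\<close> equal steps bounds the total change
  by \<open>T\<^sup>2 / n\<close>. This replaces the argument that a function with derivative zero
  is constant, for a product of functions that need not be differentiable everywhere.\<close>

lemma quadratic_increments_imp_eq:
  fixes f :: "real \<Rightarrow> real"
  assumes T: "0 \<le> T" and f: "\<And>s t. 0 \<le> s \<Longrightarrow> s \<le> t \<Longrightarrow> t \<le> T \<Longrightarrow> \<bar>f s - f t\<bar> \<le> (t - s)\<^sup>2"
  shows "f 0 = f T"
proof -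
  have b: "\<bar>f 0 - f T\<bar> \<le> T\<^sup>2 / real (Suc n)" for n
  proof -
    define h where "h = T / real (Suc n)"
    have h: "0 \<le> h" "real (Suc n) * h = T" using T by (simp_all add: h_def)
    have "\<bar>f 0 - f (real k * h)\<bar> \<le> real k * h\<^sup>2" if "k \<le> Suc n" for k
      using that
    proof (induction k)
      case (Suc k)
      have "real (Suc k) * h \<le> real (Suc n) * h" using Suc.prems h by (intro mult_right_mono) auto
      then have "\<bar>f (real k * h) - f (real (Suc k) * h)\<bar> \<le> (real (Suc k) * h - real k * h)\<^sup>2"
        using h by (intro f) (auto intro: mult_right_mono)
      also have "real (Suc k) * h - real k * h = h" by (simp add: algebra_simps)
      finally have "\<bar>f (real k * h) - f (real (Suc k) * h)\<bar> \<le> h\<^sup>2" .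
      moreover have "\<bar>f 0 - f (real k * h)\<bar> \<le> real k * h\<^sup>2" using Suc by simp
      moreover have "real (Suc k) * h\<^sup>2 = real k * h\<^sup>2 + h\<^sup>2" by (simp add: algebra_simps)
      ultimately show ?case by linarith
    qed simp
    from this[of "Suc n"] have "\<bar>f 0 - f T\<bar> \<le> real (Suc n) * h\<^sup>2" using h by simp
    also have "\<dots> = T\<^sup>2 / real (Suc n)" by (simp add: h_def power2_eq_square)
    finally show ?thesis .
  qed
  have "(\<lambda>n. T\<^sup>2 / real (Suc n)) \<longlonglongrightarrow> 0"
    using tendsto_mult_right_zero[OF LIMSEQ_inverse_real_of_nat, of "T\<^sup>2"] by (simp add: field_simps)
  then have "\<bar>f 0 - f T\<bar> \<le> 0" by (rule LIMSEQ_le_const) (use b in auto)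
  then show ?thesis by simp
qed

text \<open>Let \<open>u t\<close> be the functional of the points shifted by \<open>t\<close>.
  Conditioning on the first gap gives a renewal equation, by which
  \<open>v t = exp (- t) * u t\<close> is the integral of \<open>h * v\<close> over
  \<open>{t<..}\<close>; formally \<open>v' = - h v\<close>, with \<open>u T = 1\<close> as terminal
  value. Since \<open>h\<close> is merely measurable, the solution is verified by increments:
  \<open>v * exp (- A)\<close> changes by at most the square of the step, hence not at all.\<close>

lemma renewal_functional:
  assumes g: "g \<in> borel_measurable borel" and T: "0 \<le> T" and zero: "\<And>t. T < t \<Longrightarrow> g t = 0"
  shows "(\<integral>z. expm (\<Sum>i. g (arrival i z)) \<partial>unit_gap_sequences) = exp (- (\<integral>t. indicator {0<..T} t * (1 - expm (g t)) \<partial>lborel))"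
proof -
  define h where "h t = expm (g t)" for t
  have hm[measurable]: "h \<in> borel_measurable borel"
    unfolding h_def[abs_def] by (rule measurable_compose[OF g expm_measurable])
  have h: "0 \<le> h t" "h t \<le> 1" for t by (simp_all add: h_def)
  interpret S: prob_space unit_gap_sequences by (rule prob_space_unit_gap_sequences)
  define K where "K t z = expm (\<Sum>i. g (t + arrival i z))" for t z
  have Km: "(\<lambda>p. K (fst p) (snd p)) \<in> borel_measurable (borel \<Otimes>\<^sub>M unit_gap_sequences)"
    unfolding K_def
    by (intro measurable_compose[OF _ expm_measurable] borel_measurable_suminf_order measurable_compose[OF _ g]
        borel_measurable_add measurable_fst measurable_compose[OF measurable_snd arrival_borel_measurable])
  have Kb: "0 \<le> K t z" "K t z \<le> 1" for t z by (simp_all add: K_def)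
  have Kt: "K t \<in> borel_measurable unit_gap_sequences" for t
    using measurable_compose[OF measurable_Pair1'[of t borel unit_gap_sequences] Km] by simp
  have Ki: "integrable unit_gap_sequences (K t)" for t
    by (rule S.integrable_const_bound[where B=1]) (use Kb Kt in auto)
  define u where "u t = (\<integral>z. K t z \<partial>unit_gap_sequences)" for t
  have um[measurable]: "u \<in> borel_measurable borel"
    unfolding u_def[abs_def] by (rule S.borel_measurable_lebesgue_integral) (use Km in \<open>simp add: case_prod_beta'\<close>)
  have u: "0 \<le> u t" "u t \<le> 1" for t
  proof -
    show "0 \<le> u t" unfolding u_def by (rule Bochner_Integration.integral_nonneg) (rule Kb)
    have "u t \<le> (\<integral>z. 1 \<partial>unit_gap_sequences)" unfolding u_def by (rule integral_mono) (use Ki Kb in auto)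
    then show "u t \<le> 1" by (simp add: S.prob_space)
  qed
  have uT: "u T = 1"
  proof -
    have "u T = (\<integral>z. 1 \<partial>unit_gap_sequences)" unfolding u_def
    proof (rule Bochner_Integration.integral_cong[OF refl])
      fix z assume "z \<in> space unit_gap_sequences"
      then have "g (T + arrival i z) = 0" for i by (intro zero) (simp add: arrival_pos)
      then show "K T z = 1" by (simp add: K_def)
    qed
    then show ?thesis by (simp add: S.prob_space)
  qed
  interpret GS: pair_prob_space unit_gap_law unit_gap_sequences
    by (simp add: pair_prob_space_def pair_sigma_finite_def prob_space_unit_gap_law prob_space_unit_gap_sequences prob_space_imp_sigma_finite)
  have renewal: "u t = (\<integral>s. indicator {0<..} s * exp (- s) * (h (t + s) * u (t + s)) \<partial>lborel)" for t
  proof -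
    have cm: "(\<lambda>(s, z). case_nat s z) \<in> measurable (unit_gap_law \<Otimes>\<^sub>M unit_gap_sequences) unit_gap_sequences"
      unfolding unit_gap_sequences_def by measurable
    have d: "distr (unit_gap_law \<Otimes>\<^sub>M unit_gap_sequences) unit_gap_sequences (\<lambda>(s, z). case_nat s z) = unit_gap_sequences"
      unfolding unit_gap_sequences_def by (rule unit_gaps.PiM_iter)
    \<comment> \<open>Prepending a gap \<open>s\<close> moves every other point by \<open>s\<close>
      and adds the point \<open>s\<close> itself.\<close>
    have K1: "K t (case_nat s z) = h (t + s) * K (t + s) z" for s z
    proof -
      have "(\<Sum>i. g (t + arrival i (case_nat s z))) = g (t + s) + (\<Sum>i. g (t + s + arrival i z))"
        by (subst suminf_offset[where i=1]) (simp_all add: arrival_case_nat add.assoc)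
      then show ?thesis by (simp add: K_def h_def expm_add)
    qed
    have i: "integrable (unit_gap_law \<Otimes>\<^sub>M unit_gap_sequences) (\<lambda>p. K t (case_nat (fst p) (snd p)))"
      by (rule GS.P.integrable_const_bound[where B=1])
        (use Kb measurable_compose[OF cm Kt] in \<open>auto simp: case_prod_beta'\<close>)
    have "u t = (\<integral>p. K t (case_nat (fst p) (snd p)) \<partial>(unit_gap_law \<Otimes>\<^sub>M unit_gap_sequences))"
      unfolding u_def by (subst d[symmetric], subst integral_distr[OF cm Kt]) (simp add: case_prod_beta')
    also have "\<dots> = (\<integral>s. (\<integral>z. K t (case_nat s z) \<partial>unit_gap_sequences) \<partial>unit_gap_law)"
      using GS.integral_fst'[OF i] by simp
    also have "\<dots> = (\<integral>s. h (t + s) * u (t + s) \<partial>unit_gap_law)" by (simp add: K1 u_def)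
    also have "\<dots> = (\<integral>s. exp (- s) * (h (t + s) * u (t + s)) \<partial>half_line)"
      unfolding unit_gap_law_def by (subst integral_density) (auto intro!: measurable_half_line)
    also have "\<dots> = (\<integral>s. indicator {0<..} s *\<^sub>R (exp (- s) * (h (t + s) * u (t + s))) \<partial>lborel)"
      unfolding half_line_def by (subst integral_restrict_space) auto
    finally show ?thesis by (simp add: mult.assoc)
  qed
  define v where "v t = exp (- t) * u t" for t
  have vm[measurable]: "v \<in> borel_measurable borel" unfolding v_def[abs_def] by measurable
  have v: "0 \<le> v t" for t using u by (simp add: v_def)
  have v1: "v t \<le> 1" if "0 \<le> t" for t unfolding v_def using u that by (intro mult_le_one) auto
  have v_eq: "v t = (\<integral>r. indicator {t<..} r * (h r * v r) \<partial>lborel)" for t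
  proof -
    have "v t = (\<integral>s. exp (- t) * (indicator {0<..} s * exp (- s) * (h (t + s) * u (t + s))) \<partial>lborel)"
      unfolding v_def renewal[of t] by simp
    also have "\<dots> = (\<integral>s. indicator {t<..} (t + 1 * s) * (h (t + 1 * s) * v (t + 1 * s)) \<partial>lborel)"
    proof (rule Bochner_Integration.integral_cong[OF refl])
      fix s
      have "exp (- t) * (exp (- s) * (h (t + s) * u (t + s))) = h (t + s) * v (t + s)"
        by (simp add: v_def exp_diff exp_minus divide_inverse mult_ac)
      then show "exp (- t) * (indicator {0<..} s * exp (- s) * (h (t + s) * u (t + s))) = indicator {t<..} (t + 1 * s) * (h (t + 1 * s) * v (t + 1 * s))"
        by (simp add: indicator_def)
    qed
    also have "\<dots> = (\<integral>r. indicator {t<..} r * (h r * v r) \<partial>lborel)"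
      by (subst lborel_integral_real_affine[where c=1 and t=t]) auto
    finally show ?thesis .
  qed
  have int_exp: "integrable lborel (\<lambda>r. indicator {0<..} r * exp (- r :: real))"
  proof -
    have "integrable unit_gap_law (\<lambda>_. 1 :: real)"
      using prob_space_unit_gap_law by (simp add: prob_space.finite_measure finite_measure.integrable_const)
    then have "integrable half_line (\<lambda>t. exp (- t) *\<^sub>R (1::real))"
      unfolding unit_gap_law_def by (subst (asm) integrable_density) (auto intro: measurable_half_line)
    then show ?thesis unfolding half_line_def by (subst (asm) integrable_restrict_space) auto
  qed
  have int_v: "integrable lborel (\<lambda>r. indicator {t<..} r * (h r * v r))" if t: "0 \<le> t" for t
  proof (rule Bochner_Integration.integrable_bound[OF int_exp])
    show "AE r in lborel. norm (indicator {t<..} r * (h r * v r)) \<le> norm (indicator {0<..} r * exp (- r))"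
    proof (rule AE_I2)
      fix r :: real
      have "h r * v r \<le> exp (- r)"
        using mult_le_one[OF h(2) u(1) u(2), of r r] mult_left_mono[of "h r * u r" 1 "exp (- r)"] by (simp add: v_def mult_ac)
      then show "norm (indicator {t<..} r * (h r * v r)) \<le> norm (indicator {0<..} r * exp (- r))"
        using t h v by (auto simp: indicator_def abs_mult)
    qed
  qed measurable
  have v_diff: "v s - v t = (\<integral>r. indicator {s<..t} r * (h r * v r) \<partial>lborel)" if "0 \<le> s" "s \<le> t" for s t
  proof -
    have "v s - v t = (\<integral>r. indicator {s<..} r * (h r * v r) - indicator {t<..} r * (h r * v r) \<partial>lborel)"
      using that by (subst (1 2) v_eq) (simp add: int_v)
    also have "\<dots> = (\<integral>r. indicator {s<..t} r * (h r * v r) \<partial>lborel)"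
      by (rule Bochner_Integration.integral_cong) (use that in \<open>auto simp: indicator_def\<close>)
    finally show ?thesis .
  qed
  have int_b: "integrable lborel (\<lambda>r. indicator {s<..t} r * w r)" if "w \<in> borel_measurable borel" "\<And>r. s < r \<Longrightarrow> r \<le> t \<Longrightarrow> \<bar>w r\<bar> \<le> C" for s t C and w :: "real \<Rightarrow> real"
  proof (rule Bochner_Integration.integrable_bound[where f="\<lambda>r. C * indicator {s<..t} r"])
    show "integrable lborel (\<lambda>r. C * indicator {s<..t} r :: real)"
      by (intro integrable_mult_right integrable_real_indicator) (simp, cases "s \<le> t", simp_all)
    show "AE r in lborel. norm (indicator {s<..t} r * w r) \<le> norm (C * indicator {s<..t} r)"
      using that(2) by (intro AE_I2) (force simp: indicator_def abs_mult)
  qed (use that(1) in measurable)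
  have int_ind: "(\<integral>r. indicator {s<..t} r * (c::real) \<partial>lborel) = (t - s) * c" if "s \<le> t" for s t c
    using that by simp
  define A where "A t = (\<integral>r. indicator {t<..T} r * h r \<partial>lborel)" for t
  have A_diff: "A s - A t = (\<integral>r. indicator {s<..t} r * h r \<partial>lborel)" if "s \<le> t" "t \<le> T" for s t
  proof -
    have "A s - A t = (\<integral>r. indicator {s<..T} r * h r - indicator {t<..T} r * h r \<partial>lborel)"
      unfolding A_def by (rule Bochner_Integration.integral_diff[symmetric]) (auto intro!: int_b[of _ _ _ 1] simp: h)
    also have "\<dots> = (\<integral>r. indicator {s<..t} r * h r \<partial>lborel)"
      by (rule Bochner_Integration.integral_cong) (use that in \<open>auto simp: indicator_def\<close>)
    finally show ?thesis .
  qed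
  have A0: "0 \<le> A t" for t unfolding A_def by (rule Bochner_Integration.integral_nonneg) (simp add: h)
  have "v 0 * exp (- A 0) = v T * exp (- A T)"
  proof (rule quadratic_increments_imp_eq[OF T])
    fix s t assume s: "0 \<le> s" "s \<le> t" "t \<le> T"
    define D where "D = A s - A t"
    have D_eq: "D = (\<integral>r. indicator {s<..t} r * h r \<partial>lborel)" unfolding D_def by (rule A_diff) (use s in auto)
    have D: "0 \<le> D" "D \<le> t - s"
    proof -
      show "0 \<le> D" unfolding D_eq by (rule Bochner_Integration.integral_nonneg) (simp add: h)
      have "D \<le> (\<integral>r. indicator {s<..t} r * 1 \<partial>lborel)"
        unfolding D_eq by (intro integral_mono int_b[of _ _ _ 1]) (auto simp: h indicator_def)
      then show "D \<le> t - s" using int_ind[of s t 1] s by simp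
    qed
    have i1: "integrable lborel (\<lambda>r. indicator {s<..t} r * (h r * v r))"
      by (rule int_b[of _ _ _ 1]) (use h v v1 s in \<open>auto simp: abs_mult intro!: mult_le_one\<close>)
    have i2: "integrable lborel (\<lambda>r. indicator {s<..t} r * h r * v t)"
      by (intro integrable_mult_left int_b[of _ _ _ 1]) (auto simp: h)
    \<comment> \<open>The error made by replacing \<open>v r\<close> with \<open>v t\<close> in the
      integral for \<open>v s - v t\<close>; it is quadratic because \<open>v\<close> decreases with
      slope at most \<open>1\<close>.\<close>
    define R where "R = v s - v t - D * v t"
    have R_eq: "R = (\<integral>r. indicator {s<..t} r * (h r * (v r - v t)) \<partial>lborel)"
    proof -
      have "R = (\<integral>r. indicator {s<..t} r * (h r * v r) \<partial>lborel) - (\<integral>r. indicator {s<..t} r * h r * v t \<partial>lborel)"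
        unfolding R_def v_diff[OF s(1,2)] D_eq by simp
      also have "\<dots> = (\<integral>r. indicator {s<..t} r * (h r * v r) - indicator {s<..t} r * h r * v t \<partial>lborel)"
        by (rule Bochner_Integration.integral_diff[OF i1 i2, symmetric])
      finally show ?thesis by (simp add: algebra_simps)
    qed
    have vr: "0 \<le> v r - v t" "v r - v t \<le> t - s" if r: "s < r" "r \<le> t" for r
    proof -
      have "0 \<le> r" using r s by simp
      show "0 \<le> v r - v t" unfolding v_diff[OF \<open>0 \<le> r\<close> r(2)]
        by (rule Bochner_Integration.integral_nonneg) (simp add: h v)
      have "v r - v t \<le> (\<integral>q. indicator {r<..t} q * 1 \<partial>lborel)"
        unfolding v_diff[OF \<open>0 \<le> r\<close> r(2)]
      proof (rule integral_mono)
        show "integrable lborel (\<lambda>q. indicator {r<..t} q * (h q * v q))"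
          by (rule int_b[of _ _ _ 1]) (use h v v1 \<open>0 \<le> r\<close> in \<open>auto simp: abs_mult intro!: mult_le_one\<close>)
        show "integrable lborel (\<lambda>q. indicator {r<..t} q * (1::real))" by (rule int_b[of _ _ _ 1]) auto
        show "indicator {r<..t} q * (h q * v q) \<le> indicator {r<..t} q * 1" for q
          using h v v1[of q] \<open>0 \<le> r\<close> by (auto simp: indicator_def intro!: mult_le_one)
      qed
      then show "v r - v t \<le> t - s" using int_ind[of r t 1] r by simp
    qed
    have R: "0 \<le> R" "R \<le> (t - s)\<^sup>2"
    proof -
      show "0 \<le> R" unfolding R_eq
        by (rule Bochner_Integration.integral_nonneg) (use h vr(1) in \<open>auto simp: indicator_def\<close>)
      have hv: "h r * (v r - v t) \<le> t - s" if "s < r" "r \<le> t" for r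
        using mult_mono[OF h(2) vr(2)[OF that] _ vr(1)[OF that], of r] by simp
      have "R \<le> (\<integral>r. indicator {s<..t} r * (t - s) \<partial>lborel)"
        unfolding R_eq
      proof (rule integral_mono)
        show "integrable lborel (\<lambda>r. indicator {s<..t} r * (h r * (v r - v t)))"
          by (rule int_b[of _ _ _ "t - s"]) (use hv vr(1) h in \<open>auto simp: abs_mult\<close>)
        show "integrable lborel (\<lambda>r. indicator {s<..t} r * (t - s))" by (rule int_b[of _ _ _ "t - s"]) (use s in auto)
        show "indicator {s<..t} r * (h r * (v r - v t)) \<le> indicator {s<..t} r * (t - s)" for r
          using hv[of r] by (auto simp: indicator_def)
      qed
      also have "\<dots> = (t - s)\<^sup>2" unfolding power2_eq_square by (rule int_ind[OF s(2)])
      finally show "R \<le> (t - s)\<^sup>2" .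
    qed
    have e0: "exp (- A s) = exp (- A t) * exp (- D)" by (simp add: D_def exp_add[symmetric])
    \<comment> \<open>The first term lies between \<open>- (t - s)\<^sup>2\<close> and
      \<open>0\<close>, the second between \<open>0\<close> and \<open>(t - s)\<^sup>2\<close>;
      their opposite signs give the bound with constant \<open>1\<close>.\<close>
    have "v s * exp (- D) - v t = v t * ((1 + D) * exp (- D) - 1) + R * exp (- D)"
      by (simp add: R_def algebra_simps)
    moreover have "(1 + D) * exp (- D) \<le> 1"
      using exp_ge_add_one_self[of D] by (simp add: exp_minus field_simps)
    moreover have "1 - D\<^sup>2 \<le> (1 + D) * exp (- D)"
      using mult_left_mono[OF exp_ge_add_one_self[of "- D"], of "1 + D"] D by (simp add: power2_eq_square algebra_simps)
    moreover have "D\<^sup>2 \<le> (t - s)\<^sup>2" using D by (intro power_mono)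
    moreover have "0 \<le> v t" "v t \<le> 1" using v v1 s by auto
    moreover have "0 \<le> R * exp (- D)" "R * exp (- D) \<le> (t - s)\<^sup>2"
      using R D mult_mono[OF R(2), of "exp (- D)" 1] by auto
    moreover have "v t * ((1 + D) * exp (- D) - 1) \<le> 0" using calculation by (intro mult_nonneg_nonpos) auto
    moreover have "- (t - s)\<^sup>2 \<le> v t * ((1 + D) * exp (- D) - 1)"
      using mult_mono[of "v t" 1 "1 - (1 + D) * exp (- D)" "(t - s)\<^sup>2"] calculation by (simp add: algebra_simps)
    ultimately have "\<bar>v s * exp (- D) - v t\<bar> \<le> (t - s)\<^sup>2" by linarith
    then have "exp (- A t) * \<bar>v s * exp (- D) - v t\<bar> \<le> 1 * (t - s)\<^sup>2"
      using A0 by (intro mult_mono) auto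
    then have "\<bar>exp (- A t) * (v s * exp (- D) - v t)\<bar> \<le> (t - s)\<^sup>2" by (simp add: abs_mult)
    then show "\<bar>v s * exp (- A s) - v t * exp (- A t)\<bar> \<le> (t - s)\<^sup>2" unfolding e0 by (simp add: algebra_simps)
  qed
  moreover have "A T = 0" by (simp add: A_def)
  ultimately have "u 0 * exp (- A 0) = exp (- T)" by (simp add: v_def uT)
  then have "u 0 * (exp (- A 0) * exp (A 0)) = exp (- T) * exp (A 0)" by (simp only: mult.assoc[symmetric])
  then have "u 0 = exp (- (T - A 0))" unfolding mult_exp_exp by simp
  moreover have "(\<integral>t. indicator {0<..T} t * (1 - expm (g t)) \<partial>lborel) = T - A 0"
  proof -
    have "(\<integral>t. indicator {0<..T} t * (1 - expm (g t)) \<partial>lborel) = (\<integral>t. indicator {0<..T} t * 1 - indicator {0<..T} t * h t \<partial>lborel)"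
      by (simp add: h_def algebra_simps)
    also have "\<dots> = (\<integral>t. indicator {0<..T} t * 1 \<partial>lborel) - A 0"
      unfolding A_def by (rule Bochner_Integration.integral_diff; rule int_b[of _ _ _ 1]) (simp_all add: h)
    finally show ?thesis using int_ind[OF T, of 1] by simp
  qed
  moreover have "u 0 = (\<integral>z. expm (\<Sum>i. g (arrival i z)) \<partial>unit_gap_sequences)" by (simp add: u_def K_def)
  ultimately show ?thesis by simp
qed

lemma suminf_LIMSEQ_mono:
  fixes f :: "nat \<Rightarrow> nat \<Rightarrow> ennreal"
  assumes "\<And>i. incseq (\<lambda>n. f n i)" "\<And>i. (\<lambda>n. f n i) \<longlonglongrightarrow> F i"
  shows "(\<lambda>n. \<Sum>i. f n i) \<longlonglongrightarrow> (\<Sum>i. F i)"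
proof -
  have "(\<lambda>n. \<integral>\<^sup>+i. f n i \<partial>count_space UNIV) \<longlonglongrightarrow> (\<integral>\<^sup>+i. F i \<partial>count_space UNIV)"
    by (rule nn_integral_LIMSEQ) (use assms in \<open>auto simp: incseq_def le_fun_def\<close>)
  then show ?thesis by (simp add: nn_integral_count_space_nat)
qed

text \<open>\<open>renewal_functional\<close> asks for a function on the whole line that vanishes
  beyond a finite time. Hence \<open>g0\<close> is extended by \<open>0\<close> and cut off at
  \<open>n\<close>, and both sides pass to the limit.\<close>

theorem arrivals_laplace:
  fixes g0 :: "real \<Rightarrow> ennreal"
  assumes g0: "g0 \<in> borel_measurable half_line"
  shows "(\<integral>z. expm (\<Sum>i. g0 (arrival i z)) \<partial>unit_gap_sequences) = expm (\<integral>\<^sup>+t. ennreal (1 - expm (g0 t)) \<partial>half_line)"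
proof -
  interpret S: prob_space unit_gap_sequences by (rule prob_space_unit_gap_sequences)
  define g where "g t = g0 t * indicator {0<..} t" for t
  have g: "g \<in> borel_measurable borel"
    using g0 unfolding g_def half_line_def
    by (subst (asm) borel_measurable_restrict_space_iff_ennreal) (auto simp: mult.commute)
  define gn where "gn n t = g t * indicator {..real n} t" for n t
  have gnm: "gn n \<in> borel_measurable borel" for n unfolding gn_def[abs_def] using g by measurable
  have inc: "incseq (\<lambda>n. gn n t)" for t
    unfolding incseq_def gn_def by (intro allI impI mult_left_mono) (auto simp: indicator_def)
  have ev: "eventually (\<lambda>n. gn n t = g t) sequentially" for t
    using eventually_ge_at_top[of "nat \<lceil>t\<rceil>"] by eventually_elim (auto simp: gn_def indicator_def)
  have lim: "(\<lambda>n. gn n t) \<longlonglongrightarrow> g t" for t by (rule tendsto_eventually[OF ev])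
  have "(\<lambda>n. \<integral>z. expm (\<Sum>i. gn n (arrival i z)) \<partial>unit_gap_sequences) \<longlonglongrightarrow> (\<integral>z. expm (\<Sum>i. g (arrival i z)) \<partial>unit_gap_sequences)"
  proof (rule integral_dominated_convergence[where w="\<lambda>_. 1"])
    have m: "(\<lambda>z. expm (\<Sum>i. q (arrival i z))) \<in> borel_measurable unit_gap_sequences" if "q \<in> borel_measurable borel" for q :: "real \<Rightarrow> ennreal"
      by (intro measurable_compose[OF _ expm_measurable] borel_measurable_suminf_order measurable_compose[OF _ that] arrival_borel_measurable)
    show "(\<lambda>z. expm (\<Sum>i. g (arrival i z))) \<in> borel_measurable unit_gap_sequences" by (rule m[OF g])
    show "(\<lambda>z. expm (\<Sum>i. gn n (arrival i z))) \<in> borel_measurable unit_gap_sequences" for n by (rule m[OF gnm])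
    show "AE z in unit_gap_sequences. (\<lambda>n. expm (\<Sum>i. gn n (arrival i z))) \<longlonglongrightarrow> expm (\<Sum>i. g (arrival i z))"
      by (intro AE_I2 tendsto_expm suminf_LIMSEQ_mono inc lim)
  qed auto
  moreover have "(\<integral>z. expm (\<Sum>i. gn n (arrival i z)) \<partial>unit_gap_sequences) = expm (\<integral>\<^sup>+t. ennreal (1 - expm (gn n t)) \<partial>half_line)" for n
  proof -
    have m: "(\<lambda>t. indicator {0<..real n} t * (1 - expm (gn n t))) \<in> borel_measurable lborel"
      using measurable_compose[OF gnm expm_measurable]
      by (intro borel_measurable_times borel_measurable_diff borel_measurable_indicator) simp_all
    have i: "integrable lborel (\<lambda>t. indicator {0<..real n} t * (1 - expm (gn n t)))"
    proof (rule Bochner_Integration.integrable_bound[OF _ m])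
      show "integrable lborel (indicator {0<..real n} :: real \<Rightarrow> real)"
        by (rule integrable_real_indicator) simp_all
      show "AE t in lborel. norm (indicator {0<..real n} t * (1 - expm (gn n t))) \<le> norm (indicator {0<..real n} t :: real)"
        by (intro AE_I2) (auto simp: indicator_def)
    qed
    have "(\<integral>\<^sup>+t. ennreal (1 - expm (gn n t)) \<partial>half_line) = (\<integral>\<^sup>+t. ennreal (indicator {0<..real n} t * (1 - expm (gn n t))) \<partial>lborel)"
      unfolding nn_integral_half_line by (rule nn_integral_cong) (auto simp: indicator_def gn_def)
    also have "\<dots> = ennreal (\<integral>t. indicator {0<..real n} t * (1 - expm (gn n t)) \<partial>lborel)"
      by (rule nn_integral_eq_integral[OF i]) simp
    finally have "expm (\<integral>\<^sup>+t. ennreal (1 - expm (gn n t)) \<partial>half_line) = exp (- (\<integral>t. indicator {0<..real n} t * (1 - expm (gn n t)) \<partial>lborel))"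
      by (simp add: expm_ennreal Bochner_Integration.integral_nonneg)
    moreover have "gn n t = 0" if "real n < t" for t using that by (simp add: gn_def)
    ultimately show ?thesis using renewal_functional[OF gnm, where T="real n"] by simp
  qed
  moreover have "(\<lambda>n. expm (\<integral>\<^sup>+t. ennreal (1 - expm (gn n t)) \<partial>half_line)) \<longlonglongrightarrow> expm (\<integral>\<^sup>+t. ennreal (1 - expm (g t)) \<partial>half_line)"
  proof (intro tendsto_expm nn_integral_LIMSEQ)
    show "(\<lambda>t. ennreal (1 - expm (gn n t))) \<in> borel_measurable half_line" for n
      using measurable_compose[OF gnm expm_measurable]
      by (intro measurable_half_line measurable_compose[OF _ measurable_ennreal] borel_measurable_diff) simp_all
    show "incseq (\<lambda>n t. ennreal (1 - expm (gn n t)))"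
      unfolding incseq_def le_fun_def gn_def
      by (intro allI impI ennreal_leI) (auto simp: indicator_def)
    show "(\<lambda>n. ennreal (1 - expm (gn n t))) \<longlonglongrightarrow> ennreal (1 - expm (g t))" for t
      by (rule tendsto_eventually, rule eventually_mono[OF ev[of t]]) simp
  qed
  ultimately have "(\<integral>z. expm (\<Sum>i. g (arrival i z)) \<partial>unit_gap_sequences) = expm (\<integral>\<^sup>+t. ennreal (1 - expm (g t)) \<partial>half_line)"
    by (simp only: LIMSEQ_unique)
  moreover have "(\<integral>z. expm (\<Sum>i. g (arrival i z)) \<partial>unit_gap_sequences) = (\<integral>z. expm (\<Sum>i. g0 (arrival i z)) \<partial>unit_gap_sequences)"
    by (rule Bochner_Integration.integral_cong) (auto simp: g_def arrival_pos)
  moreover have "(\<integral>\<^sup>+t. ennreal (1 - expm (g t)) \<partial>half_line) = (\<integral>\<^sup>+t. ennreal (1 - expm (g0 t)) \<partial>half_line)"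
    by (rule nn_integral_cong) (simp add: g_def space_half_line)
  ultimately show "(\<integral>z. expm (\<Sum>i. g0 (arrival i z)) \<partial>unit_gap_sequences) = expm (\<integral>\<^sup>+t. ennreal (1 - expm (g0 t)) \<partial>half_line)"
    by simp
qed

section \<open>Polar representation and LePage series\<close>

text \<open>If the argument \<open>a\<close> of \<open>z\<close> were at least
  \<open>\<delta>\<close>, some multiple \<open>k a\<close> with \<open>k \<le> K\<close> would fall
  between \<open>pi / 2\<close> and \<open>pi\<close>, where the cosine is not positive. Positivity
  of the real parts of many powers thus forces a small imaginary part.\<close>

lemma abs_Im_less_of_Re_powers_pos:
  fixes z :: complex
  assumes z: "norm z \<le> 1" and pos: "\<And>k. 1 \<le> k \<Longrightarrow> k \<le> K \<Longrightarrow> 0 < Re (z ^ k)" and K: "pi \<le> real K * \<delta>" and \<delta>: "\<delta> > 0"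
  shows "\<bar>Im z\<bar> < \<delta>"
proof (rule ccontr)
  assume "\<not> \<bar>Im z\<bar> < \<delta>"
  then have Im: "\<delta> \<le> \<bar>Im z\<bar>" by simp
  have d1: "\<delta> \<le> 1" using Im abs_Im_le_cmod[of z] z by linarith
  define r where "r = norm z"
  define a where "a = \<bar>Arg z\<bar>"
  have r: "0 \<le> r" "r \<le> 1" using z by (simp_all add: r_def)
  have z_eq: "z = rcis r (Arg z)" by (simp add: r_def rcis_cmod_Arg)
  have cosk: "Re (z ^ k) = r ^ k * cos (real k * a)" for k
  proof -
    have "Re (z ^ k) = r ^ k * cos (real k * Arg z)" by (subst z_eq) (simp add: DeMoivre2)
    also have "cos (real k * Arg z) = cos (real k * a)" unfolding a_def by (cases "Arg z \<ge> 0") simp_all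
    finally show ?thesis .
  qed
  have "\<bar>Im z\<bar> = r * \<bar>sin (Arg z)\<bar>" by (subst z_eq) (use r in \<open>simp add: abs_mult\<close>)
  also have "\<dots> \<le> 1 * a" unfolding a_def using r by (intro mult_mono abs_sin_x_le_abs_x) auto
  finally have a: "\<delta> \<le> a" using Im by simp
  have a_pi: "a \<le> pi" unfolding a_def using Arg_bounded[of z] by (simp add: abs_le_iff)
  have K1: "1 \<le> K"
  proof (rule ccontr)
    assume "\<not> 1 \<le> K"
    then have "K = 0" by simp
    then show False using K pi_gt_zero by simp
  qed
  have "0 < Re (z ^ 1)" by (rule pos) (use K1 in auto)
  have "a < pi / 2"
  proof (rule ccontr)
    assume "\<not> a < pi / 2"
    then have "cos a \<le> cos (pi / 2)" by (intro cos_monotone_0_pi_le) (use a_pi in auto)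
    then have "r * cos a \<le> 0" using r by (intro mult_nonneg_nonpos) (auto simp del: cos_pi_half simp: cos_pi_half)
    then show False using \<open>0 < Re (z ^ 1)\<close> cosk[of 1] by simp
  qed
  \<comment> \<open>The first multiple of \<open>a\<close> that reaches \<open>pi / 2\<close>. It
    stays below \<open>pi\<close>, since a single step is shorter than \<open>pi / 2\<close> by the
    case of the first power, and \<open>pi \<le> K * \<delta>\<close> keeps \<open>k\<close> within
    \<open>K\<close>.\<close>
  define k where "k = nat \<lceil>pi / 2 / a\<rceil>"
  have apos: "0 < a" using a \<delta> by simp
  have q: "0 < pi / 2 / a" using apos by simp
  have k_real: "real k = of_int \<lceil>pi / 2 / a\<rceil>" unfolding k_def using q by simp
  have k1: "pi / 2 / a \<le> real k" "real k < pi / 2 / a + 1" unfolding k_real by linarith+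
  have ka: "pi / 2 \<le> real k * a" "real k * a < pi"
    using k1 apos \<open>a < pi / 2\<close> by (auto simp: field_simps)
  have "1 \<le> k" using k1(1) q by (cases k) auto
  moreover have "k \<le> K"
  proof -
    have "pi / 2 / a \<le> pi / 2 / \<delta>" using a \<delta> by (intro divide_left_mono) auto
    moreover have "1 \<le> pi / 2 / \<delta>" using d1 \<delta> pi_ge_two by (simp add: field_simps)
    moreover have "pi / 2 / \<delta> + pi / 2 / \<delta> \<le> real K" using K \<delta> by (simp add: field_simps)
    ultimately have "real k < real K + 1" using k1(2) by linarith
    then show ?thesis by simp
  qed
  ultimately have "0 < Re (z ^ k)" by (rule pos)
  moreover have "cos (real k * a) \<le> cos (pi / 2)" by (intro cos_monotone_0_pi_le) (use ka in auto)
  then have "r ^ k * cos (real k * a) \<le> 0" using r by (intro mult_nonneg_nonpos) (simp_all add: cos_pi_half)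
  ultimately show False using cosk[of k] by simp
qed

section \<open>Regularity of the given characters\<close>

context stable_cone
begin

text \<open>Only real parts are controlled by the hypotheses. As \<open>Im (f x) * Im (f y)\<close>
  equals \<open>Re (f x) * Re (f y) - Re (f (add x y))\<close>, the products of imaginary parts
  along an orbit are one-sided continuous, and \<open>one_sided_continuous_of_products\<close>
  applies. Imaginary parts vanish at \<open>0\<close> because all powers of \<open>f\<close> belong
  to \<open>H\<close>, so that their real parts are eventually positive.\<close>

lemma regular_of_one_sided_continuous:
  assumes chars: "\<And>f. f \<in> H \<Longrightarrow> is_character M add e star f"
    and mult: "\<And>f g. f \<in> H \<Longrightarrow> g \<in> H \<Longrightarrow> (\<lambda>x. f x * g x) \<in> H"
    and cont: "\<And>x f t. x \<noteq> e \<Longrightarrow> f \<in> H \<Longrightarrow> t > 0 \<Longrightarrow> ((\<lambda>u. Re (f (scl u x))) \<longlongrightarrow> Re (f (scl t x))) (at t within side t)"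
    and liminf: "\<And>x f. f \<in> H \<Longrightarrow> Liminf (at_right 0) (\<lambda>t. ereal (Re (f (scl t x)))) > 0"
    and f: "f \<in> H"
  shows "regular f"
proof -
  have f_char: "f \<in> borel_measurable M" "norm (f x) \<le> 1" "f (add x y) = f x * f y" for x y
    using chars[OF f] by (auto simp: is_character_def)
  have side_pos: "eventually (\<lambda>u. 0 < u) (at t within side t)" if "t > 0" for t
    unfolding eventually_at_filter using side that by (auto intro!: eventually_mono[OF order_tendstoD(1)[OF tendsto_ident_at that]] always_eventually)
  \<comment> \<open>The continuity hypothesis excludes \<open>e\<close>, which may occur as
    \<open>x\<close> or as a sum such as \<open>add x (scl s x)\<close>; there the path is
    constant.\<close>
  have Re_cont: "((\<lambda>u. Re (f (scl u x))) \<longlongrightarrow> Re (f (scl t x))) (at t within side t)" if t: "t > 0" for x t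
  proof (cases "x = e")
    case True
    show ?thesis unfolding True
      by (rule tendsto_eventually, rule eventually_mono[OF side_pos[OF t]]) (simp add: scale_neutral t)
  qed (rule cont[OF _ f t])
  have Im_cont: "((\<lambda>u. Im (f (scl u x))) \<longlongrightarrow> Im (f (scl t x))) (at t within side t)" if t: "t > 0" for x t
  proof -
    \<comment> \<open>\<open>scl\<close> has no meaning for nonpositive factors; the value
      \<open>0\<close> there makes \<open>v\<close> measurable on the whole line.\<close>
    define v where "v u = (if 0 < u then Im (f (scl u x)) else 0)" for u
    have "(v \<longlongrightarrow> v t) (at t within side t)"
    proof (rule one_sided_continuous_of_products[where C=1])
      have "(\<lambda>u. Im (f (scl u x))) \<in> borel_measurable (restrict_space borel {0<..})"
      proof -
        have "(\<lambda>u. scl u x) \<in> measurable (restrict_space borel {0<..}) M"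
          by (rule measurable_scl) (auto simp: space_restrict_space space_M intro: measurable_restrict_space1)
        from measurable_compose[OF measurable_compose[OF this f_char(1)], of Im] show ?thesis by simp
      qed
      then have "(\<lambda>u. indicator {0<..} u *\<^sub>R Im (f (scl u x))) \<in> borel_measurable borel"
        by (subst (asm) borel_measurable_restrict_space_iff) auto
      moreover have "v = (\<lambda>u. indicator {0<..} u *\<^sub>R Im (f (scl u x)))" by (auto simp: v_def fun_eq_iff)
      ultimately show "v \<in> borel_measurable borel" by simp
      show "\<bar>v u\<bar> \<le> 1" for u
        using abs_Im_le_cmod[of "f (scl u x)"] f_char(2)[of "scl u x"] by (simp add: v_def)
      show "side t = {t<..} \<or> side t = {0<..<t}" using side by auto
      fix s :: real assume s: "s > 0"
      define R where "R y u = Re (f (scl u y))" for y u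
      have eq: "v u * v (u * s) = R x u * R (scl s x) u - R (add x (scl s x)) u" if u: "u > 0" for u
      proof -
        have "f (scl u (add x (scl s x))) = f (scl u x) * f (scl (u * s) x)"
          using u s by (simp add: scale_add scale_scale f_char(3))
        then show ?thesis using u s by (simp add: v_def R_def scale_scale)
      qed
      have "((\<lambda>u. R x u * R (scl s x) u - R (add x (scl s x)) u) \<longlongrightarrow> v t * v (t * s)) (at t within side t)"
        unfolding eq[OF t] unfolding R_def by (intro tendsto_intros Re_cont t)
      then show "((\<lambda>u. v u * v (u * s)) \<longlongrightarrow> v t * v (t * s)) (at t within side t)"
        by (rule Lim_transform_eventually) (rule eventually_mono[OF side_pos[OF t]], simp add: eq)
    qed (rule t)
    then have "(v \<longlongrightarrow> Im (f (scl t x))) (at t within side t)" using t by (simp add: v_def)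
    then show ?thesis
      by (rule Lim_transform_eventually) (rule eventually_mono[OF side_pos[OF t]], simp add: v_def)
  qed
  have power: "(\<lambda>x. f x ^ k) \<in> H" if "1 \<le> k" for k
    using that
  proof (induction k rule: dec_induct)
    case base
    show ?case using f by simp
  next
    case (step k)
    show ?case using mult[OF f step.IH] by simp
  qed
  have below: "\<exists>c>0. eventually (\<lambda>t. c \<le> Re (f' (scl t x))) (at_right 0)" if f': "f' \<in> H" for f' x
  proof -
    obtain c where c: "0 < ereal c" "ereal c < Liminf (at_right 0) (\<lambda>t. ereal (Re (f' (scl t x))))"
      using ereal_dense2[OF liminf[OF f']] by auto
    from less_LiminfD[OF c(2)] have "eventually (\<lambda>t. c \<le> Re (f' (scl t x))) (at_right 0)"
      by eventually_elim simp
    then show ?thesis using c(1) by auto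
  qed
  have Im_0: "((\<lambda>t. Im (f (scl t x))) \<longlongrightarrow> 0) (at_right 0)" for x
  proof (rule tendstoI)
    fix \<delta> :: real assume \<delta>: "\<delta> > 0"
    define K where "K = nat \<lceil>pi / \<delta>\<rceil>"
    have "pi / \<delta> \<le> real K" unfolding K_def by linarith
    then have K: "pi \<le> real K * \<delta>" using \<delta> by (simp add: field_simps)
    have "eventually (\<lambda>t. 0 < Re (f (scl t x) ^ k)) (at_right 0)" if "k \<in> {1..K}" for k
    proof -
      have "(\<lambda>x. f x ^ k) \<in> H" using that by (intro power) simp
      from below[OF this, of x] obtain c where "c > 0" "eventually (\<lambda>t. c \<le> Re (f (scl t x) ^ k)) (at_right 0)" by blast
      from this(2) show ?thesis by eventually_elim (use \<open>c > 0\<close> in simp)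
    qed
    then have "eventually (\<lambda>t. \<forall>k\<in>{1..K}. 0 < Re (f (scl t x) ^ k)) (at_right 0)"
      by (intro eventually_ball_finite) auto
    then show "eventually (\<lambda>t. dist (Im (f (scl t x))) 0 < \<delta>) (at_right 0)"
    proof eventually_elim
      case (elim t)
      have "\<bar>Im (f (scl t x))\<bar> < \<delta>"
        by (rule abs_Im_less_of_Re_powers_pos[OF f_char(2) _ K \<delta>]) (use elim in auto)
      then show ?case by (simp add: dist_real_def)
    qed
  qed
  have "((\<lambda>u. f (scl u x)) \<longlongrightarrow> f (scl t x)) (at t within side t)" if "t > 0" for x t
    using Re_cont[OF that, of x] Im_cont[OF that, of x] unfolding tendsto_complex_iff by blast
  then show ?thesis unfolding regular_def using chars[OF f] Im_0 below[OF f] by blast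
qed

end

section \<open>Existence of independent marks and arrivals\<close>

lemma sigma_finite_half_line: "sigma_finite_measure half_line"
  unfolding half_line_def by (intro sigma_finite_measure_restrict_space sigma_finite_lborel) simp

lemma sigma_finite_theta: "sigma_finite_measure (theta \<alpha>)"
proof -
  interpret sigma_finite_measure "restrict_space lborel {0<..} :: real measure"
    using sigma_finite_half_line by (simp add: half_line_def)
  have "(\<lambda>t. ennreal (\<alpha> * t powr (- (\<alpha> + 1)))) \<in> borel_measurable (restrict_space lborel {0<..})"
    by (rule measurable_restrict_space1) measurable
  then show ?thesis unfolding theta_def by (subst sigma_finite_iff_density_finite) auto
qed

lemma distr_pair_snd:
  assumes "prob_space N" "sigma_finite_measure M" shows "distr (N \<Otimes>\<^sub>M M) M snd = M"
proof (rule measure_eqI)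
  interpret sigma_finite_measure M by fact
  fix A assume "A \<in> sets (distr (N \<Otimes>\<^sub>M M) M snd)"
  then have A: "A \<in> sets M" by simp
  have "snd -` A \<inter> space (N \<Otimes>\<^sub>M M) = space N \<times> A"
    using sets.sets_into_space[OF A] by (auto simp: space_pair_measure)
  then have "emeasure (distr (N \<Otimes>\<^sub>M M) M snd) A = emeasure (N \<Otimes>\<^sub>M M) (space N \<times> A)"
    using A by (simp add: emeasure_distr)
  also have "\<dots> = emeasure M A"
    using A by (simp add: emeasure_pair_measure_Times prob_space.emeasure_space_1[OF assms(1)])
  finally show "emeasure (distr (N \<Otimes>\<^sub>M M) M snd) A = emeasure M A" .
qed simp

text \<open>The canonical product space: i.i.d. marks with law \<open>\<pi>\<close> next to
  independent exponential gaps. It ensures that the series representation is not vacuous.\<close>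

theorem exists_lepage_input:
  fixes \<pi> :: "'a measure"
  assumes \<pi>: "prob_space \<pi>"
  shows "lepage_input (PiM UNIV (\<lambda>_. \<pi>) \<Otimes>\<^sub>M unit_gap_sequences) \<pi> (\<lambda>i \<omega>. fst \<omega> i) (\<lambda>i \<omega>. arrival i (snd \<omega>))"
proof -
  define E where "E = PiM (UNIV :: nat set) (\<lambda>_. \<pi>)"
  define P where "P = E \<Otimes>\<^sub>M unit_gap_sequences"
  interpret pi: prob_space \<pi> by fact
  interpret E: product_prob_space "\<lambda>_. \<pi>" "UNIV :: nat set" ..
  have Ep: "prob_space E" unfolding E_def by (rule E.P.prob_space_axioms)
  interpret PP: pair_prob_space E unit_gap_sequences
    using Ep prob_space_unit_gap_sequences by (simp add: pair_prob_space_def pair_sigma_finite_def prob_space_imp_sigma_finite)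
  interpret P: prob_space P unfolding P_def by (rule PP.P.prob_space_axioms)
  have fst_P: "fst \<in> measurable P E" and snd_P: "snd \<in> measurable P unit_gap_sequences"
    unfolding P_def by simp_all
  have d1: "distr P E fst = E" unfolding P_def
    by (rule prob_space.distr_pair_fst[OF prob_space_unit_gap_sequences])
  have d2: "distr P unit_gap_sequences snd = unit_gap_sequences" unfolding P_def
    by (rule distr_pair_snd[OF Ep prob_space_imp_sigma_finite[OF prob_space_unit_gap_sequences]])
  have comp: "(\<lambda>z. z i) \<in> measurable E \<pi>" for i unfolding E_def by (rule measurable_component_singleton) simp
  have \<epsilon>m: "(\<lambda>\<omega>. fst \<omega> i) \<in> measurable P \<pi>" for i by (rule measurable_compose[OF fst_P comp])
  have d: "distr P \<pi> (\<lambda>\<omega>. fst \<omega> i) = \<pi>" for i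
  proof -
    have "distr P \<pi> (\<lambda>\<omega>. fst \<omega> i) = distr (distr P E fst) \<pi> (\<lambda>z. z i)"
      by (subst distr_distr[OF comp fst_P]) (simp add: comp_def)
    also have "\<dots> = \<pi>" unfolding d1 unfolding E_def using E.PiM_component[of i] by simp
    finally show ?thesis .
  qed
  have ind: "P.indep_vars (\<lambda>_. \<pi>) (\<lambda>i \<omega>. fst \<omega> i) UNIV"
    using P.indep_vars_iff_distr_eq_PiM[where I=UNIV and M'="\<lambda>_. \<pi>" and X="\<lambda>i \<omega>. fst \<omega> i"] \<epsilon>m d d1
    by (simp add: restrict_UNIV E_def)
  have \<Gamma>m: "(\<lambda>\<omega>. arrival i (snd \<omega>)) \<in> measurable P half_line" for i
    by (rule measurable_compose[OF snd_P arrival_measurable])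
  have "poisson_process P half_line (point_process_of half_line (\<lambda>i \<omega>. arrival i (snd \<omega>)))"
  proof (rule poisson_point_process_of_laplace[OF P.prob_space_axioms \<Gamma>m refl])
    fix g :: "real \<Rightarrow> ennreal" assume g: "g \<in> borel_measurable half_line"
    have m: "(\<lambda>z. expm (\<Sum>i. g (arrival i z))) \<in> borel_measurable unit_gap_sequences"
      by (intro measurable_compose[OF _ expm_measurable] borel_measurable_suminf_order measurable_compose[OF arrival_measurable g])
    have "(\<integral>z. expm (\<Sum>i. g (arrival i z)) \<partial>unit_gap_sequences) = (\<integral>\<omega>. expm (\<Sum>i. g (arrival i (snd \<omega>))) \<partial>P)"
      by (subst d2[symmetric], rule integral_distr[OF snd_P m])
    then show "(\<integral>\<omega>. expm (\<Sum>i. g (arrival i (snd \<omega>))) \<partial>P) = expm (\<integral>\<^sup>+x. ennreal (1 - expm (g x)) \<partial>half_line)"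
      using arrivals_laplace[OF g] by simp
  qed
  moreover have "AE \<omega> in P. \<forall>i. arrival i (snd \<omega>) < arrival (Suc i) (snd \<omega>)"
    by (intro AE_I2 allI arrival_less_Suc measurable_space[OF snd_P])
  ultimately have succ: "successive_unit_poisson_points P (\<lambda>i \<omega>. arrival i (snd \<omega>))"
    using \<Gamma>m unfolding successive_unit_poisson_points_def by (simp add: half_line_def)
  define V where "V = PiM (UNIV :: nat set) (\<lambda>_. half_line)"
  have am: "(\<lambda>z i. arrival i z) \<in> measurable unit_gap_sequences V" unfolding V_def
    by (rule measurable_PiM_single') (use arrival_measurable in \<open>auto dest: measurable_space\<close>)
  have "P.indep_set {fst -` A \<inter> space P |A. A \<in> sets E} {(\<lambda>\<omega> i. arrival i (snd \<omega>)) -` B \<inter> space P |B. B \<in> sets V}"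
    unfolding P.indep_sets2_eq
  proof (intro conjI ballI)
    show "{fst -` A \<inter> space P |A. A \<in> sets E} \<subseteq> P.events" using measurable_sets[OF fst_P] by auto
    have cm: "(\<lambda>\<omega> i. arrival i (snd \<omega>)) \<in> measurable P V" by (rule measurable_compose[OF snd_P am])
    show "{(\<lambda>\<omega> i. arrival i (snd \<omega>)) -` B \<inter> space P |B. B \<in> sets V} \<subseteq> P.events"
      using measurable_sets[OF cm] by auto
    fix a b assume "a \<in> {fst -` A \<inter> space P |A. A \<in> sets E}" "b \<in> {(\<lambda>\<omega> i. arrival i (snd \<omega>)) -` B \<inter> space P |B. B \<in> sets V}"
    then obtain A B where a: "a = fst -` A \<inter> space P" "A \<in> sets E"
      and b: "b = (\<lambda>\<omega> i. arrival i (snd \<omega>)) -` B \<inter> space P" "B \<in> sets V" by blast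
    \<comment> \<open>Events of the arrivals depend on the second coordinate only, so the events to
      be compared are rectangles of the product space.\<close>
    define B' where "B' = (\<lambda>z i. arrival i z) -` B \<inter> space unit_gap_sequences"
    have B': "B' \<in> sets unit_gap_sequences" unfolding B'_def by (rule measurable_sets[OF am b(2)])
    have a1: "a = A \<times> space unit_gap_sequences" and b1: "b = space E \<times> B'" and ab: "a \<inter> b = A \<times> B'"
      using sets.sets_into_space[OF a(2)] unfolding a(1) b(1) B'_def P_def by (auto simp: space_pair_measure)
    have m: "P.prob (X \<times> Y) = measure E X * measure unit_gap_sequences Y" if "X \<in> sets E" "Y \<in> sets unit_gap_sequences" for X Y
      unfolding P_def measure_def using that by (simp add: PP.M2.emeasure_pair_measure_Times enn2real_mult)
    show "P.prob (a \<inter> b) = P.prob a * P.prob b"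
      using m[OF a(2) B'] m[OF a(2) sets.top] m[OF sets.top B']
      by (simp only: ab) (simp add: a1 b1 PP.M1.prob_space PP.M2.prob_space)
  qed
  then show ?thesis
    using ind d succ P.prob_space_axioms unfolding lepage_input_def E_def P_def V_def half_line_def by simp
qed

section \<open>Polar representations as integral identities\<close>

context convex_cone
begin

lemma scl_eq_neutral_iff: "t > 0 \<Longrightarrow> scl t x = e \<longleftrightarrow> x = e"
  by (metis scale_neutral scale_one scale_scale left_inverse less_irrefl inverse_positive_iff_positive)

lemma space_punctured: "space (punctured M e) = - {e}"
  by (simp add: punctured_def space_restrict_space space_M)

lemma measurable_punctured_scl:
  assumes f: "f \<in> measurable N (punctured M e)" and g: "g \<in> borel_measurable N" "\<And>x. x \<in> space N \<Longrightarrow> g x > 0"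
  shows "(\<lambda>x. scl (g x) (f x)) \<in> measurable N (punctured M e)"
proof -
  have "f \<in> measurable N M" and "\<And>x. x \<in> space N \<Longrightarrow> f x \<noteq> e"
    using f measurable_space[OF f] unfolding punctured_def by (auto simp: measurable_restrict_space2_iff space_restrict_space)
  then show ?thesis unfolding punctured_def
    by (intro measurable_restrict_space2 measurable_scl g) (auto simp: scl_eq_neutral_iff g)
qed

lemma measurable_polar:
  assumes \<pi>: "sets \<pi> = sets (punctured M e)"
  shows "(\<lambda>p. scl (snd p) (fst p)) \<in> measurable (\<pi> \<Otimes>\<^sub>M theta \<alpha>) (punctured M e)"
proof (rule measurable_punctured_scl)
  have "(\<lambda>x. x) \<in> measurable \<pi> (punctured M e)" using measurable_ident_sets[OF \<pi>] by (simp add: id_def)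
  then show "fst \<in> measurable (\<pi> \<Otimes>\<^sub>M theta \<alpha>) (punctured M e)" by (rule measurable_compose[OF measurable_fst])
  have "(\<lambda>x. x) \<in> borel_measurable (theta \<alpha>)"
    by (simp add: measurable_cong_sets[OF sets_theta refl] measurable_restrict_space1)
  then show "snd \<in> borel_measurable (\<pi> \<Otimes>\<^sub>M theta \<alpha>)" by (rule measurable_compose[OF measurable_snd])
  show "0 < snd p" if "p \<in> space (\<pi> \<Otimes>\<^sub>M theta \<alpha>)" for p
    using that by (auto simp: space_pair_measure space_theta)
qed

lemma measurable_scl_comp:
  assumes \<pi>: "sets \<pi> = sets (punctured M e)" and g: "g \<in> borel_measurable (punctured M e)"
  shows "(\<lambda>(x, t). g (scl t x)) \<in> borel_measurable (\<pi> \<Otimes>\<^sub>M theta \<alpha>)"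
  using measurable_compose[OF measurable_polar[OF \<pi>] g] by (simp add: case_prod_beta')

lemma measurable_scl_right:
  assumes "x \<noteq> e" and g: "g \<in> borel_measurable (punctured M e)"
  shows "(\<lambda>t. g (scl t x)) \<in> borel_measurable (restrict_space borel {0<..})"
  by (rule measurable_compose[OF measurable_punctured_scl g])
    (use assms(1) in \<open>auto simp: space_restrict_space space_punctured intro: measurable_restrict_space1\<close>)

text \<open>The identity of integrals is linear in \<open>\<pi>\<close>; in this form the
  representation is delivered by the polar decomposition and preserved by averaging.\<close>

lemma polar_representation_iff:
  fixes g :: "'a \<Rightarrow> ennreal"
  assumes \<pi>: "prob_space \<pi>" "sets \<pi> = sets (punctured M e)" and \<nu>: "sets \<nu> = sets (punctured M e)"
  shows "polar_representation M e scl \<alpha> \<pi> \<nu> \<longleftrightarrow>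
    (\<forall>g\<in>borel_measurable (punctured M e). (\<integral>\<^sup>+x. g x \<partial>\<nu>) = (\<integral>\<^sup>+x. (\<integral>\<^sup>+t. g (scl t x) \<partial>theta \<alpha>) \<partial>\<pi>))"
proof -
  interpret theta: sigma_finite_measure "theta \<alpha>" by (rule sigma_finite_theta)
  define D where "D = distr (\<pi> \<Otimes>\<^sub>M theta \<alpha>) (punctured M e) (\<lambda>(x, t). scl t x)"
  have m: "(\<lambda>(x, t). scl t x) \<in> measurable (\<pi> \<Otimes>\<^sub>M theta \<alpha>) (punctured M e)"
    using measurable_polar[OF \<pi>(2)] by (simp add: case_prod_beta')
  have D: "(\<integral>\<^sup>+x. g x \<partial>D) = (\<integral>\<^sup>+x. (\<integral>\<^sup>+t. g (scl t x) \<partial>theta \<alpha>) \<partial>\<pi>)" if g: "g \<in> borel_measurable (punctured M e)" for g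
    unfolding D_def
    using theta.nn_integral_fst[OF measurable_scl_comp[OF \<pi>(2) g]] m g by (simp add: nn_integral_distr case_prod_beta')
  have "\<nu> = D \<longleftrightarrow> (\<forall>g\<in>borel_measurable (punctured M e). (\<integral>\<^sup>+x. g x \<partial>\<nu>) = (\<integral>\<^sup>+x. (\<integral>\<^sup>+t. g (scl t x) \<partial>theta \<alpha>) \<partial>\<pi>))"
  proof
    assume r: "\<forall>g\<in>borel_measurable (punctured M e). (\<integral>\<^sup>+x. g x \<partial>\<nu>) = (\<integral>\<^sup>+x. (\<integral>\<^sup>+t. g (scl t x) \<partial>theta \<alpha>) \<partial>\<pi>)"
    show "\<nu> = D"
    proof (rule measure_eqI)
      show "sets \<nu> = sets D" by (simp add: \<nu> D_def)
      fix A assume "A \<in> sets \<nu>"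
      then have A: "A \<in> sets (punctured M e)" by (simp add: \<nu>)
      then have "(\<integral>\<^sup>+x. indicator A x \<partial>\<nu>) = (\<integral>\<^sup>+x. indicator A x \<partial>D)" using r D by simp
      then show "emeasure \<nu> A = emeasure D A" using A by (simp add: \<nu> D_def)
    qed
  qed (simp add: D)
  then show ?thesis using \<pi> by (simp add: polar_representation_def D_def)
qed

end

lemma (in convex_cone) nn_integral_polar:
  assumes "polar_representation M e scl \<alpha> \<pi> \<nu>" and g: "g \<in> borel_measurable (punctured M e)"
  shows "(\<integral>\<^sup>+x. g x \<partial>\<nu>) = (\<integral>\<^sup>+x. (\<integral>\<^sup>+t. g (scl t x) \<partial>theta \<alpha>) \<partial>\<pi>)"
    and "(\<integral>\<^sup>+x. g x \<partial>\<nu>) = (\<integral>\<^sup>+t. (\<integral>\<^sup>+x. g (scl t x) \<partial>\<pi>) \<partial>theta \<alpha>)"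
proof -
  have \<pi>: "prob_space \<pi>" "sets \<pi> = sets (punctured M e)" using assms(1) by (simp_all add: polar_representation_def)
  have "\<nu> = distr (\<pi> \<Otimes>\<^sub>M theta \<alpha>) (punctured M e) (\<lambda>(x, t). scl t x)"
    using assms(1) unfolding polar_representation_def by blast
  then have \<nu>: "sets \<nu> = sets (punctured M e)" by (metis sets_distr)
  show 1: "(\<integral>\<^sup>+x. g x \<partial>\<nu>) = (\<integral>\<^sup>+x. (\<integral>\<^sup>+t. g (scl t x) \<partial>theta \<alpha>) \<partial>\<pi>)"
    using assms(1) g polar_representation_iff[OF \<pi> \<nu>] by blast
  interpret pair_sigma_finite \<pi> "theta \<alpha>"
    using \<pi>(1) sigma_finite_theta by (simp add: pair_sigma_finite_def prob_space_imp_sigma_finite)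
  show "(\<integral>\<^sup>+x. g x \<partial>\<nu>) = (\<integral>\<^sup>+t. (\<integral>\<^sup>+x. g (scl t x) \<partial>\<pi>) \<partial>theta \<alpha>)"
    unfolding 1 by (rule Fubini'[symmetric]) (use measurable_scl_comp[OF \<pi>(2) g] in simp)
qed

section \<open>Polar representation, series and symmetry for the Levy measure\<close>

context levy_stable_cone
begin

text \<open>Homogeneity and symmetry of \<open>\<nu>\<close> are proved for functions on the whole
  cone; extension by \<open>0\<close> at \<open>e\<close> makes them applicable on the punctured
  cone.\<close>

lemma punctured_extend:
  fixes g :: "'a \<Rightarrow> ennreal"
  assumes "g \<in> borel_measurable (punctured M e)"
  shows "(\<lambda>x. g x * indicator (- {e}) x) \<in> borel_measurable M"
  using assms unfolding punctured_def
  by (subst (asm) borel_measurable_restrict_space_iff_ennreal) (simp_all add: neutral_sets space_M)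

text \<open>The scaling, written as the flow \<open>y\<close> |-> \<open>scl (exp y)\<close>, fits
  the polar decomposition of homogeneous measures. The zero measure is excluded because
  \<open>theta\<close> has infinite mass, so that no probability measure \<open>\<pi>\<close> could
  represent it.\<close>

lemma exists_polar_representation:
  assumes nz: "emeasure \<nu> (space \<nu>) \<noteq> 0"
  shows "\<exists>\<pi>. polar_representation M e scl \<alpha> \<pi> \<nu>"
proof -
  have sets: "sets \<nu> = sets (punctured M e)" by (simp add: sets_nu punctured_def)
  have meas: "measurable \<nu> N = measurable (punctured M e) N" for N by (rule measurable_cong_sets[OF sets refl])
  have "sigma_finite_measure \<nu>" using nu_levy by (simp add: admits_levy_measure_def)
  then interpret homogeneous_flow \<nu> "\<lambda>y. scl (exp y)" \<alpha>
  proof (rule homogeneous_flow.intro, unfold_locales)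
    have id: "(\<lambda>x. x) \<in> measurable \<nu> (punctured M e)" using measurable_ident_sets[OF sets] by (simp add: id_def)
    have "(\<lambda>p. scl (exp (snd p)) (fst p)) \<in> measurable (\<nu> \<Otimes>\<^sub>M borel) (punctured M e)"
      by (rule measurable_punctured_scl) (use measurable_compose[OF measurable_fst id] in auto)
    then show "(\<lambda>p. scl (exp (snd p)) (fst p)) \<in> measurable (\<nu> \<Otimes>\<^sub>M borel) \<nu>"
      using measurable_cong_sets[OF refl sets] by blast
    show "scl (exp y) (scl (exp z) x) = scl (exp (y + z)) x" for x y z by (simp add: scale_scale exp_add)
    show "scl (exp 0) x = x" for x by (simp add: scale_one)
    show "\<alpha> > 0" by (rule alpha_pos)
    show "emeasure \<nu> (space \<nu>) \<noteq> 0" by (rule nz)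
    fix g :: "'a \<Rightarrow> ennreal" and s :: real assume "g \<in> borel_measurable \<nu>"
    then have g: "(\<lambda>x. g x * indicator (- {e}) x) \<in> borel_measurable M" unfolding meas by (rule punctured_extend)
    have "(\<integral>\<^sup>+x. g (scl (exp s) x) \<partial>\<nu>) = (\<integral>\<^sup>+x. g (scl (exp s) x) * indicator (- {e}) (scl (exp s) x) \<partial>\<nu>)"
      by (rule nn_integral_cong) (simp add: space_nu scl_eq_neutral_iff)
    also have "\<dots> = ennreal (exp s powr \<alpha>) * (\<integral>\<^sup>+x. g x * indicator (- {e}) x \<partial>\<nu>)"
      by (rule nu_homogeneous[OF exp_gt_zero g])
    also have "(\<integral>\<^sup>+x. g x * indicator (- {e}) x \<partial>\<nu>) = (\<integral>\<^sup>+x. g x \<partial>\<nu>)"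
      by (rule nn_integral_cong) (simp add: space_nu)
    finally show "(\<integral>\<^sup>+x. g (scl (exp s) x) \<partial>\<nu>) = ennreal (exp (\<alpha> * s)) * (\<integral>\<^sup>+x. g x \<partial>\<nu>)"
      by (simp add: powr_def)
  qed
  obtain \<pi> where \<pi>: "prob_space \<pi>" "sets \<pi> = sets \<nu>"
    and rep: "\<And>g. g \<in> borel_measurable \<nu> \<Longrightarrow>
      (\<integral>\<^sup>+x. (\<integral>\<^sup>+y. g (scl (exp y) x) * ennreal (\<alpha> * exp (- \<alpha> * y)) \<partial>lborel) \<partial>\<pi>) = (\<integral>\<^sup>+x. g x \<partial>\<nu>)"
    using polar_decomposition by blast
  have \<pi>s: "sets \<pi> = sets (punctured M e)" using \<pi>(2) sets by simp
  have "polar_representation M e scl \<alpha> \<pi> \<nu>"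
    unfolding polar_representation_iff[OF \<pi>(1) \<pi>s sets]
  proof
    fix g :: "'a \<Rightarrow> ennreal" assume g: "g \<in> borel_measurable (punctured M e)"
    have "(\<integral>\<^sup>+x. (\<integral>\<^sup>+t. g (scl t x) \<partial>theta \<alpha>) \<partial>\<pi>) = (\<integral>\<^sup>+x. (\<integral>\<^sup>+y. g (scl (exp y) x) * ennreal (\<alpha> * exp (- \<alpha> * y)) \<partial>lborel) \<partial>\<pi>)"
    proof (rule nn_integral_cong)
      fix x assume "x \<in> space \<pi>"
      then have "x \<noteq> e" using sets_eq_imp_space_eq[OF \<pi>s] by (simp add: space_punctured)
      then show "(\<integral>\<^sup>+t. g (scl t x) \<partial>theta \<alpha>) = (\<integral>\<^sup>+y. g (scl (exp y) x) * ennreal (\<alpha> * exp (- \<alpha> * y)) \<partial>lborel)"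
        by (intro nn_integral_theta alpha_pos measurable_scl_right g)
    qed
    then show "(\<integral>\<^sup>+x. g x \<partial>\<nu>) = (\<integral>\<^sup>+x. (\<integral>\<^sup>+t. g (scl t x) \<partial>theta \<alpha>) \<partial>\<pi>)"
      using rep g by (simp add: meas)
  qed
  then show ?thesis by blast
qed

text \<open>In polar coordinates this is the integral of \<open>1 - Re f\<close> against
  \<open>\<nu>\<close>, divided by \<open>\<alpha>\<close>, and the Levy condition makes it
  finite.\<close>

lemma polar_integral_finite:
  assumes rep: "polar_representation M e scl \<alpha> \<pi> \<nu>" and f: "f \<in> H"
  shows "(\<integral>\<^sup>+t\<in>{0<..}. ennreal ((\<integral>x. 1 - Re (f (scl t x)) \<partial>\<pi>) * t powr (- (\<alpha> + 1))) \<partial>lborel) < \<infinity>"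
proof -
  have \<pi>: "prob_space \<pi>" "sets \<pi> = sets (punctured M e)" using rep by (simp_all add: polar_representation_def)
  interpret pi: prob_space \<pi> by fact
  have g: "regular f" by (rule H_regular[OF f])
  have fm: "f \<in> borel_measurable M" by (rule regularD(1)[OF g])
  have fM: "(\<lambda>x. ennreal (1 - Re (f x))) \<in> borel_measurable (punctured M e)"
    unfolding punctured_def by (rule measurable_restrict_space1) (use fm in measurable)
  define k where "k t = (\<integral>x. 1 - Re (f (scl t x)) \<partial>\<pi>)" for t
  have int: "integrable \<pi> (\<lambda>x. 1 - Re (f (scl t x)))" if t: "t > 0" for t
  proof (rule pi.integrable_const_bound[where B=2])
    show "AE x in \<pi>. norm (1 - Re (f (scl t x))) \<le> 2"
    proof (rule AE_I2)
      show "norm (1 - Re (f (scl t x))) \<le> 2" for x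
        using one_minus_Re_ge_0[OF g, of "scl t x"] one_minus_Re_le[OF g, of "scl t x"] by simp
    qed
    have "scl t \<in> measurable \<pi> M"
      using measurable_restrict_space1[OF measurable_scl_const[OF t]] measurable_cong_sets[OF \<pi>(2) refl] unfolding punctured_def by blast
    from measurable_compose[OF this fm] show "(\<lambda>x. 1 - Re (f (scl t x))) \<in> borel_measurable \<pi>" by measurable
  qed
  have k0: "0 \<le> k t" for t unfolding k_def by (rule Bochner_Integration.integral_nonneg) (rule one_minus_Re_ge_0[OF g])
  have k: "(\<integral>\<^sup>+x. ennreal (1 - Re (f (scl t x))) \<partial>\<pi>) = ennreal (k t)" if "t > 0" for t
    unfolding k_def by (rule nn_integral_eq_integral[OF int[OF that] AE_I2]) (rule one_minus_Re_ge_0[OF g])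
  have km: "(\<lambda>t. \<integral>\<^sup>+x. ennreal (1 - Re (f (scl t x))) \<partial>\<pi>) \<in> borel_measurable (theta \<alpha>)"
    using measurable_pair_swap[OF measurable_scl_comp[OF \<pi>(2) fM, of \<alpha>]]
    by (intro pi.borel_measurable_nn_integral) (simp add: case_prod_beta')
  have "(\<lambda>t. ennreal (k t)) \<in> borel_measurable (theta \<alpha>)"
    using km by (subst measurable_cong[where g="\<lambda>t. \<integral>\<^sup>+x. ennreal (1 - Re (f (scl t x))) \<partial>\<pi>"]) (simp_all add: space_theta k)
  then have km': "(\<lambda>t. ennreal (k t)) \<in> borel_measurable (restrict_space lborel {0<..})" by (simp add: theta_def)
  have pm: "(\<lambda>t. ennreal (\<alpha> * t powr (- (\<alpha> + 1)))) \<in> borel_measurable (restrict_space lborel {0<..})"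
    by (rule measurable_restrict_space1) measurable
  have pm1: "(\<lambda>t. ennreal (t powr (- (\<alpha> + 1)))) \<in> borel_measurable (restrict_space lborel {0<..})"
    by (rule measurable_restrict_space1) measurable
  have "(\<integral>\<^sup>+x. ennreal (1 - Re (f x)) \<partial>\<nu>) = (\<integral>\<^sup>+t. ennreal (k t) \<partial>theta \<alpha>)"
    unfolding nn_integral_polar(2)[OF rep fM] by (rule nn_integral_cong) (simp add: space_theta k)
  also have "\<dots> = (\<integral>\<^sup>+t. ennreal (\<alpha> * t powr (- (\<alpha> + 1))) * ennreal (k t) \<partial>restrict_space lborel {0<..})"
    unfolding theta_def by (rule nn_integral_density[OF pm km'])
  also have "\<dots> = (\<integral>\<^sup>+t. ennreal \<alpha> * ennreal (k t * t powr (- (\<alpha> + 1))) \<partial>restrict_space lborel {0<..})"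
    using alpha_pos k0 by (intro nn_integral_cong) (simp add: ennreal_mult[symmetric] mult_ac)
  also have "\<dots> = ennreal \<alpha> * (\<integral>\<^sup>+t. ennreal (k t * t powr (- (\<alpha> + 1))) \<partial>restrict_space lborel {0<..})"
  proof (rule nn_integral_cmult)
    have "(\<lambda>t. ennreal (k t) * ennreal (t powr (- (\<alpha> + 1)))) \<in> borel_measurable (restrict_space lborel {0<..})"
      by (rule borel_measurable_times_ennreal[OF km' pm1])
    then show "(\<lambda>t. ennreal (k t * t powr (- (\<alpha> + 1)))) \<in> borel_measurable (restrict_space lborel {0<..})"
      using k0 by (simp add: ennreal_mult)
  qed
  finally have "ennreal \<alpha> * (\<integral>\<^sup>+t. ennreal (k t * t powr (- (\<alpha> + 1))) \<partial>restrict_space lborel {0<..}) < \<infinity>"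
    using nn_integral_levy_finite[OF f] by simp
  then have "(\<integral>\<^sup>+t. ennreal (k t * t powr (- (\<alpha> + 1))) \<partial>restrict_space lborel {0<..}) < \<infinity>"
    using alpha_pos by (auto simp: ennreal_mult_less_top)
  then show ?thesis by (simp add: k_def nn_integral_restrict_space)
qed

text \<open>By \<open>nn_integral_theta_powr\<close> the map that scales the mark by
  \<open>t powr (- (1 / \<alpha>))\<close> carries the intensity of the marked unit process to
  \<open>\<nu>\<close>, so the marking theorem applies.\<close>

lemma lepage_poisson:
  fixes \<epsilon> :: "nat \<Rightarrow> 'w \<Rightarrow> 'a"
  assumes rep: "polar_representation M e scl \<alpha> \<pi> \<nu>" and input: "lepage_input P \<pi> \<epsilon> \<Gamma>"
  shows "poisson_process P \<nu> (point_process_of (punctured M e) (\<lambda>i \<omega>. scl (\<Gamma> i \<omega> powr (- (1 / \<alpha>))) (\<epsilon> i \<omega>)))"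
proof -
  have \<pi>: "prob_space \<pi>" "sets \<pi> = sets (punctured M e)" using rep by (simp_all add: polar_representation_def)
  interpret pi: prob_space \<pi> by fact
  have \<nu>: "sets \<nu> = sets (punctured M e)" by (simp add: sets_nu punctured_def)
  have id: "(\<lambda>x. x) \<in> measurable \<pi> (punctured M e)" using measurable_ident_sets[OF \<pi>(2)] by (simp add: id_def)
  have m: "(\<lambda>p. scl (fst p powr (- (1 / \<alpha>))) (snd p)) \<in> measurable (half_line \<Otimes>\<^sub>M \<pi>) (punctured M e)"
  proof (rule measurable_punctured_scl)
    show "snd \<in> measurable (half_line \<Otimes>\<^sub>M \<pi>) (punctured M e)" by (rule measurable_compose[OF measurable_snd id])
    have "(\<lambda>t. t powr (- (1 / \<alpha>))) \<in> borel_measurable half_line" by (rule measurable_half_line) measurable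
    then show "(\<lambda>p. fst p powr (- (1 / \<alpha>))) \<in> borel_measurable (half_line \<Otimes>\<^sub>M \<pi>)"
      by (rule measurable_compose[OF measurable_fst])
    show "0 < fst p powr (- (1 / \<alpha>))" if "p \<in> space (half_line \<Otimes>\<^sub>M \<pi>)" for p
      using that by (auto simp: space_pair_measure space_half_line)
  qed
  have image: "(\<integral>\<^sup>+t. (\<integral>\<^sup>+x. g (scl (t powr (- (1 / \<alpha>))) x) \<partial>\<pi>) \<partial>half_line) = (\<integral>\<^sup>+x. g x \<partial>\<nu>)"
    if g: "g \<in> borel_measurable (punctured M e)" for g
  proof -
    have "(\<lambda>t. \<integral>\<^sup>+x. g (scl t x) \<partial>\<pi>) \<in> borel_measurable (theta \<alpha>)"
      using measurable_pair_swap[OF measurable_scl_comp[OF \<pi>(2) g, of \<alpha>]]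
      by (intro pi.borel_measurable_nn_integral) (simp add: case_prod_beta')
    then have "(\<lambda>t. \<integral>\<^sup>+x. g (scl t x) \<partial>\<pi>) \<in> borel_measurable (restrict_space borel {0<..})"
      using measurable_cong_sets[OF sets_theta refl] by blast
    from nn_integral_theta_powr[OF alpha_pos this] show ?thesis
      unfolding nn_integral_polar(2)[OF rep g] by (simp add: half_line_def)
  qed
  show ?thesis
  proof (rule poisson_marking[where \<rho>=half_line and \<pi>=\<pi> and f="\<lambda>t x. scl (t powr (- (1 / \<alpha>))) x" and N="punctured M e"])
    show "prob_space P" "prob_space.indep_vars P (\<lambda>_. \<pi>) \<epsilon> UNIV" "distr P \<pi> (\<epsilon> i) = \<pi>"
      "\<Gamma> i \<in> measurable P half_line" "poisson_process P half_line (point_process_of half_line \<Gamma>)"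
      "prob_space.indep_set P
       {(\<lambda>\<omega> i. \<epsilon> i \<omega>) -` A \<inter> space P | A. A \<in> sets (PiM UNIV (\<lambda>_. \<pi>))}
       {(\<lambda>\<omega> i. \<Gamma> i \<omega>) -` B \<inter> space P | B. B \<in> sets (PiM UNIV (\<lambda>_. half_line))}" for i
      using input unfolding lepage_input_def successive_unit_poisson_points_def half_line_def by simp_all
  qed (use \<pi> m \<nu> image in simp_all)
qed

lemma measurable_star_punctured: "star \<in> measurable (punctured M e) (punctured M e)"
proof -
  have "star x \<noteq> e" if "x \<noteq> e" for x
  proof
    assume "star x = e"
    then have "x = star e" using star_star[of x] by simp
    moreover have "star e = e"
      using star_add[of "star e" e] by (simp add: add_commute[of "star e"] add_neutral star_star add_commute)
    ultimately show False using that by simp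
  qed
  then show ?thesis unfolding punctured_def
    by (intro measurable_restrict_space2 measurable_restrict_space1 star_measurable) (auto simp: space_restrict_space)
qed

text \<open>As \<open>\<nu>\<close> is symmetric and \<open>star\<close> commutes with scaling, the
  image of \<open>\<pi>\<close> under \<open>star\<close> represents \<open>\<nu>\<close> as well,
  and so does the average of the two. The average is symmetric because \<open>star\<close> is an
  involution.\<close>

lemma exists_symmetric_polar_representation:
  assumes sym: "distr \<mu> M star = \<mu>" and rep: "polar_representation M e scl \<alpha> \<pi> \<nu>"
  shows "\<exists>\<kappa>. polar_representation M e scl \<alpha> \<kappa> \<nu> \<and> distr \<kappa> (punctured M e) star = \<kappa>"
proof -
  have \<pi>: "prob_space \<pi>" "sets \<pi> = sets (punctured M e)" using rep by (simp_all add: polar_representation_def)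
  have \<nu>: "sets \<nu> = sets (punctured M e)" by (simp add: sets_nu punctured_def)
  interpret pi: prob_space \<pi> by fact
  \<comment> \<open>The average of the two laws is realized as the law of an element to which
    \<open>star\<close> is applied when a fair coin says so.\<close>
  define coin where "coin = measure_pmf (bernoulli_pmf (1 / 2))"
  interpret coin: prob_space coin unfolding coin_def by (rule prob_space_measure_pmf)
  interpret PC: pair_prob_space \<pi> coin ..
  define flip where "flip p = (if snd p then star (fst p) else fst p)" for p
  have flipm: "flip \<in> measurable (\<pi> \<Otimes>\<^sub>M coin) (punctured M e)"
  proof -
    have id: "(\<lambda>x. x) \<in> measurable \<pi> (punctured M e)" using measurable_ident_sets[OF \<pi>(2)] by (simp add: id_def)
    have 1: "fst \<in> measurable (\<pi> \<Otimes>\<^sub>M coin) (punctured M e)" by (rule measurable_compose[OF measurable_fst id])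
    have "snd -` {True} \<inter> space (\<pi> \<Otimes>\<^sub>M coin) \<in> sets (\<pi> \<Otimes>\<^sub>M coin)"
      by (rule measurable_sets[OF measurable_snd]) (simp add: coin_def)
    moreover have "snd -` {True} \<inter> space (\<pi> \<Otimes>\<^sub>M coin) = {p \<in> space (\<pi> \<Otimes>\<^sub>M coin). snd p}" by auto
    ultimately show ?thesis unfolding flip_def[abs_def]
      by (intro measurable_If 1 measurable_compose[OF 1 measurable_star_punctured]) simp
  qed
  define \<kappa> where "\<kappa> = distr (\<pi> \<Otimes>\<^sub>M coin) (punctured M e) flip"
  have \<kappa>: "prob_space \<kappa>" "sets \<kappa> = sets (punctured M e)"
    unfolding \<kappa>_def by (simp_all add: PC.P.prob_space_distr[OF flipm])
  have half: "(\<integral>\<^sup>+b. h b \<partial>coin) = ennreal (1 / 2) * h True + ennreal (1 / 2) * h False" for h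
    unfolding coin_def by (simp add: mult.commute)
  have int: "(\<integral>\<^sup>+x. g x \<partial>\<kappa>) = (\<integral>\<^sup>+x. ennreal (1 / 2) * g (star x) + ennreal (1 / 2) * g x \<partial>\<pi>)"
    if g: "g \<in> borel_measurable (punctured M e)" for g
  proof -
    have m: "(\<lambda>p. g (flip p)) \<in> borel_measurable (\<pi> \<Otimes>\<^sub>M coin)" by (rule measurable_compose[OF flipm g])
    have "(\<integral>\<^sup>+x. g x \<partial>\<kappa>) = (\<integral>\<^sup>+p. g (flip p) \<partial>(\<pi> \<Otimes>\<^sub>M coin))" unfolding \<kappa>_def using flipm g by (simp add: nn_integral_distr)
    also have "\<dots> = (\<integral>\<^sup>+x. (\<integral>\<^sup>+b. g (flip (x, b)) \<partial>coin) \<partial>\<pi>)" by (rule coin.nn_integral_fst[OF m, symmetric])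
    finally show ?thesis by (simp add: half flip_def)
  qed
  have sm: "(\<lambda>x. g (star x)) \<in> borel_measurable (punctured M e)" if "g \<in> borel_measurable (punctured M e)" for g :: "'a \<Rightarrow> ennreal"
    by (rule measurable_compose[OF measurable_star_punctured that])
  have pim: "g \<in> borel_measurable \<pi>" if "g \<in> borel_measurable (punctured M e)" for g :: "'a \<Rightarrow> ennreal"
    using that measurable_cong_sets[OF \<pi>(2) refl] by blast
  have nu_star: "(\<integral>\<^sup>+x. g (star x) \<partial>\<nu>) = (\<integral>\<^sup>+x. g x \<partial>\<nu>)" if g: "g \<in> borel_measurable (punctured M e)" for g
  proof -
    have ne: "star x \<noteq> e" if "x \<in> space \<nu>" for x
      using measurable_space[OF measurable_star_punctured] that by (simp add: space_punctured space_nu)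
    have "(\<integral>\<^sup>+x. g (star x) \<partial>\<nu>) = (\<integral>\<^sup>+x. g (star x) * indicator (- {e}) (star x) \<partial>\<nu>)"
      by (rule nn_integral_cong) (simp add: ne)
    also have "\<dots> = (\<integral>\<^sup>+x. g x * indicator (- {e}) x \<partial>\<nu>)"
      by (rule nu_symmetric[OF sym punctured_extend[OF g]])
    also have "\<dots> = (\<integral>\<^sup>+x. g x \<partial>\<nu>)" by (rule nn_integral_cong) (simp add: space_nu)
    finally show ?thesis .
  qed
  have "polar_representation M e scl \<alpha> \<kappa> \<nu>"
    unfolding polar_representation_iff[OF \<kappa> \<nu>]
  proof
    fix g :: "'a \<Rightarrow> ennreal" assume g: "g \<in> borel_measurable (punctured M e)"
    define G where "G x = (\<integral>\<^sup>+t. g (scl t x) \<partial>theta \<alpha>)" for x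
    interpret theta: sigma_finite_measure "theta \<alpha>" by (rule sigma_finite_theta)
    have G: "G \<in> borel_measurable (punctured M e)" unfolding G_def
      by (rule theta.borel_measurable_nn_integral) (use measurable_scl_comp[OF refl g, of \<alpha>] in simp)
    have "G (star x) = (\<integral>\<^sup>+t. g (star (scl t x)) \<partial>theta \<alpha>)" for x
      unfolding G_def by (rule nn_integral_cong) (simp add: space_theta star_scale)
    then have "(\<integral>\<^sup>+x. G (star x) \<partial>\<pi>) = (\<integral>\<^sup>+x. g (star x) \<partial>\<nu>)"
      using nn_integral_polar(1)[OF rep sm[OF g]] by simp
    then have Gs: "(\<integral>\<^sup>+x. G (star x) \<partial>\<pi>) = (\<integral>\<^sup>+x. g x \<partial>\<nu>)" by (simp add: nu_star[OF g])
    have G1: "(\<integral>\<^sup>+x. G x \<partial>\<pi>) = (\<integral>\<^sup>+x. g x \<partial>\<nu>)"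
      using nn_integral_polar(1)[OF rep g] by (simp add: G_def)
    have "(\<integral>\<^sup>+x. G x \<partial>\<kappa>) = ennreal (1 / 2) * (\<integral>\<^sup>+x. G (star x) \<partial>\<pi>) + ennreal (1 / 2) * (\<integral>\<^sup>+x. G x \<partial>\<pi>)"
      unfolding int[OF G] using pim[OF G] pim[OF sm[OF G]] by (simp add: nn_integral_add nn_integral_cmult)
    also have "\<dots> = (ennreal (1 / 2) + ennreal (1 / 2)) * (\<integral>\<^sup>+x. g x \<partial>\<nu>)"
      unfolding Gs G1 by (rule distrib_right[symmetric])
    also have "ennreal (1 / 2) + ennreal (1 / 2) = 1" by (subst ennreal_plus[symmetric]) simp_all
    finally show "(\<integral>\<^sup>+x. g x \<partial>\<nu>) = (\<integral>\<^sup>+x. (\<integral>\<^sup>+t. g (scl t x) \<partial>theta \<alpha>) \<partial>\<kappa>)" by (simp add: G_def)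
  qed
  moreover have "distr \<kappa> (punctured M e) star = \<kappa>"
  proof (rule measure_eqI)
    show "sets (distr \<kappa> (punctured M e) star) = sets \<kappa>" by (simp add: \<kappa>)
    fix A assume "A \<in> sets (distr \<kappa> (punctured M e) star)"
    then have A: "A \<in> sets (punctured M e)" by simp
    then have iA: "indicator A \<in> borel_measurable (punctured M e)" by (rule borel_measurable_indicator)
    have st: "star \<in> measurable \<kappa> (punctured M e)"
      using measurable_star_punctured measurable_cong_sets[OF \<kappa>(2) refl] by blast
    have "emeasure (distr \<kappa> (punctured M e) star) A = (\<integral>\<^sup>+x. indicator A (star x) \<partial>\<kappa>)"
      by (subst nn_integral_distr[OF st, symmetric]) (use A in simp_all)
    also have "\<dots> = (\<integral>\<^sup>+x. indicator A x \<partial>\<kappa>)"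
      unfolding int[OF iA] int[OF sm[OF iA]] by (simp add: star_star add.commute)
    also have "\<dots> = emeasure \<kappa> A" using A by (simp add: \<kappa>)
    finally show "emeasure (distr \<kappa> (punctured M e) star) A = emeasure \<kappa> A" .
  qed
  ultimately show ?thesis by blast
qed

end

theorem theorem3p11:
  fixes M :: "'a measure"
    and add :: "'a \<Rightarrow> 'a \<Rightarrow> 'a" and e :: 'a
    and scl :: "real \<Rightarrow> 'a \<Rightarrow> 'a" and star :: "'a \<Rightarrow> 'a"
    and H :: "('a \<Rightarrow> complex) set"
    and L :: "('a \<Rightarrow> complex) \<Rightarrow> (('a \<Rightarrow> complex) \<Rightarrow> complex) \<Rightarrow> real"
    and \<phi> :: "('a \<Rightarrow> complex) \<Rightarrow> complex"
    and \<alpha> :: real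
    and Q :: "'w measure" and \<xi> :: "'w \<Rightarrow> 'a"
    and \<nu> :: "'a measure" and S :: "'a set"
  assumes cone: "convex_cone_involution M add e scl star"
    and H_characters: "\<forall>f\<in>H. is_character M add e star f"
    and H_countable: "countable H"
    and H_separating: "separating H"
    and H_semigroup: "character_semigroup H"
    and H_generates: "generates H M"
    and alpha_pos: "\<alpha> > 0"
    and prob_space_Q: "prob_space Q"
    and xi_random: "\<xi> \<in> measurable Q M"
    and xi_stable: "strictly_stable M add scl \<alpha> (distr Q M \<xi>)"
    and L_levy: "levy_function H L"
    and phi_exponent: "laplace_exponent H (distr Q M \<xi>) \<phi>"
    and nu_levy: "admits_levy_measure M e H L \<phi> \<nu>"
    and nu_nonzero: "emeasure \<nu> (space \<nu>) \<noteq> 0"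
    and one_sided_continuous:
      "(\<forall>x. x \<noteq> e \<longrightarrow> (\<forall>f\<in>H. \<forall>t>0. continuous (at_right t) (\<lambda>t. Re (f (scl t x))))) \<or>
       (\<forall>x. x \<noteq> e \<longrightarrow> (\<forall>f\<in>H. \<forall>t>0. continuous (at_left t) (\<lambda>t. Re (f (scl t x)))))"
    and S_measurable: "S \<in> sets M" and S_punctured: "S \<subseteq> - {e}"
    and S_generates: "- {e} = {scl t x | t x. t > 0 \<and> x \<in> S}"
    and S_unique: "\<forall>x t. x \<noteq> e \<longrightarrow> t > 0 \<longrightarrow> {x, scl t x} \<subseteq> S \<longrightarrow> t = 1"
    and liminf_pos:
      "\<forall>x. \<forall>f\<in>H. Liminf (at_right 0) (\<lambda>t. ereal (Re (f (scl t x)))) > 0"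
  shows
    "(\<exists>\<pi>. polar_representation M e scl \<alpha> \<pi> \<nu>) \<and>
     (\<forall>\<pi>. polar_representation M e scl \<alpha> \<pi> \<nu> \<longrightarrow>
        (\<forall>f\<in>H. (\<integral>\<^sup>+t\<in>{0<..}. ennreal ((\<integral>x. 1 - Re (f (scl t x)) \<partial>\<pi>) * t powr (- (\<alpha> + 1)))
                    \<partial>lborel) < \<infinity>) \<and>
        (\<forall>(P :: 'v measure) \<epsilon> \<Gamma>. lepage_input P \<pi> \<epsilon> \<Gamma> \<longrightarrow>
           poisson_process P \<nu>
             (point_process_of (punctured M e)
                (\<lambda>i \<omega>. scl (\<Gamma> i \<omega> powr (- (1 / \<alpha>))) (\<epsilon> i \<omega>)))) \<and>
        (\<exists>(P :: ((nat \<Rightarrow> 'a) \<times> (nat \<Rightarrow> real)) measure) \<epsilon> \<Gamma>. lepage_input P \<pi> \<epsilon> \<Gamma> \<and>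
           poisson_process P \<nu>
             (point_process_of (punctured M e)
                (\<lambda>i \<omega>. scl (\<Gamma> i \<omega> powr (- (1 / \<alpha>))) (\<epsilon> i \<omega>))))) \<and>
     (distr Q M (\<lambda>\<omega>. star (\<xi> \<omega>)) = distr Q M \<xi> \<longrightarrow>
        (\<exists>\<pi>. polar_representation M e scl \<alpha> \<pi> \<nu> \<and> distr \<pi> (punctured M e) star = \<pi>))"
proof -
  interpret C: convex_cone_involution M add e scl star by (rule cone)
  define \<mu> where "\<mu> = distr Q M \<xi>"
  \<comment> \<open>The two variants of the continuity hypothesis are merged into one by naming the
    set \<open>side t\<close> from which \<open>t\<close> is approached.\<close>
  have cont: "\<exists>side. (side = (\<lambda>t. {t<..}) \<or> side = (\<lambda>t. {0<..<t})) \<and>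
    (\<forall>x f. \<forall>t>0. x \<noteq> e \<longrightarrow> f \<in> H \<longrightarrow> ((\<lambda>u. Re (f (scl u x))) \<longlongrightarrow> Re (f (scl t x))) (at t within side t))"
    using one_sided_continuous
  proof
    assume r: "\<forall>x. x \<noteq> e \<longrightarrow> (\<forall>f\<in>H. \<forall>t>0. continuous (at_right t) (\<lambda>t. Re (f (scl t x))))"
    show ?thesis
      by (rule exI[of _ "\<lambda>t. {t<..}"]) (use r in \<open>simp add: continuous_within\<close>)
  next
    assume l: "\<forall>x. x \<noteq> e \<longrightarrow> (\<forall>f\<in>H. \<forall>t>0. continuous (at_left t) (\<lambda>t. Re (f (scl t x))))"
    have "((\<lambda>u. Re (f (scl u x))) \<longlongrightarrow> Re (f (scl t x))) (at t within {0<..<t})" if "x \<noteq> e" "f \<in> H" "t > 0" for x f and t :: real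
    proof (rule tendsto_within_subset)
      show "((\<lambda>u. Re (f (scl u x))) \<longlongrightarrow> Re (f (scl t x))) (at_left t)"
        using l that by (simp add: continuous_within)
    qed auto
    then show ?thesis by (intro exI[of _ "\<lambda>t. {0<..<t}"]) simp
  qed
  obtain side :: "real \<Rightarrow> real set" where side: "side = (\<lambda>t. {t<..}) \<or> side = (\<lambda>t. {0<..<t})"
    and side_cont: "\<And>x f t. t > 0 \<Longrightarrow> x \<noteq> e \<Longrightarrow> f \<in> H \<Longrightarrow> ((\<lambda>u. Re (f (scl u x))) \<longlongrightarrow> Re (f (scl t x))) (at t within side t)"
    using cont by blast
  interpret mu: prob_space \<mu> unfolding \<mu>_def by (rule prob_space.prob_space_distr[OF prob_space_Q xi_random])
  interpret S: stable_cone M add e scl star \<mu> \<alpha> side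
    by unfold_locales (use alpha_pos xi_stable side in \<open>simp_all add: \<mu>_def\<close>)
  have mult: "(\<lambda>x. f x * g x) \<in> H" if "f \<in> H" "g \<in> H" for f g
    using H_semigroup that by (simp add: character_semigroup_def)
  have H_regular: "S.regular f" if f: "f \<in> H" for f
    by (rule S.regular_of_one_sided_continuous[OF _ mult side_cont _ f]) (use H_characters liminf_pos in auto)
  interpret L: levy_stable_cone M add e scl star \<mu> \<alpha> side H L \<phi> \<nu>
    by unfold_locales
      (use H_semigroup H_generates H_countable H_separating H_regular L_levy phi_exponent nu_levy in \<open>simp_all add: \<mu>_def\<close>)
  obtain \<pi>0 where \<pi>0: "polar_representation M e scl \<alpha> \<pi>0 \<nu>"
    using L.exists_polar_representation[OF nu_nonzero] by blast
  have "\<exists>(P :: ((nat \<Rightarrow> 'a) \<times> (nat \<Rightarrow> real)) measure) \<epsilon> \<Gamma>. lepage_input P \<pi> \<epsilon> \<Gamma> \<and>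
      poisson_process P \<nu> (point_process_of (punctured M e) (\<lambda>i \<omega>. scl (\<Gamma> i \<omega> powr (- (1 / \<alpha>))) (\<epsilon> i \<omega>)))"
    if \<pi>: "polar_representation M e scl \<alpha> \<pi> \<nu>" for \<pi>
  proof -
    have "prob_space \<pi>" using \<pi> by (simp add: polar_representation_def)
    from exists_lepage_input[OF this] L.lepage_poisson[OF \<pi> exists_lepage_input[OF this]]
    show ?thesis by blast
  qed
  moreover have "\<exists>\<pi>. polar_representation M e scl \<alpha> \<pi> \<nu> \<and> distr \<pi> (punctured M e) star = \<pi>"
    if "distr Q M (\<lambda>\<omega>. star (\<xi> \<omega>)) = distr Q M \<xi>"
  proof (rule L.exists_symmetric_polar_representation[OF _ \<pi>0])
    show "distr \<mu> M star = \<mu>"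
      using that unfolding \<mu>_def by (simp add: distr_distr[OF C.star_measurable xi_random] comp_def)
  qed
  ultimately show ?thesis
    using \<pi>0 L.polar_integral_finite L.lepage_poisson by blast
qed

end
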